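(* Assume (A1), (A2), (A3) and the information assumption (I) of the context. Let $\bar v_2(\cdot)\in\mathcal{U}_{ad}^{l}[0,T]$ satisfy $$\bar R(t)\bar v_2(t)+\bar r(t)+B_2(t)\check\lambda(t)+B_2(t)\Pi(t)\check K(t)=0,\quad \text{a.e. } t\in[0,T],\ \text{a.s.},$$ where $\check\lambda(t)=\mathbb{E}[\lambda(t)|\mathcal{F}_t^{Y_2^{\bar v_2}}]$, $\check K(t)=\mathbb{E}[K(t)|\mathcal{F}_t^{Y_2^{\bar v_2}}]$, $(\lambda,\eta_1,\eta_2,\eta_3)$ (with $\lambda,\eta_1,\eta_2$ being $\mathcal{F}_t$-adapted and $\eta_3$ being $\mathcal{F}_t^{Y_1}$-adapted) is the solution of $$\begin{cases}-d\lambda(t)=\big(\bar Lx^{\bar v_2}+\bar l+A\lambda-B_1^2\Pi R^{-1}\hat\lambda\big)dt-\eta_1dW(t)-\eta_2d\bar W(t)-\eta_3d\widetilde W(t),\quad t\in[0,T],\\ \lambda(T)=\bar Mx^{\bar v_2}(T)+\bar m,\end{cases}$$ with $\hat\lambda(t)=\mathbb{E}[\lambda(t)|\mathcal{F}_t^{Y_1}]$, and the $\mathcal{F}_t$-adapted process $K$ is the solution of $$\begin{cases}dK(t)=\big[-B_1^2R^{-1}\lambda+(A-B_1^2\Pi R^{-1})K\big]dt,\quad t\in[0,T],\\ K(0)=0.\end{cases}$$ Then $\bar v_2(\cdot)$ is an optimal control of the leader, i.e. $J_2(\bar v_2)=\min_{v_2\in\mathcal{U}_{ad}^{l}[0,T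]}J_2(v_2)$.
   Context: Let $T>0$ and let $(\Omega,\mathcal{F},\mathbb{P})$ be a complete probability space carrying two independent one-dimensional standard Brownian motions $W,\bar W$ (null at $0$); $\mathcal{F}_t$ is the filtration generated by $(W,\bar W)$ augmented by the $\mathbb{P}$-null sets. For a process $\Delta$, $\mathcal{F}_t^{\Delta}:=\sigma\{\Delta(r):0\le r\le t\}$. For two filtrations, $\wedge$ denotes intersection. The time variable $t$ is often omitted. State: for controls $(v_1,v_2)$ (follower, leader), all processes real valued, $$dx^{v_1,v_2}(t)=[A(t)x^{v_1,v_2}(t)+B_1(t)v_1(t)+B_2(t)v_2(t)+\alpha(t)]dt+c(t)dW(t)+\bar c(t)d\bar W(t),\quad x^{v_1,v_2}(0)=x_0.$$ Observation of the follower: $dY_1^{v_1,v_2}(t)=[f_1(t)x^{v_1,v_2}(t)+g(t)]dt+dW(t)$, $Y_1^{v_1,v_2}(0)=0$. Observation of the leader: $dY_2^{v_2}(t)=[f_2(t)+v_2(t)]dt+dW(t)$, $Y_2^{v_2}(0)=0$. Uncontrolled parts: $dx^0(t)=A(t)x^0(t)dt+c(t)dW(t)+\bar c(t)d\bar W(t)$, $x^0(0)=x_0$; $dY_1^0(t)=f_1(t)x^0(t)dt+dW(t)$, $Y_1^0(0)=0$. Admissible controls: $\mathcal{U}_{ad}^{l}[0,T]$ is the set of real-valued $\mathcal{F}_t^{Y_2^{v_2}}$-adapted processes $v_2$ with $\mathbb{E}[\sup_{0\le t\le T}v_2(t)^2]<\infty$. For given $v_2\in\mathcal{U}_{ad}^{l}[0,T]$,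 $\mathcal{U}_{ad}^{f}[0,T]$ is the set of real-valued processes $v_1$, adapted both to $\mathcal{F}_t^{Y_1^0}$ and to $\mathcal{F}_t^{Y_1^{v_1,v_2}}$, with $\mathbb{E}[\sup_{0\le t\le T}v_1(t)^2]<\infty$. Follower's response: given $v_2$, the follower minimizes over $\mathcal{U}_{ad}^{f}[0,T]$ the cost $$J_1(v_1,v_2)=\tfrac12\mathbb{E}\Big\{\int_0^T\big[L(x^{v_1,v_2})^2+Rv_1^2+2l\,x^{v_1,v_2}+2r\,v_1\big]dt+M(x^{v_1,v_2}(T))^2+2m\,x^{v_1,v_2}(T)\Big\}$$ and uses the optimal control $\bar v_1=-R^{-1}[B_1\Pi\hat x^{\bar v_1,v_2}+B_1\hat\theta+r]$, where $\Pi$ solves $\dot\Pi+2A\Pi-B_1^2\Pi^2R^{-1}+L=0$, $\Pi(T)=M$. Write $x^{v_2}:=x^{\bar v_1,v_2}$, $Y_1:=Y_1^{\bar v_1,v_2}$ and $\hat\eta(t):=\mathbb{E}[\eta(t)|\mathcal{F}_t^{Y_1}]$. The innovation process $\widetilde W(t)=\int_0^t\{dY_1(s)-(f_1(s)\hat x^{v_2}(s)+g(s))ds\}$ is a standard $\mathcal{F}_t^{Y_1}$-Brownian motion, equal to $\int_0^t\{dY_1^0(s)-f_1(s)\hat x^0(s)ds\}$. Leader's state system: for $v_2\in\mathcal{U}_{ad}^{l}[0,T]$, $$\begin{cases}dx^{v_2}(t)=\big[Ax^{v_2}-B_1^2\Pi R^{-1}\hat x^{v_2}-B_1^2R^{-1}\hat\theta-B_1R^{-1}r+B_2v_2+\alpha\big]dt+c\,dW(t)+\bar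 c\,d\bar W(t),\\ -d\hat\theta(t)=\big\{[A-B_1^2\Pi R^{-1}]\hat\theta+B_2\Pi v_2-B_1\Pi R^{-1}r+\alpha\Pi+l\big\}dt-\hat\Gamma\,d\widetilde W(t),\\ x^{v_2}(0)=x_0,\quad\hat\theta(T)=m,\end{cases}$$ with $(\hat\theta,\hat\Gamma)$ being $\mathcal{F}_t^{Y_1}$-adapted. Leader's cost: $$J_2(v_2)=\tfrac12\mathbb{E}\Big\{\int_0^T\big[\bar L(x^{v_2})^2+\bar Rv_2^2+2\bar l\,x^{v_2}+2\bar r\,v_2\big]dt+\bar M(x^{v_2}(T))^2+2\bar m\,x^{v_2}(T)\Big\}.$$ (A1) $A,B_1,B_2,\alpha,c,\bar c,f_1,f_2,g$ are uniformly bounded deterministic functions on $[0,T]$; $x_0$ is a constant. (A2) $L\ge0,\bar L\ge0,R\ge0,\bar R\ge0,l,\bar l,r,\bar r$ are uniformly bounded deterministic functions; $M\ge0,\bar M\ge0$ and $m,\bar m$ are constants. (A3) $R^{-1}$ is a uniformly bounded deterministic function. (I) For all admissible $v_1,v_2$: $\mathcal{F}_t^{Y_2^{v_2}}\subseteq\mathcal{F}_t^{Y_1^{v_1,v_2}}\wedge\mathcal{F}_t^{Y_1^0}$, $t\in[0,T]$. *)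

theory Defs
  imports "HOL-Probability.Probability"
begin

text \<open>
  A process is a function \<open>X :: real \<Rightarrow> 'a \<Rightarrow> real\<close> of time and scenario; only its values on
  \<open>{0..T}\<close> matter.
\<close>

type_synonym 'a process = "real \<Rightarrow> 'a \<Rightarrow> real"

section \<open>Filtrations and classes of processes\<close>

text \<open>
  The filtration generated by a set of processes, augmented by the null sets of \<open>M\<close>.  It is used
  both for \<open>F_t\<close> and for the observation filtrations: solutions of stochastic equations are unique
  only up to indistinguishability, so the sigma-algebra generated by such a solution is well
  defined only modulo null sets.
\<close>

definition aug_filtration :: "'a measure \<Rightarrow> 'a process set \<Rightarrow> real \<Rightarrow> 'a measure" where
  "aug_filtration M \<X> t = sigma (space M)
     ({X r -` S \<inter> space M | X r S. X \<in> \<X> \<and> r \<in> {0..t} \<and> S \<in> sets borel} \<union> null_sets M)"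

definition adapted_process ::
    "'a measure \<Rightarrow> real \<Rightarrow> (real \<Rightarrow> 'a measure) \<Rightarrow> 'a process \<Rightarrow> bool" where
  "adapted_process M T F X \<longleftrightarrow>
     (\<lambda>(t, \<omega>). X t \<omega>) \<in> borel_measurable (restrict_space borel {0..T} \<Otimes>\<^sub>M M) \<and>
     (\<forall>t\<in>{0..T}. X t \<in> borel_measurable (F t))"

definition sup_square_integrable :: "'a measure \<Rightarrow> real \<Rightarrow> 'a process \<Rightarrow> bool" where
  "sup_square_integrable M T X \<longleftrightarrow>
     (\<integral>\<^sup>+\<omega>. (\<Squnion>t\<in>{0..T}. ennreal ((X t \<omega>)\<^sup>2)) \<partial>M) < \<infinity>"

definition continuous_paths :: "'a measure \<Rightarrow> real \<Rightarrow> 'a process \<Rightarrow> bool" where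
  "continuous_paths M T X \<longleftrightarrow> (AE \<omega> in M. continuous_on {0..T} (\<lambda>t. X t \<omega>))"

definition S2_process ::
    "'a measure \<Rightarrow> real \<Rightarrow> (real \<Rightarrow> 'a measure) \<Rightarrow> 'a process \<Rightarrow> bool" where
  "S2_process M T F X \<longleftrightarrow>
     adapted_process M T F X \<and> continuous_paths M T X \<and> sup_square_integrable M T X"

text \<open>
  A jointly measurable version \<open>h\<close> of \<open>t \<mapsto> E[X(t) | F_t]\<close>, so that \<open>h\<close> can be integrated in time.
\<close>

definition cond_exp_version ::
    "'a measure \<Rightarrow> real \<Rightarrow> (real \<Rightarrow> 'a measure) \<Rightarrow> 'a process \<Rightarrow> 'a process \<Rightarrow> bool" where
  "cond_exp_version M T F X h \<longleftrightarrow>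
     adapted_process M T F h \<and>
     (\<forall>t\<in>{0..T}. AE \<omega> in M. h t \<omega> = real_cond_exp M (F t) (X t) \<omega>)"

section \<open>Brownian motion and the Ito integral\<close>

definition brownian_motion :: "'a measure \<Rightarrow> real \<Rightarrow> 'a process \<Rightarrow> bool" where
  "brownian_motion M T W \<longleftrightarrow>
     (\<forall>t\<in>{0..T}. W t \<in> borel_measurable M) \<and>
     (AE \<omega> in M. W 0 \<omega> = 0) \<and>
     continuous_paths M T W \<and>
     (\<forall>s t. 0 \<le> s \<and> s < t \<and> t \<le> T \<longrightarrow>
        distributed M lborel (\<lambda>\<omega>. W t \<omega> - W s \<omega>)
          (\<lambda>x. ennreal (normal_density 0 (sqrt (t - s)) x)) \<and>
        prob_space.indep_set M
          (sets (aug_filtration M {W} s))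
          {(\<lambda>\<omega>. W t \<omega> - W s \<omega>) -` S \<inter> space M | S. S \<in> sets borel})"

definition independent_processes :: "'a measure \<Rightarrow> real \<Rightarrow> 'a process \<Rightarrow> 'a process \<Rightarrow> bool" where
  "independent_processes M T X Y \<longleftrightarrow>
     prob_space.indep_set M (sets (aug_filtration M {X} T)) (sets (aug_filtration M {Y} T))"

text \<open>
  A simple integrand takes the bounded \<open>F (p i)\<close>-measurable value \<open>\<xi> i\<close> on \<open>{p i<..p (Suc i)}\<close>, for
  \<open>i < n\<close>, where \<open>0 = p 0 < ... < p n = T\<close>.
\<close>

definition simple_integrand ::
    "'a measure \<Rightarrow> real \<Rightarrow> (real \<Rightarrow> 'a measure) \<Rightarrow> nat \<Rightarrow> (nat \<Rightarrow> real) \<Rightarrow> (nat \<Rightarrow> 'a \<Rightarrow> real) \<Rightarrow> bool" where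
  "simple_integrand M T F n p \<xi> \<longleftrightarrow>
     p 0 = 0 \<and> p n = T \<and> (\<forall>i<n. p i < p (Suc i)) \<and>
     (\<forall>i<n. \<xi> i \<in> borel_measurable (F (p i)) \<and> (\<exists>C. \<forall>\<omega>\<in>space M. \<bar>\<xi> i \<omega>\<bar> \<le> C))"

definition simple_value :: "nat \<Rightarrow> (nat \<Rightarrow> real) \<Rightarrow> (nat \<Rightarrow> 'a \<Rightarrow> real) \<Rightarrow> 'a process" where
  "simple_value n p \<xi> t \<omega> = (\<Sum>i<n. \<xi> i \<omega> * indicator {p i<..p (Suc i)} t)"

definition simple_integral ::
    "'a process \<Rightarrow> nat \<Rightarrow> (nat \<Rightarrow> real) \<Rightarrow> (nat \<Rightarrow> 'a \<Rightarrow> real) \<Rightarrow> 'a process" where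
  "simple_integral X n p \<xi> t \<omega> =
     (\<Sum>i<n. \<xi> i \<omega> * (X (min (p (Suc i)) t) \<omega> - X (min (p i) t) \<omega>))"

text \<open>
  \<open>ito_integral M T F X H I\<close>: the square-integrable \<open>F\<close>-adapted process \<open>H\<close> has Ito integral
  process \<open>I(t) = \<integral>_0^t H dX\<close> with respect to \<open>X\<close> (meant to be an \<open>F\<close>-Brownian motion).
\<close>

definition ito_integral ::
    "'a measure \<Rightarrow> real \<Rightarrow> (real \<Rightarrow> 'a measure) \<Rightarrow> 'a process \<Rightarrow> 'a process \<Rightarrow> 'a process \<Rightarrow> bool" where
  "ito_integral M T F X H I \<longleftrightarrow>
     adapted_process M T F H \<and>
     (\<integral>\<^sup>+\<omega>. (\<integral>\<^sup>+t\<in>{0..T}. ennreal ((H t \<omega>)\<^sup>2) \<partial>lborel) \<partial>M) < \<infinity> \<and>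
     adapted_process M T F I \<and> continuous_paths M T I \<and>
     (\<exists>n p \<xi>. (\<forall>k::nat. simple_integrand M T F (n k) (p k) (\<xi> k)) \<and>
        (\<lambda>k. \<integral>\<^sup>+\<omega>. (\<integral>\<^sup>+t\<in>{0..T}.
            ennreal ((simple_value (n k) (p k) (\<xi> k) t \<omega> - H t \<omega>)\<^sup>2) \<partial>lborel) \<partial>M)
          \<longlonglongrightarrow> 0 \<and>
        (\<lambda>k. \<integral>\<^sup>+\<omega>. (\<Squnion>t\<in>{0..T}.
            ennreal ((simple_integral X (n k) (p k) (\<xi> k) t \<omega> - I t \<omega>)\<^sup>2)) \<partial>M)
          \<longlonglongrightarrow> 0)"

section \<open>Data of the leader-follower problem\<close>

text \<open>
  The letters follow the mathematical notation, and \<open>Ric\<close> below stands for the Riccati solution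
  Pi; a trailing \<open>b\<close> stands for a bar.  The terminal weights \<open>M, m\<close> of the costs are \<open>wM, wm\<close>
  (follower) and \<open>wMb, wmb\<close> (leader).
\<close>

record 'a lq_game =
  pspace :: "'a measure"
  hor :: real
  BW :: "'a process"
  BWb :: "'a process"
  x_init :: real
  cA :: "real \<Rightarrow> real"
  cB1 :: "real \<Rightarrow> real"
  cB2 :: "real \<Rightarrow> real"
  c\<alpha> :: "real \<Rightarrow> real"
  cc :: "real \<Rightarrow> real"
  ccb :: "real \<Rightarrow> real"
  cf1 :: "real \<Rightarrow> real"
  cf2 :: "real \<Rightarrow> real"
  cg :: "real \<Rightarrow> real"
  wL :: "real \<Rightarrow> real"
  wR :: "real \<Rightarrow> real"
  wl :: "real \<Rightarrow> real"
  wr :: "real \<Rightarrow> real"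
  wM :: real
  wm :: real
  wLb :: "real \<Rightarrow> real"
  wRb :: "real \<Rightarrow> real"
  wlb :: "real \<Rightarrow> real"
  wrb :: "real \<Rightarrow> real"
  wMb :: real
  wmb :: real

definition stochastic_basis :: "'a lq_game \<Rightarrow> bool" where
  "stochastic_basis G \<longleftrightarrow>
     hor G > 0 \<and> prob_space (pspace G) \<and> complete_measure (pspace G) \<and>
     brownian_motion (pspace G) (hor G) (BW G) \<and>
     brownian_motion (pspace G) (hor G) (BWb G) \<and>
     independent_processes (pspace G) (hor G) (BW G) (BWb G)"

definition bounded_coefficient :: "real \<Rightarrow> (real \<Rightarrow> real) \<Rightarrow> bool" where
  "bounded_coefficient T f \<longleftrightarrow>
     f \<in> borel_measurable (restrict_space borel {0..T}) \<and> (\<exists>C. \<forall>t\<in>{0..T}. \<bar>f t\<bar> \<le> C)"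

definition assumption_A1 :: "'a lq_game \<Rightarrow> bool" where
  "assumption_A1 G \<longleftrightarrow>
     (\<forall>f \<in> {cA G, cB1 G, cB2 G, c\<alpha> G, cc G, ccb G, cf1 G, cf2 G, cg G}.
        bounded_coefficient (hor G) f)"

definition assumption_A2 :: "'a lq_game \<Rightarrow> bool" where
  "assumption_A2 G \<longleftrightarrow>
     (\<forall>f \<in> {wL G, wLb G, wR G, wRb G, wl G, wlb G, wr G, wrb G}. bounded_coefficient (hor G) f) \<and>
     (\<forall>t\<in>{0..hor G}. wL G t \<ge> 0 \<and> wLb G t \<ge> 0 \<and> wR G t \<ge> 0 \<and> wRb G t \<ge> 0) \<and>
     wM G \<ge> 0 \<and> wMb G \<ge> 0"

text \<open>As \<open>inverse 0 = 0\<close>, the existence of the inverse of \<open>R\<close> has to be stated.\<close>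

definition assumption_A3 :: "'a lq_game \<Rightarrow> bool" where
  "assumption_A3 G \<longleftrightarrow>
     (\<forall>t\<in>{0..hor G}. wR G t \<noteq> 0) \<and> bounded_coefficient (hor G) (\<lambda>t. inverse (wR G t))"

section \<open>State, observations and admissible controls\<close>

definition full_filtration :: "'a lq_game \<Rightarrow> real \<Rightarrow> 'a measure" where
  "full_filtration G = aug_filtration (pspace G) {BW G, BWb G}"

definition state_equation :: "'a lq_game \<Rightarrow> 'a process \<Rightarrow> 'a process \<Rightarrow> 'a process \<Rightarrow> bool" where
  "state_equation G v1 v2 x \<longleftrightarrow>
     S2_process (pspace G) (hor G) (full_filtration G) x \<and>
     (\<exists>I J. ito_integral (pspace G) (hor G) (full_filtration G) (BW G) (\<lambda>t \<omega>. cc G t) I \<and>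
        ito_integral (pspace G) (hor G) (full_filtration G) (BWb G) (\<lambda>t \<omega>. ccb G t) J \<and>
        (AE \<omega> in pspace G. \<forall>t\<in>{0..hor G}.
           x t \<omega> = x_init G
             + (LBINT s:{0..t}. cA G s * x s \<omega> + cB1 G s * v1 s \<omega> + cB2 G s * v2 s \<omega> + c\<alpha> G s)
             + I t \<omega> + J t \<omega>))"

definition uncontrolled_state :: "'a lq_game \<Rightarrow> 'a process \<Rightarrow> bool" where
  "uncontrolled_state G x \<longleftrightarrow>
     S2_process (pspace G) (hor G) (full_filtration G) x \<and>
     (\<exists>I J. ito_integral (pspace G) (hor G) (full_filtration G) (BW G) (\<lambda>t \<omega>. cc G t) I \<and>
        ito_integral (pspace G) (hor G) (full_filtration G) (BWb G) (\<lambda>t \<omega>. ccb G t) J \<and>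
        (AE \<omega> in pspace G. \<forall>t\<in>{0..hor G}.
           x t \<omega> = x_init G + (LBINT s:{0..t}. cA G s * x s \<omega>) + I t \<omega> + J t \<omega>))"

text \<open>\<open>obs1 G x\<close> is the follower's observation \<open>Y_1\<close> when the state is \<open>x\<close>.\<close>

definition obs1 :: "'a lq_game \<Rightarrow> 'a process \<Rightarrow> 'a process" where
  "obs1 G x t \<omega> = (LBINT s:{0..t}. cf1 G s * x s \<omega> + cg G s) + BW G t \<omega>"

definition obs1_uncontrolled :: "'a lq_game \<Rightarrow> 'a process \<Rightarrow> 'a process" where
  "obs1_uncontrolled G x0 t \<omega> = (LBINT s:{0..t}. cf1 G s * x0 s \<omega>) + BW G t \<omega>"

definition obs2 :: "'a lq_game \<Rightarrow> 'a process \<Rightarrow> 'a process" where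
  "obs2 G v2 t \<omega> = (LBINT s:{0..t}. cf2 G s + v2 s \<omega>) + BW G t \<omega>"

abbreviation obs1_filtration :: "'a lq_game \<Rightarrow> 'a process \<Rightarrow> real \<Rightarrow> 'a measure" where
  "obs1_filtration G x \<equiv> aug_filtration (pspace G) {obs1 G x}"

abbreviation obs1_uncontrolled_filtration :: "'a lq_game \<Rightarrow> 'a process \<Rightarrow> real \<Rightarrow> 'a measure" where
  "obs1_uncontrolled_filtration G x0 \<equiv> aug_filtration (pspace G) {obs1_uncontrolled G x0}"

abbreviation obs2_filtration :: "'a lq_game \<Rightarrow> 'a process \<Rightarrow> real \<Rightarrow> 'a measure" where
  "obs2_filtration G v2 \<equiv> aug_filtration (pspace G) {obs2 G v2}"

text \<open>
  The control enters its own observation, so adaptedness to \<open>obs2_filtration G v2\<close> alone does not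
  exclude controls anticipating the Brownian motions (for instance drifts of Tsirelson type).
  Adaptedness to the filtration of the basis, implicit for every process on it, is therefore
  explicit; it follows from the inclusion required in \<open>information_assumption\<close>.
\<close>

definition leader_admissible :: "'a lq_game \<Rightarrow> 'a process \<Rightarrow> bool" where
  "leader_admissible G v2 \<longleftrightarrow>
     adapted_process (pspace G) (hor G) (full_filtration G) v2 \<and>
     adapted_process (pspace G) (hor G) (obs2_filtration G v2) v2 \<and>
     sup_square_integrable (pspace G) (hor G) v2"

text \<open>
  \<open>follower_admissible G x0 v2 v1 x\<close>: against \<open>v2\<close>, the control \<open>v1\<close> is admissible for the follower,
  and \<open>x\<close> is the state that it produces; \<open>x0\<close> is the uncontrolled state.
\<close>

definition follower_admissible ::
    "'a lq_game \<Rightarrow> 'a process \<Rightarrow> 'a process \<Rightarrow> 'a process \<Rightarrow> 'a process \<Rightarrow> bool" where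
  "follower_admissible G x0 v2 v1 x \<longleftrightarrow>
     state_equation G v1 v2 x \<and>
     adapted_process (pspace G) (hor G) (obs1_uncontrolled_filtration G x0) v1 \<and>
     adapted_process (pspace G) (hor G) (obs1_filtration G x) v1 \<and>
     sup_square_integrable (pspace G) (hor G) v1"

definition information_assumption :: "'a lq_game \<Rightarrow> 'a process \<Rightarrow> bool" where
  "information_assumption G x0 \<longleftrightarrow>
     (\<forall>v1 v2 x. leader_admissible G v2 \<and> follower_admissible G x0 v2 v1 x \<longrightarrow>
        (\<forall>t\<in>{0..hor G}. sets (obs2_filtration G v2 t) \<subseteq>
           sets (obs1_filtration G x t) \<inter> sets (obs1_uncontrolled_filtration G x0 t)))"

section \<open>The leader's problem\<close>

text \<open>The coefficients are merely measurable, hence the integrated form of the Riccati equation.\<close>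

definition riccati_solution :: "'a lq_game \<Rightarrow> (real \<Rightarrow> real) \<Rightarrow> bool" where
  "riccati_solution G Ric \<longleftrightarrow>
     continuous_on {0..hor G} Ric \<and>
     (\<forall>t\<in>{0..hor G}. Ric t = wM G
        + (LBINT s:{t..hor G}. 2 * cA G s * Ric s - (cB1 G s)\<^sup>2 * (Ric s)\<^sup>2 * inverse (wR G s) + wL G s))"

definition innovation :: "'a lq_game \<Rightarrow> 'a process \<Rightarrow> 'a process \<Rightarrow> 'a process" where
  "innovation G x xh t \<omega> = obs1 G x t \<omega> - (LBINT s:{0..t}. cf1 G s * xh s \<omega> + cg G s)"

text \<open>
  \<open>leader_system G Ric x0 v2 x xh \<theta> \<Gamma>\<close>: for the leader's control \<open>v2\<close>, the state is \<open>x\<close> with filter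
  \<open>xh\<close>, and \<open>(\<theta>, \<Gamma>)\<close> is the adjoint pair of the follower.  The last conjunct says that the follower's
  feedback \<open>- (B_1 Ric xh + B_1 \<theta> + r) / R\<close>, already inserted into the equation for \<open>x\<close>, is an
  admissible control, so that \<open>x\<close> and \<open>obs1 G x\<close> are the state and the observation belonging to it.
\<close>

definition leader_system ::
    "'a lq_game \<Rightarrow> (real \<Rightarrow> real) \<Rightarrow> 'a process \<Rightarrow> 'a process \<Rightarrow> 'a process \<Rightarrow> 'a process \<Rightarrow>
       'a process \<Rightarrow> 'a process \<Rightarrow> bool" where
  "leader_system G Ric x0 v2 x xh \<theta> \<Gamma> \<longleftrightarrow>
     cond_exp_version (pspace G) (hor G) (obs1_filtration G x) x xh \<and>
     S2_process (pspace G) (hor G) (full_filtration G) x \<and>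
     (\<exists>I J. ito_integral (pspace G) (hor G) (full_filtration G) (BW G) (\<lambda>t \<omega>. cc G t) I \<and>
        ito_integral (pspace G) (hor G) (full_filtration G) (BWb G) (\<lambda>t \<omega>. ccb G t) J \<and>
        (AE \<omega> in pspace G. \<forall>t\<in>{0..hor G}.
           x t \<omega> = x_init G
             + (LBINT s:{0..t}. cA G s * x s \<omega>
                  - (cB1 G s)\<^sup>2 * Ric s * inverse (wR G s) * xh s \<omega>
                  - (cB1 G s)\<^sup>2 * inverse (wR G s) * \<theta> s \<omega>
                  - cB1 G s * inverse (wR G s) * wr G s
                  + cB2 G s * v2 s \<omega> + c\<alpha> G s)
             + I t \<omega> + J t \<omega>)) \<and>
     S2_process (pspace G) (hor G) (obs1_filtration G x) \<theta> \<and>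
     (\<exists>N. ito_integral (pspace G) (hor G) (obs1_filtration G x) (innovation G x xh) \<Gamma> N \<and>
        (AE \<omega> in pspace G. \<forall>t\<in>{0..hor G}.
           \<theta> t \<omega> = wm G
             + (LBINT s:{t..hor G}. (cA G s - (cB1 G s)\<^sup>2 * Ric s * inverse (wR G s)) * \<theta> s \<omega>
                  + cB2 G s * Ric s * v2 s \<omega>
                  - cB1 G s * Ric s * inverse (wR G s) * wr G s
                  + c\<alpha> G s * Ric s + wl G s)
             - (N (hor G) \<omega> - N t \<omega>))) \<and>
     (\<exists>v1. follower_admissible G x0 v2 v1 x \<and>
        (AE t in lborel. t \<in> {0..hor G} \<longrightarrow> (AE \<omega> in pspace G.
           v1 t \<omega> = - inverse (wR G t) * (cB1 G t * Ric t * xh t \<omega> + cB1 G t * \<theta> t \<omega> + wr G t))))"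

definition leader_cost :: "'a lq_game \<Rightarrow> 'a process \<Rightarrow> 'a process \<Rightarrow> real" where
  "leader_cost G v2 x = 1 / 2 * (LINT \<omega>|pspace G.
     (LBINT t:{0..hor G}. wLb G t * (x t \<omega>)\<^sup>2 + wRb G t * (v2 t \<omega>)\<^sup>2
        + 2 * wlb G t * x t \<omega> + 2 * wrb G t * v2 t \<omega>)
     + wMb G * (x (hor G) \<omega>)\<^sup>2 + 2 * wmb G * x (hor G) \<omega>)"

text \<open>
  The cost of a control is \<open>leader_cost G v2 x\<close> for the state \<open>x\<close> of the leader's system.  All
  states belonging to \<open>v2\<close> are compared, including the case \<open>w2 = v2\<close>, so an optimal control has
  the same cost for each of its states.
\<close>

definition leader_optimal ::
    "'a lq_game \<Rightarrow> (real \<Rightarrow> real) \<Rightarrow> 'a process \<Rightarrow> 'a process \<Rightarrow> bool" where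
  "leader_optimal G Ric x0 v2 \<longleftrightarrow>
     leader_admissible G v2 \<and>
     (\<forall>x xh \<theta> \<Gamma>. leader_system G Ric x0 v2 x xh \<theta> \<Gamma> \<longrightarrow>
        (\<forall>w2 y yh \<theta>' \<Gamma>'. leader_admissible G w2 \<and> leader_system G Ric x0 w2 y yh \<theta>' \<Gamma>' \<longrightarrow>
           leader_cost G v2 x \<le> leader_cost G w2 y))"

definition adjoint_lambda_equation ::
    "'a lq_game \<Rightarrow> (real \<Rightarrow> real) \<Rightarrow> 'a process \<Rightarrow> 'a process \<Rightarrow>
       'a process \<Rightarrow> 'a process \<Rightarrow> 'a process \<Rightarrow> 'a process \<Rightarrow> bool" where
  "adjoint_lambda_equation G Ric x xh lam \<eta>1 \<eta>2 \<eta>3 \<longleftrightarrow>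
     S2_process (pspace G) (hor G) (full_filtration G) lam \<and>
     (\<exists>lamh N1 N2 N3.
        cond_exp_version (pspace G) (hor G) (obs1_filtration G x) lam lamh \<and>
        ito_integral (pspace G) (hor G) (full_filtration G) (BW G) \<eta>1 N1 \<and>
        ito_integral (pspace G) (hor G) (full_filtration G) (BWb G) \<eta>2 N2 \<and>
        ito_integral (pspace G) (hor G) (obs1_filtration G x) (innovation G x xh) \<eta>3 N3 \<and>
        (AE \<omega> in pspace G. \<forall>t\<in>{0..hor G}.
           lam t \<omega> = wMb G * x (hor G) \<omega> + wmb G
             + (LBINT s:{t..hor G}. wLb G s * x s \<omega> + wlb G s + cA G s * lam s \<omega>
                  - (cB1 G s)\<^sup>2 * Ric s * inverse (wR G s) * lamh s \<omega>)
             - (N1 (hor G) \<omega> - N1 t \<omega>) - (N2 (hor G) \<omega> - N2 t \<omega>) - (N3 (hor G) \<omega> - N3 t \<omega>)))"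

definition adjoint_K_equation ::
    "'a lq_game \<Rightarrow> (real \<Rightarrow> real) \<Rightarrow> 'a process \<Rightarrow> 'a process \<Rightarrow> bool" where
  "adjoint_K_equation G Ric lam K \<longleftrightarrow>
     S2_process (pspace G) (hor G) (full_filtration G) K \<and>
     (AE \<omega> in pspace G. \<forall>t\<in>{0..hor G}.
        K t \<omega> = (LBINT s:{0..t}. - (cB1 G s)\<^sup>2 * inverse (wR G s) * lam s \<omega>
                   + (cA G s - (cB1 G s)\<^sup>2 * Ric s * inverse (wR G s)) * K s \<omega>))"

end

theory Submission imports Defs begin

text \<open>
  The leader's problem is linear-quadratic with a convex cost, so a stationary control is optimal; the
  work lies in the information structure.  Let \<open>v\<close> be the stationary control, \<open>v'\<close> a competitor,
  \<open>u = v' - v\<close>, and let \<open>\<xi>\<close> and \<open>\<phi>\<close> be the differences of the two states and of the two adjoint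
  processes \<open>\<theta>\<close> of the follower.  The difference of the costs is a quadratic form in \<open>(\<xi>, u)\<close>, which is
  nonnegative by the signs of the weights, plus a part that is linear in \<open>(\<xi>, u)\<close>
  (\<open>leader_cost_difference\<close>).  Now \<open>\<xi>\<close> solves a forward linear equation driven by \<open>\<phi>\<close> and \<open>u\<close> in which
  the noise has cancelled, and \<open>\<phi>\<close> a backward one driven by \<open>u\<close>.  Integrating \<open>lam \<xi>\<close> and \<open>K \<phi>\<close> by parts
  and subtracting the results expresses the part linear in \<open>\<xi>\<close> through \<open>u\<close> alone
  (\<open>first_order_identity\<close>); what remains of the linear part is the pairing of \<open>u\<close> with the stationarity condition, which is zero (\<open>stationarity_pairing\<close>).

  The product rule behind this is elementary, because the forward processes \<open>\<xi>\<close> and \<open>K\<close> have absolutely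
  continuous paths: it follows from Fubini's theorem once the martingale part of the backward process
  has increments orthogonal to adapted variables (\<open>duality\<close>).

  The filters disappear because of the information assumption.  It makes the difference between a
  state and the uncontrolled state a functional of either observation of the follower, so both
  generate the same filtration, whatever the controls (\<open>controlled_state\<close>).  Therefore \<open>\<xi>\<close> is its own
  filter (\<open>filter_difference\<close>), and the filter of \<open>lam\<close> may be replaced by \<open>lam\<close> in products with \<open>\<xi>\<close>.
  Moreover \<open>W\<close> is adapted to the observation of the leader, hence to that of the follower, which forces
  the innovation to be \<open>W\<close> itself (\<open>innovation_is_noise\<close>).

  The delicate point is the last pairing.  The stationarity condition is conditioned on the observation
  \<open>Y\<close> generated by \<open>v\<close>, but \<open>v'\<close> is adapted to the observation that \<open>v'\<close> itself generates.  The way out is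
  that every admissible control is adapted to \<open>W\<close> alone (\<open>control_adapted_to_noise\<close>), and \<open>W\<close> is adapted
  to \<open>Y\<close>.  To see this, let \<open>V\<close> be the second Brownian motion.  An observation \<open>dY = \<beta> dt + dW\<close> whose drift
  is a functional of \<open>Y\<close> is independent of \<open>V\<close>: by Girsanov's theorem its conditional law given \<open>V\<close>
  would have the same density with respect to Wiener measure for each path of \<open>V\<close>.  A variable that is
  measurable with respect to \<open>Y\<close> as well as with respect to \<open>(W, V)\<close> then cannot depend on \<open>V\<close>.

  Since \<open>\<beta>\<close> is only square integrable, the exponential need not be a martingale, and the change of
  measure is applied to a time discretisation instead.  There the observation moves by Gaussian steps
  with a drift \<open>b\<close>, and \<open>\<beta>\<close> is close to a feedback \<open>h\<close> of the discretised observation.  The density that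
  replaces \<open>b\<close> by \<open>h\<close> makes the observation independent of the initial information (\<open>Z_factor\<close>),
  and it is close to \<open>1\<close> in \<open>L\<^sup>1\<close>, because \<open>b - h\<close> is small (\<open>Z_near_one\<close>).
  Independence of \<open>Y\<close> follows in the limit (\<open>observation_decoupled\<close>).

  As the cost of an optimal control is compared for all states that belong to it, uniqueness of the
  state is needed too; it follows from Gronwall's lemma, first backward for \<open>\<phi>\<close> and then forward
  for \<open>\<xi>\<close> (\<open>leader_state_unique\<close>).
\<close>

section \<open>Square integrable variables and processes\<close>

lemma real_product_le_squares: "\<bar>a * b\<bar> \<le> a\<^sup>2 + (b::real)\<^sup>2"
proof -
  have "0 \<le> (\<bar>a\<bar> - \<bar>b\<bar>)\<^sup>2" by simp
  then have "2 * \<bar>a * b\<bar> \<le> a\<^sup>2 + b\<^sup>2" by (simp add: power2_diff abs_mult)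
  then show ?thesis using zero_le_power2[of a] zero_le_power2[of b] by linarith
qed

lemma square_sum_le: "(a + b)\<^sup>2 \<le> 2 * a\<^sup>2 + 2 * (b::real)\<^sup>2"
proof -
  have "0 \<le> (a - b)\<^sup>2" by simp
  then show ?thesis by (simp add: power2_diff power2_sum)
qed

context prob_space
begin

abbreviation mean :: "('a \<Rightarrow> real) \<Rightarrow> real" (binder "\<E>" 10) where
  "mean f \<equiv> expectation f"

definition l2 :: "('a \<Rightarrow> real) \<Rightarrow> bool" where
  "l2 f \<longleftrightarrow> f \<in> borel_measurable M \<and> integrable M (\<lambda>w. (f w)\<^sup>2)"

lemma l2_measurable [measurable_dest]: "l2 f \<Longrightarrow> f \<in> borel_measurable M"
  and l2_square_integrable: "l2 f \<Longrightarrow> integrable M (\<lambda>w. (f w)\<^sup>2)"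
  by (auto simp: l2_def)

lemma l2_mult_integrable:
  assumes "l2 f" "l2 g"
  shows "integrable M (\<lambda>w. f w * g w)"
proof (rule Bochner_Integration.integrable_bound)
  show "integrable M (\<lambda>w. (f w)\<^sup>2 + (g w)\<^sup>2)" using assms by (auto simp: l2_def)
  show "(\<lambda>w. f w * g w) \<in> borel_measurable M" using assms by (auto simp: l2_def)
  show "AE w in M. norm (f w * g w) \<le> norm ((f w)\<^sup>2 + (g w)\<^sup>2)"
    using real_product_le_squares by auto
qed

lemma l2_bounded_mult:
  assumes "l2 f" "g \<in> borel_measurable M" "\<And>w. w \<in> space M \<Longrightarrow> \<bar>g w\<bar> \<le> C"
  shows "l2 (\<lambda>w. g w * f w)"
proof -
  have "integrable M (\<lambda>w. (g w * f w)\<^sup>2)"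
  proof (rule Bochner_Integration.integrable_bound)
    show "integrable M (\<lambda>w. C\<^sup>2 * (f w)\<^sup>2)" using assms by (auto simp: l2_def)
    show "(\<lambda>w. (g w * f w)\<^sup>2) \<in> borel_measurable M" using assms by (auto simp: l2_def)
    have "(g w)\<^sup>2 \<le> C\<^sup>2" if "w \<in> space M" for w
      using assms(3)[OF that] abs_le_square_iff[of "g w" C] by linarith
    then show "AE w in M. norm ((g w * f w)\<^sup>2) \<le> norm (C\<^sup>2 * (f w)\<^sup>2)"
      by (auto simp: power_mult_distrib intro!: mult_right_mono)
  qed
  then show ?thesis using assms by (auto simp: l2_def)
qed

lemma l2_const [simp, intro]: "l2 (\<lambda>w. c)"
  by (simp add: l2_def)

lemma l2_cmult [intro]: "l2 f \<Longrightarrow> l2 (\<lambda>w. c * f w)"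
  by (auto simp: l2_def power_mult_distrib)

lemma l2_integrable: "l2 f \<Longrightarrow> integrable M f"
  using l2_mult_integrable[OF _ l2_const, of f 1] by simp

lemma l2_bounded:
  assumes "g \<in> borel_measurable M" "\<And>w. w \<in> space M \<Longrightarrow> \<bar>g w\<bar> \<le> C"
  shows "l2 g"
  using l2_bounded_mult[OF l2_const assms, of 1] by simp

lemma l2_add [intro]: assumes "l2 f" "l2 g" shows "l2 (\<lambda>w. f w + g w)"
proof -
  have "integrable M (\<lambda>w. (f w)\<^sup>2 + (g w)\<^sup>2 + 2 * (f w * g w))"
    using assms l2_mult_integrable[OF assms] by (auto simp: l2_def)
  then show ?thesis using assms by (auto simp: l2_def power2_sum algebra_simps)
qed

lemma l2_minus [intro]: "l2 f \<Longrightarrow> l2 (\<lambda>w. - f w)"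
  using l2_cmult[of f "-1"] by simp

lemma l2_diff [intro]: assumes "l2 f" "l2 g" shows "l2 (\<lambda>w. f w - g w)"
  using l2_add[OF assms(1) l2_minus[OF assms(2)]] by simp

lemma l2_sum: "(\<And>i. i \<in> I \<Longrightarrow> l2 (f i)) \<Longrightarrow> l2 (\<lambda>w. \<Sum>i\<in>I. f i w)"
  by (induction I rule: infinite_finite_induct) auto

lemma l2_cong_AE:
  assumes "l2 f" "g \<in> borel_measurable M" "AE w in M. f w = g w"
  shows "l2 g"
proof -
  have "integrable M (\<lambda>w. (g w)\<^sup>2)"
    using assms by (subst integrable_cong_AE[of _ _ "\<lambda>w. (f w)\<^sup>2"]) (auto simp: l2_def)
  with assms show ?thesis by (auto simp: l2_def)
qed

lemma l2_zero_AE: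
  assumes "l2 f" "(\<E> w. (f w)\<^sup>2) \<le> 0"
  shows "AE w in M. f w = 0"
proof -
  have "(\<E> w. (f w)\<^sup>2) = 0" using assms(2) by (intro antisym) auto
  then have "AE w in M. (f w)\<^sup>2 = 0"
    using assms(1) integral_nonneg_eq_0_iff_AE[of M "\<lambda>w. (f w)\<^sup>2"] by (auto simp: l2_def)
  then show ?thesis by simp
qed

lemma expectation_square_le:
  assumes "l2 f" shows "(expectation f)\<^sup>2 \<le> (\<E> w. (f w)\<^sup>2)"
  using variance_eq[of f] variance_positive[of f] assms
  by (simp add: l2_integrable l2_square_integrable)

lemma l2_orthogonal_projection:
  assumes "subalgebra M F" "l2 f"
  shows "l2 (real_cond_exp M F f)"
    and "\<And>U. l2 U \<Longrightarrow> U \<in> borel_measurable F \<Longrightarrow>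
      (\<E> w. U w * real_cond_exp M F f w) = (\<E> w. U w * f w)"
    and "(\<E> w. (real_cond_exp M F f w)\<^sup>2) \<le> (\<E> w. (f w)\<^sup>2)"
proof -
  interpret F: finite_measure_subalgebra M F
    using assms(1) by unfold_locales auto
  have f: "integrable M f" using assms l2_integrable by auto
  have cv: "convex_on UNIV (\<lambda>x::real. x\<^sup>2)" by (rule convex_power2)
  have J: "integrable M (\<lambda>w. (real_cond_exp M F f w)\<^sup>2)"
    and J2: "AE w in M. (real_cond_exp M F f w)\<^sup>2 \<le> real_cond_exp M F (\<lambda>w. (f w)\<^sup>2) w"
    using F.integrable_convex_cond_exp[OF f _ _ _ cv] F.real_cond_exp_jensens_inequality[OF f _ _ _ cv]
      assms(2) by (auto simp: l2_def)
  show l: "l2 (real_cond_exp M F f)"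
    using J by (simp add: l2_def)
  show "(\<E> w. U w * real_cond_exp M F f w) = (\<E> w. U w * f w)"
    if "l2 U" "U \<in> borel_measurable F" for U
    using F.real_cond_exp_intg(2)[OF l2_mult_integrable[OF that(1) assms(2)] that(2)] assms(2)
    by (auto simp: l2_def)
  have "(\<E> w. (real_cond_exp M F f w)\<^sup>2) \<le> expectation (real_cond_exp M F (\<lambda>w. (f w)\<^sup>2))"
    using J J2 F.real_cond_exp_int(1)[of "\<lambda>w. (f w)\<^sup>2"] assms(2)
    by (intro integral_mono_AE) (auto simp: l2_def)
  then show "(\<E> w. (real_cond_exp M F f w)\<^sup>2) \<le> (\<E> w. (f w)\<^sup>2)"
    using F.real_cond_exp_int(2)[of "\<lambda>w. (f w)\<^sup>2"] assms(2) by (auto simp: l2_def)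
qed

end

locale finite_horizon = prob_space M for M :: "'a measure" +
  fixes T :: real
  assumes T_pos: "0 < T"
begin

abbreviation TM :: "real measure" where "TM \<equiv> restrict_space lborel {0..T}"

lemma space_TM [simp]: "space TM = {0..T}"
  by (simp add: space_restrict_space)

lemma sets_TM: "sets TM = sets (restrict_space borel {0..T})"
  by (rule sets_restrict_space_cong) simp

lemma measure_TM: "measure TM (space TM) = T" "emeasure TM (space TM) = ennreal T"
  using T_pos by (simp_all add: measure_restrict_space emeasure_restrict_space)

sublocale TM: finite_measure TM
  by standard (use measure_TM(2) in simp)

sublocale TP: pair_sigma_finite TM M ..

lemma integral_TM:
  fixes f :: "real \<Rightarrow> real"
  assumes "0 \<le> a" "b \<le> T"
  shows "(LBINT s:{a..b}. f s) = (\<integral>s. indicator {a..b} s * f s \<partial>TM)"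
proof -
  have "indicator {0..T} s * (indicator {a..b} s * f s) = indicator {a..b} s * f s" for s
    using assms by (auto simp: indicator_def)
  then have "(\<lambda>s. indicator {0..T} s * (indicator {a..b} s * f s)) = (\<lambda>s. indicator {a..b} s * f s)"
    by (rule ext)
  then show ?thesis
    by (simp add: set_lebesgue_integral_def integral_restrict_space del: mult_cancel_left mult_cancel_right)
qed

lemma set_integrable_TM:
  fixes f :: "real \<Rightarrow> real"
  assumes "0 \<le> a" "b \<le> T"
  shows "set_integrable lborel {a..b} f \<longleftrightarrow> integrable TM (\<lambda>s. indicator {a..b} s * f s)"
proof -
  have "indicator {0..T} s * (indicator {a..b} s * f s) = indicator {a..b} s * f s" for s
    using assms by (auto simp: indicator_def)
  then have "(\<lambda>s. indicator {0..T} s * (indicator {a..b} s * f s)) = (\<lambda>s. indicator {a..b} s * f s)"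
    by (rule ext)
  then show ?thesis
    by (simp add: set_integrable_def integrable_restrict_space)
qed

lemma integral_TM_full:
  fixes f :: "real \<Rightarrow> real"
  shows "(LBINT s:{0..T}. f s) = (\<integral>s. f s \<partial>TM)"
  by (simp add: set_lebesgue_integral_def integral_restrict_space)

text \<open>
  Processes bounded in \<open>L\<^sup>2\<close> uniformly in time: the class contains all processes of the game and is
  closed under multiplication by bounded coefficients and under integration in time, and products
  of two of its members are integrable over time and space.
\<close>

definition l2p :: "'a process \<Rightarrow> bool" where
  "l2p X \<longleftrightarrow> (\<lambda>(t, w). X t w) \<in> borel_measurable (TM \<Otimes>\<^sub>M M) \<and>
     (\<exists>C. \<forall>t\<in>{0..T}. integrable M (\<lambda>w. (X t w)\<^sup>2) \<and> (\<E> w. (X t w)\<^sup>2) \<le> C)"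

lemma l2p_measurable: "l2p X \<Longrightarrow> (\<lambda>(t, w). X t w) \<in> borel_measurable (TM \<Otimes>\<^sub>M M)"
  by (simp add: l2p_def)

lemma l2p_l2:
  assumes "l2p X" "t \<in> {0..T}"
  shows "l2 (X t)"
proof -
  have "(\<lambda>w. (\<lambda>(t, w). X t w) (t, w)) \<in> borel_measurable M"
    using l2p_measurable[OF assms(1)] assms(2) by (intro measurable_compose[OF measurable_Pair1']) auto
  then show ?thesis using assms by (auto simp: l2p_def l2_def)
qed

lemma l2p_bound:
  assumes "l2p X"
  obtains C where "C \<ge> 0" "\<And>t. t \<in> {0..T} \<Longrightarrow> (\<E> w. (X t w)\<^sup>2) \<le> C"
proof -
  obtain C where C: "\<And>t. t \<in> {0..T} \<Longrightarrow> (\<E> w. (X t w)\<^sup>2) \<le> C"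
    using assms unfolding l2p_def by blast
  show thesis
    by (rule that[of "max C 0"]) (use C in \<open>auto simp: le_max_iff_disj\<close>)
qed

lemma l2pI:
  assumes "(\<lambda>(t, w). X t w) \<in> borel_measurable (TM \<Otimes>\<^sub>M M)"
    "\<And>t. t \<in> {0..T} \<Longrightarrow> l2 (X t)" "\<And>t. t \<in> {0..T} \<Longrightarrow> (\<E> w. (X t w)\<^sup>2) \<le> C"
  shows "l2p X"
  using assms unfolding l2p_def l2_def by blast

lemma l2p_add [intro]:
  assumes "l2p X" "l2p Y" shows "l2p (\<lambda>t w. X t w + Y t w)"
proof -
  obtain C where C: "\<And>t. t \<in> {0..T} \<Longrightarrow> (\<E> w. (X t w)\<^sup>2) \<le> C"
    using l2p_bound[OF assms(1)] by blast
  obtain D where D: "\<And>t. t \<in> {0..T} \<Longrightarrow> (\<E> w. (Y t w)\<^sup>2) \<le> D"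
    using l2p_bound[OF assms(2)] by blast
  show ?thesis
  proof (rule l2pI)
    show "(\<lambda>(t, w). X t w + Y t w) \<in> borel_measurable (TM \<Otimes>\<^sub>M M)"
      using assms[THEN l2p_measurable] by (simp add: case_prod_unfold)
    fix t assume t: "t \<in> {0..T}"
    have l: "l2 (X t)" "l2 (Y t)" using assms t l2p_l2 by auto
    show "l2 (\<lambda>w. X t w + Y t w)" using l by auto
    have "(\<E> w. (X t w + Y t w)\<^sup>2) \<le> (\<E> w. 2 * (X t w)\<^sup>2 + 2 * (Y t w)\<^sup>2)"
      using l[THEN l2_square_integrable] l2_square_integrable[OF l2_add[OF l]]
      by (intro integral_mono) (auto intro: square_sum_le)
    also have "\<dots> = 2 * (\<E> w. (X t w)\<^sup>2) + 2 * (\<E> w. (Y t w)\<^sup>2)"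
      using l by (simp add: l2_square_integrable)
    finally show "(\<E> w. (X t w + Y t w)\<^sup>2) \<le> 2 * C + 2 * D"
      using C[OF t] D[OF t] by linarith
  qed
qed

lemma bounded_coefficient_measurable:
  assumes "bounded_coefficient T f" shows "f \<in> borel_measurable TM"
  using assms measurable_cong_sets[OF sets_TM refl, of borel] by (auto simp: bounded_coefficient_def)

lemma l2p_coeff_mult [intro]:
  assumes "bounded_coefficient T f" "l2p X" shows "l2p (\<lambda>t w. f t * X t w)"
proof -
  obtain C where C: "C \<ge> 0" "\<And>t. t \<in> {0..T} \<Longrightarrow> (\<E> w. (X t w)\<^sup>2) \<le> C"
    using l2p_bound[OF assms(2)] by blast
  obtain B where B: "\<And>t. t \<in> {0..T} \<Longrightarrow> \<bar>f t\<bar> \<le> B"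
    using assms(1) unfolding bounded_coefficient_def by blast
  show ?thesis
  proof (rule l2pI)
    have [measurable]: "f \<in> borel_measurable TM" using assms(1) by (rule bounded_coefficient_measurable)
    show "(\<lambda>(t, w). f t * X t w) \<in> borel_measurable (TM \<Otimes>\<^sub>M M)"
      using l2p_measurable[OF assms(2)] by (simp add: case_prod_unfold)
    fix t assume t: "t \<in> {0..T}"
    have l: "l2 (X t)" using assms t l2p_l2 by auto
    show "l2 (\<lambda>w. f t * X t w)" using l by auto
    have "(f t)\<^sup>2 \<le> B\<^sup>2" using B[OF t] abs_le_square_iff[of "f t" B] by linarith
    then have "(f t)\<^sup>2 * (\<E> w. (X t w)\<^sup>2) \<le> B\<^sup>2 * C"
      using C t by (intro mult_mono) auto
    then show "(\<E> w. (f t * X t w)\<^sup>2) \<le> B\<^sup>2 * C"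
      by (simp add: power_mult_distrib)
  qed
qed

lemma l2p_coeff [intro]:
  assumes "bounded_coefficient T f" shows "l2p (\<lambda>t w. f t)"
proof -
  have "l2p (\<lambda>t w. 1)" by (rule l2pI[where C=1]) (auto simp: prob_space)
  from l2p_coeff_mult[OF assms this] show ?thesis by simp
qed

lemma bounded_coefficient_const [simp, intro]: "bounded_coefficient T (\<lambda>_. c)"
  by (auto simp: bounded_coefficient_def)

lemma l2p_cmult [intro]: "l2p X \<Longrightarrow> l2p (\<lambda>t w. c * X t w)"
  using l2p_coeff_mult[of "\<lambda>_. c"] by simp

lemma l2p_minus [intro]: "l2p X \<Longrightarrow> l2p (\<lambda>t w. - X t w)"
  using l2p_cmult[of X "-1"] by simp

lemma l2p_diff [intro]:
  assumes "l2p X" "l2p Y" shows "l2p (\<lambda>t w. X t w - Y t w)"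
  using l2p_add[OF assms(1) l2p_minus[OF assms(2)]] by simp

lemma bounded_coefficient_mult [intro]:
  assumes "bounded_coefficient T f" "bounded_coefficient T g"
  shows "bounded_coefficient T (\<lambda>t. f t * g t)"
proof -
  obtain A where A: "\<And>t. t \<in> {0..T} \<Longrightarrow> \<bar>f t\<bar> \<le> A" using assms(1) unfolding bounded_coefficient_def by blast
  obtain B where B: "\<And>t. t \<in> {0..T} \<Longrightarrow> \<bar>g t\<bar> \<le> B" using assms(2) unfolding bounded_coefficient_def by blast
  have "\<bar>f t * g t\<bar> \<le> A * B" if "t \<in> {0..T}" for t
    using A[OF that] B[OF that] by (auto simp: abs_mult intro!: mult_mono)
  then show ?thesis
    using assms unfolding bounded_coefficient_def by (blast intro: borel_measurable_times borel_measurable_add)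
qed

lemma bounded_coefficient_minus [intro]:
  assumes "bounded_coefficient T f" shows "bounded_coefficient T (\<lambda>t. - f t)"
  using bounded_coefficient_mult[OF bounded_coefficient_const assms, of "-1"] by simp

lemma bounded_coefficient_add [intro]:
  assumes "bounded_coefficient T f" "bounded_coefficient T g"
  shows "bounded_coefficient T (\<lambda>t. f t + g t)"
proof -
  obtain A where A: "\<And>t. t \<in> {0..T} \<Longrightarrow> \<bar>f t\<bar> \<le> A" using assms(1) unfolding bounded_coefficient_def by blast
  obtain B where B: "\<And>t. t \<in> {0..T} \<Longrightarrow> \<bar>g t\<bar> \<le> B" using assms(2) unfolding bounded_coefficient_def by blast
  have "\<bar>f t + g t\<bar> \<le> A + B" if "t \<in> {0..T}" for t
    using A[OF that] B[OF that] by linarith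
  then show ?thesis
    using assms unfolding bounded_coefficient_def by (blast intro: borel_measurable_times borel_measurable_add)
qed

lemma l2p_mult_integrable:
  assumes "l2p X" "l2p Y"
  shows "integrable (TM \<Otimes>\<^sub>M M) (\<lambda>(t, w). X t w * Y t w)"
proof (rule Bochner_Integration.integrable_bound)
  have sq: "integrable (TM \<Otimes>\<^sub>M M) (\<lambda>(t, w). (X t w)\<^sup>2)" if X: "l2p X" for X
  proof (rule TP.Fubini_integrable)
    have m[measurable]: "(\<lambda>(t, w). (X t w)\<^sup>2) \<in> borel_measurable (TM \<Otimes>\<^sub>M M)"
      using l2p_measurable[OF X] by (simp add: case_prod_unfold)
    show "(\<lambda>(t, w). (X t w)\<^sup>2) \<in> borel_measurable (TM \<Otimes>\<^sub>M M)" by fact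
    obtain C where C: "C \<ge> 0" "\<And>t. t \<in> {0..T} \<Longrightarrow> (\<E> w. (X t w)\<^sup>2) \<le> C"
      using l2p_bound[OF X] by blast
    have "(\<lambda>t. (\<E> w. (X t w)\<^sup>2)) \<in> borel_measurable TM"
      using borel_measurable_lebesgue_integral[of "\<lambda>t w. (X t w)\<^sup>2" TM] m by simp
    then show "integrable TM (\<lambda>t. \<integral>w. norm (case (t, w) of (t, w) \<Rightarrow> (X t w)\<^sup>2) \<partial>M)"
      using C by (intro TM.integrable_const_bound[where B=C]) auto
    show "AE t in TM. integrable M (\<lambda>w. case (t, w) of (t, w) \<Rightarrow> (X t w)\<^sup>2)"
      using l2p_l2[OF X] by (intro AE_I2) (auto intro: l2_square_integrable)
  qed
  show "integrable (TM \<Otimes>\<^sub>M M) (\<lambda>(t, w). (X t w)\<^sup>2 + (Y t w)\<^sup>2)"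
    using Bochner_Integration.integrable_add[OF sq[OF assms(1)] sq[OF assms(2)]] by (simp add: case_prod_unfold)
  show "(\<lambda>(t, w). X t w * Y t w) \<in> borel_measurable (TM \<Otimes>\<^sub>M M)"
    using assms[THEN l2p_measurable] by (simp add: case_prod_unfold)
  show "AE x in TM \<Otimes>\<^sub>M M. norm (case x of (t, w) \<Rightarrow> X t w * Y t w)
      \<le> norm (case x of (t, w) \<Rightarrow> (X t w)\<^sup>2 + (Y t w)\<^sup>2)"
    using real_product_le_squares by (auto simp: case_prod_unfold)
qed

lemma l2p_integrable:
  assumes "l2p X" shows "integrable (TM \<Otimes>\<^sub>M M) (\<lambda>(t, w). X t w)"
  using l2p_mult_integrable[OF assms l2p_coeff[OF bounded_coefficient_const, of 1]] by simp

lemma l2p_AE_integrable: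
  assumes "l2p X" "l2p Y"
  shows "AE w in M. integrable TM (\<lambda>t. X t w * Y t w)"
  using TP.AE_integrable_snd[OF l2p_mult_integrable[OF assms]] .

lemma l2p_AE_integrable1:
  assumes "l2p X" shows "AE w in M. integrable TM (\<lambda>t. X t w)"
  using TP.AE_integrable_snd[OF l2p_integrable[OF assms]] .

lemma l2p_indicator [intro]:
  assumes "l2p X" shows "l2p (\<lambda>t w. indicator {a..b} t * X t w)"
proof (rule l2p_coeff_mult[OF _ assms])
  have "\<bar>indicat_real {a..b} t\<bar> \<le> 1" for t by (auto simp: indicator_def)
  then show "bounded_coefficient T (indicat_real {a..b})"
    unfolding bounded_coefficient_def
    by (intro conjI exI[of _ 1] ballI measurable_restrict_space1) auto
qed

lemma expectation_product_LBINT: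
  assumes "l2p X" "l2p Y" "0 \<le> a" "b \<le> T"
  shows "(\<E> w. LBINT t:{a..b}. X t w * Y t w) = (LBINT t:{a..b}. (\<E> w. X t w * Y t w))"
    and "integrable M (\<lambda>w. LBINT t:{a..b}. X t w * Y t w)"
    and "set_integrable lborel {a..b} (\<lambda>t. (\<E> w. X t w * Y t w))"
proof -
  have I: "integrable (TM \<Otimes>\<^sub>M M) (\<lambda>(t, w). indicator {a..b} t * X t w * Y t w)"
    by (rule l2p_mult_integrable) (auto intro: assms)
  note * = TP.integrable_snd[OF I] TP.integrable_fst[OF I] TP.integral_fst[OF I] TP.integral_snd[OF I]
  show "(\<E> w. LBINT t:{a..b}. X t w * Y t w) = (LBINT t:{a..b}. (\<E> w. X t w * Y t w))"
    using * by (simp add: integral_TM assms mult.assoc)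
  show "integrable M (\<lambda>w. LBINT t:{a..b}. X t w * Y t w)"
    using * by (simp add: integral_TM assms mult.assoc)
  show "set_integrable lborel {a..b} (\<lambda>t. (\<E> w. X t w * Y t w))"
    using * by (simp add: set_integrable_TM assms mult.assoc)
qed

lemma l2p_const_process [intro]: assumes "l2 U" shows "l2p (\<lambda>t. U)"
proof (rule l2pI)
  show "(\<lambda>(t, w). U w) \<in> borel_measurable (TM \<Otimes>\<^sub>M M)"
    using assms by (auto simp: l2_def)
qed (use assms in auto)

definition time_int :: "'a process \<Rightarrow> 'a process" where
  "time_int X t w = (LBINT s:{0..t}. X s w)"

lemma time_int_zero [simp]: "time_int X 0 w = 0"
  unfolding time_int_def set_lebesgue_integral_def
  by (rule integral_eq_zero_AE) (use AE_lborel_singleton[of 0] in \<open>auto elim!: eventually_mono\<close>)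

lemma time_int_TM: "t \<in> {0..T} \<Longrightarrow> time_int X t w = (\<integral>s. indicator {0..t} s * X s w \<partial>TM)"
  by (simp add: time_int_def integral_TM)

text \<open>Nonnegativity of the variance with respect to the uniform distribution on \<open>{0..T}\<close>.\<close>

lemma square_integral_le:
  fixes f :: "real \<Rightarrow> real"
  assumes "integrable TM f" "integrable TM (\<lambda>s. (f s)\<^sup>2)"
  shows "(\<integral>s. f s \<partial>TM)\<^sup>2 \<le> T * (\<integral>s. (f s)\<^sup>2 \<partial>TM)"
proof -
  define m where "m = (\<integral>s. f s \<partial>TM) / T"
  have "0 \<le> (\<integral>s. (f s - m)\<^sup>2 \<partial>TM)" by simp
  also have "\<dots> = (\<integral>s. (f s)\<^sup>2 - 2 * m * f s + m\<^sup>2 \<partial>TM)"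
    by (simp add: power2_diff algebra_simps)
  also have "\<dots> = (\<integral>s. (f s)\<^sup>2 \<partial>TM) - 2 * m * (\<integral>s. f s \<partial>TM) + m\<^sup>2 * T"
    using assms measure_TM T_pos by (simp del: space_TM)
  also have "\<dots> = (\<integral>s. (f s)\<^sup>2 \<partial>TM) - (\<integral>s. f s \<partial>TM)\<^sup>2 / T"
    using T_pos by (simp add: m_def power2_eq_square field_simps)
  finally show ?thesis using T_pos by (simp add: field_simps)
qed

lemma time_int_measurable:
  assumes "(\<lambda>(t, w). X t w) \<in> borel_measurable (TM \<Otimes>\<^sub>M M)"
  shows "(\<lambda>(t, w). time_int X t w) \<in> borel_measurable (TM \<Otimes>\<^sub>M M)"
proof -
  have [measurable]: "(\<lambda>x. X (fst x) (snd x)) \<in> borel_measurable (TM \<Otimes>\<^sub>M M)"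
    using assms by (simp add: case_prod_unfold)
  have [measurable]: "(\<lambda>p. X (snd p) (snd (fst p))) \<in> borel_measurable ((TM \<Otimes>\<^sub>M M) \<Otimes>\<^sub>M TM)"
  proof -
    have "(\<lambda>p. (snd p, snd (fst p))) \<in> (TM \<Otimes>\<^sub>M M) \<Otimes>\<^sub>M TM \<rightarrow>\<^sub>M TM \<Otimes>\<^sub>M M" by measurable
    from measurable_compose[OF this assms] show ?thesis by simp
  qed
  have [measurable]: "(\<lambda>p. indicat_real {0..fst (fst p)} (snd p)) \<in> borel_measurable ((TM \<Otimes>\<^sub>M M) \<Otimes>\<^sub>M TM)"
  proof -
    have "(\<lambda>p. (fst (fst p), snd p)) \<in> (TM \<Otimes>\<^sub>M M) \<Otimes>\<^sub>M TM \<rightarrow>\<^sub>M borel \<Otimes>\<^sub>M borel"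
      by (intro measurable_Pair measurable_compose[OF measurable_snd] measurable_compose[OF measurable_fst] 
          measurable_restrict_space1) auto
    then have "(\<lambda>p. indicat_real {(a, b). 0 \<le> b \<and> b \<le> a} (fst (fst p), snd p)) 
        \<in> borel_measurable ((TM \<Otimes>\<^sub>M M) \<Otimes>\<^sub>M TM)"
    proof (rule measurable_compose)
      have "{x :: real \<times> real. 0 \<le> snd x \<and> snd x \<le> fst x} \<in> sets (borel \<Otimes>\<^sub>M borel)"
        unfolding borel_prod by (intro borel_closed closed_Collect_conj closed_Collect_le continuous_intros)
      then show "indicat_real {(a :: real, b :: real). 0 \<le> b \<and> b \<le> a} \<in> borel_measurable (borel \<Otimes>\<^sub>M borel)"
        by (intro borel_measurable_indicator) (simp add: case_prod_unfold)
    qed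
    then show ?thesis
      by (rule measurable_cong[THEN iffD1, rotated]) (auto simp: indicator_def)
  qed
  have "(\<lambda>x. \<integral>s. indicator {0..fst x} s * X s (snd x) \<partial>TM) \<in> borel_measurable (TM \<Otimes>\<^sub>M M)"
    by (rule TM.borel_measurable_lebesgue_integral) (simp add: case_prod_unfold)
  then show ?thesis
    by (rule measurable_cong[THEN iffD1, rotated])
       (auto simp: space_pair_measure time_int_TM)
qed

lemma l2p_time_int_bound:
  assumes "l2p X" "t \<in> {0..T}"
  shows "l2 (time_int X t)"
    and "(\<E> w. (time_int X t w)\<^sup>2) \<le> T * (LBINT s:{0..t}. (\<E> w. (X s w)\<^sup>2))"
proof -
  define Z where "Z s w = indicator {0..t} s * X s w" for s w
  have Z: "l2p Z" unfolding Z_def using assms by auto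
  have tM: "time_int X t \<in> borel_measurable M"
  proof -
    have "(\<lambda>w. (\<lambda>(t, w). time_int X t w) (t, w)) \<in> borel_measurable M"
      using time_int_measurable[OF l2p_measurable[OF assms(1)]] assms(2)
      by (intro measurable_compose[OF measurable_Pair1']) auto
    then show ?thesis by simp
  qed
  have AE: "AE w in M. (time_int X t w)\<^sup>2 \<le> T * (LBINT s:{0..t}. X s w * X s w)"
    using l2p_AE_integrable1[OF Z] l2p_AE_integrable[OF Z Z]
  proof eventually_elim
    case (elim w)
    have "(\<integral>s. Z s w \<partial>TM)\<^sup>2 \<le> T * (\<integral>s. (Z s w)\<^sup>2 \<partial>TM)"
      using elim by (intro square_integral_le) (auto simp: power2_eq_square)
    moreover have "(\<integral>s. (Z s w)\<^sup>2 \<partial>TM) = (\<integral>s. indicator {0..t} s * (X s w * X s w) \<partial>TM)"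
      by (intro Bochner_Integration.integral_cong) (auto simp: Z_def power2_eq_square indicator_def)
    ultimately show ?case using assms(2) by (simp add: integral_TM time_int_TM Z_def)
  qed
  have i: "integrable M (\<lambda>w. T * (LBINT s:{0..t}. X s w * X s w))"
    using expectation_product_LBINT(2)[OF assms(1) assms(1), of 0 t] assms(2) by auto
  have i2: "integrable M (\<lambda>w. (time_int X t w)\<^sup>2)"
    using AE tM by (intro Bochner_Integration.integrable_bound[OF i]) auto
  then show "l2 (time_int X t)" using tM by (simp add: l2_def)
  have "(\<E> w. (time_int X t w)\<^sup>2) \<le> (\<E> w. T * (LBINT s:{0..t}. X s w * X s w))"
    using i i2 AE by (intro integral_mono_AE) auto
  also have "\<dots> = T * (LBINT s:{0..t}. (\<E> w. X s w * X s w))"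
    using expectation_product_LBINT(1)[OF assms(1) assms(1), of 0 t] assms(2) by simp
  finally show "(\<E> w. (time_int X t w)\<^sup>2) \<le> T * (LBINT s:{0..t}. (\<E> w. (X s w)\<^sup>2))"
    by (simp add: power2_eq_square)
qed

end

section \<open>Orthogonality and integration by parts in time\<close>

context prob_space
begin

lemma l2_cauchy_schwarz:
  assumes "l2 f" "l2 g"
  shows "((\<E> w. f w * g w))\<^sup>2
    \<le> (\<E> w. (f w)\<^sup>2) * (\<E> w. (g w)\<^sup>2)"
proof (cases "(\<E> w. (g w)\<^sup>2) = 0")
  case True
  then have "AE w in M. g w = 0" using l2_zero_AE[OF assms(2)] by simp
  then have "(\<E> w. f w * g w) = 0"
    by (intro integral_eq_zero_AE) (auto elim!: eventually_mono)
  then show ?thesis using True by simp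
next
  case False
  then have pos: "0 < (\<E> w. (g w)\<^sup>2)"
    using Bochner_Integration.integral_nonneg[of M "\<lambda>w. (g w)\<^sup>2"] by (simp add: less_le)
  define c where "c = (\<E> w. f w * g w) / (\<E> w. (g w)\<^sup>2)"
  have "0 \<le> (\<E> w. (f w - c * g w)\<^sup>2)" by simp
  also have "\<dots> = (\<E> w. (f w)\<^sup>2 - 2 * c * (f w * g w) + c\<^sup>2 * (g w)\<^sup>2)"
    by (simp add: power2_diff power_mult_distrib algebra_simps)
  also have "\<dots> = (\<E> w. (f w)\<^sup>2) - 2 * c * (\<E> w. f w * g w)
      + c\<^sup>2 * (\<E> w. (g w)\<^sup>2)"
    using l2_mult_integrable[OF assms] assms[THEN l2_square_integrable] by simp
  finally show ?thesis using pos
    by (simp add: c_def power2_eq_square field_simps)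
qed

text \<open>
  The residual \<open>R\<close> of the projection of \<open>Z\<close> onto \<open>L\<^sup>2(F)\<close> is orthogonal to the projection and, by \<open>orth\<close>,
  to \<open>Z\<close>, hence to itself. So \<open>Z\<close> agrees almost everywhere with its conditional expectation, and \<open>F\<close>
  contains the null sets.
\<close>

lemma l2_orthogonal_measurable:
  assumes F: "subalgebra M F" "null_sets M \<subseteq> sets F" and Z: "l2 Z"
    and orth: "\<And>R. l2 R \<Longrightarrow> (\<And>U. l2 U \<Longrightarrow> U \<in> borel_measurable F \<Longrightarrow> (\<E> w. U w * R w) = 0)
      \<Longrightarrow> (\<E> w. Z w * R w) = 0"
  shows "Z \<in> borel_measurable F"
proof -
  let ?P = "real_cond_exp M F Z"
  note P = l2_orthogonal_projection[OF F(1) Z]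
  have Pm: "?P \<in> borel_measurable F" by simp
  define R where "R w = Z w - ?P w" for w
  have R: "l2 R" unfolding R_def using P(1) Z by auto
  have UR: "(\<E> w. U w * R w) = 0" if U: "l2 U" "U \<in> borel_measurable F" for U
    using P(2)[OF U] l2_mult_integrable[OF U(1) Z] l2_mult_integrable[OF U(1) P(1)]
    by (simp add: R_def right_diff_distrib)
  have "(\<E> w. (R w)\<^sup>2) = (\<E> w. Z w * R w - ?P w * R w)"
    by (simp add: R_def power2_eq_square left_diff_distrib)
  also have "\<dots> = (\<E> w. Z w * R w) - (\<E> w. ?P w * R w)"
    using l2_mult_integrable[OF Z R] l2_mult_integrable[OF P(1) R]
    by (rule Bochner_Integration.integral_diff)
  also have "(\<E> w. Z w * R w) = 0" by (rule orth[OF R]) (rule UR)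
  also have "(\<E> w. ?P w * R w) = 0" by (rule UR[OF P(1) Pm])
  finally have "AE w in M. R w = 0" by (intro l2_zero_AE[OF R]) simp
  then have AE: "AE w in M. Z w = ?P w" by (simp add: R_def)
  define N where "N = {w \<in> space M. Z w \<noteq> ?P w}"
  have Zm: "Z \<in> borel_measurable M" using Z by (simp add: l2_def)
  have PmM: "?P \<in> borel_measurable M" by simp
  have N: "N \<in> null_sets M" using AE Zm PmM unfolding N_def
    by (subst (asm) AE_iff_null) auto
  have sp: "space F = space M" using F(1) by (auto simp: subalgebra_def)
  show ?thesis
  proof (rule measurableI)
    fix A :: "real set" assume A: "A \<in> sets borel"
    have "Z -` A \<inter> space M \<inter> N \<in> null_sets M"
      using N Zm A by (intro null_set_Int1) (auto intro: measurable_sets)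
    then have 1: "Z -` A \<inter> space M \<inter> N \<in> sets F" using F(2) by auto
    have 2: "?P -` A \<inter> space F \<in> sets F" using Pm A by (rule measurable_sets)
    have "Z -` A \<inter> space F = (?P -` A \<inter> space F - N) \<union> (Z -` A \<inter> space M \<inter> N)"
      using sp by (auto simp: N_def)
    then show "Z -` A \<inter> space F \<in> sets F" using 1 2 N F(2) by auto
  qed auto
qed

lemma AE_eq_measurable:
  assumes "subalgebra M F" "null_sets M \<subseteq> sets F" "g \<in> borel_measurable F" "f \<in> borel_measurable M"
    "AE w in M. f w = g w"
  shows "(f :: 'a \<Rightarrow> real) \<in> borel_measurable F"
proof -
  have sp: "space F = space M" using assms(1) by (auto simp: subalgebra_def)
  have gM: "g \<in> borel_measurable M" using assms(1,3) by (rule measurable_from_subalg)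
  define N where "N = {w \<in> space M. f w \<noteq> g w}"
  have N: "N \<in> null_sets M" using assms gM unfolding N_def
    by (subst (asm) AE_iff_null) auto
  show ?thesis
  proof (rule measurableI)
    fix A :: "real set" assume A: "A \<in> sets borel"
    have "f -` A \<inter> space M \<inter> N \<in> null_sets M"
      using N assms(4) A by (intro null_set_Int1) (auto intro: measurable_sets)
    then have 1: "f -` A \<inter> space M \<inter> N \<in> sets F" using assms(2) by auto
    have 2: "g -` A \<inter> space F \<in> sets F" using assms(3) A by (rule measurable_sets)
    have "f -` A \<inter> space F = (g -` A \<inter> space F - N) \<union> (f -` A \<inter> space M \<inter> N)"
      using sp by (auto simp: N_def)
    then show "f -` A \<inter> space F \<in> sets F" using 1 2 N assms(2) by auto
  qed auto
qed

text \<open>\<open>L\<^sup>2(F)\<close> is closed: a variable orthogonal to it is orthogonal to each \<open>Zn n\<close>, hence to the limit.\<close>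

lemma l2_limit_measurable:
  assumes F: "subalgebra M F" "null_sets M \<subseteq> sets F" and Z: "l2 Z"
    and Zn: "\<And>n::nat. l2 (Zn n)" "\<And>n. Zn n \<in> borel_measurable F"
    and lim: "(\<lambda>n. (\<E> w. (Z w - Zn n w)\<^sup>2)) \<longlonglongrightarrow> 0"
  shows "Z \<in> borel_measurable F"
proof (rule l2_orthogonal_measurable[OF F Z])
  fix R assume R: "l2 R" and orth: "\<And>U. l2 U \<Longrightarrow> U \<in> borel_measurable F \<Longrightarrow> (\<E> w. U w * R w) = 0"
  have le: "((\<E> w. Z w * R w))\<^sup>2 \<le> (\<E> w. (Z w - Zn n w)\<^sup>2) * (\<E> w. (R w)\<^sup>2)" for n
  proof -
    have "(\<E> w. Z w * R w) = (\<E> w. (Z w - Zn n w) * R w)"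
      using orth[OF Zn] l2_mult_integrable[OF Z R] l2_mult_integrable[OF Zn(1) R]
      by (simp add: left_diff_distrib)
    then show ?thesis using l2_cauchy_schwarz[OF l2_diff[OF Z Zn(1)] R] by simp
  qed
  have "(\<lambda>n. (\<E> w. (Z w - Zn n w)\<^sup>2) * (\<E> w. (R w)\<^sup>2)) \<longlonglongrightarrow> 0"
    using tendsto_mult_left_zero[OF lim] by simp
  then have "((\<E> w. Z w * R w))\<^sup>2 \<le> 0"
    by (rule LIMSEQ_le_const) (use le in auto)
  then show "(\<E> w. Z w * R w) = 0" by simp
qed

end

context finite_horizon
begin

lemma expectation_LBINT_le:
  assumes "l2p X" "0 \<le> a" "b \<le> T" "C \<ge> 0" "\<And>t. t \<in> {0..T} \<Longrightarrow> (\<E> w. (X t w)\<^sup>2) \<le> C"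
  shows "(LBINT s:{a..b}. (\<E> w. (X s w)\<^sup>2)) \<le> C * T"
proof -
  have "(LBINT s:{a..b}. (\<E> w. (X s w)\<^sup>2)) 
      = (\<integral>s. indicator {a..b} s * (\<E> w. (X s w)\<^sup>2) \<partial>TM)"
    using assms by (simp add: integral_TM)
  also have "\<dots> \<le> (\<integral>s. C \<partial>TM)"
  proof (rule integral_mono)
    show "integrable TM (\<lambda>s. indicator {a..b} s * (\<E> w. (X s w)\<^sup>2))"
      using expectation_product_LBINT(3)[OF assms(1) assms(1) assms(2,3)] set_integrable_TM[OF assms(2,3)]
      by (simp add: power2_eq_square)
  qed (use assms in \<open>auto simp: indicator_def\<close>)
  also have "\<dots> = C * T" using measure_TM by (simp del: space_TM)
  finally show ?thesis .
qed

lemma l2p_time_int [intro]: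
  assumes "l2p X" shows "l2p (time_int X)"
proof -
  obtain C where C: "C \<ge> 0" "\<And>t. t \<in> {0..T} \<Longrightarrow> (\<E> w. (X t w)\<^sup>2) \<le> C"
    using l2p_bound[OF assms] by blast
  show ?thesis
  proof (rule l2pI)
    show "(\<lambda>(t, w). time_int X t w) \<in> borel_measurable (TM \<Otimes>\<^sub>M M)"
      by (rule time_int_measurable[OF l2p_measurable[OF assms]])
    fix t assume t: "t \<in> {0..T}"
    show "l2 (time_int X t)" using l2p_time_int_bound(1)[OF assms t] .
    have "(LBINT s:{0..t}. (\<E> w. (X s w)\<^sup>2)) \<le> C * T"
      using t by (intro expectation_LBINT_le assms C) auto
    then have "T * (LBINT s:{0..t}. (\<E> w. (X s w)\<^sup>2)) \<le> T * (C * T)"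
      using T_pos by simp
    with l2p_time_int_bound(2)[OF assms t]
    show "(\<E> w. (time_int X t w)\<^sup>2) \<le> T * (C * T)" by linarith
  qed
qed

lemma expectation_time_int:
  assumes "l2 U" "l2p X" "t \<in> {0..T}"
  shows "(\<E> w. U w * time_int X t w) = (LBINT s:{0..t}. (\<E> w. U w * X s w))"
  using expectation_product_LBINT(1)[OF l2p_const_process[OF assms(1)] assms(2), of 0 t] assms(3)
  by (simp add: time_int_def)

lemma time_int_add:
  assumes "l2p X" "l2p Y" "t \<in> {0..T}"
  shows "AE w in M. time_int (\<lambda>s w. X s w + Y s w) t w = time_int X t w + time_int Y t w"
  using l2p_AE_integrable1[OF l2p_indicator[OF assms(1), of 0 t]] l2p_AE_integrable1[OF l2p_indicator[OF assms(2), of 0 t]]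
  by eventually_elim (use assms(3) in \<open>simp add: time_int_TM distrib_left\<close>)

lemma time_int_cmult: "time_int (\<lambda>s w. c * X s w) t w = c * time_int X t w"
  by (simp add: time_int_def)

lemma time_int_diff:
  assumes "l2p X" "l2p Y" "t \<in> {0..T}"
  shows "AE w in M. time_int (\<lambda>s w. X s w - Y s w) t w = time_int X t w - time_int Y t w"
  using time_int_add[OF assms(1) l2p_minus[OF assms(2)] assms(3)]
  by eventually_elim (use time_int_cmult[of "-1" Y] in simp)

lemma LBINT_between:
  assumes "l2p X" "0 \<le> s" "s \<le> t" "t \<le> T"
  shows "AE w in M. (LBINT r:{s..t}. X r w) = time_int X t w - time_int X s w"
  using l2p_AE_integrable1[OF l2p_indicator[OF assms(1), of 0 t]] l2p_AE_integrable1[OF l2p_indicator[OF assms(1), of 0 s]]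
    l2p_AE_integrable1[OF l2p_indicator[OF assms(1), of s t]]
proof eventually_elim
  case (elim w)
  have "(LBINT r:{s..t}. X r w) + time_int X s w
      = (\<integral>r. indicator {s..t} r * X r w + indicator {0..s} r * X r w \<partial>TM)"
    using elim assms by (simp add: integral_TM time_int_TM)
  also have "\<dots> = (\<integral>r. indicator {0..t} r * X r w \<partial>TM)"
  proof (rule integral_cong_AE)
    have "AE r in TM. r \<noteq> s"
      using AE_lborel_singleton[of s] by (subst AE_restrict_space_iff) auto
    then show "AE r in TM. indicator {s..t} r * X r w + indicator {0..s} r * X r w = indicator {0..t} r * X r w"
      by eventually_elim (use assms in \<open>auto simp: indicator_def\<close>)
  qed (use elim in auto)
  finally show ?case using assms by (simp add: time_int_TM)
qed

lemma time_int_cong_AE: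
  assumes X: "l2p X" and Y: "l2p Y" and t: "t \<in> {0..T}"
    and eq: "\<And>s. s \<in> {0..t} \<Longrightarrow> AE w in M. X s w = Y s w"
  shows "AE w in M. time_int X t w = time_int Y t w"
proof -
  let ?D = "\<lambda>s w. X s w - Y s w"
  have D: "l2p ?D" using X Y by auto
  have "(LBINT s:{0..t}. (\<E> w. (?D s w)\<^sup>2)) = (LBINT s:{0..t}. 0)"
  proof (rule set_lebesgue_integral_cong)
    show "\<forall>s. s \<in> {0..t} \<longrightarrow> (\<E> w. (?D s w)\<^sup>2) = 0"
      using eq by (auto intro!: integral_eq_zero_AE elim!: eventually_mono)
  qed simp
  then have "(\<E> w. (time_int ?D t w)\<^sup>2) \<le> 0"
    using l2p_time_int_bound(2)[OF D t] by (simp add: set_lebesgue_integral_def)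
  then have "AE w in M. time_int ?D t w = 0"
    using l2_zero_AE l2p_time_int_bound(1)[OF D t] by blast
  with time_int_diff[OF X Y t] show ?thesis by eventually_elim simp
qed


lemma AE_TM_neq: "AE r in TM. r \<noteq> s"
  using AE_lborel_singleton[of s] by (subst AE_restrict_space_iff) auto

text \<open>The square \<open>{0..T} \<times> {0..T}\<close> is split along its diagonal, which is a null set.\<close>

lemma integral_product_by_parts:
  fixes f g :: "real \<Rightarrow> real"
  assumes f: "integrable TM f" and g: "integrable TM g" 
  shows "(\<integral>s. f s \<partial>TM) * (\<integral>s. g s \<partial>TM) = (\<integral>s. f s * (\<integral>r. indicator {0..s} r * g r \<partial>TM) \<partial>TM)
    + (\<integral>s. g s * (\<integral>r. indicator {0..s} r * f r \<partial>TM) \<partial>TM)"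
proof -
  interpret TT: pair_sigma_finite TM TM ..
  have [measurable]: "f \<in> borel_measurable TM" "g \<in> borel_measurable TM" using f g by auto
  have id[measurable]: "(\<lambda>x. x) \<in> TM \<rightarrow>\<^sub>M borel"
    by (rule measurable_restrict_space1) simp
  have I: "integrable (TM \<Otimes>\<^sub>M TM) (\<lambda>(s, r). f s * g r)"
    by (rule TT.Fubini_integrable) (use f g in \<open>auto simp: abs_mult\<close>)
  have "{p \<in> space (TM \<Otimes>\<^sub>M TM). snd p \<le> fst p} \<in> sets (TM \<Otimes>\<^sub>M TM)"
    using measurable_compose[OF measurable_snd id] measurable_compose[OF measurable_fst id]
    by (rule borel_measurable_le)
  note mle = this
  have "{p \<in> space (TM \<Otimes>\<^sub>M TM). fst p < snd p} \<in> sets (TM \<Otimes>\<^sub>M TM)"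
    using measurable_compose[OF measurable_fst id] measurable_compose[OF measurable_snd id]
    by (rule borel_measurable_less)
  note mless = this
  have I1: "integrable (TM \<Otimes>\<^sub>M TM) (\<lambda>(s, r). f s * (indicator {0..s} r * g r))"
    using integrable_mult_indicator[OF mle I]
    by (rule Bochner_Integration.integrable_cong[THEN iffD1, rotated 2])
       (auto simp: indicator_def space_pair_measure)
  have I2: "integrable (TM \<Otimes>\<^sub>M TM) (\<lambda>(s, r). f s * (indicator {s<..T} r * g r))"
    using integrable_mult_indicator[OF mless I]
    by (rule Bochner_Integration.integrable_cong[THEN iffD1, rotated 2])
       (auto simp: indicator_def space_pair_measure)
  have "(\<integral>s. f s \<partial>TM) * (\<integral>s. g s \<partial>TM) = (\<integral>s. (\<integral>r. f s * g r \<partial>TM) \<partial>TM)" by simp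
  also have "\<dots> = (\<integral>p. (case p of (s, r) \<Rightarrow> f s * g r) \<partial>(TM \<Otimes>\<^sub>M TM))"
    using TT.integral_fst[OF I] .
  also have "\<dots> = (\<integral>p. (case p of (s, r) \<Rightarrow> f s * (indicator {0..s} r * g r))
      + (case p of (s, r) \<Rightarrow> f s * (indicator {s<..T} r * g r)) \<partial>(TM \<Otimes>\<^sub>M TM))"
    by (rule Bochner_Integration.integral_cong) (auto simp: indicator_def space_pair_measure)
  also have "\<dots> = (\<integral>p. (case p of (s, r) \<Rightarrow> f s * (indicator {0..s} r * g r)) \<partial>(TM \<Otimes>\<^sub>M TM))
      + (\<integral>p. (case p of (s, r) \<Rightarrow> f s * (indicator {s<..T} r * g r)) \<partial>(TM \<Otimes>\<^sub>M TM))"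
    using I1 I2 by (rule Bochner_Integration.integral_add)
  also have "(\<integral>p. (case p of (s, r) \<Rightarrow> f s * (indicator {0..s} r * g r)) \<partial>(TM \<Otimes>\<^sub>M TM))
      = (\<integral>s. f s * (\<integral>r. indicator {0..s} r * g r \<partial>TM) \<partial>TM)"
    using TT.integral_fst[OF I1] by simp
  also have "(\<integral>p. (case p of (s, r) \<Rightarrow> f s * (indicator {s<..T} r * g r)) \<partial>(TM \<Otimes>\<^sub>M TM))
      = (\<integral>r. (\<integral>s. f s * (indicator {s<..T} r * g r) \<partial>TM) \<partial>TM)"
    using TT.integral_snd[OF I2] by simp
  also have "\<dots> = (\<integral>s. g s * (\<integral>r. indicator {0..s} r * f r \<partial>TM) \<partial>TM)"
  proof (rule Bochner_Integration.integral_cong[OF refl])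
    fix r assume r: "r \<in> space TM"
    have ir: "integrable TM (\<lambda>s. indicator {0..r} s * f s)"
    proof -
      have "{0..r} \<inter> space TM \<in> sets TM" using sets_TM by (auto simp: sets_restrict_space)
      then have "integrable TM (\<lambda>s. indicator ({0..r} \<inter> space TM) s *\<^sub>R f s)"
        by (intro integrable_mult_indicator f) 
      then show ?thesis
        by (rule Bochner_Integration.integrable_cong[THEN iffD1, rotated 2]) (auto simp: indicator_def)
    qed
    have "(\<integral>s. f s * (indicator {s<..T} r * g r) \<partial>TM) = (\<integral>s. g r * (indicator {0..r} s * f s) \<partial>TM)"
    proof (rule integral_cong_AE)
      have "(\<lambda>s. indicator {0..<r} s * f s * g r) \<in> borel_measurable TM"
      proof -
        have "indicat_real {0..<r} \<in> borel_measurable TM"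
          by (intro measurable_restrict_space1) auto
        then show ?thesis by measurable
      qed
      then show "(\<lambda>s. f s * (indicator {s<..T} r * g r)) \<in> borel_measurable TM"
        by (rule measurable_cong[THEN iffD1, rotated]) (use r in \<open>auto simp: indicator_def\<close>)
      show "(\<lambda>s. g r * (indicator {0..r} s * f s)) \<in> borel_measurable TM"
        using ir by (intro borel_measurable_times borel_measurable_const borel_measurable_integrable)
      show "AE s in TM. f s * (indicator {s<..T} r * g r) = g r * (indicator {0..r} s * f s)"
        using AE_TM_neq[of r] AE_space[of TM] by eventually_elim (use r in \<open>auto simp: indicator_def\<close>)
    qed
    then show "(\<integral>s. f s * (indicator {s<..T} r * g r) \<partial>TM) = g r * (\<integral>s. indicator {0..r} s * f s \<partial>TM)"
      by simp
  qed
  finally show ?thesis .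
qed

lemma expectation_by_parts:
  assumes f: "l2p f" and g: "l2p g" and t: "t \<in> {0..T}"
  shows "(\<E> w. time_int f t w * time_int g t w) =
    (LBINT s:{0..t}. (\<E> w. f s w * time_int g s w))
    + (LBINT s:{0..t}. (\<E> w. g s w * time_int f s w))"
proof -
  have AE: "AE w in M. time_int f t w * time_int g t w =
     (LBINT s:{0..t}. f s w * time_int g s w) + (LBINT s:{0..t}. g s w * time_int f s w)"
    using l2p_AE_integrable1[OF l2p_indicator[OF f, of 0 t]] l2p_AE_integrable1[OF l2p_indicator[OF g, of 0 t]]
  proof eventually_elim
    case (elim w)
    have *: "(\<integral>s. indicator {0..t} s * f s w * (\<integral>r. indicator {0..s} r * (indicator {0..t} r * g r w) \<partial>TM) \<partial>TM)
       = (\<integral>s. indicator {0..t} s * (f s w * time_int g s w) \<partial>TM)" for f g :: "'a process"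
    proof (rule Bochner_Integration.integral_cong[OF refl])
      fix s assume s: "s \<in> space TM"
      show "indicator {0..t} s * f s w * (\<integral>r. indicator {0..s} r * (indicator {0..t} r * g r w) \<partial>TM)
        = indicator {0..t} s * (f s w * time_int g s w)"
      proof (cases "s \<le> t")
        case True
        have "(\<integral>r. indicator {0..s} r * (indicator {0..t} r * g r w) \<partial>TM) = (\<integral>r. indicator {0..s} r * g r w \<partial>TM)"
          by (rule Bochner_Integration.integral_cong) (use True in \<open>auto simp: indicator_def\<close>)
        then show ?thesis using s by (simp add: time_int_TM)
      qed (auto simp: indicator_def)
    qed
    show ?case using integral_product_by_parts[OF elim] t
      by (simp add: time_int_TM[OF t] integral_TM *)
  qed
  have "(\<E> w. time_int f t w * time_int g t w) =
     (\<E> w. (LBINT s:{0..t}. f s w * time_int g s w) + (LBINT s:{0..t}. g s w * time_int f s w))"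
    using f g t l2p_time_int_bound(1)[OF f t] l2p_time_int_bound(1)[OF g t]
    by (intro integral_cong_AE AE) (auto intro!: borel_measurable_integrable Bochner_Integration.integrable_add expectation_product_LBINT l2_mult_integrable)
  also have "\<dots> = (LBINT s:{0..t}. (\<E> w. f s w * time_int g s w))
    + (LBINT s:{0..t}. (\<E> w. g s w * time_int f s w))"
    using expectation_product_LBINT(1,2)[OF f l2p_time_int[OF g], of 0 t] 
      expectation_product_LBINT(1,2)[OF g l2p_time_int[OF f], of 0 t] t by simp
  finally show ?thesis .
qed

text \<open>
  The product rule for \<open>lam\<close> and \<open>\<integral>Z\<close>, where \<open>lam\<close> has drift \<open>- g\<close> and a martingale part whose increments
  are orthogonal to \<open>Z\<close>. By Fubini, \<open>lam t\<close> is paired with each \<open>Z s\<close> separately and may then be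
  replaced by \<open>lam s\<close> and the integral of \<open>g\<close> over the remaining time, which integration by parts
  brings into the form stated.
\<close>

lemma duality:
  assumes lam: "l2p lam" and g: "l2p g" and Z: "l2p Z" and t: "t \<in> {0..T}"
    and mart: "\<And>s. s \<in> {0..t} \<Longrightarrow>
      (\<E> w. (lam t w - lam s w + (time_int g t w - time_int g s w)) * Z s w) = 0"
  shows "(\<E> w. lam t w * time_int Z t w) =
    (LBINT s:{0..t}. (\<E> w. lam s w * Z s w)) - (LBINT s:{0..t}. (\<E> w. g s w * time_int Z s w))"
proof -
  have G: "l2p (time_int g)" using g by auto
  note i1 = expectation_product_LBINT(3)[OF lam Z, of 0 t]
  note i2 = expectation_product_LBINT(3)[OF l2p_const_process[OF l2p_l2[OF G t]] Z, of 0 t]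
  note i3 = expectation_product_LBINT(3)[OF G Z, of 0 t]
  have "(\<E> w. lam t w * time_int Z t w) = (LBINT s:{0..t}. (\<E> w. lam t w * Z s w))"
    by (rule expectation_time_int[OF l2p_l2[OF lam t] Z t])
  also have "\<dots> = (LBINT s:{0..t}. (\<E> w. lam s w * Z s w) - (\<E> w. time_int g t w * Z s w)
       + (\<E> w. time_int g s w * Z s w))"
  proof (rule set_lebesgue_integral_cong, simp, intro allI impI)
    fix s assume s: "s \<in> {0..t}"
    then have sT: "s \<in> {0..T}" using t by auto
    note l = l2_mult_integrable[OF _ l2p_l2[OF Z sT]]
    have i: "integrable M (\<lambda>w. lam t w * Z s w)" "integrable M (\<lambda>w. lam s w * Z s w)"
      "integrable M (\<lambda>w. time_int g t w * Z s w)" "integrable M (\<lambda>w. time_int g s w * Z s w)"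
      using l2p_l2[OF lam] l2p_l2[OF G] t sT by (auto intro!: l)
    have "0 = (\<E> w. lam t w * Z s w - lam s w * Z s w + (time_int g t w * Z s w - time_int g s w * Z s w))"
      using mart[OF s] by (simp add: algebra_simps)
    also have "\<dots> = (\<E> w. lam t w * Z s w) - (\<E> w. lam s w * Z s w)
      + ((\<E> w. time_int g t w * Z s w) - (\<E> w. time_int g s w * Z s w))"
      using i by simp
    finally show "(\<E> w. lam t w * Z s w) = (\<E> w. lam s w * Z s w)
       - (\<E> w. time_int g t w * Z s w) + (\<E> w. time_int g s w * Z s w)" by simp
  qed
  also have "\<dots> = (LBINT s:{0..t}. (\<E> w. lam s w * Z s w))
       - (LBINT s:{0..t}. (\<E> w. time_int g t w * Z s w))
       + (LBINT s:{0..t}. (\<E> w. time_int g s w * Z s w))"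
    using i1 i2 i3 t by simp
  also have "(LBINT s:{0..t}. (\<E> w. time_int g t w * Z s w)) =
     (\<E> w. time_int g t w * time_int Z t w)"
    by (rule expectation_time_int[OF l2p_l2[OF G t] Z t, symmetric])
  also have "\<dots> = (LBINT s:{0..t}. (\<E> w. g s w * time_int Z s w))
    + (LBINT s:{0..t}. (\<E> w. Z s w * time_int g s w))"
    by (rule expectation_by_parts[OF g Z t])
  finally show ?thesis by (simp add: mult.commute)
qed

end

section \<open>Gronwall estimates and filtrations\<close>

context finite_horizon
begin

text \<open>Iterating the integral inequality produces the terms of the exponential series.\<close>

lemma picard_bound:
  fixes e :: "nat \<Rightarrow> real \<Rightarrow> real"
  assumes C: "C \<ge> 0" and int: "\<And>n t. t \<in> {0..T} \<Longrightarrow> set_integrable lborel {0..t} (e n)"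
    and e0: "\<And>t. t \<in> {0..T} \<Longrightarrow> e 0 t \<le> S"
    and step: "\<And>n t. t \<in> {0..T} \<Longrightarrow> e (Suc n) t \<le> C * (LBINT s:{0..t}. e n s)"
    and t: "t \<in> {0..T}"
  shows "e n t \<le> S * (C * t) ^ n / fact n"
  using t
proof (induction n arbitrary: t)
  case 0
  then show ?case using e0 by simp
next
  case (Suc n)
  define c where "c = S * C ^ n / fact n"
  have pw: "(LBINT s:{0..t}. c * s ^ n) = c * (t ^ Suc n / Suc n)"
    using integral_power[of 0 t n] Suc.prems
    by (simp add: set_lebesgue_integral_def mult.commute mult.left_commute)
  have si: "set_integrable lborel {0..t} (\<lambda>s. c * s ^ n)"
    by (rule borel_integrable_atLeastAtMost') (intro continuous_intros)
  have "(LBINT s:{0..t}. e n s) \<le> (LBINT s:{0..t}. c * s ^ n)"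
  proof (rule set_integral_mono[OF int[OF Suc.prems] si])
    fix s assume "s \<in> {0..t}"
    then have "s \<in> {0..T}" using Suc.prems by auto
    from Suc.IH[OF this] show "e n s \<le> c * s ^ n" by (simp add: c_def power_mult_distrib)
  qed
  then have "C * (LBINT s:{0..t}. e n s) \<le> C * (c * (t ^ Suc n / Suc n))"
    unfolding pw using C by (rule mult_left_mono)
  also have "\<dots> = S * (C * t) ^ Suc n / fact (Suc n)"
    by (simp add: c_def power_mult_distrib mult_ac)
  finally show ?case using step[OF Suc.prems, of n] by linarith
qed

lemma picard_limit:
  fixes e :: "nat \<Rightarrow> real \<Rightarrow> real"
  assumes "C \<ge> 0" "\<And>n t. t \<in> {0..T} \<Longrightarrow> set_integrable lborel {0..t} (e n)"
    "\<And>t. t \<in> {0..T} \<Longrightarrow> e 0 t \<le> S"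
    "\<And>n t. t \<in> {0..T} \<Longrightarrow> e (Suc n) t \<le> C * (LBINT s:{0..t}. e n s)"
    and t: "t \<in> {0..T}" and pos: "\<And>n. 0 \<le> e n t"
  shows "(\<lambda>n. e n t) \<longlonglongrightarrow> 0"
proof (rule tendsto_sandwich[OF _ _ tendsto_const])
  show "\<forall>\<^sub>F n in sequentially. e n t \<le> S * (C * t) ^ n / fact n"
    using picard_bound[OF assms(1-5)] by simp
  have "(\<lambda>n. (C * t) ^ n / fact n) \<longlonglongrightarrow> 0"
    using summable_LIMSEQ_zero[OF summable_exp[of "C * t"]] by (simp add: field_simps)
  from tendsto_mult_right_zero[OF this, of S]
  show "(\<lambda>n. S * (C * t) ^ n / fact n) \<longlonglongrightarrow> 0" by simp
qed (use pos in simp)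

lemma gronwall_zero:
  fixes e :: "real \<Rightarrow> real"
  assumes "C \<ge> 0" "\<And>t. t \<in> {0..T} \<Longrightarrow> set_integrable lborel {0..t} e"
    "\<And>t. t \<in> {0..T} \<Longrightarrow> e t \<le> S"
    "\<And>t. t \<in> {0..T} \<Longrightarrow> e t \<le> C * (LBINT s:{0..t}. e s)"
    and t: "t \<in> {0..T}" and pos: "0 \<le> e t"
  shows "e t = 0"
  using picard_limit[of C "\<lambda>_. e" S t] assms LIMSEQ_unique[OF tendsto_const, of "e t" 0] by auto

lemma l2p_sq_integrable:
  assumes "l2p X" "0 \<le> a" "b \<le> T"
  shows "set_integrable lborel {a..b} (\<lambda>s. (\<E> w. (X s w)\<^sup>2))"
  using expectation_product_LBINT(3)[OF assms(1,1,2,3)] by (simp add: power2_eq_square)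

lemma l2p_gronwall_forward:
  assumes X: "l2p X" and C: "C \<ge> 0"
    and le: "\<And>t. t \<in> {0..T} \<Longrightarrow> (\<E> w. (X t w)\<^sup>2) \<le> C * (LBINT s:{0..t}. (\<E> w. (X s w)\<^sup>2))"
    and t: "t \<in> {0..T}"
  shows "AE w in M. X t w = 0"
proof (rule l2_zero_AE[OF l2p_l2[OF X t]])
  obtain S where S: "\<And>t. t \<in> {0..T} \<Longrightarrow> (\<E> w. (X t w)\<^sup>2) \<le> S"
    using l2p_bound[OF X] by blast
  have "(\<E> w. (X t w)\<^sup>2) = 0"
    by (rule gronwall_zero[OF C _ S le t]) (use l2p_sq_integrable[OF X] in auto)
  then show "(\<E> w. (X t w)\<^sup>2) \<le> 0" by simp
qed

lemma LBINT_reflect: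
  fixes f :: "real \<Rightarrow> real"
  shows "(LBINT s:{0..t}. f (T - s)) = (LBINT s:{T-t..T}. f s)"
proof -
  have "(LBINT s. indicator {T-t..T} s *\<^sub>R f s) = (LBINT s. indicator {T-t..T} (T + (-1) * s) *\<^sub>R f (T + (-1) * s))"
    by (subst lborel_integral_real_affine[of "-1" _ T]) auto
  also have "\<dots> = (LBINT s. indicator {0..t} s *\<^sub>R f (T - s))"
    by (rule Bochner_Integration.integral_cong) (auto simp: indicator_def)
  finally show ?thesis by (simp add: set_lebesgue_integral_def)
qed

text \<open>Time reversal of the forward estimate.\<close>

lemma l2p_gronwall_backward:
  assumes X: "l2p X" and C: "C \<ge> 0"
    and le: "\<And>t. t \<in> {0..T} \<Longrightarrow> (\<E> w. (X t w)\<^sup>2) \<le> C * (LBINT s:{t..T}. (\<E> w. (X s w)\<^sup>2))"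
    and t: "t \<in> {0..T}"
  shows "AE w in M. X t w = 0"
proof (rule l2_zero_AE[OF l2p_l2[OF X t]])
  let ?f = "\<lambda>t. (\<E> w. (X t w)\<^sup>2)"
  obtain S where S: "\<And>t. t \<in> {0..T} \<Longrightarrow> ?f t \<le> S"
    using l2p_bound[OF X] by blast
  have "?f (T - (T - t)) = 0"
  proof (rule gronwall_zero[OF C, where e="\<lambda>t. ?f (T - t)" and S=S])
    fix t assume t: "t \<in> {0..T}"
    have "integrable lborel (\<lambda>s. indicator {T-t..T} s *\<^sub>R ?f s)"
      using l2p_sq_integrable[OF X, of "T-t" T] t by (simp add: set_integrable_def)
    from lborel_integrable_real_affine[OF this, of "-1" T]
    have "integrable lborel (\<lambda>s. indicator {T-t..T} (T - s) *\<^sub>R ?f (T - s))" by simp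
    then show "set_integrable lborel {0..t} (\<lambda>t. ?f (T - t))"
      unfolding set_integrable_def
      by (rule Bochner_Integration.integrable_cong[THEN iffD1, rotated 2]) (auto simp: indicator_def)
    show "?f (T - t) \<le> S" using S[of "T - t"] t by auto
    show "?f (T - t) \<le> C * (LBINT s:{0..t}. ?f (T - s))"
      using le[of "T - t"] t by (simp add: LBINT_reflect[of t ?f])
  qed (use t in auto)
  then show "?f t \<le> 0" by simp
qed

definition filtration :: "(real \<Rightarrow> 'a measure) \<Rightarrow> bool" where
  "filtration H \<longleftrightarrow> (\<forall>t\<in>{0..T}. subalgebra M (H t) \<and> null_sets M \<subseteq> sets (H t)) \<and>
     (\<forall>s t. 0 \<le> s \<and> s \<le> t \<and> t \<le> T \<longrightarrow> sets (H s) \<subseteq> sets (H t))"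

lemma filtrationD:
  assumes "filtration H" "t \<in> {0..T}"
  shows "subalgebra M (H t)" "null_sets M \<subseteq> sets (H t)" "space (H t) = space M"
    "\<And>f :: 'a \<Rightarrow> real. f \<in> borel_measurable (H t) \<Longrightarrow> f \<in> borel_measurable M"
  using assms measurable_from_subalg[of M "H t"] by (auto simp: filtration_def subalgebra_def)

lemma filtration_measurable_mono:
  fixes f :: "'a \<Rightarrow> real"
  assumes "filtration H" "0 \<le> s" "s \<le> t" "t \<le> T" "f \<in> borel_measurable (H s)"
  shows "f \<in> borel_measurable (H t)"
  by (rule measurable_from_subalg[OF _ assms(5)])
     (use assms in \<open>auto simp: filtration_def subalgebra_def\<close>)

text \<open>
  The joint measurability of \<open>X\<close> refers to the \<open>\<sigma>\<close>-algebra of \<open>M\<close>, not to \<open>F\<close>, so Fubini's theorem is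
  used in a weak form: the integral is orthogonal to everything that is orthogonal to \<open>L\<^sup>2(F)\<close>.
\<close>

lemma time_int_adapted:
  assumes F: "subalgebra M F" "null_sets M \<subseteq> sets F" and X: "l2p X" and t: "t \<in> {0..T}"
    and ad: "\<And>s. s \<in> {0..t} \<Longrightarrow> X s \<in> borel_measurable F"
  shows "time_int X t \<in> borel_measurable F"
proof (rule l2_orthogonal_measurable[OF F l2p_time_int_bound(1)[OF X t]])
  fix R assume R: "l2 R" and orth: "\<And>U. l2 U \<Longrightarrow> U \<in> borel_measurable F \<Longrightarrow> (\<E> w. U w * R w) = 0"
  have "(\<E> w. R w * time_int X t w) = (LBINT s:{0..t}. (\<E> w. R w * X s w))"
    by (rule expectation_time_int[OF R X t])
  also have "\<dots> = (LBINT s:{0..t}. 0)"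
  proof (rule set_lebesgue_integral_cong, simp, intro allI impI)
    fix s assume s: "s \<in> {0..t}"
    show "(\<E> w. R w * X s w) = 0"
      using orth[OF l2p_l2[OF X] ad[OF s]] s t by (simp add: mult.commute)
  qed
  finally show "(\<E> w. time_int X t w * R w) = 0"
    by (simp add: mult.commute set_lebesgue_integral_def)
qed

lemma expectation_coeff_LBINT_le:
  assumes X: "l2p X" and B: "\<And>t. t \<in> {0..T} \<Longrightarrow> \<bar>A t\<bar> \<le> B" and A: "bounded_coefficient T A"
    and ab: "0 \<le> a" "b \<le> T"
  shows "(LBINT s:{a..b}. (\<E> w. (A s * X s w)\<^sup>2)) \<le> B\<^sup>2 * (LBINT s:{a..b}. (\<E> w. (X s w)\<^sup>2))"
proof -
  have "(LBINT s:{a..b}. (\<E> w. (A s * X s w)\<^sup>2)) \<le> (LBINT s:{a..b}. B\<^sup>2 * (\<E> w. (X s w)\<^sup>2))"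
  proof (rule set_integral_mono)
    show "set_integrable lborel {a..b} (\<lambda>s. (\<E> w. (A s * X s w)\<^sup>2))"
      by (rule l2p_sq_integrable[OF l2p_coeff_mult[OF A X] ab])
    show "set_integrable lborel {a..b} (\<lambda>s. B\<^sup>2 * (\<E> w. (X s w)\<^sup>2))"
      using l2p_sq_integrable[OF X ab] by simp
    fix s assume "s \<in> {a..b}"
    then have "\<bar>A s\<bar> \<le> B" using B ab by auto
    then have "(A s)\<^sup>2 \<le> B\<^sup>2" using abs_le_square_iff[of "A s" B] by linarith
    then show "(\<E> w. (A s * X s w)\<^sup>2) \<le> B\<^sup>2 * (\<E> w. (X s w)\<^sup>2)"
      by (simp add: power_mult_distrib mult_right_mono)
  qed
  then show ?thesis by simp
qed

lemma expectation_square_cong_AE: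
  fixes f g :: "'a \<Rightarrow> real"
  assumes "AE w in M. f w = g w" "f \<in> borel_measurable M" "g \<in> borel_measurable M"
  shows "(\<E> w. (f w)\<^sup>2) = (\<E> w. (g w)\<^sup>2)"
  using assms by (intro integral_cong_AE borel_measurable_power) (auto elim!: eventually_mono)

text \<open>
  The solution is the \<open>L\<^sup>2\<close> limit of its Picard iterates, each of which is adapted as a time
  integral of adapted processes. This is how the difference of two states is found to depend on
  the observation only.
\<close>

lemma linear_ode_adapted:
  assumes H: "filtration H" and z: "l2p z" and f: "l2p f" and A: "bounded_coefficient T A"
    and ad: "\<And>s. s \<in> {0..T} \<Longrightarrow> f s \<in> borel_measurable (H s)"
    and ode: "\<And>t. t \<in> {0..T} \<Longrightarrow> AE w in M. z t w = time_int (\<lambda>s w. A s * z s w + f s w) t w"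
    and t: "t \<in> {0..T}"
  shows "z t \<in> borel_measurable (H t)"
proof -
  define zn where "zn = rec_nat (\<lambda>t w. 0) (\<lambda>n u. time_int (\<lambda>s w. A s * u s w + f s w))"
  have zn_Suc: "zn (Suc n) = time_int (\<lambda>s w. A s * zn n s w + f s w)" for n by (simp add: zn_def)
  have zn0: "zn 0 = (\<lambda>t w. 0)" by (simp add: zn_def)
  have l: "l2p (zn n)" for n
  proof (induction n)
    case 0
    show ?case using l2p_coeff[OF bounded_coefficient_const[of 0]] by (simp add: zn0)
  next
    case (Suc n)
    show ?case unfolding zn_Suc by (intro l2p_time_int l2p_add l2p_coeff_mult A f Suc)
  qed
  have adn: "zn n s \<in> borel_measurable (H s)" if "s \<in> {0..T}" for n s
    using that
  proof (induction n arbitrary: s)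
    case (Suc n)
    show ?case unfolding zn_Suc
    proof (rule time_int_adapted[OF filtrationD(1,2)[OF H Suc.prems] _ Suc.prems])
      show "l2p (\<lambda>s w. A s * zn n s w + f s w)" by (intro l2p_add l2p_coeff_mult A f l)
      fix r assume r: "r \<in> {0..s}"
      then have "zn n r \<in> borel_measurable (H r)" "f r \<in> borel_measurable (H r)"
        using Suc ad by auto
      then show "(\<lambda>w. A r * zn n r w + f r w) \<in> borel_measurable (H s)"
        using r Suc.prems by (auto intro!: filtration_measurable_mono[OF H, of r s])
    qed
  qed (simp add: zn0)
  obtain B where B: "\<And>t. t \<in> {0..T} \<Longrightarrow> \<bar>A t\<bar> \<le> B" using A unfolding bounded_coefficient_def by blast
  obtain S where S: "\<And>t. t \<in> {0..T} \<Longrightarrow> (\<E> w. (z t w)\<^sup>2) \<le> S"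
    using l2p_bound[OF z] by blast
  define e where "e n t = (\<E> w. (z t w - zn n t w)\<^sup>2)" for n t
  have d: "l2p (\<lambda>t w. z t w - zn n t w)" for n by (intro l2p_diff z l)
  have "(\<lambda>n. e n t) \<longlonglongrightarrow> 0"
  proof (rule picard_limit[where C="T * B\<^sup>2" and S=S])
    show "0 \<le> T * B\<^sup>2" using T_pos by simp
    show "set_integrable lborel {0..t} (e n)" if "t \<in> {0..T}" for n t
      using l2p_sq_integrable[OF d[of n], of 0 t] that by (simp add: e_def[abs_def])
    show "e 0 t \<le> S" if "t \<in> {0..T}" for t using S[OF that] by (simp add: e_def zn0)
    show "e (Suc n) t \<le> T * B\<^sup>2 * (LBINT s:{0..t}. e n s)" if t: "t \<in> {0..T}" for n t
    proof -
      let ?D = "\<lambda>s w. A s * (z s w - zn n s w)"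
      have lD: "l2p ?D" by (intro l2p_coeff_mult A d)
      have AE: "AE w in M. z t w - zn (Suc n) t w = time_int ?D t w"
      proof -
        have "(\<lambda>s w. (A s * z s w + f s w) - (A s * zn n s w + f s w)) = ?D" by (auto simp: fun_eq_iff right_diff_distrib)
        then have "AE w in M. time_int ?D t w = time_int (\<lambda>s w. A s * z s w + f s w) t w - zn (Suc n) t w"
          using time_int_diff[of "\<lambda>s w. A s * z s w + f s w" "\<lambda>s w. A s * zn n s w + f s w", OF l2p_add[OF l2p_coeff_mult[OF A z] f] l2p_add[OF l2p_coeff_mult[OF A l] f] t]
          by (simp add: zn_Suc)
        with ode[OF t] show ?thesis by eventually_elim simp
      qed
      have "e (Suc n) t = (\<E> w. (time_int ?D t w)\<^sup>2)"
        unfolding e_def using l2p_l2[OF d t, of "Suc n"] l2p_l2[OF l2p_time_int[OF lD] t]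
        by (intro expectation_square_cong_AE[OF AE]) (auto simp: l2_def)
      also have "\<dots> \<le> T * (LBINT s:{0..t}. (\<E> w. (?D s w)\<^sup>2))"
        by (rule l2p_time_int_bound(2)[OF lD t])
      also have "\<dots> \<le> T * (B\<^sup>2 * (LBINT s:{0..t}. e n s))"
        unfolding e_def using T_pos t
        by (intro mult_left_mono expectation_coeff_LBINT_le[OF d B A]) auto
      finally show ?thesis by (simp add: mult.assoc)
    qed
    show "0 \<le> e n t" for n by (simp add: e_def)
  qed (rule t)
  then show ?thesis
    using l2_limit_measurable[OF filtrationD(1,2)[OF H t] l2p_l2[OF z t] l2p_l2[OF l t] adn[OF t]]
    by (simp add: e_def)
qed

end


lemma (in finite_horizon) aug_filtration_filtration:
  assumes "\<And>X r. X \<in> \<X> \<Longrightarrow> r \<in> {0..T} \<Longrightarrow> X r \<in> borel_measurable M"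
  shows "filtration (aug_filtration M \<X>)"
proof -
  let ?G = "\<lambda>t. {X r -` S \<inter> space M | X r S. X \<in> \<X> \<and> r \<in> {0..t} \<and> S \<in> sets borel} \<union> null_sets M"
  have P: "?G t \<subseteq> Pow (space M)" for t using sets.sets_into_space by auto
  have s: "sets (aug_filtration M \<X> t) = sigma_sets (space M) (?G t)" for t
    unfolding aug_filtration_def using P[of t] by simp
  have M: "?G t \<subseteq> sets M" if "t \<le> T" for t
    using that assms by (auto intro!: measurable_sets)
  show ?thesis unfolding filtration_def
  proof (intro conjI ballI allI impI)
    fix t assume t: "t \<in> {0..T}"
    show "subalgebra M (aug_filtration M \<X> t)"
      unfolding subalgebra_def s using sets.sigma_sets_subset[OF M[of t]] t P[of t]
      by (auto simp: aug_filtration_def)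
    show "null_sets M \<subseteq> sets (aug_filtration M \<X> t)"
      unfolding s using sigma_sets_superset_generator[of "?G t" "space M"] by (rule subset_trans[OF Un_upper2])
  next
    fix r t :: real assume "0 \<le> r \<and> r \<le> t \<and> t \<le> T"
    then have "{0..r} \<subseteq> {0..t}" by simp
    then have "?G r \<subseteq> ?G t" by blast
    then show "sets (aug_filtration M \<X> r) \<subseteq> sets (aug_filtration M \<X> t)"
      unfolding s by (rule sigma_sets_mono')
  qed
qed

lemma aug_filtration_measurable:
  assumes "X \<in> \<X>" "r \<in> {0..t}"
  shows "X r \<in> borel_measurable (aug_filtration M \<X> t)"
proof -
  let ?G = "{X r -` S \<inter> space M | X r S. X \<in> \<X> \<and> r \<in> {0..t} \<and> S \<in> sets borel} \<union> null_sets M"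
  have P: "?G \<subseteq> Pow (space M)" using sets.sets_into_space by auto
  have sp: "space (aug_filtration M \<X> t) = space M" unfolding aug_filtration_def using P by simp
  show ?thesis
  proof (rule measurableI)
    fix A :: "real set" assume "A \<in> sets borel"
    then have "X r -` A \<inter> space M \<in> ?G" using assms by blast
    then show "X r -` A \<inter> space (aug_filtration M \<X> t) \<in> sets (aug_filtration M \<X> t)"
      unfolding sp using P by (auto simp: aug_filtration_def intro!: sigma_sets.Basic)
  qed auto
qed

lemma aug_filtration_subset:
  assumes "\<And>X r. X \<in> \<X> \<Longrightarrow> r \<in> {0..t} \<Longrightarrow> X r \<in> borel_measurable F"
    "space F = space M" "null_sets M \<subseteq> sets F"
  shows "sets (aug_filtration M \<X> t) \<subseteq> sets F"
proof -
  let ?G = "{X r -` S \<inter> space M | X r S. X \<in> \<X> \<and> r \<in> {0..t} \<and> S \<in> sets borel} \<union> null_sets M"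
  have P: "?G \<subseteq> Pow (space M)" using sets.sets_into_space by auto
  have "?G \<subseteq> sets F" using assms(1,3) measurable_sets[of _ F borel] assms(2)[symmetric] by auto
  then show ?thesis unfolding aug_filtration_def using P assms(2) sets.sigma_sets_subset[of ?G F] by simp
qed

lemma aug_filtration_eqI:
  assumes "sets (aug_filtration M \<X> t) = sets (aug_filtration M \<Y> t)"
  shows "aug_filtration M \<X> t = aug_filtration M \<Y> t"
  using assms by (rule measure_eqI) (simp add: aug_filtration_def emeasure_sigma)

section \<open>Brownian motion with respect to a filtration\<close>

context prob_space
begin

lemma indep_set_indep_var:
  assumes F: "subalgebra M F" and D: "D \<in> borel_measurable M"
    and ind: "indep_set (sets F) {D -` S \<inter> space M | S. S \<in> sets borel}"
    and Z: "Z \<in> borel_measurable F" and g: "g \<in> borel_measurable borel"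
  shows "indep_var borel (Z :: 'a \<Rightarrow> real) borel (\<lambda>w. g (D w :: real) :: real)"
proof -
  have sp: "space F = space M" and sub: "sets F \<subseteq> sets M" using F by (auto simp: subalgebra_def)
  have 2: "Int_stable (sets F)" by (auto simp: Int_stable_def)
  have 3: "Int_stable {D -` S \<inter> space M | S. S \<in> sets borel}"
  proof (rule Int_stableI, clarify)
    fix A B :: "real set" assume "A \<in> sets borel" "B \<in> sets borel"
    then show "\<exists>S. D -` A \<inter> space M \<inter> (D -` B \<inter> space M) = D -` S \<inter> space M \<and> S \<in> sets borel"
      by (intro exI[of _ "A \<inter> B"]) auto
  qed
  have "sigma_sets (space M) {Z -` A \<inter> space M | A. A \<in> sets borel} \<subseteq> sigma_sets (space M) (sets F)"
    using measurable_sets[OF Z] sp by (intro sigma_sets_mono') auto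
  then have "indep_var borel Z borel D"
    unfolding indep_var_eq using D measurable_from_subalg[OF F Z] indep_set_sigma_sets[OF ind 2 3]
    unfolding indep_sets2_eq by blast
  from indep_var_compose[OF this, of "\<lambda>x. x" borel g borel] g show ?thesis by (simp add: comp_def)
qed

end

context finite_horizon
begin

definition brownian_wrt :: "(real \<Rightarrow> 'a measure) \<Rightarrow> 'a process \<Rightarrow> bool" where
  "brownian_wrt H B \<longleftrightarrow> filtration H \<and> (\<forall>t\<in>{0..T}. B t \<in> borel_measurable (H t)) \<and>
     (\<forall>s t. 0 \<le> s \<and> s < t \<and> t \<le> T \<longrightarrow>
        distributed M lborel (\<lambda>w. B t w - B s w) (\<lambda>x. ennreal (normal_density 0 (sqrt (t - s)) x)) \<and>
        indep_set (sets (H s)) {(\<lambda>w. B t w - B s w) -` S \<inter> space M | S. S \<in> sets borel})"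

lemma brownian_wrt_filtration: "brownian_wrt H B \<Longrightarrow> filtration H"
  by (simp add: brownian_wrt_def)

lemma brownian_wrt_adapted:
  assumes "brownian_wrt H B" "t \<in> {0..T}"
  shows "B t \<in> borel_measurable (H t)" "B t \<in> borel_measurable M"
  using assms filtrationD(4)[of H t "B t"] by (auto simp: brownian_wrt_def)

lemma brownian_wrt_coarser:
  assumes B: "brownian_wrt H B" and H': "filtration H'"
    and sub: "\<And>t. t \<in> {0..T} \<Longrightarrow> sets (H' t) \<subseteq> sets (H t)"
    and ad: "\<And>t. t \<in> {0..T} \<Longrightarrow> B t \<in> borel_measurable (H' t)"
  shows "brownian_wrt H' B"
proof -
  have "indep_set (sets (H' s)) {(\<lambda>w. B t w - B s w) -` S \<inter> space M | S. S \<in> sets borel}"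
    if "0 \<le> s" "s < t" "t \<le> T" for s t
  proof -
    have "indep_set (sets (H s)) {(\<lambda>w. B t w - B s w) -` S \<inter> space M | S. S \<in> sets borel}"
      using B that by (auto simp: brownian_wrt_def)
    moreover have "sets (H' s) \<subseteq> sets (H s)" using sub that by auto
    ultimately show ?thesis unfolding indep_sets2_eq by blast
  qed
  with B H' ad show ?thesis by (auto simp: brownian_wrt_def)
qed

lemma brownian_increment_indep:
  assumes B: "brownian_wrt H B" and st: "0 \<le> s" "s < t" "t \<le> T"
    and Z: "Z \<in> borel_measurable (H s)" and g: "g \<in> borel_measurable borel"
  shows "indep_var borel (Z :: 'a \<Rightarrow> real) borel (\<lambda>w. g (B t w - B s w) :: real)"
proof (rule indep_set_indep_var[OF _ _ _ Z g])
  show "subalgebra M (H s)" using B st by (auto simp: brownian_wrt_def filtration_def)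
  show "(\<lambda>w. B t w - B s w) \<in> borel_measurable M"
    using brownian_wrt_adapted(2)[OF B] st by auto
qed (use B st in \<open>auto simp: brownian_wrt_def\<close>)

lemma brownian_increment_moments:
  assumes B: "brownian_wrt H B" and st: "0 \<le> s" "s \<le> t" "t \<le> T"
  shows "l2 (\<lambda>w. B t w - B s w)" "(\<E> w. B t w - B s w) = 0"
    "(\<E> w. (B t w - B s w)\<^sup>2) = t - s"
proof -
  have "l2 (\<lambda>w. B t w - B s w) \<and> (\<E> w. B t w - B s w) = 0
    \<and> (\<E> w. (B t w - B s w)\<^sup>2) = t - s"
  proof (cases "s = t")
    case False
    then have lt: "s < t" "0 < sqrt (t - s)" using st by auto
    have D: "distributed M lborel (\<lambda>w. B t w - B s w) (\<lambda>x. ennreal (normal_density 0 (sqrt (t - s)) x))"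
      using B st lt by (auto simp: brownian_wrt_def)
    have i: "integrable M (\<lambda>w. (B t w - B s w)\<^sup>2)"
      using distributed_integrable[OF D, of "\<lambda>x. x\<^sup>2"] integrable_normal_moment[OF lt(2), of 0 2]
      by auto
    have e: "(\<E> w. B t w - B s w) = 0"
      using normal_distributed_expectation[OF lt(2) D] .
    have m: "(\<lambda>w. B t w - B s w) \<in> borel_measurable M"
      using brownian_wrt_adapted(2)[OF B] st by auto
    show ?thesis
      using normal_distributed_variance[OF lt(2) D] i e m lt by (simp add: l2_def)
  qed simp
  then show "l2 (\<lambda>w. B t w - B s w)" "(\<E> w. B t w - B s w) = 0"
    "(\<E> w. (B t w - B s w)\<^sup>2) = t - s" by auto
qed

lemma brownian_increment_expectation:
  assumes B: "brownian_wrt H B" and st: "0 \<le> s" "s \<le> t" "t \<le> T"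
    and Z: "s < t \<Longrightarrow> Z \<in> borel_measurable (H s)" "integrable M Z"
  shows "(\<E> w. Z w * (B t w - B s w)) = 0" (is ?a)
    "integrable M (\<lambda>w. Z w * (B t w - B s w))" (is ?b)
    "(\<E> w. Z w * (B t w - B s w)\<^sup>2) = expectation Z * (t - s)" (is ?c)
    "integrable M (\<lambda>w. Z w * (B t w - B s w)\<^sup>2)" (is ?d)
proof -
  note m = brownian_increment_moments[OF B st]
  have "?a \<and> ?b \<and> ?c \<and> ?d"
  proof (cases "s = t")
    case False
    then have lt: "s < t" using st by auto
    note ind = brownian_increment_indep[OF B st(1) lt st(3) Z(1)[OF lt]]
    show ?thesis
      using indep_var_lebesgue_integral[OF ind[of "\<lambda>x. x"] Z(2)] indep_var_lebesgue_integral[OF ind[of "\<lambda>x. x\<^sup>2"] Z(2)]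
        indep_var_integrable[OF ind[of "\<lambda>x. x"] Z(2)] indep_var_integrable[OF ind[of "\<lambda>x. x\<^sup>2"] Z(2)]
        m by (simp add: l2_integrable l2_square_integrable)
  qed simp
  then show ?a ?b ?c ?d by auto
qed

lemma generated_by_inter:
  assumes "subalgebra M F" "subalgebra M G"
  shows "sets (sigma (space M) (sets F \<union> sets G)) \<subseteq> sigma_sets (space M) {A \<inter> B | A B. A \<in> sets F \<and> B \<in> sets G}"
proof -
  have sp: "space F = space M" "space G = space M" and sub: "sets F \<subseteq> sets M" "sets G \<subseteq> sets M"
    using assms by (auto simp: subalgebra_def)
  have P: "sets F \<union> sets G \<subseteq> Pow (space M)" using sub sets.space_closed[of M] by blast
  have "sets F \<union> sets G \<subseteq> sigma_sets (space M) {A \<inter> B | A B. A \<in> sets F \<and> B \<in> sets G}"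
  proof
    have top: "space M \<in> sets F" "space M \<in> sets G" using sp sets.top[of F] sets.top[of G] by auto
    fix A assume A: "A \<in> sets F \<union> sets G"
    then have "A \<subseteq> space M" using P by auto
    then have eq: "A \<inter> space M = A" "space M \<inter> A = A" by auto
    have "\<exists>C D. A = C \<inter> D \<and> C \<in> sets F \<and> D \<in> sets G"
      using A top eq by (elim UnE) metis+
    then show "A \<in> sigma_sets (space M) {A \<inter> B | A B. A \<in> sets F \<and> B \<in> sets G}"
      by (intro sigma_sets.Basic) simp
  qed
  then show ?thesis unfolding sets_measure_of[OF P] by (rule sigma_sets_mono)
qed

lemma subalgebra_join:
  assumes "subalgebra M F" "subalgebra M G"
  shows "subalgebra M (sigma (space M) (sets F \<union> sets G))"
    "sets F \<subseteq> sets (sigma (space M) (sets F \<union> sets G))"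
    "sets G \<subseteq> sets (sigma (space M) (sets F \<union> sets G))"
proof -
  have sub: "sets F \<subseteq> sets M" "sets G \<subseteq> sets M"
    using assms by (auto simp: subalgebra_def)
  then have P: "sets F \<union> sets G \<subseteq> Pow (space M)" using sets.space_closed[of M] by blast
  then have s: "sets (sigma (space M) (sets F \<union> sets G)) = sigma_sets (space M) (sets F \<union> sets G)"
     "space (sigma (space M) (sets F \<union> sets G)) = space M" by auto
  show "sets F \<subseteq> sets (sigma (space M) (sets F \<union> sets G))" "sets G \<subseteq> sets (sigma (space M) (sets F \<union> sets G))"
    unfolding s by (auto intro: sigma_sets.Basic)
  show "subalgebra M (sigma (space M) (sets F \<union> sets G))"
    unfolding subalgebra_def s using sets.sigma_sets_subset[of "sets F \<union> sets G" M] sub by simp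
qed

text \<open>
  All of \<open>V\<close> may be known from the beginning: the increment of \<open>W\<close> is independent of the past of \<open>W\<close>,
  and the two together are independent of \<open>V\<close>.
\<close>

lemma brownian_enlarged:
  assumes W: "brownian_motion M T W" and V: "\<And>r. r \<in> {0..T} \<Longrightarrow> V r \<in> borel_measurable M"
    and ind: "independent_processes M T W V"
  shows "brownian_wrt (\<lambda>t. sigma (space M) (sets (aug_filtration M {W} t) \<union> sets (aug_filtration M {V} T))) W"
proof -
  let ?F = "aug_filtration M {W}" and ?G = "aug_filtration M {V} T"
  have Wm: "W t \<in> borel_measurable M" if "t \<in> {0..T}" for t using W that by (auto simp: brownian_motion_def)
  have F: "filtration ?F" by (rule aug_filtration_filtration) (use Wm in auto)
  have G: "filtration (aug_filtration M {V})" by (rule aug_filtration_filtration) (use V in auto)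
  have TT: "T \<in> {0..T}" using T_pos by auto
  note subF = filtrationD(1)[OF F] and subG = filtrationD(1)[OF G TT]
  let ?H = "\<lambda>t. sigma (space M) (sets (?F t) \<union> sets ?G)"
  have mono: "sets (?F s) \<subseteq> sets (?F t)" if "0 \<le> s" "s \<le> t" "t \<le> T" for s t
    using F that by (auto simp: filtration_def)
  have H: "filtration ?H" unfolding filtration_def
  proof (intro conjI ballI allI impI)
    fix t assume t: "t \<in> {0..T}"
    show "subalgebra M (?H t)" by (rule subalgebra_join(1)[OF subF[OF t] subG])
    show "null_sets M \<subseteq> sets (?H t)"
      using subalgebra_join(2)[OF subF[OF t] subG] filtrationD(2)[OF F t] by blast
  next
    fix s t assume st: "0 \<le> s \<and> s \<le> t \<and> t \<le> T"
    then have t: "s \<in> {0..T}" "t \<in> {0..T}" by auto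
    have P: "sets (?F t) \<union> sets ?G \<subseteq> Pow (space M)" if "t \<in> {0..T}" for t
      using subF[OF that] subG sets.space_closed[of M] unfolding subalgebra_def by blast
    show "sets (?H s) \<subseteq> sets (?H t)"
      unfolding sets_measure_of[OF P[OF t(1)]] sets_measure_of[OF P[OF t(2)]]
      using st by (intro sigma_sets_mono' Un_mono mono order_refl) auto
  qed
  have ad: "W t \<in> borel_measurable (?H t)" if t: "t \<in> {0..T}" for t
  proof (rule measurable_from_subalg)
    show "W t \<in> borel_measurable (?F t)" using t by (intro aug_filtration_measurable) auto
    show "subalgebra (?H t) (?F t)"
      using subalgebra_join(1,2)[OF subF[OF t] subG] subF[OF t] by (auto simp: subalgebra_def)
  qed
  have prod: "prob (A \<inter> B) = prob A * prob B" if "A \<in> sets (?F T)" "B \<in> sets ?G" for A B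
    using ind that unfolding independent_processes_def indep_sets2_eq by blast
  have "indep_set (sets (?H s)) {(\<lambda>w. W t w - W s w) -` S \<inter> space M | S. S \<in> sets borel}"
    if st: "0 \<le> s" "s < t" "t \<le> T" for s t
  proof -
    let ?D = "{(\<lambda>w. W t w - W s w) -` S \<inter> space M | S. S \<in> sets borel}"
    let ?P = "{A \<inter> B | A B. A \<in> sets (?F s) \<and> B \<in> sets ?G}"
    have s: "s \<in> {0..T}" and t: "t \<in> {0..T}" using st by auto
    have indW: "indep_set (sets (?F s)) ?D" using W st by (auto simp: brownian_motion_def)
    have DF: "?D \<subseteq> sets (?F T)"
    proof clarify
      fix S :: "real set" assume S: "S \<in> sets borel"
      have "W t \<in> borel_measurable (?F T)" "W s \<in> borel_measurable (?F T)"
        using s t by (auto intro!: aug_filtration_measurable)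
      then have "(\<lambda>w. W t w - W s w) \<in> borel_measurable (?F T)" by auto
      then show "(\<lambda>w. W t w - W s w) -` S \<inter> space M \<in> sets (?F T)"
        using measurable_sets[OF _ S] filtrationD(3)[OF F TT] by metis
    qed
    have "indep_set ?P ?D" unfolding indep_sets2_eq
    proof (intro conjI ballI)
      have FG: "sets (?F s) \<subseteq> events" "sets ?G \<subseteq> events" "sets (?F T) \<subseteq> events"
        using subF[OF s] subF[OF TT] subG by (auto simp: subalgebra_def)
      show "?P \<subseteq> events" using FG by auto
      show "?D \<subseteq> events" using FG DF by blast
      fix E C assume "E \<in> ?P" and C: "C \<in> ?D"
      then obtain A B where E: "E = A \<inter> B" and A: "A \<in> sets (?F s)" and B: "B \<in> sets ?G" by blast
      have AT: "A \<in> sets (?F T)" using A mono[of s T] st by auto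
      have CT: "C \<in> sets (?F T)" using C DF by blast
      have AC: "prob (A \<inter> C) = prob A * prob C"
        using indW A C unfolding indep_sets2_eq by blast
      have "prob (E \<inter> C) = prob ((A \<inter> C) \<inter> B)" unfolding E by (simp add: Int_ac)
      also have "\<dots> = prob (A \<inter> C) * prob B" using AT CT B by (intro prod) auto
      also have "\<dots> = prob (A \<inter> B) * prob C" using AC prod[OF AT B] by simp
      finally show "prob (E \<inter> C) = prob E * prob C" unfolding E .
    qed
    moreover have "Int_stable ?P"
    proof (rule Int_stableI, clarify)
      fix A B A' B' assume "A \<in> sets (?F s)" "B \<in> sets ?G" "A' \<in> sets (?F s)" "B' \<in> sets ?G"
      then show "\<exists>C D. A \<inter> B \<inter> (A' \<inter> B') = C \<inter> D \<and> C \<in> sets (?F s) \<and> D \<in> sets ?G"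
        by (intro exI[of _ "A \<inter> A'"] exI[of _ "B \<inter> B'"]) auto
    qed
    moreover have "Int_stable ?D"
    proof (rule Int_stableI, clarify)
      fix A B :: "real set" assume "A \<in> sets borel" "B \<in> sets borel"
      then show "\<exists>S. (\<lambda>w. W t w - W s w) -` A \<inter> space M \<inter> ((\<lambda>w. W t w - W s w) -` B \<inter> space M)
        = (\<lambda>w. W t w - W s w) -` S \<inter> space M \<and> S \<in> sets borel"
        by (intro exI[of _ "A \<inter> B"]) auto
    qed
    ultimately have "indep_set (sigma_sets (space M) ?P) (sigma_sets (space M) ?D)"
      by (rule indep_set_sigma_sets)
    moreover have "sets (?H s) \<subseteq> sigma_sets (space M) ?P"
      by (rule generated_by_inter[OF subF[OF s] subG])
    moreover have "?D \<subseteq> sigma_sets (space M) ?D" by (rule sigma_sets_superset_generator)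
    ultimately show ?thesis unfolding indep_sets2_eq by blast
  qed
  then show ?thesis using H ad W by (auto simp: brownian_wrt_def brownian_motion_def)
qed

lemma independent_processes_sym:
  "independent_processes M T W V \<Longrightarrow> independent_processes M T V W"
  unfolding independent_processes_def indep_sets2_eq by (metis Int_commute mult.commute)

lemma aug_filtration_pair_subset:
  assumes W: "\<And>r. r \<in> {0..T} \<Longrightarrow> W r \<in> borel_measurable M"
    and V: "\<And>r. r \<in> {0..T} \<Longrightarrow> V r \<in> borel_measurable M" and t: "t \<in> {0..T}"
  shows "sets (aug_filtration M {W, V} t) \<subseteq> sets (sigma (space M) (sets (aug_filtration M {W} t) \<union> sets (aug_filtration M {V} T)))"
proof (rule aug_filtration_subset)
  let ?F = "aug_filtration M {W} t" and ?G = "aug_filtration M {V} T"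
  have F: "filtration (aug_filtration M {W})" by (rule aug_filtration_filtration) (use W in auto)
  have G: "filtration (aug_filtration M {V})" by (rule aug_filtration_filtration) (use V in auto)
  have TT: "T \<in> {0..T}" using T_pos by auto
  note J = subalgebra_join[OF filtrationD(1)[OF F t] filtrationD(1)[OF G TT]]
  show sp: "space (sigma (space M) (sets ?F \<union> sets ?G)) = space M"
    using J(1) by (auto simp: subalgebra_def)
  show "null_sets M \<subseteq> sets (sigma (space M) (sets ?F \<union> sets ?G))"
    using J(2) filtrationD(2)[OF F t] by blast
  fix X r assume X: "X \<in> {W, V}" and r: "r \<in> {0..t}"
  have "subalgebra (sigma (space M) (sets ?F \<union> sets ?G)) ?F" "subalgebra (sigma (space M) (sets ?F \<union> sets ?G)) ?G"
    using J sp filtrationD(3)[OF F t] filtrationD(3)[OF G TT] by (auto simp: subalgebra_def)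
  moreover have "W r \<in> borel_measurable ?F" "V r \<in> borel_measurable ?G"
    using r t by (auto intro!: aug_filtration_measurable)
  ultimately show "X r \<in> borel_measurable (sigma (space M) (sets ?F \<union> sets ?G))"
    using X measurable_from_subalg by blast
qed

lemma brownian_full:
  assumes W: "brownian_motion M T W" and V: "brownian_motion M T V" and ind: "independent_processes M T W V"
  shows "brownian_wrt (aug_filtration M {W, V}) W" "brownian_wrt (aug_filtration M {W, V}) V"
proof -
  have *: "brownian_wrt (aug_filtration M {W, V}) W"
    if W: "brownian_motion M T W" and V: "brownian_motion M T V" and ind: "independent_processes M T W V" for W V
  proof (rule brownian_wrt_coarser[OF brownian_enlarged[OF W _ ind]])
    show "V r \<in> borel_measurable M" if "r \<in> {0..T}" for r using V that by (auto simp: brownian_motion_def)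
    then show "filtration (aug_filtration M {W, V})"
      using W by (intro aug_filtration_filtration) (auto simp: brownian_motion_def)
    show "sets (aug_filtration M {W, V} t) \<subseteq> sets (sigma (space M) (sets (aug_filtration M {W} t) \<union> sets (aug_filtration M {V} T)))"
      if "t \<in> {0..T}" for t
      using W V by (intro aug_filtration_pair_subset that) (auto simp: brownian_motion_def)
    show "W t \<in> borel_measurable (aug_filtration M {W, V} t)" if "t \<in> {0..T}" for t
      using that by (intro aug_filtration_measurable) auto
  qed
  show "brownian_wrt (aug_filtration M {W, V}) W" by (rule *[OF W V ind])
  show "brownian_wrt (aug_filtration M {W, V}) V"
    using *[OF V W independent_processes_sym[OF ind]] by (simp add: insert_commute)
qed

end

section \<open>Orthogonality and isometry of Ito integrals\<close>

context finite_horizon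
begin

lemma partition_mono:
  assumes "simple_integrand M T F n p \<xi>" "i \<le> j" "j \<le> n"
  shows "p i \<le> p j"
  using assms(2,3)
proof (induction j rule: dec_induct)
  case (step k)
  then have "p k < p (Suc k)" using assms(1) by (auto simp: simple_integrand_def)
  then show ?case using step by auto
qed simp

lemma partition_range:
  assumes "simple_integrand M T F n p \<xi>" "i \<le> n"
  shows "p i \<in> {0..T}"
  using partition_mono[OF assms(1), of 0 i] partition_mono[OF assms(1), of i n] assms
  by (auto simp: simple_integrand_def)

lemma simple_integrand_bound:
  assumes "simple_integrand M T F n p \<xi>"
  obtains C where "\<And>i w. i < n \<Longrightarrow> w \<in> space M \<Longrightarrow> \<bar>\<xi> i w\<bar> \<le> C"
proof -
  have "\<forall>i. \<exists>C. i < n \<longrightarrow> (\<forall>w\<in>space M. \<bar>\<xi> i w\<bar> \<le> C)"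
    using assms by (auto simp: simple_integrand_def)
  then obtain C where C: "\<And>i w. i < n \<Longrightarrow> w \<in> space M \<Longrightarrow> \<bar>\<xi> i w\<bar> \<le> C i" by metis
  have "\<bar>\<xi> i w\<bar> \<le> (\<Sum>j<n. \<bar>C j\<bar>)" if "i < n" "w \<in> space M" for i w
  proof -
    have "\<bar>\<xi> i w\<bar> \<le> \<bar>C i\<bar>" using C[OF that] by linarith
    also have "\<dots> \<le> (\<Sum>j<n. \<bar>C j\<bar>)" using that by (intro member_le_sum) auto
    finally show ?thesis .
  qed
  then show thesis by (rule that)
qed

lemma simple_integrand_measurable:
  assumes "simple_integrand M T F n p \<xi>" "filtration F" "i < n"
  shows "\<xi> i \<in> borel_measurable (F (p i))" "\<xi> i \<in> borel_measurable M"
  using assms filtrationD(4)[OF assms(2) partition_range[OF assms(1), of i], of "\<xi> i"]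
  by (auto simp: simple_integrand_def)

lemma simple_integral_l2:
  assumes s: "simple_integrand M T F n p \<xi>" and F: "filtration F" 
    and B: "brownian_wrt F' B" and X: "\<And>t. t \<in> {0..T} \<Longrightarrow> X t \<in> borel_measurable M"
    and XB: "\<And>t. t \<in> {0..T} \<Longrightarrow> AE w in M. X t w = B t w" and t: "t \<in> {0..T}"
  shows "l2 (simple_integral X n p \<xi> t)"
proof -
  have inc: "l2 (\<lambda>w. X b w - X a w)" if "a \<in> {0..T}" "b \<in> {0..T}" "a \<le> b" for a b
  proof (rule l2_cong_AE[OF brownian_increment_moments(1)[OF B, of a b]])
    show "AE w in M. B b w - B a w = X b w - X a w"
      using XB[OF that(1)] XB[OF that(2)] by eventually_elim simp
  qed (use that X in auto)
  obtain C where C: "\<And>i w. i < n \<Longrightarrow> w \<in> space M \<Longrightarrow> \<bar>\<xi> i w\<bar> \<le> C"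
    using simple_integrand_bound[OF s] by blast
  have "l2 (\<lambda>w. \<Sum>i<n. \<xi> i w * (X (min (p (Suc i)) t) w - X (min (p i) t) w))"
  proof (rule l2_sum)
    fix i assume i: "i \<in> {..<n}"
    show "l2 (\<lambda>w. \<xi> i w * (X (min (p (Suc i)) t) w - X (min (p i) t) w))"
    proof (rule l2_bounded_mult[OF inc])
      show "\<xi> i \<in> borel_measurable M" using simple_integrand_measurable[OF s F] i by auto
      show "min (p i) t \<le> min (p (Suc i)) t"
        using partition_mono[OF s, of i "Suc i"] i by auto
    qed (use C i t partition_range[OF s, of i] partition_range[OF s, of "Suc i"] in auto)
  qed
  then show ?thesis by (simp add: simple_integral_def[abs_def])
qed

lemma simple_integral_orthogonal:
  assumes s: "simple_integrand M T F n p \<xi>" and F: "filtration F" 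
    and B: "brownian_wrt F' B" and FF': "\<And>t. t \<in> {0..T} \<Longrightarrow> sets (F t) \<subseteq> sets (F' t)"
    and XB: "\<And>t. t \<in> {0..T} \<Longrightarrow> AE w in M. X t w = B t w"
    and X: "\<And>t. t \<in> {0..T} \<Longrightarrow> X t \<in> borel_measurable M" and r: "r \<in> {0..T}"
    and Z: "l2 Z" "Z \<in> borel_measurable (F' r)"
  shows "(\<E> w. (simple_integral X n p \<xi> T w - simple_integral X n p \<xi> r w) * Z w) = 0"
proof -
  obtain C where C: "\<And>i w. i < n \<Longrightarrow> w \<in> space M \<Longrightarrow> \<bar>\<xi> i w\<bar> \<le> C"
    using simple_integrand_bound[OF s] by blast
  note F' = brownian_wrt_filtration[OF B]
  have TT: "T \<in> {0..T}" using T_pos by auto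
  let ?t = "\<lambda>i w. \<xi> i w * Z w * (B (max (p (Suc i)) r) w - B (max (p i) r) w)"
  have 1: "expectation (?t i) = 0" "integrable M (?t i)" if i: "i < n" for i
  proof -
    have pr: "p i \<in> {0..T}" "p (Suc i) \<in> {0..T}" "p i \<le> p (Suc i)"
      using partition_range[OF s, of i] partition_range[OF s, of "Suc i"] partition_mono[OF s, of i "Suc i"] i by auto
    have x: "\<xi> i \<in> borel_measurable (F' (p i))"
      by (rule measurable_from_subalg[OF _ simple_integrand_measurable(1)[OF s F i]])
         (use FF'[OF pr(1)] filtrationD(3)[OF F pr(1)] filtrationD(3)[OF F' pr(1)] in \<open>auto simp: subalgebra_def\<close>)
    have "\<xi> i \<in> borel_measurable (F' (max (p i) r))"
      by (rule filtration_measurable_mono[OF F' _ _ _ x]) (use pr r in auto)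
    moreover have "Z \<in> borel_measurable (F' (max (p i) r))"
      by (rule filtration_measurable_mono[OF F' _ _ _ Z(2)]) (use pr r in auto)
    ultimately have m: "(\<lambda>w. \<xi> i w * Z w) \<in> borel_measurable (F' (max (p i) r))" by auto
    have i: "integrable M (\<lambda>w. \<xi> i w * Z w)"
      using simple_integrand_measurable[OF s F i] C[OF i] by (intro l2_integrable l2_bounded_mult Z(1)) auto
    show "expectation (?t i) = 0" "integrable M (?t i)"
      using brownian_increment_expectation(1,2)[OF B _ _ _ m i, of "max (p (Suc i)) r"] pr r by auto
  qed
  have AE: "AE w in M. (simple_integral X n p \<xi> T w - simple_integral X n p \<xi> r w) * Z w = (\<Sum>i<n. ?t i w)"
  proof -
    have "AE w in M. \<forall>i\<in>{..n}. X (p i) w = B (p i) w"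
      using XB partition_range[OF s] by (intro AE_finite_allI) auto
    with XB[OF r] show ?thesis
    proof eventually_elim
      case (elim w)
      have "\<xi> i w * (X (min (p (Suc i)) T) w - X (min (p i) T) w) - \<xi> i w * (X (min (p (Suc i)) r) w - X (min (p i) r) w)
        = \<xi> i w * (B (max (p (Suc i)) r) w - B (max (p i) r) w)" if i: "i < n" for i
      proof -
        have pr: "p i \<in> {0..T}" "p (Suc i) \<in> {0..T}" "p i \<le> p (Suc i)"
          using partition_range[OF s, of i] partition_range[OF s, of "Suc i"] partition_mono[OF s, of i "Suc i"] i by auto
        have e: "X (p i) w = B (p i) w" "X (p (Suc i)) w = B (p (Suc i)) w" using elim i by auto
        have m: "min (p i) T = p i" "min (p (Suc i)) T = p (Suc i)" using pr by auto
        consider "p (Suc i) \<le> r" | "p i \<le> r" "r < p (Suc i)" | "r < p i" by linarith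
        then show ?thesis
          unfolding m by cases (use pr elim e in \<open>auto simp: min_def max_def right_diff_distrib\<close>)
      qed
      then have "simple_integral X n p \<xi> T w - simple_integral X n p \<xi> r w =
         (\<Sum>i<n. \<xi> i w * (B (max (p (Suc i)) r) w - B (max (p i) r) w))"
        unfolding simple_integral_def sum_subtractf[symmetric] by (intro sum.cong) auto
      then show ?case by (simp only: sum_distrib_right) (intro sum.cong refl, simp)
    qed
  qed
  have mX: "(\<lambda>w. (simple_integral X n p \<xi> T w - simple_integral X n p \<xi> r w) * Z w) \<in> borel_measurable M"
    using simple_integral_l2[OF s F B X XB TT] simple_integral_l2[OF s F B X XB r] Z(1) by (auto simp: l2_def)
  have "(\<E> w. (simple_integral X n p \<xi> T w - simple_integral X n p \<xi> r w) * Z w) = (\<E> w. \<Sum>i<n. ?t i w)"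
    by (rule integral_cong_AE[OF mX _ AE]) (auto intro!: borel_measurable_sum borel_measurable_integrable 1)
  also have "\<dots> = (\<Sum>i<n. expectation (?t i))"
    using 1 by (intro Bochner_Integration.integral_sum) auto
  also have "\<dots> = 0" using 1 by simp
  finally show ?thesis .
qed

lemma nn_limit_l2:
  assumes S: "\<And>k::nat. S k \<in> borel_measurable M" and I: "I \<in> borel_measurable M"
    and lim: "(\<lambda>k. \<integral>\<^sup>+w. ennreal ((S k w - I w)\<^sup>2) \<partial>M) \<longlonglongrightarrow> 0"
  shows "\<forall>\<^sub>F k in sequentially. l2 (\<lambda>w. S k w - I w)"
    "(\<lambda>k. (\<E> w. (S k w - I w)\<^sup>2)) \<longlonglongrightarrow> 0"
proof -
  have "\<forall>\<^sub>F k in sequentially. (\<integral>\<^sup>+w. ennreal ((S k w - I w)\<^sup>2) \<partial>M) < 1"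
    using order_tendstoD(2)[OF lim, of 1] by simp
  then show "\<forall>\<^sub>F k in sequentially. l2 (\<lambda>w. S k w - I w)"
  proof eventually_elim
    case (elim k)
    have "integrable M (\<lambda>w. (S k w - I w)\<^sup>2)"
    proof (rule integrableI_bounded)
      show "(\<lambda>w. (S k w - I w)\<^sup>2) \<in> borel_measurable M" using S I by auto
      show "(\<integral>\<^sup>+w. ennreal (norm ((S k w - I w)\<^sup>2)) \<partial>M) < \<infinity>"
        using elim by (simp add: less_top order.strict_trans)
    qed
    then show ?case using S I by (auto simp: l2_def)
  qed
  have "(\<E> w. (S k w - I w)\<^sup>2) = enn2real (\<integral>\<^sup>+w. ennreal ((S k w - I w)\<^sup>2) \<partial>M)" for k
    using S I by (intro integral_eq_nn_integral) auto
  then show "(\<lambda>k. (\<E> w. (S k w - I w)\<^sup>2)) \<longlonglongrightarrow> 0"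
    using tendsto_enn2real[of _ 0 sequentially] lim by (simp add: zero_ennreal_def[symmetric])
qed

lemma nn_le_sup_limit:
  assumes lim: "(\<lambda>k. \<integral>\<^sup>+w. (\<Squnion>t\<in>{0..T}. ennreal ((f k t w)\<^sup>2)) \<partial>M) \<longlonglongrightarrow> 0" and t: "t \<in> {0..T}"
  shows "(\<lambda>k. \<integral>\<^sup>+w. ennreal ((f k t w)\<^sup>2) \<partial>M) \<longlonglongrightarrow> 0"
proof (rule tendsto_sandwich[OF _ _ tendsto_const lim])
  show "\<forall>\<^sub>F k in sequentially. (\<integral>\<^sup>+w. ennreal ((f k t w)\<^sup>2) \<partial>M) \<le> (\<integral>\<^sup>+w. (\<Squnion>t\<in>{0..T}. ennreal ((f k t w)\<^sup>2)) \<partial>M)"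
    using t by (intro always_eventually allI nn_integral_mono SUP_upper) auto
qed simp

lemma ito_integral_measurable:
  assumes "ito_integral M T F X H I" "filtration F" "t \<in> {0..T}"
  shows "I t \<in> borel_measurable (F t)" "I t \<in> borel_measurable M"
  using assms filtrationD(4)[OF assms(2,3), of "I t"] by (auto simp: ito_integral_def adapted_process_def)

lemma ito_integral_approx:
  assumes I: "ito_integral M T F X H I" and F: "filtration F"
    and B: "brownian_wrt F' B" 
    and XB: "\<And>t. t \<in> {0..T} \<Longrightarrow> AE w in M. X t w = B t w"
    and X: "\<And>t. t \<in> {0..T} \<Longrightarrow> X t \<in> borel_measurable M"
  shows "\<exists>n p \<xi>. (\<forall>k::nat. simple_integrand M T F (n k) (p k) (\<xi> k)) \<and>
    (\<lambda>k. \<integral>\<^sup>+w. (\<integral>\<^sup>+t\<in>{0..T}.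
            ennreal ((simple_value (n k) (p k) (\<xi> k) t w - H t w)\<^sup>2) \<partial>lborel) \<partial>M) \<longlonglongrightarrow> 0 \<and>
    (\<forall>k. \<forall>t\<in>{0..T}. l2 (simple_integral X (n k) (p k) (\<xi> k) t)) \<and>
    (\<forall>t\<in>{0..T}. l2 (I t)) \<and>
    (\<forall>t\<in>{0..T}. (\<lambda>k. (\<E> w. (simple_integral X (n k) (p k) (\<xi> k) t w - I t w)\<^sup>2)) \<longlonglongrightarrow> 0)"
proof -
  obtain n p \<xi> where a: "\<And>k::nat. simple_integrand M T F (n k) (p k) (\<xi> k)"
    "(\<lambda>k. \<integral>\<^sup>+w. (\<integral>\<^sup>+t\<in>{0..T}.
            ennreal ((simple_value (n k) (p k) (\<xi> k) t w - H t w)\<^sup>2) \<partial>lborel) \<partial>M) \<longlonglongrightarrow> 0"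
    "(\<lambda>k. \<integral>\<^sup>+w. (\<Squnion>t\<in>{0..T}.
            ennreal ((simple_integral X (n k) (p k) (\<xi> k) t w - I t w)\<^sup>2)) \<partial>M) \<longlonglongrightarrow> 0"
    using I unfolding ito_integral_def by blast
  have l: "l2 (simple_integral X (n k) (p k) (\<xi> k) t)" if "t \<in> {0..T}" for k t
    by (rule simple_integral_l2[OF a(1) F B X XB that])
  have nn: "(\<lambda>k. \<integral>\<^sup>+w. ennreal ((simple_integral X (n k) (p k) (\<xi> k) t w - I t w)\<^sup>2) \<partial>M) \<longlonglongrightarrow> 0"
    if "t \<in> {0..T}" for t
    using nn_le_sup_limit[OF a(3) that] .
  have m: "simple_integral X (n k) (p k) (\<xi> k) t \<in> borel_measurable M" if "t \<in> {0..T}" for k t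
    using l[OF that] by (simp add: l2_def)
  note L = nn_limit_l2[OF m ito_integral_measurable(2)[OF I F] nn]
  have "l2 (I t)" if t: "t \<in> {0..T}" for t
  proof -
    obtain k where "l2 (\<lambda>w. simple_integral X (n k) (p k) (\<xi> k) t w - I t w)"
      using eventually_happens[OF L(1)[OF t t t]] by auto
    from l2_diff[OF l[OF t, of k] this] show ?thesis by simp
  qed
  with a l L(2) show ?thesis by blast
qed

text \<open>
  The integral may be formed with a process \<open>X\<close> that agrees with a Brownian motion only up to
  modification, and with a filtration \<open>F\<close> smaller than that of the Brownian motion. This covers the
  integrals with respect to the innovation, whose integrands are adapted to an observation.
\<close>

lemma ito_integral_orthogonal:
  assumes I: "ito_integral M T F X H I" and F: "filtration F" and FF': "\<And>t. t \<in> {0..T} \<Longrightarrow> sets (F t) \<subseteq> sets (F' t)"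
    and B: "brownian_wrt F' B" 
    and XB: "\<And>t. t \<in> {0..T} \<Longrightarrow> AE w in M. X t w = B t w"
    and X: "\<And>t. t \<in> {0..T} \<Longrightarrow> X t \<in> borel_measurable M"
    and r: "r \<in> {0..T}" and Z: "l2 Z" "Z \<in> borel_measurable (F' r)"
  shows "(\<E> w. (I T w - I r w) * Z w) = 0"
proof -
  have TT: "T \<in> {0..T}" using T_pos by auto
  obtain n p \<xi> where a: "\<And>k::nat. simple_integrand M T F (n k) (p k) (\<xi> k)"
    and "(\<lambda>k. \<integral>\<^sup>+w. (\<integral>\<^sup>+t\<in>{0..T}.
            ennreal ((simple_value (n k) (p k) (\<xi> k) t w - H t w)\<^sup>2) \<partial>lborel) \<partial>M) \<longlonglongrightarrow> 0"
    and b: "\<And>k t. t \<in> {0..T} \<Longrightarrow> l2 (simple_integral X (n k) (p k) (\<xi> k) t)"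
    "\<And>t. t \<in> {0..T} \<Longrightarrow> l2 (I t)"
    "\<And>t. t \<in> {0..T} \<Longrightarrow> (\<lambda>k. (\<E> w. (simple_integral X (n k) (p k) (\<xi> k) t w - I t w)\<^sup>2)) \<longlonglongrightarrow> 0"
    using ito_integral_approx[OF I F B XB X] by blast
  define S where "S k t = simple_integral X (n k) (p k) (\<xi> k) t" for k t
  have ls: "l2 (S k t)" if "t \<in> {0..T}" for k t using b(1)[OF that] by (simp add: S_def)
  have e0: "(\<lambda>k. (\<E> w. (S k t w - I t w) * Z w)) \<longlonglongrightarrow> 0" if t: "t \<in> {0..T}" for t
  proof -
    have le: "((\<E> w. (S k t w - I t w) * Z w))\<^sup>2 \<le> (\<E> w. (S k t w - I t w)\<^sup>2) * (\<E> w. (Z w)\<^sup>2)" for k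
      by (rule l2_cauchy_schwarz[OF l2_diff[OF ls[OF t] b(2)[OF t]] Z(1)])
    have "(\<lambda>k. (\<E> w. (S k t w - I t w)\<^sup>2) * (\<E> w. (Z w)\<^sup>2)) \<longlonglongrightarrow> 0"
      unfolding S_def by (rule tendsto_mult_left_zero[OF b(3)[OF t]])
    then have "(\<lambda>k. ((\<E> w. (S k t w - I t w) * Z w))\<^sup>2) \<longlonglongrightarrow> 0"
      by (rule Lim_null_comparison[rotated]) (use le in simp)
    then show ?thesis by (simp only: power_tendsto_0_iff zero_less_numeral)
  qed
  have "(\<E> w. (S k T w - S k r w) * Z w) = 0" for k
    unfolding S_def by (rule simple_integral_orthogonal[OF a F B FF' XB X r Z])
  then have "(\<E> w. (I T w - I r w) * Z w) = (\<E> w. (S k r w - I r w) * Z w) - (\<E> w. (S k T w - I T w) * Z w)" for k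
  proof -
    note l = l2_mult_integrable[OF ls[OF TT, of k] Z(1)] l2_mult_integrable[OF ls[OF r, of k] Z(1)]
      l2_mult_integrable[OF b(2)[OF TT] Z(1)] l2_mult_integrable[OF b(2)[OF r] Z(1)]
    show ?thesis using \<open>(\<E> w. (S k T w - S k r w) * Z w) = 0\<close> l
      by (simp add: left_diff_distrib)
  qed
  moreover have "(\<lambda>k. (\<E> w. (S k r w - I r w) * Z w) - (\<E> w. (S k T w - I T w) * Z w)) \<longlonglongrightarrow> 0"
    using tendsto_diff[OF e0[OF r] e0[OF TT]] by simp
  ultimately have "(\<lambda>k::nat. (\<E> w. (I T w - I r w) * Z w)) \<longlonglongrightarrow> 0" by simp
  then show ?thesis by (simp add: LIMSEQ_const_iff)
qed


text \<open>
  Cut at the common points: an increment over an interval that starts later is orthogonal to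
  everything known at its beginning, and only the overlap of the two intervals contributes.
\<close>

lemma brownian_two_increments_aux:
  assumes B: "brownian_wrt F B" and ab: "0 \<le> a" "a \<le> b" "b \<le> T" and cd: "a \<le> c" "c \<le> d" "d \<le> T"
    and x: "a < b \<Longrightarrow> x \<in> borel_measurable (F a)" "x \<in> borel_measurable M" "\<And>w. w \<in> space M \<Longrightarrow> \<bar>x w\<bar> \<le> C"
    and y: "c < d \<Longrightarrow> y \<in> borel_measurable (F c)" "y \<in> borel_measurable M" "\<And>w. w \<in> space M \<Longrightarrow> \<bar>y w\<bar> \<le> D"
  shows "(\<E> w. x w * (B b w - B a w) * (y w * (B d w - B c w)))
      = (\<E> w. x w * y w) * max 0 (min b d - max a c)"
proof (cases "a < b \<and> c < d")
  case False
  then show ?thesis using ab cd by auto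
next
  case True
  note F = brownian_wrt_filtration[OF B]
  have xa: "x \<in> borel_measurable (F a)" and yc: "y \<in> borel_measurable (F c)" using x y True by auto
  have xc: "x \<in> borel_measurable (F c)" by (rule filtration_measurable_mono[OF F _ _ _ xa]) (use ab cd in auto)
  have xy: "(\<lambda>w. x w * y w) \<in> borel_measurable (F c)" using xc yc by auto
  have xyb: "\<bar>x w * y w\<bar> \<le> C * D" if "w \<in> space M" for w
    using x(3)[OF that] y(3)[OF that] by (auto simp: abs_mult intro!: mult_mono)
  have lxy: "l2 (\<lambda>w. x w * y w * f w)" if "l2 f" for f
    by (rule l2_bounded_mult[OF that _ xyb]) (use x y in auto)
  have Bad: "B t \<in> borel_measurable (F u)" if "t \<in> {0..T}" "t \<le> u" "u \<le> T" for t u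
    by (rule filtration_measurable_mono[OF F _ _ _ brownian_wrt_adapted(1)[OF B that(1)]]) (use that in auto)
  let ?e = "min b d" and ?m = "min b c"
  note inc = brownian_increment_moments(1)[OF B]
  let ?A = "\<lambda>w. x w * y w * (B ?m w - B a w)"
  have A: "(\<E> w. ?A w * (B d w - B c w)) = 0" "integrable M (\<lambda>w. ?A w * (B d w - B c w))"
  proof -
    have "?A \<in> borel_measurable (F c)" using xy Bad[of ?m c] Bad[of a c] ab cd by auto
    moreover have "integrable M ?A" by (rule l2_integrable[OF lxy[OF inc]]) (use ab cd in auto)
    ultimately show "(\<E> w. ?A w * (B d w - B c w)) = 0" "integrable M (\<lambda>w. ?A w * (B d w - B c w))"
      using brownian_increment_expectation(1,2)[OF B, of c d] ab cd by auto
  qed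
  show ?thesis
  proof (cases "c < b")
    case False
    then have "?m = b" "max 0 (?e - max a c) = 0" using ab cd by auto
    then show ?thesis using A(1) by (simp add: mult_ac)
  next
    case cb: True
    then have m: "?m = c" by auto
    let ?Q = "\<lambda>w. x w * y w * (B ?e w - B c w)\<^sup>2"
    have Q: "expectation ?Q = (\<E> w. x w * y w) * (?e - c)" "integrable M ?Q"
    proof -
      have "integrable M (\<lambda>w. x w * y w)" using l2_integrable[OF lxy[OF l2_const, of 1]] by simp
      then show "expectation ?Q = (\<E> w. x w * y w) * (?e - c)" "integrable M ?Q"
        using brownian_increment_expectation(3,4)[OF B, of c ?e] xy ab cd cb by auto
    qed
    let ?R = "\<lambda>w. x w * y w * (B ?e w - B c w)"
    have eR: "(\<E> w. ?R w * (B u w - B ?e w)) = 0" "integrable M (\<lambda>w. ?R w * (B u w - B ?e w))"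
      if u: "?e \<le> u" "u \<le> T" for u
    proof -
      have "x \<in> borel_measurable (F ?e)" "y \<in> borel_measurable (F ?e)"
        using filtration_measurable_mono[OF F _ _ _ xc, of ?e] filtration_measurable_mono[OF F _ _ _ yc, of ?e] ab cd cb by auto
      then have "?R \<in> borel_measurable (F ?e)" using Bad[of ?e ?e] Bad[of c ?e] ab cd cb by auto
      moreover have "integrable M ?R" by (rule l2_integrable[OF lxy[OF inc]]) (use ab cd cb in auto)
      ultimately show "(\<E> w. ?R w * (B u w - B ?e w)) = 0" "integrable M (\<lambda>w. ?R w * (B u w - B ?e w))"
        using brownian_increment_expectation(1,2)[OF B _ _ u(2), of ?e] ab cd u by auto
    qed
    have "x w * (B b w - B a w) * (y w * (B d w - B c w)) =
       ?A w * (B d w - B c w) + (?Q w + (?R w * (B b w - B ?e w) + ?R w * (B d w - B ?e w)))" for w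
    proof (cases "b \<le> d")
      case True
      then have "?e = b" by auto
      then show ?thesis unfolding m by (simp add: power2_eq_square algebra_simps)
    next
      case False
      then have "?e = d" by auto
      then show ?thesis unfolding m by (simp add: power2_eq_square algebra_simps)
    qed
    then have "(\<E> w. x w * (B b w - B a w) * (y w * (B d w - B c w))) =
       (\<E> w. ?A w * (B d w - B c w)) + (expectation ?Q + ((\<E> w. ?R w * (B b w - B ?e w))
         + (\<E> w. ?R w * (B d w - B ?e w))))"
      using A(2) Q(2) eR(2)[of b] eR(2)[of d] ab cd by simp
    also have "\<dots> = (\<E> w. x w * y w) * (?e - c)"
      using A(1) Q(1) eR(1)[of b] eR(1)[of d] ab cd by simp
    also have "?e - c = max 0 (min b d - max a c)" using ab cd cb True by auto
    finally show ?thesis .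
  qed
qed

lemma brownian_two_increments:
  assumes B: "brownian_wrt F B" and ab: "0 \<le> a" "a \<le> b" "b \<le> T" and cd: "0 \<le> c" "c \<le> d" "d \<le> T"
    and x: "a < b \<Longrightarrow> x \<in> borel_measurable (F a)" "x \<in> borel_measurable M" "\<And>w. w \<in> space M \<Longrightarrow> \<bar>x w\<bar> \<le> C"
    and y: "c < d \<Longrightarrow> y \<in> borel_measurable (F c)" "y \<in> borel_measurable M" "\<And>w. w \<in> space M \<Longrightarrow> \<bar>y w\<bar> \<le> D"
  shows "(\<E> w. x w * (B b w - B a w) * (y w * (B d w - B c w)))
      = (\<E> w. x w * y w) * max 0 (min b d - max a c)"
proof (cases "a \<le> c")
  case True
  show ?thesis by (rule brownian_two_increments_aux[OF B ab True cd(2,3) x y])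
next
  case False
  then have ca: "c \<le> a" by simp
  show ?thesis
    using brownian_two_increments_aux[OF B cd ca ab(2,3) y x]
    by (simp add: mult.commute min.commute max.commute)
qed

lemma LBINT_indicator_product:
  fixes a b c d :: real
  shows "(LBINT s. indicator {a<..b} s * indicator {c<..d} s) = max 0 (min b d - max a c)"
    "integrable lborel (\<lambda>s. indicat_real {a<..b} s * indicator {c<..d} s)"
proof -
  have *: "(\<lambda>s. indicat_real {a<..b} s * indicator {c<..d} s) = indicator {max a c<..min b d}"
    by (auto simp: fun_eq_iff indicator_def)
  show "(LBINT s. indicator {a<..b} s * indicator {c<..d} s) = max 0 (min b d - max a c)"
    unfolding * by (cases "max a c \<le> min b d") (auto simp: max_def)
  show "integrable lborel (\<lambda>s. indicat_real {a<..b} s * indicator {c<..d} s)"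
    unfolding * by (cases "max a c \<le> min b d") auto
qed

text \<open>
  The intervals of the finitely many terms may overlap, so that differences of simple integrals
  over different partitions are covered without a common refinement.
\<close>

lemma isometry:
  assumes B: "brownian_wrt F B" and J: "finite J"
    and ab: "\<And>j. j \<in> J \<Longrightarrow> 0 \<le> a j \<and> a j \<le> b j \<and> b j \<le> T"
    and x: "\<And>j. j \<in> J \<Longrightarrow> a j < b j \<Longrightarrow> x j \<in> borel_measurable (F (a j))"
       "\<And>j. j \<in> J \<Longrightarrow> x j \<in> borel_measurable M" "\<And>j w. j \<in> J \<Longrightarrow> w \<in> space M \<Longrightarrow> \<bar>x j w\<bar> \<le> C"
  shows "(\<E> w. (\<Sum>j\<in>J. x j w * (B (b j) w - B (a j) w))\<^sup>2)
    = (\<E> w. LBINT s. (\<Sum>j\<in>J. x j w * indicator {a j<..b j} s)\<^sup>2)"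
    "integrable M (\<lambda>w. LBINT s. (\<Sum>j\<in>J. x j w * indicator {a j<..b j} s)\<^sup>2)"
proof -
  let ?ov = "\<lambda>i j. max 0 (min (b i) (b j) - max (a i) (a j))"
  have l: "l2 (\<lambda>w. x j w * (B (b j) w - B (a j) w))" if "j \<in> J" for j
    by (rule l2_bounded_mult[OF brownian_increment_moments(1)[OF B] x(2)[OF that] x(3)[OF that]])
       (use ab[OF that] in auto)
  have lx: "l2 (x j)" if "j \<in> J" for j by (rule l2_bounded[OF x(2)[OF that] x(3)[OF that]])
  have "(\<E> w. (\<Sum>j\<in>J. x j w * (B (b j) w - B (a j) w))\<^sup>2) =
    (\<E> w. \<Sum>i\<in>J. \<Sum>j\<in>J. x i w * (B (b i) w - B (a i) w) * (x j w * (B (b j) w - B (a j) w)))"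
    by (simp add: power2_eq_square sum_product)
  also have "\<dots> = (\<Sum>i\<in>J. \<Sum>j\<in>J. (\<E> w. x i w * (B (b i) w - B (a i) w) * (x j w * (B (b j) w - B (a j) w))))"
    by (subst Bochner_Integration.integral_sum; (intro Bochner_Integration.integrable_sum l2_mult_integrable l)?; assumption?)
       (intro sum.cong refl Bochner_Integration.integral_sum l2_mult_integrable l; assumption)
  also have "\<dots> = (\<Sum>i\<in>J. \<Sum>j\<in>J. (\<E> w. x i w * x j w) * ?ov i j)"
    using ab x by (intro sum.cong refl brownian_two_increments[OF B, where C=C and D=C]) auto
  finally have 1: "(\<E> w. (\<Sum>j\<in>J. x j w * (B (b j) w - B (a j) w))\<^sup>2) = \<dots>" .
  have in2: "(LBINT s. (\<Sum>j\<in>J. x j w * indicator {a j<..b j} s)\<^sup>2) = (\<Sum>i\<in>J. \<Sum>j\<in>J. (x i w * x j w) * ?ov i j)" for w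
  proof -
    have "(\<Sum>j\<in>J. x j w * indicator {a j<..b j} s)\<^sup>2 = 
      (\<Sum>i\<in>J. \<Sum>j\<in>J. (x i w * x j w) * (indicator {a i<..b i} s * indicator {a j<..b j} s))" for s
      by (simp add: power2_eq_square sum_product mult_ac)
    then show ?thesis using LBINT_indicator_product
      by (simp add: Bochner_Integration.integral_sum)
  qed
  have ixx: "integrable M (\<lambda>w. (x i w * x j w) * ?ov i j)" if "i \<in> J" "j \<in> J" for i j
    using l2_mult_integrable[OF lx[OF that(1)] lx[OF that(2)]] by simp
  show 2: "integrable M (\<lambda>w. LBINT s. (\<Sum>j\<in>J. x j w * indicator {a j<..b j} s)\<^sup>2)"
    unfolding in2 by (intro Bochner_Integration.integrable_sum ixx)
  have "(\<E> w. LBINT s. (\<Sum>j\<in>J. x j w * indicator {a j<..b j} s)\<^sup>2) = (\<Sum>i\<in>J. \<Sum>j\<in>J. (\<E> w. x i w * x j w) * ?ov i j)"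
    unfolding in2
    by (subst Bochner_Integration.integral_sum; (intro Bochner_Integration.integrable_sum ixx)?; assumption?)
       (intro sum.cong refl trans[OF Bochner_Integration.integral_sum] ixx; simp)
  with 1 show "(\<E> w. (\<Sum>j\<in>J. x j w * (B (b j) w - B (a j) w))\<^sup>2)
    = (\<E> w. LBINT s. (\<Sum>j\<in>J. x j w * indicator {a j<..b j} s)\<^sup>2)" by simp
qed

end

section \<open>Uniqueness of Ito integrals\<close>

context finite_horizon
begin

lemma adapted_process_joint:
  assumes "adapted_process M T F X"
  shows "(\<lambda>(t, w). X t w) \<in> borel_measurable (TM \<Otimes>\<^sub>M M)"
proof -
  have "sets (TM \<Otimes>\<^sub>M M) = sets (restrict_space borel {0..T} \<Otimes>\<^sub>M M)"
    by (rule sets_pair_measure_cong[OF sets_TM refl])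
  then show ?thesis using assms unfolding adapted_process_def
    by (simp cong: measurable_cong_sets)
qed

lemma nn_integral_TM:
  "(\<integral>\<^sup>+t\<in>{0..T}. f t \<partial>lborel) = (\<integral>\<^sup>+t. f t \<partial>TM)"
  by (subst nn_integral_restrict_space) auto

lemma joint_section:
  assumes "(\<lambda>(t, w). f t w) \<in> measurable (TM \<Otimes>\<^sub>M M) N" "w \<in> space M"
  shows "(\<lambda>t. f t w) \<in> measurable TM N"
proof -
  have "(\<lambda>t. (\<lambda>(t, w). f t w) (t, w)) \<in> measurable TM N"
    using assms by (intro measurable_compose[OF measurable_Pair2']) auto
  then show ?thesis by simp
qed

lemma joint_nn_integral_measurable:
  assumes "(\<lambda>(t, w). f t w) \<in> borel_measurable (TM \<Otimes>\<^sub>M M)"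
  shows "(\<lambda>w. \<integral>\<^sup>+t. f t w \<partial>TM) \<in> borel_measurable M"
proof (rule TM.borel_measurable_nn_integral)
  have "(\<lambda>(w, t). (t, w)) \<in> M \<Otimes>\<^sub>M TM \<rightarrow>\<^sub>M TM \<Otimes>\<^sub>M M" by measurable
  from measurable_compose[OF this assms]
  show "case_prod (\<lambda>w t. f t w) \<in> borel_measurable (M \<Otimes>\<^sub>M TM)"
    by (simp add: case_prod_unfold)
qed

lemma simple_value_joint:
  assumes "simple_integrand M T F n p \<xi>" "filtration F"
  shows "(\<lambda>(t, w). simple_value n p \<xi> t w) \<in> borel_measurable (TM \<Otimes>\<^sub>M M)"
  unfolding simple_value_def case_prod_unfold
proof (intro borel_measurable_sum borel_measurable_times)
  fix i assume "i \<in> {..<n}"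
  then have [measurable]: "\<xi> i \<in> borel_measurable M"
    using simple_integrand_measurable(2)[OF assms] by auto
  show "(\<lambda>p. \<xi> i (snd p)) \<in> borel_measurable (TM \<Otimes>\<^sub>M M)" by measurable
  have "indicat_real {p i<..p (Suc i)} \<in> borel_measurable TM"
    by (intro measurable_restrict_space1) auto
  then show "(\<lambda>x. indicat_real {p i<..p (Suc i)} (fst x)) \<in> borel_measurable (TM \<Otimes>\<^sub>M M)"
    by (rule measurable_compose[OF measurable_fst])
qed

lemma ennreal_square_diff_le:
  "ennreal ((a - b)\<^sup>2) \<le> 2 * ennreal ((a - c)\<^sup>2) + 2 * ennreal ((b - c)\<^sup>2)"
proof -
  have "(a - b)\<^sup>2 \<le> 2 * (a - c)\<^sup>2 + 2 * (b - c)\<^sup>2"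
    using square_sum_le[of "a - c" "c - b"] by (simp add: power2_commute[of c b])
  then have "ennreal ((a - b)\<^sup>2) \<le> ennreal (2 * (a - c)\<^sup>2 + 2 * (b - c)\<^sup>2)"
    by (rule ennreal_leI)
  then show ?thesis by (simp add: ennreal_mult')
qed

text \<open>
  By the isometry the distance of two simple integrals is that of their integrands, and these are
  compared through \<open>H\<close>.
\<close>

lemma simple_integral_distance:
  assumes B: "brownian_wrt F B" and s: "simple_integrand M T F n p x" and s': "simple_integrand M T F m q y"
    and t: "t \<in> {0..T}" and H: "adapted_process M T F H"
  shows "ennreal ((\<E> w. (simple_integral B n p x t w - simple_integral B m q y t w)\<^sup>2))
    \<le> 2 * (\<integral>\<^sup>+w. (\<integral>\<^sup>+t\<in>{0..T}. ennreal ((simple_value n p x t w - H t w)\<^sup>2) \<partial>lborel) \<partial>M)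
     + 2 * (\<integral>\<^sup>+w. (\<integral>\<^sup>+t\<in>{0..T}. ennreal ((simple_value m q y t w - H t w)\<^sup>2) \<partial>lborel) \<partial>M)"
proof -
  note F = brownian_wrt_filtration[OF B]
  define J where "J = {..<n} <+> {..<m}"
  define a where "a = case_sum (\<lambda>i. min (p i) t) (\<lambda>i. min (q i) t)"
  define b where "b = case_sum (\<lambda>i. min (p (Suc i)) t) (\<lambda>i. min (q (Suc i)) t)"
  define z where "z = case_sum x (\<lambda>i w. - y i w)"
  obtain C where C: "\<And>i w. i < n \<Longrightarrow> w \<in> space M \<Longrightarrow> \<bar>x i w\<bar> \<le> C"
    using simple_integrand_bound[OF s] by blast
  obtain D where D: "\<And>i w. i < m \<Longrightarrow> w \<in> space M \<Longrightarrow> \<bar>y i w\<bar> \<le> D"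
    using simple_integrand_bound[OF s'] by blast
  have J: "finite J" by (simp add: J_def)
  have sumJ: "(\<Sum>j\<in>J. f j) = (\<Sum>i<n. f (Inl i)) + (\<Sum>i<m. f (Inr i))" for f :: "nat + nat \<Rightarrow> real"
    unfolding J_def by (subst sum.Plus) (auto simp: comp_def)
  have ab: "0 \<le> a j \<and> a j \<le> b j \<and> b j \<le> T" if "j \<in> J" for j
  proof (cases j)
    case (Inl i)
    with that have "i < n" by (auto simp: J_def)
    then show ?thesis
      using Inl t partition_range[OF s, of i] partition_range[OF s, of "Suc i"] partition_mono[OF s, of i "Suc i"]
      by (auto simp: a_def b_def)
  next
    case (Inr i)
    with that have "i < m" by (auto simp: J_def)
    then show ?thesis
      using Inr t partition_range[OF s', of i] partition_range[OF s', of "Suc i"] partition_mono[OF s', of i "Suc i"]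
      by (auto simp: a_def b_def)
  qed
  have zF: "z j \<in> borel_measurable (F (a j))" if j: "j \<in> J" "a j < b j" for j
  proof (cases j)
    case (Inl i)
    then have "a j = p i" "i < n" using j by (auto simp: a_def b_def J_def min_def split: if_splits)
    then show ?thesis using simple_integrand_measurable(1)[OF s F] Inl by (simp add: z_def)
  next
    case (Inr i)
    then have "a j = q i" "i < m" using j by (auto simp: a_def b_def J_def min_def split: if_splits)
    then show ?thesis using simple_integrand_measurable(1)[OF s' F, of i] Inr by (simp add: z_def)
  qed
  have zM: "z j \<in> borel_measurable M" if j: "j \<in> J" for j
    using j simple_integrand_measurable(2)[OF s F] simple_integrand_measurable(2)[OF s' F]
    by (auto simp: J_def z_def)
  have zC: "\<bar>z j w\<bar> \<le> max C D" if j: "j \<in> J" "w \<in> space M" for j w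
    using j C D by (auto simp: J_def z_def le_max_iff_disj)
  have S: "simple_integral B n p x t w - simple_integral B m q y t w = (\<Sum>j\<in>J. z j w * (B (b j) w - B (a j) w))" for w
    by (simp add: sumJ simple_integral_def a_def b_def z_def sum_negf)
  let ?V = "\<lambda>w s. (\<Sum>j\<in>J. z j w * indicator {a j<..b j} s)\<^sup>2"
  let ?vx = "\<lambda>t w. ennreal ((simple_value n p x t w - H t w)\<^sup>2)"
  let ?vy = "\<lambda>t w. ennreal ((simple_value m q y t w - H t w)\<^sup>2)"
  have Vle: "ennreal (?V w s) \<le> (2 * ?vx s w + 2 * ?vy s w) * indicator {0..T} s" for w s
  proof -
    have ind: "indicat_real {min u t<..min v t} s = indicator {u<..v} s * indicator {..t} s" for u v :: real
      by (auto simp: indicator_def min_def)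
    have "(\<Sum>j\<in>J. z j w * indicator {a j<..b j} s) = (simple_value n p x s w - simple_value m q y s w) * indicator {..t} s"
      unfolding sumJ z_def a_def b_def sum.case ind
      by (simp only: simple_value_def ring_distribs sum_distrib_right mult.assoc minus_mult_left[symmetric]
          sum_negf add_uminus_conv_diff)
    then have eq: "?V w s = (simple_value n p x s w - simple_value m q y s w)\<^sup>2 * indicator {..t} s"
      by (simp add: power_mult_distrib indicator_def)
    show ?thesis
    proof (cases "s \<in> {0..T}")
      case True
      have "?V w s \<le> (simple_value n p x s w - simple_value m q y s w)\<^sup>2" unfolding eq by (auto simp: indicator_def)
      then have "ennreal (?V w s) \<le> ennreal ((simple_value n p x s w - simple_value m q y s w)\<^sup>2)" by (rule ennreal_leI)
      also have "\<dots> \<le> 2 * ?vx s w + 2 * ?vy s w" by (rule ennreal_square_diff_le)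
      finally show ?thesis using True by simp
    next
      case False
      have "z j w * indicator {a j<..b j} s = 0" if "j \<in> J" for j
        using False ab[OF that] by (auto simp: indicator_def)
      then have "(\<Sum>j\<in>J. z j w * indicator {a j<..b j} s) = 0" by (intro sum.neutral) auto
      then show ?thesis by simp
    qed
  qed
  have jx: "(\<lambda>(t, w). ?vx t w) \<in> borel_measurable (TM \<Otimes>\<^sub>M M)" "(\<lambda>(t, w). ?vy t w) \<in> borel_measurable (TM \<Otimes>\<^sub>M M)"
    using simple_value_joint[OF s F] simple_value_joint[OF s' F] adapted_process_joint[OF H]
    by (simp_all add: case_prod_unfold)
  have iV: "integrable lborel (?V w)" for w
  proof -
    have "?V w s = (\<Sum>i\<in>J. \<Sum>j\<in>J. (z i w * z j w) * (indicator {a i<..b i} s * indicator {a j<..b j} s))" for s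
      by (simp add: power2_eq_square sum_product mult_ac)
    moreover have "integrable lborel (\<lambda>s. \<Sum>i\<in>J. \<Sum>j\<in>J. (z i w * z j w) * (indicator {a i<..b i} s * indicator {a j<..b j} s))"
      by (intro Bochner_Integration.integrable_sum integrable_mult_right LBINT_indicator_product(2))
    ultimately show ?thesis by simp
  qed
  note iso = isometry[OF B J ab zF zM zC]
  have "ennreal ((\<E> w. (simple_integral B n p x t w - simple_integral B m q y t w)\<^sup>2))
     = ennreal ((\<E> w. LBINT s. ?V w s))"
    unfolding S using iso(1) by simp
  also have "\<dots> = (\<integral>\<^sup>+w. ennreal (LBINT s. ?V w s) \<partial>M)"
    using iso(2) by (intro nn_integral_eq_integral[symmetric]) auto
  also have "\<dots> = (\<integral>\<^sup>+w. (\<integral>\<^sup>+s. ennreal (?V w s) \<partial>lborel) \<partial>M)"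
    by (intro nn_integral_cong nn_integral_eq_integral[symmetric] iV) auto
  also have "\<dots> \<le> (\<integral>\<^sup>+w. (\<integral>\<^sup>+s\<in>{0..T}. (2 * ?vx s w + 2 * ?vy s w) \<partial>lborel) \<partial>M)"
    by (intro nn_integral_mono Vle)
  also have "\<dots> = (\<integral>\<^sup>+w. 2 * (\<integral>\<^sup>+s. ?vx s w \<partial>TM) + 2 * (\<integral>\<^sup>+s. ?vy s w \<partial>TM) \<partial>M)"
    unfolding nn_integral_TM
  proof (rule nn_integral_cong)
    fix w assume d: "w \<in> space M"
    note j = joint_section[OF jx(1) d] joint_section[OF jx(2) d]
    show "(\<integral>\<^sup>+s. 2 * ?vx s w + 2 * ?vy s w \<partial>TM) = 2 * (\<integral>\<^sup>+s. ?vx s w \<partial>TM) + 2 * (\<integral>\<^sup>+s. ?vy s w \<partial>TM)"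
      using j by (subst nn_integral_add) (auto simp only: nn_integral_cmult intro: borel_measurable_times_ennreal borel_measurable_const)
  qed
  also have "\<dots> = 2 * (\<integral>\<^sup>+w. (\<integral>\<^sup>+s. ?vx s w \<partial>TM) \<partial>M) + 2 * (\<integral>\<^sup>+w. (\<integral>\<^sup>+s. ?vy s w \<partial>TM) \<partial>M)"
    using joint_nn_integral_measurable[OF jx(1)] joint_nn_integral_measurable[OF jx(2)]
    by (subst nn_integral_add) (auto simp only: nn_integral_cmult intro: borel_measurable_times_ennreal borel_measurable_const)
  finally show ?thesis unfolding nn_integral_TM .
qed

lemma ito_integral_unique:
  assumes B: "brownian_wrt F B" and I: "ito_integral M T F B H I" and I': "ito_integral M T F B H I'"
    and t: "t \<in> {0..T}"
  shows "AE w in M. I t w = I' t w"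
proof -
  note F = brownian_wrt_filtration[OF B]
  have BB: "AE w in M. B t w = B t w" for t by simp
  have H: "adapted_process M T F H" using I by (simp add: ito_integral_def)
  obtain n p x where a: "\<And>k::nat. simple_integrand M T F (n k) (p k) (x k)"
    "(\<lambda>k. \<integral>\<^sup>+w. (\<integral>\<^sup>+t\<in>{0..T}.
            ennreal ((simple_value (n k) (p k) (x k) t w - H t w)\<^sup>2) \<partial>lborel) \<partial>M) \<longlonglongrightarrow> 0"
    "\<And>k t. t \<in> {0..T} \<Longrightarrow> l2 (simple_integral B (n k) (p k) (x k) t)"
    "\<And>t. t \<in> {0..T} \<Longrightarrow> l2 (I t)"
    "\<And>t. t \<in> {0..T} \<Longrightarrow> (\<lambda>k. (\<E> w. (simple_integral B (n k) (p k) (x k) t w - I t w)\<^sup>2)) \<longlonglongrightarrow> 0"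
    using ito_integral_approx[OF I F B BB brownian_wrt_adapted(2)[OF B]] by blast
  obtain m q y where b: "\<And>k::nat. simple_integrand M T F (m k) (q k) (y k)"
    "(\<lambda>k. \<integral>\<^sup>+w. (\<integral>\<^sup>+t\<in>{0..T}.
            ennreal ((simple_value (m k) (q k) (y k) t w - H t w)\<^sup>2) \<partial>lborel) \<partial>M) \<longlonglongrightarrow> 0"
    "\<And>k t. t \<in> {0..T} \<Longrightarrow> l2 (simple_integral B (m k) (q k) (y k) t)"
    "\<And>t. t \<in> {0..T} \<Longrightarrow> l2 (I' t)"
    "\<And>t. t \<in> {0..T} \<Longrightarrow> (\<lambda>k. (\<E> w. (simple_integral B (m k) (q k) (y k) t w - I' t w)\<^sup>2)) \<longlonglongrightarrow> 0"
    using ito_integral_approx[OF I' F B BB brownian_wrt_adapted(2)[OF B]] by blast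
  define S where "S k = simple_integral B (n k) (p k) (x k) t" for k
  define S' where "S' k = simple_integral B (m k) (q k) (y k) t" for k
  have l: "l2 (S k)" "l2 (S' k)" for k using a(3)[OF t] b(3)[OF t] by (auto simp: S_def S'_def)
  have lim1: "(\<lambda>k. (\<E> w. (S k w - I t w)\<^sup>2)) \<longlonglongrightarrow> 0" unfolding S_def by (rule a(5)[OF t])
  have lim2: "(\<lambda>k. (\<E> w. (S' k w - I' t w)\<^sup>2)) \<longlonglongrightarrow> 0" unfolding S'_def by (rule b(5)[OF t])
  have lim3: "(\<lambda>k. (\<E> w. (S k w - S' k w)\<^sup>2)) \<longlonglongrightarrow> 0"
  proof -
    let ?q = "\<lambda>k. 2 * (\<integral>\<^sup>+w. (\<integral>\<^sup>+t\<in>{0..T}. ennreal ((simple_value (n k) (p k) (x k) t w - H t w)\<^sup>2) \<partial>lborel) \<partial>M)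
       + 2 * (\<integral>\<^sup>+w. (\<integral>\<^sup>+t\<in>{0..T}. ennreal ((simple_value (m k) (q k) (y k) t w - H t w)\<^sup>2) \<partial>lborel) \<partial>M)"
    have q0: "?q \<longlonglongrightarrow> 2 * 0 + 2 * 0"
      by (intro tendsto_add ennreal_tendsto_cmult a(2) b(2)) auto
    have "(\<lambda>k. ennreal ((\<E> w. (S k w - S' k w)\<^sup>2))) \<longlonglongrightarrow> 0"
    proof (rule tendsto_sandwich[OF _ _ tendsto_const])
      show "?q \<longlonglongrightarrow> 0" using q0 by simp
      show "\<forall>\<^sub>F k in sequentially. ennreal ((\<E> w. (S k w - S' k w)\<^sup>2)) \<le> ?q k"
        unfolding S_def S'_def
        by (intro always_eventually allI simple_integral_distance[OF B a(1) b(1) t H])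
    qed simp
    then show ?thesis
      by (subst (asm) ennreal_0[symmetric], subst (asm) tendsto_ennreal_iff) auto
  qed
  have le: "(\<E> w. (I t w - I' t w)\<^sup>2) \<le> 2 * (\<E> w. (S k w - I t w)\<^sup>2)
    + 4 * (\<E> w. (S k w - S' k w)\<^sup>2) + 4 * (\<E> w. (S' k w - I' t w)\<^sup>2)" for k
  proof -
    have i: "integrable M (\<lambda>w. (S k w - I t w)\<^sup>2)" "integrable M (\<lambda>w. (S k w - S' k w)\<^sup>2)"
      "integrable M (\<lambda>w. (S' k w - I' t w)\<^sup>2)" "integrable M (\<lambda>w. (I t w - I' t w)\<^sup>2)"
      using l a(4)[OF t] b(4)[OF t] by (auto intro!: l2_square_integrable)
    have "(I t w - I' t w)\<^sup>2 \<le> 2 * (S k w - I t w)\<^sup>2 + 4 * (S k w - S' k w)\<^sup>2 + 4 * (S' k w - I' t w)\<^sup>2" for w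
      using square_sum_le[of "I t w - S k w" "S k w - I' t w"] square_sum_le[of "S k w - S' k w" "S' k w - I' t w"]
      by (simp add: power2_commute[of "I t w" "S k w"])
    then have "(\<E> w. (I t w - I' t w)\<^sup>2) \<le> 
      (\<E> w. 2 * (S k w - I t w)\<^sup>2 + 4 * (S k w - S' k w)\<^sup>2 + 4 * (S' k w - I' t w)\<^sup>2)"
      using i by (intro integral_mono) auto
    then show ?thesis using i by simp
  qed
  have "(\<lambda>k. 2 * (\<E> w. (S k w - I t w)\<^sup>2)
    + 4 * (\<E> w. (S k w - S' k w)\<^sup>2) + 4 * (\<E> w. (S' k w - I' t w)\<^sup>2)) \<longlonglongrightarrow> 2 * 0 + 4 * 0 + 4 * 0"
    by (intro tendsto_intros lim1 lim2 lim3)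
  then have "(\<E> w. (I t w - I' t w)\<^sup>2) \<le> 2 * 0 + 4 * 0 + 4 * 0"
    by (rule LIMSEQ_le_const) (use le in auto)
  then have "AE w in M. I t w - I' t w = 0"
    using a(4)[OF t] b(4)[OF t] by (intro l2_zero_AE) auto
  then show ?thesis by simp
qed

end

section \<open>A discrete change of measure\<close>

text \<open>
  Dynkin's lemma leads from the generator to all measurable sets, linearity to simple functions,
  and dominated convergence to square integrable functions.
\<close>

lemma (in finite_measure) l2_induct:
  fixes f :: "'a \<Rightarrow> real"
  assumes G: "sets M = sigma_sets (space M) G" "Int_stable G" "G \<subseteq> Pow (space M)"
    and ind: "\<And>A. A \<in> G \<Longrightarrow> P (indicator A)" "P (indicator (space M))"
    and add: "\<And>f g. P f \<Longrightarrow> P g \<Longrightarrow> P (\<lambda>x. f x + g x)"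
    and cmult: "\<And>c f. P f \<Longrightarrow> P (\<lambda>x. c * f x)"
    and lim: "\<And>f s. (\<And>n::nat. P (s n)) \<Longrightarrow> f \<in> borel_measurable M \<Longrightarrow> integrable M (\<lambda>x. (f x)\<^sup>2)
      \<Longrightarrow> (\<lambda>n. \<integral>x. (f x - s n x)\<^sup>2 \<partial>M) \<longlonglongrightarrow> 0 \<Longrightarrow> P f"
    and f: "f \<in> borel_measurable M" "integrable M (\<lambda>x. (f x)\<^sup>2)"
  shows "P f"
proof -
  have P0: "P (\<lambda>x. 0)" using cmult[OF ind(2), of 0] by simp
  have Psum: "P (\<lambda>x. \<Sum>i\<in>I. g i x)" if "finite I" "\<And>i. i \<in> I \<Longrightarrow> P (g i)" for I :: "'c set" and g
    using that by (induction I rule: finite_induct) (auto intro: P0 add)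
  have cong: "P g" if "P h" "\<And>x. x \<in> space M \<Longrightarrow> g x = h x" "g \<in> borel_measurable M" "integrable M (\<lambda>x. (g x)\<^sup>2)" for g h
  proof (rule lim[of "\<lambda>_. h"])
    have "(\<integral>x. (g x - h x)\<^sup>2 \<partial>M) = (\<integral>x. 0 \<partial>M)"
      by (rule Bochner_Integration.integral_cong) (use that in auto)
    then show "(\<lambda>n. \<integral>x. (g x - h x)\<^sup>2 \<partial>M) \<longlonglongrightarrow> 0" by simp
  qed (use that in auto)
  have sqi: "integrable M (\<lambda>x. (indicat_real A x)\<^sup>2)" if "A \<in> sets M" for A
  proof -
    have "(\<lambda>x. (indicat_real A x)\<^sup>2) = indicator A" by (auto simp: indicator_def fun_eq_iff)
    then show ?thesis using that by (simp add: less_top[symmetric])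
  qed
  have indI: "P (indicator A)" if "A \<in> sets M" for A
  proof -
    have "A \<in> sigma_sets (space M) G" using that G by simp
    from G(2,3) this show ?thesis
    proof (induction rule: sigma_sets_induct_disjoint)
      case (basic A)
      then show ?case using ind by auto
    next
      case empty
      then show ?case using P0 by (simp add: indicator_def[abs_def])
    next
      case (compl A)
      then have A: "A \<in> sets M" using G by simp
      have "P (\<lambda>x. indicator (space M) x + (-1) * indicator A x)"
        by (intro add cmult ind(2) compl)
      then show ?case
      proof (rule cong)
        show "integrable M (\<lambda>x. (indicat_real (space M - A) x)\<^sup>2)" using A by (intro sqi) auto
      qed (use A in \<open>auto simp: indicator_def\<close>)
    next
      case (union A)
      then have A: "\<And>i. A i \<in> sets M" using G by auto
      define g where "g n x = (\<Sum>i<n. indicat_real (A i) x)" for n x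
      have U: "(\<Union>i. A i) \<in> sets M" using A by auto
      have gu: "g n x = indicator (\<Union>i<n. A i) x" for n x
        unfolding g_def using union(1)
        by (subst indicator_UN_disjoint) (auto simp: disjoint_family_on_def)
      show ?case
      proof (rule lim[of g])
        show "P (g n)" for n unfolding g_def[abs_def] using union by (intro Psum) auto
        show "indicat_real (\<Union>i. A i) \<in> borel_measurable M" using U by auto
        show "integrable M (\<lambda>x. (indicat_real (\<Union>i. A i) x)\<^sup>2)" by (rule sqi[OF U])
        have "(\<lambda>n. \<integral>x. (indicat_real (\<Union>i. A i) x - g n x)\<^sup>2 \<partial>M) \<longlonglongrightarrow> (\<integral>x. 0 \<partial>M)"
        proof (rule integral_dominated_convergence[where w="\<lambda>_. 1"])
          show "AE x in M. (\<lambda>n. (indicat_real (\<Union>i. A i) x - g n x)\<^sup>2) \<longlonglongrightarrow> 0"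
          proof (rule AE_I2)
            fix x
            have "\<forall>\<^sub>F n in sequentially. g n x = indicat_real (\<Union>i. A i) x"
            proof (cases "x \<in> (\<Union>i. A i)")
              case True
              then obtain i where "x \<in> A i" by auto
              then show ?thesis unfolding gu
                by (intro eventually_sequentiallyI[of "Suc i"]) (auto simp: indicator_def)
            qed (auto simp: gu indicator_def)
            then have "\<forall>\<^sub>F n in sequentially. (indicat_real (\<Union>i. A i) x - g n x)\<^sup>2 = 0"
              by eventually_elim simp
            then show "(\<lambda>n. (indicat_real (\<Union>i. A i) x - g n x)\<^sup>2) \<longlonglongrightarrow> 0"
              by (rule tendsto_eventually)
          qed
          show "AE x in M. norm ((indicat_real (\<Union>i. A i) x - g n x)\<^sup>2) \<le> 1" for n
            unfolding gu by (auto simp: indicator_def)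
        qed (use A U in \<open>auto simp: g_def\<close>)
        then show "(\<lambda>n. \<integral>x. (indicat_real (\<Union>i. A i) x - g n x)\<^sup>2 \<partial>M) \<longlonglongrightarrow> 0" by simp
      qed
    qed
  qed
  obtain s where s: "\<And>i. simple_function M (s i)"
    "\<And>x. x \<in> space M \<Longrightarrow> (\<lambda>i. s i x) \<longlonglongrightarrow> f x"
    "\<And>i x. x \<in> space M \<Longrightarrow> dist (s i x) 0 \<le> 2 * dist (f x) 0"
    using borel_measurable_implies_sequence_metric[OF f(1), of 0] by blast
  have sm: "s i \<in> borel_measurable M" for i using s(1) by (rule borel_measurable_simple_function)
  have s2: "(s i x)\<^sup>2 \<le> 4 * (f x)\<^sup>2" if "x \<in> space M" for i x
  proof -
    have "\<bar>s i x\<bar> \<le> \<bar>2 * f x\<bar>" using s(3)[OF that, of i] by (simp add: dist_norm)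
    then have "(s i x)\<^sup>2 \<le> (2 * f x)\<^sup>2" by (simp only: abs_le_square_iff)
    then show ?thesis by (simp add: power_mult_distrib)
  qed
  have Ps: "P (s i)" for i
  proof (rule cong)
    show "P (\<lambda>x. \<Sum>y\<in>s i ` space M. y * indicator (s i -` {y} \<inter> space M) x)"
      using s(1)[of i] sm[of i] by (intro Psum cmult indI) (auto simp: simple_function_def)
    show "s i x = (\<Sum>y\<in>s i ` space M. y * indicator (s i -` {y} \<inter> space M) x)" if "x \<in> space M" for x
      by (rule trans[OF simple_function_indicator_representation_banach[OF s(1) that]])
        (intro sum.cong refl, simp only: real_scaleR_def mult.commute)
    show "integrable M (\<lambda>x. (s i x)\<^sup>2)"
      by (rule Bochner_Integration.integrable_bound[of M "\<lambda>x. 4 * (f x)\<^sup>2"]) (use f sm s2 in auto)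
  qed (rule sm)
  show "P f"
  proof (rule lim[OF Ps f])
    have "(\<lambda>n. \<integral>x. (f x - s n x)\<^sup>2 \<partial>M) \<longlonglongrightarrow> (\<integral>x. 0 \<partial>M)"
    proof (rule integral_dominated_convergence[where w="\<lambda>x. 10 * (f x)\<^sup>2"])
      show "AE x in M. (\<lambda>n. (f x - s n x)\<^sup>2) \<longlonglongrightarrow> 0"
      proof (rule AE_I2)
        fix x assume "x \<in> space M"
        from tendsto_power[OF tendsto_diff[OF tendsto_const s(2)[OF this]], of "f x" 2]
        show "(\<lambda>n. (f x - s n x)\<^sup>2) \<longlonglongrightarrow> 0" by simp
      qed
      show "AE x in M. norm ((f x - s n x)\<^sup>2) \<le> 10 * (f x)\<^sup>2" for n
      proof (rule AE_I2)
        fix x assume "x \<in> space M"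
        then show "norm ((f x - s n x)\<^sup>2) \<le> 10 * (f x)\<^sup>2"
          using s2[of x n] square_sum_le[of "f x" "- s n x"] by simp
      qed
    qed (use f sm in auto)
    then show "(\<lambda>n. \<integral>x. (f x - s n x)\<^sup>2 \<partial>M) \<longlonglongrightarrow> 0" by simp
  qed
qed


text \<open>Completing the square: the exponential moves the mean of the Gaussian by \<open>g \<delta>\<close>.\<close>

lemma gaussian_shift:
  fixes \<delta> g c :: real and F :: "real \<Rightarrow> ennreal"
  assumes "\<delta> > 0" and [measurable]: "F \<in> borel_measurable borel"
  shows "(\<integral>\<^sup>+x. ennreal (exp (- g * x - g\<^sup>2 * \<delta> / 2)) * F (x + g * \<delta>) * ennreal (normal_density 0 (sqrt \<delta>) x) \<partial>lborel)
     = (\<integral>\<^sup>+z. F z * ennreal (normal_density 0 (sqrt \<delta>) z) \<partial>lborel)"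
proof -
  have "exp (- g * x - g\<^sup>2 * \<delta> / 2) * normal_density 0 (sqrt \<delta>) x = normal_density 0 (sqrt \<delta>) (x + g * \<delta>)" for x
  proof -
    have "- g * x - g\<^sup>2 * \<delta> / 2 + - (x\<^sup>2 / (2 * \<delta>)) = - ((x + g * \<delta>)\<^sup>2 / (2 * \<delta>))"
      using assms(1) by (simp add: power2_eq_square field_simps)
    then show ?thesis using assms(1) by (simp add: normal_density_def mult_exp_exp)
  qed
  then have "ennreal (exp (- g * x - g\<^sup>2 * \<delta> / 2)) * F (x + g * \<delta>) * ennreal (normal_density 0 (sqrt \<delta>) x)
     = F (x + g * \<delta>) * ennreal (normal_density 0 (sqrt \<delta>) (x + g * \<delta>))" for x
    by (simp add: ennreal_mult'[symmetric] mult_ac ennreal_mult'')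
       (metis ennreal_mult' exp_ge_zero mult.commute mult.assoc)
  then have "(\<integral>\<^sup>+x. ennreal (exp (- g * x - g\<^sup>2 * \<delta> / 2)) * F (x + g * \<delta>) * ennreal (normal_density 0 (sqrt \<delta>) x) \<partial>lborel)
    = (\<integral>\<^sup>+x. F (g * \<delta> + 1 * x) * ennreal (normal_density 0 (sqrt \<delta>) (g * \<delta> + 1 * x)) \<partial>lborel)"
    by (simp add: add.commute)
  also have "\<dots> = (\<integral>\<^sup>+z. F z * ennreal (normal_density 0 (sqrt \<delta>) z) \<partial>lborel)"
    using nn_integral_real_affine[of "\<lambda>z. F z * ennreal (normal_density 0 (sqrt \<delta>) z)" 1 "g * \<delta>"] by simp
  finally show ?thesis .
qed

lemma (in prob_space) nn_integral_indep:
  assumes F: "subalgebra M F" and D: "D \<in> borel_measurable M"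
    and ind: "indep_set (sets F) {D -` S \<inter> space M | S. S \<in> sets borel}"
    and dens: "distributed M lborel D (\<lambda>x. ennreal (d x))"
    and f: "(\<lambda>(w, x). f w x) \<in> borel_measurable (F \<Otimes>\<^sub>M borel)"
  shows "(\<integral>\<^sup>+w. f w (D w) \<partial>M) = (\<integral>\<^sup>+w. (\<integral>\<^sup>+x. f w x * ennreal (d x) \<partial>lborel) \<partial>M)"
proof -
  have sp: "space F = space M" and sub: "sets F \<subseteq> sets M" using F by (auto simp: subalgebra_def)
  let ?R = "restr_to_subalg M F" and ?L = "distr M borel D"
  have sR: "sets ?R = sets F" "space ?R = space M" using F by (auto simp: sets_restr_to_subalg space_restr_to_subalg)
  interpret R: prob_space ?R
    using prob_space_axioms F by (simp add: prob_space_restr_to_subalg)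
  interpret L: prob_space ?L using D by (rule prob_space_distr)
  have pair: "(\<lambda>w. (w, D w)) \<in> M \<rightarrow>\<^sub>M (?R \<Otimes>\<^sub>M ?L)"
  proof (rule measurable_Pair)
    show "(\<lambda>x. x) \<in> M \<rightarrow>\<^sub>M ?R" by (rule measurableI) (use sR sub sp sets.sets_into_space in \<open>auto simp: Int_absorb2\<close>)
    show "D \<in> M \<rightarrow>\<^sub>M ?L" using D by simp
  qed
  have eq: "?R \<Otimes>\<^sub>M ?L = distr M (?R \<Otimes>\<^sub>M ?L) (\<lambda>w. (w, D w))"
  proof (rule pair_measure_eqI)
    show "sigma_finite_measure ?R" "sigma_finite_measure ?L" by unfold_locales
    show "sets (?R \<Otimes>\<^sub>M ?L) = sets (distr M (?R \<Otimes>\<^sub>M ?L) (\<lambda>w. (w, D w)))" by simp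
    fix A B assume A: "A \<in> sets ?R" and B: "B \<in> sets ?L"
    have AF: "A \<in> sets F" "A \<in> sets M" "A \<subseteq> space M" using A sR sub sets.sets_into_space[of A M] by auto
    have "emeasure (distr M (?R \<Otimes>\<^sub>M ?L) (\<lambda>w. (w, D w))) (A \<times> B) = emeasure M (A \<inter> (D -` B \<inter> space M))"
    proof (subst emeasure_distr[OF pair])
      show "A \<times> B \<in> sets (?R \<Otimes>\<^sub>M ?L)" using A B by auto
      have "(\<lambda>w. (w, D w)) -` (A \<times> B) \<inter> space M = A \<inter> (D -` B \<inter> space M)" using AF by auto
      then show "emeasure M ((\<lambda>w. (w, D w)) -` (A \<times> B) \<inter> space M) = emeasure M (A \<inter> (D -` B \<inter> space M))" by simp
    qed
    also have "\<dots> = ennreal (prob (A \<inter> (D -` B \<inter> space M)))" by (simp add: emeasure_eq_measure)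
    also have "prob (A \<inter> (D -` B \<inter> space M)) = prob A * prob (D -` B \<inter> space M)"
    proof (rule indep_setD[OF ind AF(1)])
      show "D -` B \<inter> space M \<in> {D -` S \<inter> space M | S. S \<in> sets borel}" using B by auto
    qed
    also have "ennreal \<dots> = emeasure ?R A * emeasure ?L B"
      using A B D F AF by (simp add: emeasure_restr_to_subalg emeasure_distr emeasure_eq_measure ennreal_mult)
    finally show "emeasure ?R A * emeasure ?L B = emeasure (distr M (?R \<Otimes>\<^sub>M ?L) (\<lambda>w. (w, D w))) (A \<times> B)" by simp
  qed
  have fm: "(\<lambda>(w, x). f w x) \<in> borel_measurable (?R \<Otimes>\<^sub>M ?L)"
    using f sR by (simp cong: measurable_cong_sets sets_pair_measure_cong)
  have "(\<integral>\<^sup>+w. f w (D w) \<partial>M) = (\<integral>\<^sup>+p. (case p of (w, x) \<Rightarrow> f w x) \<partial>distr M (?R \<Otimes>\<^sub>M ?L) (\<lambda>w. (w, D w)))"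
    using pair fm by (subst nn_integral_distr) auto
  also have "\<dots> = (\<integral>\<^sup>+w. (\<integral>\<^sup>+x. f w x \<partial>?L) \<partial>?R)"
    unfolding eq[symmetric] using L.nn_integral_fst[OF fm] by simp
  also have "\<dots> = (\<integral>\<^sup>+w. (\<integral>\<^sup>+x. f w x \<partial>?L) \<partial>M)"
  proof (rule nn_integral_subalgebra2[OF F])
    have "(\<lambda>w. \<integral>\<^sup>+x. f w x \<partial>?L) \<in> borel_measurable ?R" by (rule L.borel_measurable_nn_integral[OF fm])
    then show "(\<lambda>w. \<integral>\<^sup>+x. f w x \<partial>?L) \<in> borel_measurable F" using sR by (simp cong: measurable_cong_sets)
  qed
  also have "\<dots> = (\<integral>\<^sup>+w. (\<integral>\<^sup>+x. f w x * ennreal (d x) \<partial>lborel) \<partial>M)"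
  proof (rule nn_integral_cong)
    fix w assume "w \<in> space M"
    then have "(\<lambda>x. (\<lambda>(w, x). f w x) (w, x)) \<in> borel_measurable borel"
      using f sp by (intro measurable_compose[OF measurable_Pair1']) auto
    then have fb: "f w \<in> borel_measurable borel" by simp
    have "(\<integral>\<^sup>+x. f w x \<partial>?L) = (\<integral>\<^sup>+x. f w (D x) \<partial>M)"
      using D fb by (subst nn_integral_distr) auto
    also have "\<dots> = (\<integral>\<^sup>+x. ennreal (d x) * f w x \<partial>lborel)"
      using distributed_nn_integral[OF dens, of "f w"] fb by simp
    finally show "(\<integral>\<^sup>+x. f w x \<partial>?L) = (\<integral>\<^sup>+x. f w x * ennreal (d x) \<partial>lborel)" by (simp add: mult.commute)
  qed
  finally show ?thesis .
qed

abbreviation paths :: "(nat \<Rightarrow> real) measure" where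
  "paths \<equiv> PiM UNIV (\<lambda>_. borel)"

text \<open>
  A discretised observation: after \<open>k\<close> steps the information is \<open>H k\<close>, and the position \<open>Y k\<close> moves by the drift
  \<open>b k\<close> and a Gaussian increment \<open>D k\<close> of variance \<open>\<delta>\<close>.  The drift may depend on all of \<open>H k\<close>; the
  functional \<open>h k\<close> of the path of positions is what it is compared with.
\<close>

locale gaussian_feedback = prob_space M for M :: "'a measure" +
  fixes \<delta> :: real and n :: nat and H :: "nat \<Rightarrow> 'a measure"
    and D b :: "nat \<Rightarrow> 'a \<Rightarrow> real" and h :: "nat \<Rightarrow> (nat \<Rightarrow> real) \<Rightarrow> real"
  assumes \<delta>: "\<delta> > 0"
    and sub: "\<And>k. k \<le> n \<Longrightarrow> subalgebra M (H k)"
    and mono: "\<And>k. k < n \<Longrightarrow> sets (H k) \<subseteq> sets (H (Suc k))"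
    and D: "\<And>k. k < n \<Longrightarrow> D k \<in> borel_measurable (H (Suc k))"
    and ind: "\<And>k. k < n \<Longrightarrow> indep_set (sets (H k)) {D k -` S \<inter> space M | S. S \<in> sets borel}"
    and dist: "\<And>k. k < n \<Longrightarrow> distributed M lborel (D k) (\<lambda>x. ennreal (normal_density 0 (sqrt \<delta>) x))"
    and b: "\<And>k. k < n \<Longrightarrow> b k \<in> borel_measurable (H k)"
    and h: "\<And>k. k < n \<Longrightarrow> h k \<in> borel_measurable paths"
begin

primrec Y :: "nat \<Rightarrow> 'a \<Rightarrow> real" where
  "Y 0 w = 0"
| "Y (Suc k) w = Y k w + b k w * \<delta> + D k w"

definition X :: "nat \<Rightarrow> 'a \<Rightarrow> nat \<Rightarrow> real" where
  "X k w = (\<lambda>j. if j \<le> k then Y j w else 0)"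

definition g :: "nat \<Rightarrow> 'a \<Rightarrow> real" where
  "g k w = b k w - h k (X k w)"

text \<open>The Girsanov density that replaces the drift \<open>b\<close> of the steps by the feedback \<open>h\<close>.\<close>

definition Z :: "nat \<Rightarrow> 'a \<Rightarrow> real" where
  "Z k w = (\<Prod>j<k. exp (- g j w * D j w - (g j w)\<^sup>2 * \<delta> / 2))"

lemma H_mono:
  assumes "j \<le> k" "k \<le> n" shows "sets (H j) \<subseteq> sets (H k)"
  using assms
proof (induction k rule: dec_induct)
  case (step m)
  then show ?case using mono[of m] by auto
qed simp

lemma H_space: "k \<le> n \<Longrightarrow> space (H k) = space M"
  using sub by (auto simp: subalgebra_def)

lemma H_measurable_mono:
  assumes "j \<le> k" "k \<le> n" "f \<in> measurable (H j) N" shows "f \<in> measurable (H k) N"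
  by (rule measurable_from_subalg[OF _ assms(3)])
     (use assms H_mono H_space in \<open>auto simp: subalgebra_def\<close>)

lemma H_measurable_M: "k \<le> n \<Longrightarrow> f \<in> measurable (H k) N \<Longrightarrow> f \<in> measurable M N"
  using measurable_from_subalg[OF sub] by auto

lemma Y_measurable: "k \<le> n \<Longrightarrow> Y k \<in> borel_measurable (H k)"
proof (induction k)
  case (Suc k)
  have "Y k \<in> borel_measurable (H (Suc k))" "b k \<in> borel_measurable (H (Suc k))"
    using Suc b[of k] by (auto intro: H_measurable_mono[of k "Suc k"])
  then show ?case using D[of k] Suc unfolding Y.simps(2)[abs_def] by simp
qed (simp add: Y.simps(1)[abs_def])

lemma X_measurable:
  assumes "k \<le> n" shows "X k \<in> measurable (H k) paths"
proof (rule measurable_PiM_single')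
  fix j :: nat
  show "(\<lambda>w. X k w j) \<in> borel_measurable (H k)"
    using H_measurable_mono[OF _ assms Y_measurable[of j]] assms by (cases "j \<le> k") (auto simp: X_def)
qed (auto simp: PiE_def extensional_def)

lemma g_measurable: "k < n \<Longrightarrow> g k \<in> borel_measurable (H k)"
  unfolding g_def[abs_def] using b measurable_compose[OF X_measurable h, of k] by auto

lemma Z_measurable: "k \<le> n \<Longrightarrow> Z k \<in> borel_measurable (H k)"
  unfolding Z_def[abs_def]
proof (intro borel_measurable_prod)
  fix j assume k: "k \<le> n" and "j \<in> {..<k}"
  then have j: "j < k" by simp
  have "g j \<in> borel_measurable (H k)" "D j \<in> borel_measurable (H k)"
    using H_measurable_mono[OF _ k g_measurable[of j]] H_measurable_mono[OF _ k D[of j]] j k by auto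
  then show "(\<lambda>w. exp (- g j w * D j w - (g j w)\<^sup>2 * \<delta> / 2)) \<in> borel_measurable (H k)" by measurable
qed

lemma X_Suc: "X (Suc k) w = (X k w)(Suc k := Y k w + b k w * \<delta> + D k w)"
  by (auto simp: X_def fun_eq_iff le_Suc_eq)

text \<open>
  Under the density, the steps \<open>D k + g k * \<delta>\<close> are Gaussian and independent of the past, and the
  path follows the closed recursion \<open>Y (Suc k) = Y k + h k (X k) * \<delta> + (D k + g k * \<delta>)\<close> started at
  \<open>0\<close>. Its law is therefore the same for every initial information. In the induction the last step
  is integrated out, which turns the test function \<open>G\<close> into another function of the shorter path.
\<close>

lemma Z_factor:
  assumes "k \<le> n" and "G \<in> borel_measurable paths"
  shows "\<exists>c. (\<forall>m\<in>borel_measurable (H 0). (\<integral>\<^sup>+w. ennreal (Z k w) * G (X k w) * m w \<partial>M) = c * (\<integral>\<^sup>+w. m w \<partial>M))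
    \<and> ((\<forall>y. G y = (1::ennreal)) \<longrightarrow> c = 1)"
  using assms
proof (induction k arbitrary: G)
  case 0
  have X0: "X 0 w = (\<lambda>j. 0)" for w by (auto simp: X_def)
  show ?case
  proof (intro exI[of _ "G (\<lambda>j. 0)"] conjI ballI impI)
    fix m :: "'a \<Rightarrow> ennreal" assume "m \<in> borel_measurable (H 0)"
    then have "m \<in> borel_measurable M" using H_measurable_M[of 0] by simp
    then show "(\<integral>\<^sup>+w. ennreal (Z 0 w) * G (X 0 w) * m w \<partial>M) = G (\<lambda>j. 0) * (\<integral>\<^sup>+w. m w \<partial>M)"
      unfolding X0 by (simp add: Z_def nn_integral_cmult)
  qed simp
next
  case (Suc k)
  note G[measurable] = Suc.prems(2)
  have k: "k < n" "k \<le> n" using Suc.prems by auto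
  note [measurable] = h[OF k(1)]
  define N where "N = normal_density 0 (sqrt \<delta>)"
  have [measurable]: "N \<in> borel_measurable borel" by (simp add: N_def)
  define up where "up = (\<lambda>(y :: nat \<Rightarrow> real, z :: real). y(Suc k := y k + h k y * \<delta> + z))"
  have up[measurable]: "up \<in> measurable (paths \<Otimes>\<^sub>M borel) paths"
  proof (rule measurable_PiM_single')
    fix j :: nat
    show "(\<lambda>p. up p j) \<in> borel_measurable (paths \<Otimes>\<^sub>M borel)"
      by (cases "j = Suc k") (simp_all add: up_def case_prod_unfold)
  qed (auto simp: PiE_def extensional_def)
  define G' where "G' y = (\<integral>\<^sup>+z. G (up (y, z)) * ennreal (N z) \<partial>lborel)" for y
  have G': "G' \<in> borel_measurable paths" unfolding G'_def
    by (rule lborel.borel_measurable_nn_integral) (simp add: case_prod_unfold)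
  obtain c where c: "\<And>m. m \<in> borel_measurable (H 0) \<Longrightarrow> (\<integral>\<^sup>+w. ennreal (Z k w) * G' (X k w) * m w \<partial>M) = c * (\<integral>\<^sup>+w. m w \<partial>M)"
    and c1: "(\<forall>y. G' y = 1) \<Longrightarrow> c = 1"
    using Suc.IH[OF k(2) G'] by blast
  show ?case
  proof (intro exI[of _ c] conjI ballI impI)
    fix m :: "'a \<Rightarrow> ennreal" assume m: "m \<in> borel_measurable (H 0)"
    have mk[measurable]: "m \<in> borel_measurable (H k)" by (rule H_measurable_mono[OF _ k(2) m]) simp
    note [measurable] = Z_measurable[OF k(2)] g_measurable[OF k(1)] Y_measurable[OF k(2)] b[OF k(1)] X_measurable[OF k(2)]
    let ?f = "\<lambda>w x. ennreal (Z k w) * ennreal (exp (- g k w * x - (g k w)\<^sup>2 * \<delta> / 2))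
       * G ((X k w)(Suc k := Y k w + b k w * \<delta> + x)) * m w"
    have upf: "(\<lambda>p. (X k (fst p))(Suc k := Y k (fst p) + b k (fst p) * \<delta> + snd p)) \<in> measurable (H k \<Otimes>\<^sub>M borel) paths"
    proof (rule measurable_PiM_single')
      fix j :: nat
      show "(\<lambda>p. ((X k (fst p))(Suc k := Y k (fst p) + b k (fst p) * \<delta> + snd p)) j) \<in> borel_measurable (H k \<Otimes>\<^sub>M borel)"
      proof (cases "j = Suc k")
        case False
        have "(\<lambda>w. X k w j) \<in> borel_measurable (H k)"
          by (rule measurable_compose[OF X_measurable[OF k(2)] measurable_component_singleton]) simp
        then show ?thesis using False measurable_compose[OF measurable_fst] by simp
      qed simp
    qed (auto simp: PiE_def extensional_def)
    have fm: "(\<lambda>(w, x). ?f w x) \<in> borel_measurable (H k \<Otimes>\<^sub>M borel)"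
      unfolding case_prod_unfold using measurable_compose[OF upf G] by measurable
    have "(\<integral>\<^sup>+w. ennreal (Z (Suc k) w) * G (X (Suc k) w) * m w \<partial>M) = (\<integral>\<^sup>+w. ?f w (D k w) \<partial>M)"
      by (intro nn_integral_cong) (simp add: Z_def X_Suc ennreal_mult' prod_nonneg)
    also have "\<dots> = (\<integral>\<^sup>+w. (\<integral>\<^sup>+x. ?f w x * ennreal (N x) \<partial>lborel) \<partial>M)"
      unfolding N_def
      by (rule nn_integral_indep[OF sub[OF k(2)] H_measurable_M[OF _ D[OF k(1)]] ind[OF k(1)] dist[OF k(1)] fm]) (use k in auto)
    also have "\<dots> = (\<integral>\<^sup>+w. ennreal (Z k w) * G' (X k w) * m w \<partial>M)"
    proof (rule nn_integral_cong)
      fix w assume "w \<in> space M"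
      have Xp: "X k w \<in> space paths" by (simp add: space_PiM)
      have Gm: "(\<lambda>z. G (up (X k w, z))) \<in> borel_measurable borel"
        by (rule measurable_compose[OF measurable_Pair1'[OF Xp]]) simp
      have upx: "(X k w)(Suc k := Y k w + b k w * \<delta> + x) = up (X k w, x + g k w * \<delta>)" for x
      proof -
        have "X k w k = Y k w" by (simp add: X_def)
        then show ?thesis by (simp add: up_def g_def algebra_simps)
      qed
      have "(\<integral>\<^sup>+x. ?f w x * ennreal (N x) \<partial>lborel) = (\<integral>\<^sup>+x. (ennreal (Z k w) * m w) * 
          (ennreal (exp (- g k w * x - (g k w)\<^sup>2 * \<delta> / 2)) * G (up (X k w, x + g k w * \<delta>)) * ennreal (N x)) \<partial>lborel)"
        unfolding upx by (simp add: mult_ac)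
      also have "\<dots> = (ennreal (Z k w) * m w) * (\<integral>\<^sup>+x. ennreal (exp (- g k w * x - (g k w)\<^sup>2 * \<delta> / 2)) * G (up (X k w, x + g k w * \<delta>)) * ennreal (N x) \<partial>lborel)"
      proof (rule nn_integral_cmult)
        have "(\<lambda>x. G (up (X k w, x + g k w * \<delta>))) \<in> borel_measurable borel"
          by (rule measurable_compose[OF _ Gm]) simp
        then show "(\<lambda>x. ennreal (exp (- g k w * x - (g k w)\<^sup>2 * \<delta> / 2)) * G (up (X k w, x + g k w * \<delta>)) * ennreal (N x)) \<in> borel_measurable lborel"
          by simp
      qed
      also have "(\<integral>\<^sup>+x. ennreal (exp (- g k w * x - (g k w)\<^sup>2 * \<delta> / 2)) * G (up (X k w, x + g k w * \<delta>)) * ennreal (N x) \<partial>lborel)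
          = G' (X k w)"
        unfolding G'_def N_def by (rule gaussian_shift[OF \<delta> Gm])
      finally show "(\<integral>\<^sup>+x. ?f w x * ennreal (N x) \<partial>lborel) = ennreal (Z k w) * G' (X k w) * m w"
        by (simp only: mult_ac)
    qed
    also have "\<dots> = c * (\<integral>\<^sup>+w. m w \<partial>M)" by (rule c[OF m])
    finally show "(\<integral>\<^sup>+w. ennreal (Z (Suc k) w) * G (X (Suc k) w) * m w \<partial>M) = c * (\<integral>\<^sup>+w. m w \<partial>M)" .
  next
    assume "\<forall>y. G y = 1"
    moreover have "(\<integral>\<^sup>+z. ennreal (N z) \<partial>lborel) = 1"
      unfolding N_def using \<delta> by (subst nn_integral_eq_integral) (auto simp: normal_density_nonneg)
    ultimately show "c = 1" by (intro c1) (simp add: G'_def)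
  qed
qed

end

section \<open>Decoupling of Gaussian feedback systems\<close>

context gaussian_feedback
begin

lemma D_M: "k < n \<Longrightarrow> D k \<in> borel_measurable M"
  using H_measurable_M[OF _ D] by auto

lemma D_moments:
  assumes k: "k < n"
  shows "integrable M (D k)" "expectation (D k) = 0" "integrable M (\<lambda>w. (D k w)\<^sup>2)" "(\<E> w. (D k w)\<^sup>2) = \<delta>"
proof -
  have s: "0 < sqrt \<delta>" using \<delta> by simp
  show e: "expectation (D k) = 0" using normal_distributed_expectation[OF s dist[OF k]] .
  show i: "integrable M (\<lambda>w. (D k w)\<^sup>2)"
    using distributed_integrable[OF dist[OF k], of "\<lambda>x. x\<^sup>2"] integrable_normal_moment[OF s, of 0 2] by auto
  show "(\<E> w. (D k w)\<^sup>2) = \<delta>"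
    using normal_distributed_variance[OF s dist[OF k]] e \<delta> by simp
  have "l2 (D k)" using i D_M[OF k] by (simp add: l2_def)
  then show "integrable M (D k)" by (rule l2_integrable)
qed

lemma D_indep:
  assumes k: "k < n" and f: "f \<in> borel_measurable (H k)" "integrable M f"
  shows "(\<E> w. f w * D k w) = 0" "integrable M (\<lambda>w. f w * D k w)"
    "(\<E> w. f w * (D k w)\<^sup>2) = expectation f * \<delta>" "integrable M (\<lambda>w. f w * (D k w)\<^sup>2)"
proof -
  note i = indep_set_indep_var[OF sub[OF less_imp_le[OF k]] D_M[OF k] ind[OF k] f(1)]
  note i1 = i[of "\<lambda>x. x"] and i2 = i[of "\<lambda>x. x\<^sup>2"]
  show "(\<E> w. f w * D k w) = 0"
    using indep_var_lebesgue_integral[OF i1 f(2)] D_moments[OF k] by simp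
  show "integrable M (\<lambda>w. f w * D k w)"
    using indep_var_integrable[OF i1 f(2)] D_moments[OF k] by simp
  show "(\<E> w. f w * (D k w)\<^sup>2) = expectation f * \<delta>"
    using indep_var_lebesgue_integral[OF i2 f(2)] D_moments[OF k] by simp
  show "integrable M (\<lambda>w. f w * (D k w)\<^sup>2)"
    using indep_var_integrable[OF i2 f(2)] D_moments[OF k] by simp
qed

lemma Z_expectation: "integrable M (Z n)" "expectation (Z n) = 1"
proof -
  obtain c where "\<forall>m\<in>borel_measurable (H 0). (\<integral>\<^sup>+w. ennreal (Z n w) * 1 * m w \<partial>M) = c * (\<integral>\<^sup>+w. m w \<partial>M)" "c = 1"
    using Z_factor[of n "\<lambda>_. 1"] by auto
  from this(1)[rule_format, of "\<lambda>_. 1"] this(2) have nn: "(\<integral>\<^sup>+w. ennreal (Z n w) \<partial>M) = 1"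
    by (simp add: emeasure_space_1)
  have pos: "0 \<le> Z n w" for w by (simp add: Z_def prod_nonneg)
  have m: "Z n \<in> borel_measurable M" using H_measurable_M[OF _ Z_measurable] by simp
  show "integrable M (Z n)" using nn pos m by (intro integrableI_bounded) auto
  show "expectation (Z n) = 1" using nn pos m by (subst integral_eq_nn_integral) auto
qed

text \<open>The terms are orthogonal in \<open>L\<^sup>2\<close>.\<close>

lemma martingale_part:
  assumes g2: "\<And>k. k < n \<Longrightarrow> l2 (g k)" and "k \<le> n"
  shows "l2 (\<lambda>w. \<Sum>j<k. g j w * D j w) \<and>
    (\<E> w. (\<Sum>j<k. g j w * D j w)\<^sup>2) = \<delta> * (\<Sum>j<k. (\<E> w. (g j w)\<^sup>2))"
  using assms(2)
proof (induction k)
  case (Suc k)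
  then have k: "k < n" "k \<le> n" by auto
  let ?N = "\<lambda>w. \<Sum>j<k. g j w * D j w"
  have N: "l2 ?N" using Suc k by auto
  have NH: "?N \<in> borel_measurable (H k)"
  proof (intro borel_measurable_sum borel_measurable_times)
    fix j assume "j \<in> {..<k}"
    then show "g j \<in> borel_measurable (H k)" "D j \<in> borel_measurable (H k)"
      using H_measurable_mono[OF _ k(2) g_measurable[of j]] H_measurable_mono[OF _ k(2) D[of j]] k by auto
  qed
  note gk = g2[OF k(1)] g_measurable[OF k(1)]
  have g2k: "(\<lambda>w. (g k w)\<^sup>2) \<in> borel_measurable (H k)" using gk by auto
  note q = D_indep(3,4)[OF k(1) g2k l2_square_integrable[OF gk(1)]]
  have gD: "l2 (\<lambda>w. g k w * D k w)"
    using q D_M[OF k(1)] gk(1) by (auto simp: l2_def power_mult_distrib)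
  have "(\<lambda>w. ?N w * g k w) \<in> borel_measurable (H k)" using NH gk by auto
  note cr = D_indep(1,2)[OF k(1) this l2_mult_integrable[OF N gk(1)]]
  have "(\<E> w. (\<Sum>j<Suc k. g j w * D j w)\<^sup>2) =
    (\<E> w. (?N w)\<^sup>2 + (g k w)\<^sup>2 * (D k w)\<^sup>2 + 2 * (?N w * g k w * D k w))"
    by (simp add: power2_sum power_mult_distrib mult.assoc)
  also have "\<dots> = (\<E> w. (?N w)\<^sup>2) + (\<E> w. (g k w)\<^sup>2 * (D k w)\<^sup>2) + 2 * (\<E> w. ?N w * g k w * D k w)"
    using l2_square_integrable[OF N] q(2) cr(2) by simp
  also have "\<dots> = \<delta> * (\<Sum>j<Suc k. (\<E> w. (g j w)\<^sup>2))"
    using Suc k q(1) cr(1) by (simp add: algebra_simps)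
  finally show ?case using l2_add[OF N gD] by simp
qed simp

text \<open>
  As \<open>Z n\<close> is nonnegative with mean \<open>1\<close>, its distance from \<open>1\<close> is twice the mean of the positive part
  of \<open>1 - Z n\<close>, and \<open>1 - exp (- a) \<le> max 0 a\<close>. The exponent has a martingale part of variance \<open>v\<close> and a
  drift part with mean \<open>v / 2\<close>.
\<close>

lemma Z_near_one:
  assumes g2: "\<And>k. k < n \<Longrightarrow> l2 (g k)" and v: "v = \<delta> * (\<Sum>j<n. (\<E> w. (g j w)\<^sup>2))"
  shows "(\<E> w. \<bar>1 - Z n w\<bar>) \<le> 2 * sqrt v + v"
proof -
  define N where "N w = (\<Sum>j<n. g j w * D j w)" for w
  define V where "V w = (\<Sum>j<n. (g j w)\<^sup>2 * \<delta>)" for w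
  have N: "l2 N" "(\<E> w. (N w)\<^sup>2) = v"
    using martingale_part[OF g2, of n] v by (auto simp: N_def[abs_def])
  have iV: "integrable M V" unfolding V_def[abs_def]
    by (intro Bochner_Integration.integrable_sum integrable_mult_left l2_square_integrable g2) simp
  have eV: "expectation V = v" unfolding V_def[abs_def] v
    by (subst Bochner_Integration.integral_sum; (intro integrable_mult_left l2_square_integrable g2)?)
       (auto simp: sum_distrib_left mult.commute)
  have V0: "0 \<le> V w" for w using \<delta> by (auto simp: V_def intro!: sum_nonneg)
  have Z: "Z n w = exp (- N w - V w / 2)" for w
  proof -
    have "Z n w = exp (\<Sum>j<n. - g j w * D j w - (g j w)\<^sup>2 * \<delta> / 2)"
      by (simp add: Z_def exp_sum)
    also have "(\<Sum>j<n. - g j w * D j w - (g j w)\<^sup>2 * \<delta> / 2) = - N w - V w / 2"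
      by (simp add: N_def V_def sum_subtractf sum_negf sum_divide_distrib)
    finally show ?thesis .
  qed
  have iN: "integrable M (\<lambda>w. \<bar>N w\<bar>)" using l2_integrable[OF N(1)] by simp
  have le: "\<bar>1 - Z n w\<bar> \<le> 2 * (\<bar>N w\<bar> + V w / 2) - (1 - Z n w)" for w
  proof -
    have "1 - Z n w \<le> N w + V w / 2" unfolding Z using exp_ge_add_one_self[of "- N w - V w / 2"] by linarith
    then show ?thesis using V0[of w] by (auto simp: abs_if)
  qed
  have "(\<E> w. \<bar>1 - Z n w\<bar>) \<le> (\<E> w. 2 * (\<bar>N w\<bar> + V w / 2) - (1 - Z n w))"
    using Z_expectation iN iV le by (intro integral_mono) auto
  also have "\<dots> = 2 * ((\<E> w. \<bar>N w\<bar>) + expectation V / 2)"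
    using Z_expectation iN iV by (simp add: prob_space)
  also have "(\<E> w. \<bar>N w\<bar>) \<le> sqrt v"
  proof -
    have "l2 (\<lambda>w. \<bar>N w\<bar>)" using N(1) by (auto simp: l2_def)
    from expectation_square_le[OF this] N(2) show ?thesis by (intro real_le_rsqrt) simp
  qed
  finally show ?thesis using eV by simp
qed

text \<open>
  With the weight \<open>Z n\<close> the expectation factorises exactly; removing the weight from a variable
  bounded by \<open>1\<close> costs at most the distance of \<open>Z n\<close> from \<open>1\<close>, and this is done twice.
\<close>

lemma decoupling01:
  assumes g2: "\<And>k. k < n \<Longrightarrow> l2 (g k)" and v: "v = \<delta> * (\<Sum>j<n. (\<E> w. (g j w)\<^sup>2))"
    and G: "G \<in> borel_measurable paths" "\<And>y. 0 \<le> G y \<and> G y \<le> 1"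
    and m: "m \<in> borel_measurable (H 0)" "\<And>w. 0 \<le> m w \<and> m w \<le> (1 :: real)"
  shows "\<bar>(\<E> w. G (X n w) * m w) - (\<E> w. G (X n w)) * expectation m\<bar> \<le> 2 * (2 * sqrt v + v)"
proof -
  have Xm: "X n \<in> measurable M paths" using H_measurable_M[OF _ X_measurable] by simp
  have GX: "(\<lambda>w. G (X n w)) \<in> borel_measurable M" using measurable_compose[OF Xm G(1)] .
  have mM: "m \<in> borel_measurable M" using H_measurable_M[OF _ m(1)] by simp
  have ZM: "Z n \<in> borel_measurable M" using Z_expectation by auto
  have pos: "0 \<le> Z n w" for w by (simp add: Z_def prod_nonneg)
  define c where "c = (\<E> w. Z n w * G (X n w))"
  have iZ: "integrable M (\<lambda>w. Z n w * u w)" if "u \<in> borel_measurable M" "\<And>w. \<bar>u w\<bar> \<le> 1" for u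
  proof (rule Bochner_Integration.integrable_bound[OF Z_expectation(1)])
    show "AE w in M. norm (Z n w * u w) \<le> norm (Z n w)"
      using that pos by (auto simp: abs_mult intro!: mult_left_le)
  qed (use that ZM in auto)
  have G1: "\<bar>G y\<bar> \<le> 1" for y using G(2)[of y] by auto
  have m1: "\<bar>m w\<bar> \<le> 1" for w using m(2)[of w] by auto
  have Gm1: "\<bar>G (X n w) * m w\<bar> \<le> 1" for w using G1 m1 by (simp add: abs_mult mult_le_one)
  have fac: "(\<E> w. Z n w * (G (X n w) * m w)) = c * expectation m"
  proof -
    have "(\<lambda>y. ennreal (G y)) \<in> borel_measurable paths" using G(1) by simp
    then obtain d where d: "\<And>m. m \<in> borel_measurable (H 0) \<Longrightarrow>
       (\<integral>\<^sup>+w. ennreal (Z n w) * ennreal (G (X n w)) * m w \<partial>M) = d * (\<integral>\<^sup>+w. m w \<partial>M)"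
      using Z_factor[of n "\<lambda>y. ennreal (G y)"] by blast
    have "d = (\<integral>\<^sup>+w. ennreal (Z n w) * ennreal (G (X n w)) \<partial>M)"
      using d[of "\<lambda>_. 1"] by (simp add: emeasure_space_1)
    also have "\<dots> = ennreal c" unfolding c_def using pos G(2) iZ[OF GX] G1
      by (subst nn_integral_eq_integral[symmetric]) (auto simp: ennreal_mult)
    finally have dc: "d = ennreal c" .
    have c0: "0 \<le> c" unfolding c_def using pos G(2) by (auto intro!: Bochner_Integration.integral_nonneg)
    have "ennreal ((\<E> w. Z n w * (G (X n w) * m w))) = (\<integral>\<^sup>+w. ennreal (Z n w) * ennreal (G (X n w)) * ennreal (m w) \<partial>M)"
      using pos G(2) m(2) iZ[of "\<lambda>w. G (X n w) * m w"] Gm1 GX mM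
      by (subst nn_integral_eq_integral[symmetric]) (auto simp: ennreal_mult mult.assoc)
    also have "\<dots> = d * (\<integral>\<^sup>+w. ennreal (m w) \<partial>M)" using m by (intro d) auto
    also have "(\<integral>\<^sup>+w. ennreal (m w) \<partial>M) = ennreal (expectation m)"
      using m mM m1 by (intro nn_integral_eq_integral integrable_const_bound[where B=1]) auto
    finally have "ennreal ((\<E> w. Z n w * (G (X n w) * m w))) = ennreal (c * expectation m)"
      using dc c0 by (simp add: ennreal_mult')
    moreover have "0 \<le> (\<E> w. Z n w * (G (X n w) * m w))" "0 \<le> c * expectation m"
      using pos G(2) m(2) c0 by (auto intro!: Bochner_Integration.integral_nonneg mult_nonneg_nonneg)
    ultimately show ?thesis by simp
  qed
  have d: "\<bar>expectation u - (\<E> w. Z n w * u w)\<bar> \<le> 2 * sqrt v + v"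
    if u: "u \<in> borel_measurable M" "\<And>w. \<bar>u w\<bar> \<le> 1" for u
  proof -
    have iu: "integrable M u" using u by (intro integrable_const_bound[where B=1]) auto
    have "expectation u - (\<E> w. Z n w * u w) = (\<E> w. (1 - Z n w) * u w)"
      using iu iZ[OF u] by (simp add: left_diff_distrib)
    also have "\<bar>\<dots>\<bar> \<le> (\<E> w. \<bar>(1 - Z n w) * u w\<bar>)" by (rule integral_abs_bound)
    also have "\<dots> \<le> (\<E> w. \<bar>1 - Z n w\<bar>)"
    proof (rule integral_mono)
      show "integrable M (\<lambda>w. \<bar>(1 - Z n w) * u w\<bar>)" using iu iZ[OF u] by (simp add: left_diff_distrib)
      show "integrable M (\<lambda>w. \<bar>1 - Z n w\<bar>)" using Z_expectation by simp
    qed (use u in \<open>auto simp: abs_mult intro!: mult_left_le\<close>)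
    also have "\<dots> \<le> 2 * sqrt v + v" by (rule Z_near_one[OF g2 v])
    finally show ?thesis .
  qed
  have 1: "\<bar>(\<E> w. G (X n w) * m w) - c * expectation m\<bar> \<le> 2 * sqrt v + v"
    using d[of "\<lambda>w. G (X n w) * m w"] Gm1 GX mM fac by auto
  have 2: "\<bar>(\<E> w. G (X n w)) - c\<bar> \<le> 2 * sqrt v + v"
    using d[OF GX G1] by (simp add: c_def)
  have Em: "0 \<le> expectation m" "expectation m \<le> 1"
    using m mM m1 by (auto intro!: Bochner_Integration.integral_nonneg integral_le_const integrable_const_bound[where B=1])
  have "\<bar>(\<E> w. G (X n w)) - c\<bar> * expectation m \<le> (2 * sqrt v + v) * 1"
    using 2 Em by (intro mult_mono) auto
  then have 3: "\<bar>((\<E> w. G (X n w)) - c) * expectation m\<bar> \<le> 2 * sqrt v + v"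
    using Em by (simp add: abs_mult)
  have eq: "(\<E> w. G (X n w) * m w) - (\<E> w. G (X n w)) * expectation m
    = ((\<E> w. G (X n w) * m w) - c * expectation m) - ((\<E> w. G (X n w)) - c) * expectation m"
    by (simp add: left_diff_distrib)
  have "\<bar>x - y\<bar> \<le> 2 * s" if "\<bar>x\<bar> \<le> s" "\<bar>y\<bar> \<le> s" for x y s :: real
    using that by (simp add: abs_le_iff)
  from this[OF 1 3] show ?thesis unfolding eq .
qed

lemma decoupling:
  assumes g2: "\<And>k. k < n \<Longrightarrow> l2 (g k)" and v: "v = \<delta> * (\<Sum>j<n. (\<E> w. (g j w)\<^sup>2))"
    and G: "G \<in> borel_measurable paths" "\<And>y. \<bar>G y\<bar> \<le> C" and C: "C > 0"
    and m: "m \<in> borel_measurable (H 0)" "\<And>w. 0 \<le> m w \<and> m w \<le> (1 :: real)"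
  shows "\<bar>(\<E> w. G (X n w) * m w) - (\<E> w. G (X n w)) * expectation m\<bar> \<le> 4 * C * (2 * sqrt v + v)"
proof -
  \<comment> \<open>\<open>G\<close> rescaled to values in the unit interval\<close>
  define K where "K y = (G y + C) / (2 * C)" for y
  have Xm: "X n \<in> measurable M paths" using H_measurable_M[OF _ X_measurable] by simp
  have GX: "(\<lambda>w. G (X n w)) \<in> borel_measurable M" using measurable_compose[OF Xm G(1)] .
  have mM: "m \<in> borel_measurable M" using H_measurable_M[OF _ m(1)] by simp
  have K: "K \<in> borel_measurable paths" "\<And>y. 0 \<le> K y \<and> K y \<le> 1"
  proof -
    show "K \<in> borel_measurable paths" unfolding K_def[abs_def] using G by simp
    show "0 \<le> K y \<and> K y \<le> 1" for y
      using G(2)[of y] C by (simp add: K_def abs_le_iff)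
  qed
  have im: "integrable M m" using m mM by (intro integrable_const_bound[where B=1]) (auto simp: abs_le_iff)
  have iG: "integrable M (\<lambda>w. G (X n w))" using G GX by (intro integrable_const_bound[where B=C]) auto
  have lG: "l2 (\<lambda>w. G (X n w))" "l2 m"
  proof -
    show "l2 (\<lambda>w. G (X n w))" by (rule l2_bounded[OF GX G(2)])
    have "\<bar>m w\<bar> \<le> 1" for w using m(2)[of w] by auto
    then show "l2 m" by (rule l2_bounded[OF mM])
  qed
  note iGm = l2_mult_integrable[OF lG]
  have "(\<E> w. K (X n w) * m w) = ((\<E> w. G (X n w) * m w) + C * expectation m) / (2 * C)"
    using iGm im by (simp add: K_def distrib_right)
  moreover have "(\<E> w. K (X n w)) = ((\<E> w. G (X n w)) + C) / (2 * C)"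
    using iG by (simp add: K_def prob_space)
  ultimately have "(\<E> w. K (X n w) * m w) - (\<E> w. K (X n w)) * expectation m
     = ((\<E> w. G (X n w) * m w) - (\<E> w. G (X n w)) * expectation m) / (2 * C)"
    using C by (simp add: field_simps)
  with decoupling01[OF g2 v K m] have
    "\<bar>((\<E> w. G (X n w) * m w) - (\<E> w. G (X n w)) * expectation m) / (2 * C)\<bar> \<le> 2 * (2 * sqrt v + v)" by simp
  then show ?thesis using C by (simp add: abs_divide field_simps)
qed

end

section \<open>Approximation of square integrable functions by averages\<close>

context finite_horizon
begin

definition grid :: "nat \<Rightarrow> nat \<Rightarrow> real" where
  "grid n k = real k * (T / real n)"

definition step :: "nat \<Rightarrow> (nat \<Rightarrow> real) \<Rightarrow> real \<Rightarrow> real" where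
  "step n c t = (\<Sum>k<n. indicator {grid n k<..grid n (Suc k)} t * c k)"

lemma grid_simps [simp]: "grid n 0 = 0" "n > 0 \<Longrightarrow> grid n n = T"
  and grid_Suc: "grid n (Suc k) = grid n k + T / real n"
  by (auto simp: grid_def algebra_simps add_divide_distrib)

lemma grid_mono: "j \<le> k \<Longrightarrow> grid n j \<le> grid n k"
  unfolding grid_def using T_pos by (intro mult_right_mono) auto

lemma grid_range: "n > 0 \<Longrightarrow> k \<le> n \<Longrightarrow> grid n k \<in> {0..T}"
  using grid_mono[of 0 k n] grid_mono[of k n n] by auto

lemma step_value:
  assumes "k < n" "t \<in> {grid n k<..grid n (Suc k)}"
  shows "step n c t = c k"
proof -
  have "indicator {grid n j<..grid n (Suc j)} t * c j = (if j = k then c k else 0)" for j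
  proof (cases "j < k \<or> k < j")
    case True
    then show ?thesis using grid_mono[of "Suc j" k n] grid_mono[of "Suc k" j n] assms(2)
      by (auto simp: indicator_def)
  next
    case False
    then have "j = k" by auto
    then show ?thesis using assms(2) by auto
  qed
  then show ?thesis using assms(1) by (simp add: step_def)
qed

lemma step_zero: "t \<le> 0 \<Longrightarrow> step n c t = 0"
  unfolding step_def
proof (rule sum.neutral, rule ballI)
  fix k assume "t \<le> 0"
  then show "indicator {grid n k<..grid n (Suc k)} t * c k = 0"
    using grid_mono[of 0 k n] by (auto simp: indicator_def)
qed

lemma grid_cell:
  assumes "n > 0" "0 < t" "t \<le> T"
  obtains k where "k < n" "t \<in> {grid n k<..grid n (Suc k)}"
proof -
  define i where "i = (LEAST i. t \<le> grid n i)"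
  have ex: "t \<le> grid n n" using assms by simp
  have i: "t \<le> grid n i" unfolding i_def by (rule LeastI[of _ n]) (rule ex)
  have "i \<noteq> 0" using i assms by (cases i) auto
  then obtain k where k: "i = Suc k" by (cases i) auto
  have "i \<le> n" unfolding i_def by (rule Least_le) (rule ex)
  moreover have "\<not> t \<le> grid n k" using not_less_Least[of k "\<lambda>i. t \<le> grid n i"] k by (auto simp: i_def)
  ultimately show thesis using k i by (intro that[of k]) auto
qed

lemma step_cases:
  assumes "n > 0" "t \<in> {0..T}"
  obtains "t = 0" | k where "k < n" "t \<in> {grid n k<..grid n (Suc k)}"
proof (cases "t = 0")
  case False
  then have "0 < t" "t \<le> T" using assms(2) by auto
  with grid_cell[OF assms(1)] that(2) show thesis by blast
qed (rule that(1))

lemma step_refine: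
  assumes "N > 0" "m > 0" "t \<in> {0..T}"
  shows "step (N * m) (\<lambda>k. c (k div m)) t = step N c t"
proof -
  have "N * m > 0" using assms by simp
  from this assms(3) show ?thesis
  proof (cases rule: step_cases)
    case 1
    then show ?thesis by (simp add: step_zero)
  next
    case (2 k)
    let ?d = "T / real (N * m)"
    have d: "?d > 0" using assms T_pos by simp
    have g: "grid N j = real (j * m) * ?d" for j using assms by (simp add: grid_def)
    have k: "k div m < N" using 2(1) assms by (simp add: less_mult_imp_div_less)
    have "k div m * m \<le> k" by simp
    then have "real (k div m * m) * ?d \<le> real k * ?d" using d by (intro mult_right_mono) (auto simp del: of_nat_mult)
    moreover have "Suc k \<le> Suc (k div m) * m"
      using assms(2) by (metis Suc_leI div_mult_mod_eq mult_Suc mod_less_divisor nat_add_left_cancel_less add.commute)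
    then have "real (Suc k) * ?d \<le> real (Suc (k div m) * m) * ?d" using d by (intro mult_right_mono) (auto simp del: of_nat_mult of_nat_Suc)
    ultimately have "t \<in> {grid N (k div m)<..grid N (Suc (k div m))}"
      using 2(2) unfolding g by (auto simp: grid_def simp del: of_nat_mult of_nat_Suc)
    with k show ?thesis using step_value[OF 2] step_value[OF k] by simp
  qed
qed

lemma step_linear:
  "step n (\<lambda>k. c k + d k) t = step n c t + step n d t"
  "step n (\<lambda>k. c k - d k) t = step n c t - step n d t"
  "step n (\<lambda>k. x * c k) t = x * step n c t"
  unfolding step_def
  by (simp_all only: distrib_left right_diff_distrib sum.distrib sum_subtractf sum_distrib_left mult.left_commute[of x])

lemma step_square: 
  assumes "n > 0" "t \<in> {0..T}"
  shows "(step n c t)\<^sup>2 = step n (\<lambda>k. (c k)\<^sup>2) t"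
  using assms
proof (cases rule: step_cases)
  case 1
  then show ?thesis by (simp add: step_zero)
next
  case (2 k)
  then show ?thesis by (simp add: step_value)
qed

lemma indicator_cell_integral:
  assumes "0 \<le> a" "a \<le> b" "b \<le> T"
  shows "(\<integral>t. indicator {a<..b} t \<partial>TM) = b - a" "integrable TM (\<lambda>t. indicat_real {a<..b} t)"
proof -
  have "{a<..b} \<inter> space TM = {a<..b}" using assms by auto
  moreover have "{a<..b} \<in> sets TM" using assms by (subst sets_restrict_space_iff) auto
  moreover have "measure TM {a<..b} = b - a" using assms by (subst measure_restrict_space) auto
  ultimately show "(\<integral>t. indicator {a<..b} t \<partial>TM) = b - a" "integrable TM (\<lambda>t. indicat_real {a<..b} t)"
    using TM.emeasure_finite[of "{a<..b}"] by (auto simp: less_top[symmetric])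
qed

lemma step_integral:
  assumes "n > 0"
  shows "(\<integral>t. step n c t \<partial>TM) = T / real n * (\<Sum>k<n. c k)" "integrable TM (step n c)"
proof -
  have *: "(\<integral>t. indicator {grid n k<..grid n (Suc k)} t \<partial>TM) = T / real n"
    "integrable TM (\<lambda>t. indicat_real {grid n k<..grid n (Suc k)} t)" if "k < n" for k
    using indicator_cell_integral[of "grid n k" "grid n (Suc k)"] grid_range[OF assms, of k] grid_range[OF assms, of "Suc k"]
      grid_mono[of k "Suc k" n] that by (auto simp: grid_Suc)
  show "integrable TM (step n c)" unfolding step_def[abs_def] using * by (intro Bochner_Integration.integrable_sum integrable_mult_left) auto
  show "(\<integral>t. step n c t \<partial>TM) = T / real n * (\<Sum>k<n. c k)"
    unfolding step_def using * by (subst Bochner_Integration.integral_sum) (auto simp: sum_distrib_left)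
qed

lemma step_square_integral:
  assumes "n > 0"
  shows "(\<integral>t. (step n c t)\<^sup>2 \<partial>TM) = T / real n * (\<Sum>k<n. (c k)\<^sup>2)" "integrable TM (\<lambda>t. (step n c t)\<^sup>2)"
proof -
  have "(\<integral>t. (step n c t)\<^sup>2 \<partial>TM) = (\<integral>t. step n (\<lambda>k. (c k)\<^sup>2) t \<partial>TM)"
    by (rule Bochner_Integration.integral_cong) (use step_square[OF assms] in auto)
  then show "(\<integral>t. (step n c t)\<^sup>2 \<partial>TM) = T / real n * (\<Sum>k<n. (c k)\<^sup>2)" using step_integral[OF assms] by simp
  show "integrable TM (\<lambda>t. (step n c t)\<^sup>2)"
    using step_integral(2)[OF assms, of "\<lambda>k. (c k)\<^sup>2"]
    by (rule Bochner_Integration.integrable_cong[THEN iffD1, rotated 2]) (use step_square[OF assms] in auto)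
qed

text \<open>
  The mean of \<open>f\<close> over the cell before \<open>grid n k\<close>, and \<open>0\<close> for \<open>k = 0\<close>. On the cell after \<open>grid n k\<close> it
  stands for \<open>f\<close>; the delay by one cell keeps the approximation of an adapted process adapted.
\<close>

definition average :: "nat \<Rightarrow> (real \<Rightarrow> real) \<Rightarrow> nat \<Rightarrow> real" where
  "average n f k = real n / T * ((\<integral>s. indicator {0..grid n k} s * f s \<partial>TM) - (\<integral>s. indicator {0..grid n (k - 1)} s * f s \<partial>TM))"

lemma integrable_cell:
  fixes f :: "real \<Rightarrow> real"
  assumes "integrable TM f"
  shows "integrable TM (\<lambda>s. indicator {a..b} s * f s)" "integrable TM (\<lambda>s. indicator {a<..b} s * f s)"
proof -
  have *: "integrable TM (\<lambda>s. indicator S s * f s)" if S: "S \<in> sets borel" for S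
  proof -
    have "indicat_real S \<in> borel_measurable TM" by (intro measurable_restrict_space1 borel_measurable_indicator) (use S in simp)
    moreover have "\<bar>indicat_real S s * f s\<bar> \<le> \<bar>f s\<bar>" for s by (simp add: indicator_def)
    ultimately show ?thesis
      using assms by (intro Bochner_Integration.integrable_bound[OF assms]) auto
  qed
  show "integrable TM (\<lambda>s. indicator {a..b} s * f s)" "integrable TM (\<lambda>s. indicator {a<..b} s * f s)"
    by (rule *; simp)+
qed

lemma average_cell:
  assumes "integrable TM f"
  shows "average n f k = real n / T * (\<integral>s. indicator {grid n (k - 1)<..grid n k} s * f s \<partial>TM)"
proof -
  have g: "0 \<le> grid n (k - 1)" "grid n (k - 1) \<le> grid n k" using grid_mono[of 0 "k - 1" n] grid_mono[of "k - 1" k n] by auto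
  have "(\<integral>s. indicator {0..grid n k} s * f s \<partial>TM) - (\<integral>s. indicator {0..grid n (k - 1)} s * f s \<partial>TM)
     = (\<integral>s. indicator {0..grid n k} s * f s - indicator {0..grid n (k - 1)} s * f s \<partial>TM)"
    using integrable_cell[OF assms] by simp
  also have "\<dots> = (\<integral>s. indicator {grid n (k - 1)<..grid n k} s * f s \<partial>TM)"
    by (rule Bochner_Integration.integral_cong) (use g in \<open>auto simp: indicator_def\<close>)
  finally show ?thesis by (simp add: average_def)
qed

lemma TM_L2_L1:
  fixes f :: "real \<Rightarrow> real"
  assumes "f \<in> borel_measurable TM" "integrable TM (\<lambda>s. (f s)\<^sup>2)"
  shows "integrable TM f"
proof (rule Bochner_Integration.integrable_bound[of TM "\<lambda>s. (f s)\<^sup>2 + 1"])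
  show "AE x in TM. norm (f x) \<le> norm ((f x)\<^sup>2 + 1)"
    using real_product_le_squares[of "f _" 1] by (intro AE_I2) auto
qed (use assms in auto)

lemma cell_cauchy_schwarz:
  fixes f :: "real \<Rightarrow> real"
  assumes f: "f \<in> borel_measurable TM" "integrable TM (\<lambda>s. (f s)\<^sup>2)" and ab: "0 \<le> a" "a \<le> b" "b \<le> T"
  shows "(\<integral>s. indicator {a<..b} s * f s \<partial>TM)\<^sup>2 \<le> (b - a) * (\<integral>s. indicator {a<..b} s * (f s)\<^sup>2 \<partial>TM)"
proof (cases "a = b")
  case False
  then have lt: "0 < b - a" using ab by auto
  note i = integrable_cell(2)[OF TM_L2_L1[OF f], of a b] integrable_cell(2)[OF f(2), of a b] indicator_cell_integral[OF ab]
  define m where "m = (\<integral>s. indicator {a<..b} s * f s \<partial>TM) / (b - a)"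
  have "0 \<le> (\<integral>s. indicator {a<..b} s * (f s - m)\<^sup>2 \<partial>TM)" by (intro Bochner_Integration.integral_nonneg) auto
  also have "\<dots> = (\<integral>s. indicator {a<..b} s * (f s)\<^sup>2 - 2 * m * (indicator {a<..b} s * f s) + m\<^sup>2 * indicator {a<..b} s \<partial>TM)"
    by (rule Bochner_Integration.integral_cong) (auto simp: power2_diff algebra_simps)
  also have "\<dots> = (\<integral>s. indicator {a<..b} s * (f s)\<^sup>2 \<partial>TM) - 2 * m * (\<integral>s. indicator {a<..b} s * f s \<partial>TM) + m\<^sup>2 * (b - a)"
    using i by simp
  also have "\<dots> = (\<integral>s. indicator {a<..b} s * (f s)\<^sup>2 \<partial>TM) - (\<integral>s. indicator {a<..b} s * f s \<partial>TM)\<^sup>2 / (b - a)"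
  proof -
    have "x - 2 * (y / q) * y + (y / q)\<^sup>2 * q = x - y\<^sup>2 / q" if "0 < q" for x y q :: real
      using that by (simp add: power2_eq_square field_simps)
    then show ?thesis using lt by (simp only: m_def)
  qed
  finally have "(\<integral>s. indicator {a<..b} s * f s \<partial>TM)\<^sup>2 / (b - a) \<le> (\<integral>s. indicator {a<..b} s * (f s)\<^sup>2 \<partial>TM)" by simp
  then show ?thesis using lt by (simp add: pos_divide_le_eq mult.commute)
qed simp

text \<open>The Cauchy-Schwarz inequality on each cell.\<close>

lemma average_contraction:
  fixes f :: "real \<Rightarrow> real"
  assumes f: "f \<in> borel_measurable TM" "integrable TM (\<lambda>s. (f s)\<^sup>2)"
  shows "(\<integral>t. (step (Suc n) (average (Suc n) f) t)\<^sup>2 \<partial>TM) \<le> (\<integral>t. (f t)\<^sup>2 \<partial>TM)"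
proof -
  let ?n = "Suc n"
  define C where "C k = {grid ?n k<..grid ?n (Suc k)}" for k
  have le: "T / real ?n * (average ?n f (Suc k))\<^sup>2 \<le> (\<integral>s. indicator (C k) s * (f s)\<^sup>2 \<partial>TM)" if k: "k < n" for k
  proof -
    have "(\<integral>s. indicator (C k) s * f s \<partial>TM)\<^sup>2 \<le> (grid ?n (Suc k) - grid ?n k) * (\<integral>s. indicator (C k) s * (f s)\<^sup>2 \<partial>TM)"
      unfolding C_def using grid_range[of ?n k] grid_range[of ?n "Suc k"] grid_mono[of k "Suc k" ?n] k
      by (intro cell_cauchy_schwarz f) auto
    then have A: "(\<integral>s. indicator (C k) s * f s \<partial>TM)\<^sup>2 \<le> T / real ?n * (\<integral>s. indicator (C k) s * (f s)\<^sup>2 \<partial>TM)"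
      by (simp add: grid_Suc)
    have B: "average ?n f (Suc k) = real ?n / T * (\<integral>s. indicator (C k) s * f s \<partial>TM)"
      using average_cell[OF TM_L2_L1[OF f]] by (simp add: C_def)
    have gen: "p * (inverse p * I)\<^sup>2 \<le> J" if "I\<^sup>2 \<le> p * J" "0 < p" for p I J :: real
    proof -
      have "p * (inverse p * I)\<^sup>2 = inverse p * I\<^sup>2" using that(2) by (simp add: power2_eq_square)
      also have "\<dots> \<le> inverse p * (p * J)" using that by (intro mult_left_mono) auto
      also have "\<dots> = J" using that(2) by simp
      finally show ?thesis .
    qed
    have eq: "real ?n / T = inverse (T / real ?n)" and pos: "0 < T / real ?n" using T_pos by auto
    show ?thesis unfolding B eq by (rule gen[OF A pos])
  qed
  have a0: "average ?n f 0 = 0" by (simp add: average_def)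
  have ic: "integrable TM (\<lambda>s. indicator (C k) s * (f s)\<^sup>2)" for k unfolding C_def by (rule integrable_cell(2)[OF f(2)])
  have "(\<integral>t. (step ?n (average ?n f) t)\<^sup>2 \<partial>TM) = T / real ?n * (\<Sum>k<Suc n. (average ?n f k)\<^sup>2)"
    by (rule step_square_integral) simp
  also have "\<dots> = (\<Sum>k<n. T / real ?n * (average ?n f (Suc k))\<^sup>2)"
    by (subst sum.lessThan_Suc_shift) (simp add: a0 sum_distrib_left del: of_nat_Suc)
  also have "\<dots> \<le> (\<Sum>k<n. \<integral>s. indicator (C k) s * (f s)\<^sup>2 \<partial>TM)" by (intro sum_mono le) auto
  also have "\<dots> = (\<integral>s. (\<Sum>k<n. indicator (C k) s * (f s)\<^sup>2) \<partial>TM)"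
    using ic by (intro Bochner_Integration.integral_sum[symmetric]) auto
  also have "\<dots> \<le> (\<integral>s. (f s)\<^sup>2 \<partial>TM)"
  proof (rule integral_mono)
    fix s assume s: "s \<in> space TM"
    have "(\<Sum>k<n. indicat_real (C k) s) \<le> (\<Sum>k<Suc n. indicator (C k) s * 1)"
      by simp
    also have "\<dots> = step ?n (\<lambda>_. 1) s" by (simp add: step_def C_def)
    also have "\<dots> \<le> 1"
    proof -
      have "?n > 0" "s \<in> {0..T}" using s by auto
      then show ?thesis by (cases rule: step_cases) (auto simp: step_zero step_value)
    qed
    finally have "(\<Sum>k<n. indicat_real (C k) s) * (f s)\<^sup>2 \<le> 1 * (f s)\<^sup>2" by (intro mult_right_mono) auto
    then show "(\<Sum>k<n. indicator (C k) s * (f s)\<^sup>2) \<le> (f s)\<^sup>2" by (simp only: sum_distrib_right mult_1)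
  next
    show "integrable TM (\<lambda>s. \<Sum>k<n. indicator (C k) s * (f s)\<^sup>2)" by (intro Bochner_Integration.integrable_sum ic)
  qed (rule f(2))
  finally show ?thesis .
qed

lemma average_add:
  assumes "integrable TM f" "integrable TM h"
  shows "average n (\<lambda>s. f s + h s) k = average n f k + average n h k"
  using integrable_cell(1)[OF assms(1)] integrable_cell(1)[OF assms(2)]
  by (simp add: average_def distrib_left right_diff_distrib)

lemma average_cmult: "average n (\<lambda>s. c * f s) k = c * average n f k"
  by (simp add: average_def mult.left_commute[of _ c] right_diff_distrib)

lemma sets_TM_generator:
  "sets TM = sigma_sets (space TM) ((\<lambda>a. {0..T} \<inter> {..a}) ` UNIV)"
proof -
  have b: "sets (borel :: real measure) = sigma_sets UNIV (range atMost)"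
    by (subst borel_eq_atMost) simp
  have "sets TM = (\<inter>) {0..T} ` sigma_sets UNIV (range atMost)"
    by (simp add: sets_restrict_space b[symmetric])
  also have "\<dots> = sigma_sets {0..T} ((\<inter>) {0..T} ` range atMost)"
    by (rule sigma_sets_Int) (auto simp flip: b)
  also have "(\<inter>) {0..T} ` range atMost = (\<lambda>a. {0..T} \<inter> {..a}) ` UNIV" by (auto simp: image_image)
  finally show ?thesis by simp
qed

text \<open>Only the first cell and the two cells around the jump contribute.\<close>

lemma average_indicator_error:
  fixes f :: "real \<Rightarrow> real"
  assumes f: "f = indicator ({0..T} \<inter> {..a})"
  shows "(\<integral>t. (f t - step (Suc n) (average (Suc n) f) t)\<^sup>2 \<partial>TM) \<le> 3 * (T / real (Suc n))"
proof -
  let ?n = "Suc n" let ?d = "T / real (Suc n)"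
  have d: "0 < ?d" using T_pos by simp
  have I: "(\<integral>s. indicator {0..x} s * f s \<partial>TM) = max 0 (min x a)" if x: "x \<in> {0..T}" for x
  proof -
    have "(\<integral>s. indicator {0..x} s * f s \<partial>TM) = (\<integral>s. indicator {0..min x a} s \<partial>TM)"
      by (rule Bochner_Integration.integral_cong) (use x in \<open>auto simp: f indicator_def\<close>)
    also have "\<dots> = measure TM {0..min x a}"
    proof -
      have e: "{0..min x a} \<inter> space TM = {0..min x a}" using x by auto
      show ?thesis by (simp only: Bochner_Integration.integral_indicator e)
    qed
    also have "\<dots> = max 0 (min x a)" using x by (subst measure_restrict_space) auto
    finally show ?thesis .
  qed
  have av: "average ?n f k = real ?n / T * (max 0 (min (grid ?n k) a) - max 0 (min (grid ?n (k - 1)) a))" if "k < ?n" for k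
    unfolding average_def using I grid_range[of ?n k] grid_range[of ?n "k - 1"] that by simp
  have av01: "0 \<le> average ?n f k \<and> average ?n f k \<le> 1" if k: "k < ?n" for k
  proof -
    have g: "0 \<le> grid ?n (k - 1)" "grid ?n (k - 1) \<le> grid ?n k" "grid ?n k \<le> grid ?n (k - 1) + ?d"
      using grid_mono[of 0 "k - 1" ?n] grid_mono[of "k - 1" k ?n] grid_Suc[of ?n "k - 1"] d by (cases k; auto)+
    then have x: "0 \<le> max 0 (min (grid ?n k) a) - max 0 (min (grid ?n (k - 1)) a)"
      "max 0 (min (grid ?n k) a) - max 0 (min (grid ?n (k - 1)) a) \<le> ?d" using d by (auto simp: max_def min_def)
    have gen: "0 \<le> inverse q * x \<and> inverse q * x \<le> 1" if "0 \<le> x" "x \<le> q" "0 < q" for x q :: real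
      using that by (simp add: field_simps)
    have eq: "real ?n / T = inverse ?d" by simp
    show ?thesis unfolding av[OF k] eq by (rule gen[OF x d])
  qed
  have f01: "0 \<le> f t \<and> f t \<le> 1" for t by (auto simp: f indicator_def)
  have le: "(f t - step ?n (average ?n f) t)\<^sup>2 \<le> indicator {0..?d} t + indicator {a..a + 2 * ?d} t" if t: "t \<in> space TM" for t
  proof -
    have "?n > 0" "t \<in> {0..T}" using t by auto
    then show ?thesis
    proof (cases rule: step_cases)
      case 1
      then have "(f t - step ?n (average ?n f) t)\<^sup>2 \<le> 1" using f01[of t] by (simp add: step_zero abs_square_le_1)
      moreover have "1 \<le> indicat_real {0..?d} t + indicat_real {a..a + 2 * ?d} t"
        using 1 d by (auto simp: indicator_def)
      ultimately show ?thesis by linarith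
    next
      case (2 k)
      have st: "step ?n (average ?n f) t = average ?n f k" by (rule step_value[OF 2])
      have sq: "(f t - average ?n f k)\<^sup>2 \<le> 1"
      proof -
        have "\<bar>f t - average ?n f k\<bar> \<le> 1" using f01[of t] av01[OF 2(1)] by linarith
        then show ?thesis by (simp only: abs_square_le_1)
      qed
      show ?thesis
      proof (cases "t \<le> ?d \<or> (a \<le> t \<and> t \<le> a + 2 * ?d)")
        case True
        then have "1 \<le> indicat_real {0..?d} t + indicat_real {a..a + 2 * ?d} t"
          using t by (auto simp: indicator_def)
        then show ?thesis unfolding st by (rule order_trans[OF sq])
      next
        case False
        have "k \<noteq> 0" using False 2(2) by (cases k) (auto simp: grid_Suc)
        then obtain j where j: "k = Suc j" by (cases k) auto
        have gj: "grid ?n k = grid ?n j + ?d" "0 \<le> grid ?n j" using j grid_Suc grid_mono[of 0 j ?n] by auto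
        have tk: "grid ?n k < t" "t \<le> grid ?n k + ?d" using 2(2) by (auto simp: grid_Suc)
        have "f t = average ?n f k"
        proof (cases "t < a")
          case True
          then have "f t = 1" using t by (auto simp: f)
          moreover have "average ?n f k = real ?n / T * ?d"
            unfolding av[OF 2(1)] using j gj tk True d by (simp add: max_def min_def)
          ultimately show ?thesis using T_pos by simp
        next
          case False2: False
          then have ta: "a + 2 * ?d < t" using False by auto
          then have "f t = 0" using d by (auto simp: f)
          moreover have "average ?n f k = 0"
            unfolding av[OF 2(1)] using j gj tk ta d by (simp add: max_def min_def)
          ultimately show ?thesis by simp
        qed
        then show ?thesis using st by simp
      qed
    qed
  qed
  have fi: "f \<in> borel_measurable TM" unfolding f by (intro measurable_restrict_space1) auto
  have m: "(\<lambda>t. (f t - step ?n (average ?n f) t)\<^sup>2) \<in> borel_measurable TM"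
    using fi step_integral(2)[of ?n "average ?n f"] by auto
  have ii: "integrable TM (indicat_real {x..y})" for x y
  proof -
    have "indicat_real {x..y} \<in> borel_measurable TM" by (intro measurable_restrict_space1) auto
    then show ?thesis by (intro TM.integrable_const_bound[where B=1]) (auto simp: indicator_def)
  qed
  have mi: "(\<integral>t. indicat_real {x..y} t \<partial>TM) \<le> y - x" if "x \<le> y" for x y
  proof -
    have "(\<integral>t. indicat_real {x..y} t \<partial>TM) = (LBINT t. indicator {0..T} t * indicat_real {x..y} t)"
      by (subst integral_restrict_space) (simp, simp only: real_scaleR_def)
    also have "\<dots> \<le> (LBINT t. indicat_real {x..y} t)"
    proof (rule integral_mono)
      have *: "integrable lborel (indicat_real {u..v})" for u v :: real
        by (intro integrable_real_indicator) (auto simp: emeasure_lborel_Icc_eq)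
      have "(\<lambda>t. indicator {0..T} t * indicat_real {x..y} t) = indicator {max 0 x..min T y}"
        by (auto simp: indicator_def fun_eq_iff)
      then show "integrable lborel (\<lambda>t. indicator {0..T} t * indicat_real {x..y} t)" using * by simp
      show "integrable lborel (indicat_real {x..y})" by (rule *)
      show "indicator {0..T} t * indicat_real {x..y} t \<le> indicat_real {x..y} t" for t
        by (simp add: indicator_def)
    qed
    also have "\<dots> = y - x" using that by simp
    finally show ?thesis .
  qed
  have "(\<integral>t. (f t - step ?n (average ?n f) t)\<^sup>2 \<partial>TM) \<le> (\<integral>t. indicator {0..?d} t + indicator {a..a + 2 * ?d} t \<partial>TM)"
  proof (rule integral_mono)
    show "integrable TM (\<lambda>t. (f t - step ?n (average ?n f) t)\<^sup>2)"
      by (rule Bochner_Integration.integrable_bound[of TM "\<lambda>t. indicat_real {0..?d} t + indicator {a..a + 2 * ?d} t"])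
         (use ii m le in \<open>auto intro!: AE_I2\<close>)
  qed (use ii le in auto)
  also have "\<dots> = (\<integral>t. indicator {0..?d} t \<partial>TM) + (\<integral>t. indicator {a..a + 2 * ?d} t \<partial>TM)" using ii by simp
  also have "\<dots> \<le> ?d + 2 * ?d" using mi[of 0 ?d] mi[of a "a + 2 * ?d"] d by auto
  finally show ?thesis by simp
qed

text \<open>
  The approximation is linear and contracts in \<open>L\<^sup>2\<close>, so it is enough to know the convergence on a
  \<open>\<pi>\<close>-system of indicators.
\<close>

lemma average_converges:
  fixes f :: "real \<Rightarrow> real"
  assumes f: "f \<in> borel_measurable TM" "integrable TM (\<lambda>s. (f s)\<^sup>2)"
  shows "(\<lambda>n. \<integral>t. (f t - step (Suc n) (average (Suc n) f) t)\<^sup>2 \<partial>TM) \<longlonglongrightarrow> 0"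
proof -
  let ?e = "\<lambda>f n. \<integral>t. (f t - step (Suc n) (average (Suc n) f) t)\<^sup>2 \<partial>TM"
  let ?L = "\<lambda>f :: real \<Rightarrow> real. f \<in> borel_measurable TM \<and> integrable TM (\<lambda>s. (f s)\<^sup>2)"
  have dint: "integrable TM (\<lambda>t. (h t)\<^sup>2) \<Longrightarrow> h \<in> borel_measurable TM \<Longrightarrow> integrable TM (\<lambda>t. (u t)\<^sup>2) \<Longrightarrow> u \<in> borel_measurable TM
     \<Longrightarrow> integrable TM (\<lambda>t. (h t + u t)\<^sup>2)" for h u :: "real \<Rightarrow> real"
  proof (rule Bochner_Integration.integrable_bound[of TM "\<lambda>t. 2 * (h t)\<^sup>2 + 2 * (u t)\<^sup>2"])
    show "AE t in TM. norm ((h t + u t)\<^sup>2) \<le> norm (2 * (h t)\<^sup>2 + 2 * (u t)\<^sup>2)"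
      using square_sum_le by auto
  qed auto
  have sm: "step (Suc n) c \<in> borel_measurable TM" for n c using step_integral(2)[of "Suc n" c] by auto
  have di: "integrable TM (\<lambda>t. (h t - step (Suc n) c t)\<^sup>2)" if "?L h" for h n c
    using dint[of h "\<lambda>t. - step (Suc n) c t"] that step_square_integral(2)[of "Suc n" c] sm by auto
  have "?L f \<and> ?e f \<longlonglongrightarrow> 0"
  proof (rule TM.l2_induct[OF sets_TM_generator, where P="\<lambda>f. ?L f \<and> ?e f \<longlonglongrightarrow> 0"])
    show "Int_stable ((\<lambda>a. {0..T} \<inter> {..a}) ` UNIV)"
    proof (rule Int_stableI, clarify)
      fix a b show "{0..T} \<inter> {..a} \<inter> ({0..T} \<inter> {..b}) \<in> (\<lambda>a. {0..T} \<inter> {..a}) ` UNIV"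
        by (intro image_eqI[of _ _ "min a b"]) auto
    qed
    show "(\<lambda>a. {0..T} \<inter> {..a}) ` UNIV \<subseteq> Pow (space TM)" by auto
    have ind: "?L (indicator ({0..T} \<inter> {..a})) \<and> ?e (indicator ({0..T} \<inter> {..a})) \<longlonglongrightarrow> 0" for a
    proof (intro conjI)
      show m: "indicat_real ({0..T} \<inter> {..a}) \<in> borel_measurable TM" by (intro measurable_restrict_space1) auto
      have "(indicat_real ({0..T} \<inter> {..a}) s)\<^sup>2 \<le> 1" for s by (auto simp: indicator_def)
      then show "integrable TM (\<lambda>s. (indicat_real ({0..T} \<inter> {..a}) s)\<^sup>2)"
        using m by (intro TM.integrable_const_bound[where B=1]) auto
      show "?e (indicator ({0..T} \<inter> {..a})) \<longlonglongrightarrow> 0"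
      proof (rule Lim_null_comparison)
        show "\<forall>\<^sub>F n in sequentially. norm (?e (indicator ({0..T} \<inter> {..a})) n) \<le> 3 * (T / real (Suc n))"
          using average_indicator_error[OF refl, of a] by (intro always_eventually) auto
        have "(\<lambda>n. 3 * (T * inverse (real (Suc n)))) \<longlonglongrightarrow> 3 * (T * 0)"
          by (intro tendsto_intros LIMSEQ_inverse_real_of_nat)
        then show "(\<lambda>n. 3 * (T / real (Suc n))) \<longlonglongrightarrow> 0" by (simp add: divide_inverse)
      qed
    qed
    show "?L (indicator A) \<and> ?e (indicator A) \<longlonglongrightarrow> 0" if "A \<in> (\<lambda>a. {0..T} \<inter> {..a}) ` UNIV" for A
      using that ind by auto
    show "?L (indicator (space TM)) \<and> ?e (indicator (space TM)) \<longlonglongrightarrow> 0"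
    proof -
      have "{0..T} \<inter> {..T} = space TM" by auto
      then show ?thesis using ind[of T] by simp
    qed
  next
    fix h u :: "real \<Rightarrow> real" assume h: "?L h \<and> ?e h \<longlonglongrightarrow> 0" and u: "?L u \<and> ?e u \<longlonglongrightarrow> 0"
    have hu: "?L (\<lambda>x. h x + u x)" using dint[of h u] h u by auto
    moreover have "?e (\<lambda>x. h x + u x) \<longlonglongrightarrow> 0"
    proof (rule Lim_null_comparison)
      have "?e (\<lambda>x. h x + u x) n \<le> 2 * ?e h n + 2 * ?e u n" for n
      proof -
        have sp: "h t + u t - step (Suc n) (average (Suc n) (\<lambda>x. h x + u x)) t =
          (h t - step (Suc n) (average (Suc n) h) t) + (u t - step (Suc n) (average (Suc n) u) t)" for t
        proof -
          have "average (Suc n) (\<lambda>x. h x + u x) = (\<lambda>k. average (Suc n) h k + average (Suc n) u k)"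
            using average_add[OF TM_L2_L1 TM_L2_L1, of h u] h u by (intro ext) auto
          then show ?thesis by (simp add: step_linear)
        qed
        have pt: "(h t + u t - step (Suc n) (average (Suc n) (\<lambda>x. h x + u x)) t)\<^sup>2 \<le>
           2 * (h t - step (Suc n) (average (Suc n) h) t)\<^sup>2 + 2 * (u t - step (Suc n) (average (Suc n) u) t)\<^sup>2" for t
          unfolding sp by (rule square_sum_le)
        then have "?e (\<lambda>x. h x + u x) n \<le> (\<integral>t. 2 * (h t - step (Suc n) (average (Suc n) h) t)\<^sup>2 + 2 * (u t - step (Suc n) (average (Suc n) u) t)\<^sup>2 \<partial>TM)"
          using di[OF hu, of n "average (Suc n) (\<lambda>x. h x + u x)"] di[of h n "average (Suc n) h"] di[of u n "average (Suc n) u"] h u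
          by (intro integral_mono pt) auto
        also have "\<dots> = 2 * ?e h n + 2 * ?e u n" using di h u by simp
        finally show ?thesis .
      qed
      then show "\<forall>\<^sub>F n in sequentially. norm (?e (\<lambda>x. h x + u x) n) \<le> 2 * ?e h n + 2 * ?e u n"
        by (intro always_eventually) auto
      have "(\<lambda>n. 2 * ?e h n + 2 * ?e u n) \<longlonglongrightarrow> 2 * 0 + 2 * 0" using h u by (intro tendsto_intros) auto
      then show "(\<lambda>n. 2 * ?e h n + 2 * ?e u n) \<longlonglongrightarrow> 0" by simp
    qed
    ultimately show "?L (\<lambda>x. h x + u x) \<and> ?e (\<lambda>x. h x + u x) \<longlonglongrightarrow> 0" by simp
  next
    fix c and h :: "real \<Rightarrow> real" assume h: "?L h \<and> ?e h \<longlonglongrightarrow> 0"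
    have "?e (\<lambda>x. c * h x) = (\<lambda>n. c\<^sup>2 * ?e h n)"
    proof
      fix n
      have "(c * h t - step (Suc n) (average (Suc n) (\<lambda>x. c * h x)) t)\<^sup>2 = c\<^sup>2 * (h t - step (Suc n) (average (Suc n) h) t)\<^sup>2" for t
      proof -
        have "average (Suc n) (\<lambda>x. c * h x) = (\<lambda>k. c * average (Suc n) h k)" by (rule ext) (rule average_cmult)
        then show ?thesis by (simp only: step_linear power_mult_distrib right_diff_distrib[symmetric])
      qed
      then show "?e (\<lambda>x. c * h x) n = c\<^sup>2 * ?e h n" by simp
    qed
    then show "?L (\<lambda>x. c * h x) \<and> ?e (\<lambda>x. c * h x) \<longlonglongrightarrow> 0"
      using h tendsto_mult_right_zero[of "?e h" sequentially "c\<^sup>2"] by (auto simp: power_mult_distrib)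
  next
    fix h :: "real \<Rightarrow> real" and s
    assume s: "\<And>m::nat. ?L (s m) \<and> ?e (s m) \<longlonglongrightarrow> 0" and h: "h \<in> borel_measurable TM" "integrable TM (\<lambda>x. (h x)\<^sup>2)"
      and lim: "(\<lambda>m. \<integral>x. (h x - s m x)\<^sup>2 \<partial>TM) \<longlonglongrightarrow> 0"
    have le: "?e h n \<le> 6 * (\<integral>x. (h x - s m x)\<^sup>2 \<partial>TM) + 4 * ?e (s m) n" for n m
    proof -
      let ?w = "\<lambda>x. h x - s m x" let ?A = "\<lambda>f. step (Suc n) (average (Suc n) f)"
      have w: "?L ?w" using dint[of h "\<lambda>x. - s m x"] h s[of m] by auto
      have "?A h t = ?A ?w t + ?A (s m) t" for t
      proof -
        have "average (Suc n) (\<lambda>x. ?w x + s m x) = (\<lambda>k. average (Suc n) ?w k + average (Suc n) (s m) k)"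
          using average_add[OF TM_L2_L1 TM_L2_L1, of ?w "s m"] w s[of m] by (intro ext) auto
        then show ?thesis by (simp add: step_linear(1)[symmetric])
      qed
      then have "(h t - ?A h t)\<^sup>2 \<le> 2 * (?w t)\<^sup>2 + 4 * (s m t - ?A (s m) t)\<^sup>2 + 4 * (?A ?w t)\<^sup>2" for t
        using square_sum_le[of "?w t" "s m t - ?A (s m) t - ?A ?w t"] square_sum_le[of "s m t - ?A (s m) t" "- ?A ?w t"]
        by (simp add: algebra_simps)
      then have "?e h n \<le> (\<integral>t. 2 * (?w t)\<^sup>2 + 4 * (s m t - ?A (s m) t)\<^sup>2 + 4 * (?A ?w t)\<^sup>2 \<partial>TM)"
        using di[of h] di[of "s m"] h s[of m] w step_square_integral(2)[of "Suc n"]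
        by (intro integral_mono) auto
      also have "\<dots> = 2 * (\<integral>t. (?w t)\<^sup>2 \<partial>TM) + 4 * ?e (s m) n + 4 * (\<integral>t. (?A ?w t)\<^sup>2 \<partial>TM)"
        using di[of "s m"] s[of m] w step_square_integral(2)[of "Suc n"] by simp
      also have "(\<integral>t. (?A ?w t)\<^sup>2 \<partial>TM) \<le> (\<integral>t. (?w t)\<^sup>2 \<partial>TM)" using w by (intro average_contraction) auto
      finally show ?thesis by simp
    qed
    have "?e h \<longlonglongrightarrow> 0"
    proof (rule LIMSEQ_I)
      fix \<epsilon> :: real assume e: "0 < \<epsilon>"
      obtain m where m: "(\<integral>x. (h x - s m x)\<^sup>2 \<partial>TM) < \<epsilon> / 12"
        using order_tendstoD(2)[OF lim, of "\<epsilon> / 12"] e by (auto dest!: eventually_happens)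
      obtain N where N: "\<And>n. n \<ge> N \<Longrightarrow> ?e (s m) n < \<epsilon> / 8"
        using order_tendstoD(2)[of "?e (s m)" 0 sequentially "\<epsilon> / 8"] s[of m] e by (auto simp: eventually_sequentially)
      have "norm (?e h n - 0) < \<epsilon>" if "n \<ge> N" for n
        using le[of n m] m N[OF that] by simp
      then show "\<exists>N. \<forall>n\<ge>N. norm (?e h n - 0) < \<epsilon>" by blast
    qed
    then show "?L h \<and> ?e h \<longlonglongrightarrow> 0" using h by simp
  qed (use f in auto)
  then show ?thesis by simp
qed

end

section \<open>Density of Lipschitz cylinder functions\<close>

text \<open>
  Bounded Lipschitz functions of finitely many values of a path up to time \<open>t\<close>, generated as an
  algebra so that closure under products and sums is built in.
\<close>

inductive lip_cyl :: "real \<Rightarrow> ((real \<Rightarrow> real) \<Rightarrow> real) \<Rightarrow> bool" for t where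
  const: "lip_cyl t (\<lambda>y. c)"
| add: "lip_cyl t F \<Longrightarrow> lip_cyl t G \<Longrightarrow> lip_cyl t (\<lambda>y. F y + G y)"
| mult: "lip_cyl t F \<Longrightarrow> lip_cyl t G \<Longrightarrow> lip_cyl t (\<lambda>y. F y * G y)"
| atom: "r \<in> {0..t} \<Longrightarrow> (\<And>x. \<bar>\<phi> x\<bar> \<le> C) \<Longrightarrow> (\<And>x x'. \<bar>\<phi> x - \<phi> x'\<bar> \<le> L * \<bar>x - x'\<bar>) \<Longrightarrow> lip_cyl t (\<lambda>y. \<phi> (y r))"

lemma lip_cyl_bounded:
  assumes "lip_cyl t F" obtains C where "C > 0" "\<And>y. \<bar>F y\<bar> \<le> C"
proof -
  have "\<exists>C>0. \<forall>y. \<bar>F y\<bar> \<le> C"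
    using assms
  proof induction
    case (const c)
    then show ?case by (intro exI[of _ "\<bar>c\<bar> + 1"]) auto
  next
    case (add F G)
    then obtain C D where "C > 0" "D > 0" "\<And>y. \<bar>F y\<bar> \<le> C" "\<And>y. \<bar>G y\<bar> \<le> D" by blast
    then show ?case by (intro exI[of _ "C + D"]) (auto intro: order_trans[OF abs_triangle_ineq add_mono])
  next
    case (mult F G)
    then obtain C D where "C > 0" "D > 0" "\<And>y. \<bar>F y\<bar> \<le> C" "\<And>y. \<bar>G y\<bar> \<le> D" by blast
    then have "\<bar>F y * G y\<bar> \<le> C * D" for y unfolding abs_mult by (intro mult_mono) (auto intro: less_imp_le)
    then show ?case using \<open>C > 0\<close> \<open>D > 0\<close> by (intro exI[of _ "C * D"]) auto
  next
    case (atom r \<phi> C L)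
    have "\<bar>\<phi> x\<bar> \<le> \<bar>C\<bar> + 1" for x using atom(2)[of x] by linarith
    then show ?case by (intro exI[of _ "\<bar>C\<bar> + 1"]) auto
  qed
  then show thesis using that by blast
qed

lemma lip_cyl_lipschitz:
  assumes "lip_cyl t F"
  obtains R L where "finite R" "R \<subseteq> {0..t}" "L \<ge> 0" "\<And>y y'. \<bar>F y - F y'\<bar> \<le> L * (\<Sum>r\<in>R. \<bar>y r - y' r\<bar>)"
proof -
  have "\<exists>R L. finite R \<and> R \<subseteq> {0..t} \<and> L \<ge> 0 \<and> (\<forall>y y'. \<bar>F y - F y'\<bar> \<le> L * (\<Sum>r\<in>R. \<bar>y r - y' r\<bar>))"
    using assms
  proof induction
    case (const c)
    then show ?case by (intro exI[of _ "{}"] exI[of _ 0]) auto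
  next
    case (add F G)
    then obtain R L S K where R: "finite R" "R \<subseteq> {0..t}" "L \<ge> 0" "\<And>y y'. \<bar>F y - F y'\<bar> \<le> L * (\<Sum>r\<in>R. \<bar>y r - y' r\<bar>)"
      and S: "finite S" "S \<subseteq> {0..t}" "K \<ge> 0" "\<And>y y'. \<bar>G y - G y'\<bar> \<le> K * (\<Sum>r\<in>S. \<bar>y r - y' r\<bar>)" by blast
    have "\<bar>(F y + G y) - (F y' + G y')\<bar> \<le> (L + K) * (\<Sum>r\<in>R \<union> S. \<bar>y r - y' r\<bar>)" for y y'
    proof -
      have "(\<Sum>r\<in>R. \<bar>y r - y' r\<bar>) \<le> (\<Sum>r\<in>R \<union> S. \<bar>y r - y' r\<bar>)" "(\<Sum>r\<in>S. \<bar>y r - y' r\<bar>) \<le> (\<Sum>r\<in>R \<union> S. \<bar>y r - y' r\<bar>)"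
        using R S by (auto intro!: sum_mono2)
      then have "L * (\<Sum>r\<in>R. \<bar>y r - y' r\<bar>) \<le> L * (\<Sum>r\<in>R \<union> S. \<bar>y r - y' r\<bar>)" "K * (\<Sum>r\<in>S. \<bar>y r - y' r\<bar>) \<le> K * (\<Sum>r\<in>R \<union> S. \<bar>y r - y' r\<bar>)"
        using R S by (auto intro!: mult_left_mono)
      then show ?thesis using R(4)[of y y'] S(4)[of y y'] by (simp add: distrib_right)
    qed
    then show ?case using R S by (intro exI[of _ "R \<union> S"] exI[of _ "L + K"]) auto
  next
    case (mult F G)
    then obtain R L S K where R: "finite R" "R \<subseteq> {0..t}" "L \<ge> 0" "\<And>y y'. \<bar>F y - F y'\<bar> \<le> L * (\<Sum>r\<in>R. \<bar>y r - y' r\<bar>)"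
      and S: "finite S" "S \<subseteq> {0..t}" "K \<ge> 0" "\<And>y y'. \<bar>G y - G y'\<bar> \<le> K * (\<Sum>r\<in>S. \<bar>y r - y' r\<bar>)" by blast
    obtain C where C: "C > 0" "\<And>y. \<bar>F y\<bar> \<le> C" using lip_cyl_bounded[OF mult(1)] by blast
    obtain D where D: "D > 0" "\<And>y. \<bar>G y\<bar> \<le> D" using lip_cyl_bounded[OF mult(2)] by blast
    have "\<bar>F y * G y - F y' * G y'\<bar> \<le> (C * K + D * L) * (\<Sum>r\<in>R \<union> S. \<bar>y r - y' r\<bar>)" for y y'
    proof -
      let ?U = "\<Sum>r\<in>R \<union> S. \<bar>y r - y' r\<bar>"
      have "(\<Sum>r\<in>R. \<bar>y r - y' r\<bar>) \<le> ?U" "(\<Sum>r\<in>S. \<bar>y r - y' r\<bar>) \<le> ?U"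
        using R S by (auto intro!: sum_mono2)
      then have "L * (\<Sum>r\<in>R. \<bar>y r - y' r\<bar>) \<le> L * ?U" "K * (\<Sum>r\<in>S. \<bar>y r - y' r\<bar>) \<le> K * ?U"
        using R S by (auto intro!: mult_left_mono)
      then have 1: "\<bar>F y - F y'\<bar> \<le> L * ?U" "\<bar>G y - G y'\<bar> \<le> K * ?U" using R(4)[of y y'] S(4)[of y y'] by linarith+
      have "F y * G y - F y' * G y' = F y * (G y - G y') + G y' * (F y - F y')" by (simp add: algebra_simps)
      also have "\<bar>\<dots>\<bar> \<le> \<bar>F y\<bar> * \<bar>G y - G y'\<bar> + \<bar>G y'\<bar> * \<bar>F y - F y'\<bar>"
        by (rule order_trans[OF abs_triangle_ineq]) (simp add: abs_mult)
      also have "\<dots> \<le> C * (K * ?U) + D * (L * ?U)"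
        using C D 1 by (intro add_mono mult_mono) auto
      finally show ?thesis by (simp add: algebra_simps)
    qed
    then show ?case using R S C D by (intro exI[of _ "R \<union> S"] exI[of _ "C * K + D * L"]) auto
  next
    case (atom r \<phi> C L)
    have "\<bar>\<phi> (y r) - \<phi> (y' r)\<bar> \<le> \<bar>L\<bar> * (\<Sum>r\<in>{r}. \<bar>y r - y' r\<bar>)" for y y'
      using order_trans[OF atom(3)[of "y r" "y' r"] mult_right_mono[OF abs_ge_self abs_ge_zero]] by simp
    then show ?case using atom(1) by (intro exI[of _ "{r}"] exI[of _ "\<bar>L\<bar>"]) auto
  qed
  then show thesis using that by blast
qed

lemma lip_cyl_cong:
  assumes "lip_cyl t F" "\<And>r. r \<in> {0..t} \<Longrightarrow> y r = y' r"
  shows "F y = F y'"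
  using assms by induction auto

lemma lip_cyl_measurable:
  assumes "lip_cyl t F" "\<And>r. r \<in> {0..t} \<Longrightarrow> (\<lambda>x. y x r) \<in> borel_measurable N"
  shows "(\<lambda>x. F (y x)) \<in> borel_measurable N"
  using assms
proof induction
  case (atom r \<phi> C L)
  have "continuous_on UNIV \<phi>"
  proof (rule lipschitz_on_continuous_on[of "\<bar>L\<bar>"], rule lipschitz_onI)
    fix x x' show "dist (\<phi> x) (\<phi> x') \<le> \<bar>L\<bar> * dist x x'"
      using order_trans[OF atom(3)[of x x'] mult_right_mono[OF abs_ge_self abs_ge_zero]] by (simp add: dist_real_def)
  qed simp
  then have "\<phi> \<in> borel_measurable borel" by (rule borel_measurable_continuous_onI)
  from measurable_compose[OF atom(4)[OF atom(1)] this] show ?case .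
qed auto

lemma lip_cyl_prod:
  assumes "finite K" "\<And>i. i \<in> K \<Longrightarrow> lip_cyl t (F i)"
  shows "lip_cyl t (\<lambda>y. \<Prod>i\<in>K. F i y)"
  using assms by (induction K rule: finite_induct) (auto intro: lip_cyl.intros)

definition ramp :: "nat \<Rightarrow> real \<Rightarrow> real" where
  "ramp n x = max 0 (min 1 (1 - real n * x))"

lemma ramp_bounds: "0 \<le> ramp n x" "ramp n x \<le> 1"
  by (auto simp: ramp_def)

lemma ramp_lipschitz: "\<bar>ramp n x - ramp n x'\<bar> \<le> real n * \<bar>x - x'\<bar>"
proof -
  have "\<bar>max 0 (min 1 (1 - u)) - max 0 (min 1 (1 - u'))\<bar> \<le> \<bar>u - u'\<bar>" for u u' :: real
    by (auto simp: max_def min_def abs_if)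
  from this[of "real n * x" "real n * x'"] show ?thesis
    by (simp add: ramp_def abs_mult flip: right_diff_distrib)
qed

lemma ramp_limit: "(\<lambda>n. ramp n x) \<longlonglongrightarrow> (if x \<le> 0 then 1 else 0)"
proof (cases "x \<le> 0")
  case True
  then have "ramp n x = 1" for n by (auto simp: ramp_def max_def min_def mult_nonneg_nonpos not_le)
  then show ?thesis using True by simp
next
  case False
  obtain N :: nat where N: "1 / x < real N" using reals_Archimedean2 by blast
  have "ramp n x = 0" if "n \<ge> N" for n
  proof -
    have "1 / x < real n" using N that by linarith
    then have "1 < real n * x" using False by (simp add: field_simps)
    then show ?thesis by (simp add: ramp_def)
  qed
  then have "\<forall>\<^sub>F n in sequentially. ramp n x = 0" by (auto simp: eventually_sequentially)
  then show ?thesis using False by (simp add: tendsto_eventually)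
qed

context finite_horizon
begin

text \<open>
  Products of ramps approximate the indicators of \<open>{Y r\<^sub>1 \<le> a\<^sub>1, \<dots>, Y r\<^sub>m \<le> a\<^sub>m}\<close>, which together with
  the null sets generate the \<open>\<sigma>\<close>-algebra.
\<close>

lemma cylinder_dense:
  assumes Y: "\<And>r. r \<in> {0..T} \<Longrightarrow> Y r \<in> borel_measurable M" and t: "t \<in> {0..T}"
    and f: "f \<in> borel_measurable (aug_filtration M {Y} t)" "l2 f" and e: "\<epsilon> > 0"
  shows "\<exists>F. lip_cyl t F \<and> (\<E> w. (f w - F (\<lambda>r. Y r w))\<^sup>2) < \<epsilon>"
proof -
  let ?F = "aug_filtration M {Y} t" and ?N = "restr_to_subalg M (aug_filtration M {Y} t)"
  have filt: "filtration (aug_filtration M {Y})" by (rule aug_filtration_filtration) (use Y in auto)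
  note F = filtrationD(1)[OF filt t] and Fnull = filtrationD(2)[OF filt t] and Fsp = filtrationD(3)[OF filt t]
  interpret N: prob_space ?N using prob_space_axioms F by (simp add: prob_space_restr_to_subalg)
  have sN: "sets ?N = sets ?F" "space ?N = space M" using F by (auto simp: sets_restr_to_subalg space_restr_to_subalg)
  have mN: "measurable ?N borel = (measurable ?F borel :: ('a \<Rightarrow> real) set)" by (rule measurable_cong_sets) (use sN in auto)
  let ?E = "\<lambda>K. {w \<in> space M. \<forall>p\<in>K. Y (fst p) w \<le> snd p}"
  let ?K = "{K. finite K \<and> K \<subseteq> {0..t} \<times> (UNIV :: real set)}"
  let ?G = "?E ` ?K \<union> null_sets M"
  have YF: "Y r \<in> borel_measurable ?F" if "r \<in> {0..t}" for r using that by (intro aug_filtration_measurable) auto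
  have EF: "?E K \<in> sets ?F" if "K \<in> ?K" for K
  proof -
    have "{w \<in> space ?F. \<forall>p\<in>K. Y (fst p) w \<le> snd p} \<in> sets ?F"
      using that YF by (intro sets.sets_Collect_finite_All borel_measurable_le) auto
    then show ?thesis using Fsp by simp
  qed
  have GF: "?G \<subseteq> sets ?F" using EF Fnull by blast
  have GP: "?G \<subseteq> Pow (space ?N)" using GF sN sets.space_closed[of ?F] Fsp by auto
  have gen: "sets ?N = sigma_sets (space ?N) ?G"
  proof
    have sub: "sigma_sets (space ?N) ?G \<subseteq> sets ?F" using GF Fsp sN(2) sets.sigma_sets_subset[of ?G ?F] by simp
    then show "sigma_sets (space ?N) ?G \<subseteq> sets ?N" using sN by simp
    let ?S = "sigma (space M) ?G"
    have S: "sets ?S = sigma_sets (space M) ?G" "space ?S = space M" using GP sN by auto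
    have "sets ?F \<subseteq> sets ?S"
    proof (rule aug_filtration_subset)
      show "space ?S = space M" by (rule S)
      show "null_sets M \<subseteq> sets ?S" unfolding S by (auto intro: sigma_sets.Basic)
      fix X r assume X: "X \<in> {Y}" and r: "r \<in> {0..t}"
      have "Y r \<in> borel_measurable ?S"
      proof (rule borel_measurableI_le)
        fix a
        have "{w \<in> space ?S. Y r w \<le> a} = ?E {(r, a)}" using S by auto
        moreover have "?E {(r, a)} \<in> ?G" using r by blast
        ultimately show "{w \<in> space ?S. Y r w \<le> a} \<in> sets ?S" unfolding S by (auto intro: sigma_sets.Basic)
      qed
      then show "X r \<in> borel_measurable ?S" using X by simp
    qed
    then show "sets ?N \<subseteq> sigma_sets (space ?N) ?G" using S sN by simp
  qed
  have ist: "Int_stable ?G"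
  proof (rule Int_stableI)
    fix A B assume A: "A \<in> ?G" and B: "B \<in> ?G"
    have AB: "A \<in> sets M" "B \<in> sets M" using A B GF F by (auto simp: subalgebra_def)
    show "A \<inter> B \<in> ?G"
    proof (cases "A \<in> null_sets M \<or> B \<in> null_sets M")
      case True
      then have "A \<inter> B \<in> null_sets M" using AB null_set_Int1[of B M A] null_set_Int2[of A M B] by blast
      then show ?thesis by blast
    next
      case False
      then obtain K L where "A = ?E K" "B = ?E L" "K \<in> ?K" "L \<in> ?K" using A B by blast
      then have "A \<inter> B = ?E (K \<union> L)" "K \<union> L \<in> ?K" by auto
      then show ?thesis by blast
    qed
  qed
  let ?app = "\<lambda>f. \<forall>\<epsilon>>0. \<exists>F. lip_cyl t F \<and> (\<E> w. (f w - F (\<lambda>r. Y r w))\<^sup>2) < \<epsilon>"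
  let ?P = "\<lambda>f. f \<in> borel_measurable ?F \<and> l2 f \<and> ?app f"
  have FY: "l2 (\<lambda>w. F (\<lambda>r. Y r w))" if F: "lip_cyl t F" for F
  proof -
    obtain C where "\<And>y. \<bar>F y\<bar> \<le> C" using lip_cyl_bounded[OF F] by blast
    then show ?thesis using lip_cyl_measurable[OF F, of "\<lambda>w r. Y r w" M] Y t by (intro l2_bounded) auto
  qed
  have dl: "(\<E> w. (f w + g w)\<^sup>2) \<le> 2 * (\<E> w. (f w)\<^sup>2) + 2 * (\<E> w. (g w)\<^sup>2)"
    if fg: "l2 f" "l2 g" for f g
  proof -
    have "(\<E> w. (f w + g w)\<^sup>2) \<le> (\<E> w. 2 * (f w)\<^sup>2 + 2 * (g w)\<^sup>2)"
      using fg[THEN l2_square_integrable] l2_square_integrable[OF l2_add[OF fg]]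
      by (intro integral_mono) (auto intro: square_sum_le)
    then show ?thesis using fg[THEN l2_square_integrable] by simp
  qed
  have ind: "?P (indicator (?E K))" if K: "K \<in> ?K" for K
  proof (intro conjI allI impI)
    show m: "indicat_real (?E K) \<in> borel_measurable ?F" using EF[OF K] by simp
    have mM: "indicat_real (?E K) \<in> borel_measurable M" using measurable_from_subalg[OF F m] .
    show "l2 (indicat_real (?E K))" using mM by (rule l2_bounded[where C=1]) (auto simp: indicator_def)
    fix \<epsilon> :: real assume e: "\<epsilon> > 0"
    define A where "A n y = (\<Prod>p\<in>K. ramp n (y (fst p) - snd p))" for n and y :: "real \<Rightarrow> real"
    have cA: "lip_cyl t (A n)" for n
      unfolding A_def[abs_def]
    proof (rule lip_cyl_prod)
      show "finite K" using K by simp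
      fix p assume "p \<in> K"
      then have "fst p \<in> {0..t}" using K by auto
      then show "lip_cyl t (\<lambda>y. ramp n (y (fst p) - snd p))"
        using ramp_lipschitz[of n "_ - snd p" "_ - snd p"] ramp_bounds
        by (intro lip_cyl.atom[where \<phi>="\<lambda>x. ramp n (x - snd p)" and C=1 and L="real n"]) auto
    qed
    have A01: "0 \<le> A n y \<and> A n y \<le> 1" for n y unfolding A_def using ramp_bounds by (auto intro!: prod_nonneg prod_le_1)
    have "(\<lambda>n. (\<E> w. (indicat_real (?E K) w - A n (\<lambda>r. Y r w))\<^sup>2)) \<longlonglongrightarrow> (\<E> w. 0)"
    proof (rule integral_dominated_convergence[where w="\<lambda>_. 1"])
      show "AE w in M. (\<lambda>n. (indicat_real (?E K) w - A n (\<lambda>r. Y r w))\<^sup>2) \<longlonglongrightarrow> 0"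
      proof (rule AE_I2)
        fix w assume q: "w \<in> space M"
        have "(\<lambda>n. A n (\<lambda>r. Y r w)) \<longlonglongrightarrow> (\<Prod>p\<in>K. if Y (fst p) w - snd p \<le> 0 then 1 else 0)"
          unfolding A_def by (intro tendsto_prod ramp_limit)
        also have "(\<Prod>p\<in>K. if Y (fst p) w - snd p \<le> 0 then 1 else 0) = indicat_real (?E K) w"
          using K q by (auto simp: indicator_def prod_zero_iff)
        finally have "(\<lambda>n. (indicat_real (?E K) w - A n (\<lambda>r. Y r w))\<^sup>2) \<longlonglongrightarrow> (indicat_real (?E K) w - indicat_real (?E K) w)\<^sup>2"
          by (intro tendsto_power tendsto_diff tendsto_const)
        then show "(\<lambda>n. (indicat_real (?E K) w - A n (\<lambda>r. Y r w))\<^sup>2) \<longlonglongrightarrow> 0" by simp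
      qed
      show "AE w in M. norm ((indicat_real (?E K) w - A n (\<lambda>r. Y r w))\<^sup>2) \<le> 1" for n
      proof (rule AE_I2)
        fix w
        have "\<bar>indicat_real (?E K) w - A n (\<lambda>r. Y r w)\<bar> \<le> 1" using A01[of n "\<lambda>r. Y r w"] by (auto simp: indicator_def)
        then show "norm ((indicat_real (?E K) w - A n (\<lambda>r. Y r w))\<^sup>2) \<le> 1" by (simp add: abs_square_le_1)
      qed
      show "(\<lambda>w. (indicat_real (?E K) w - A n (\<lambda>r. Y r w))\<^sup>2) \<in> borel_measurable M" for n
        using mM l2_measurable[OF FY[OF cA[of n]]] by auto
    qed auto
    then have "\<forall>\<^sub>F n in sequentially. (\<E> w. (indicat_real (?E K) w - A n (\<lambda>r. Y r w))\<^sup>2) < \<epsilon>"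
      using e by (intro order_tendstoD(2)) auto
    then obtain n where "(\<E> w. (indicat_real (?E K) w - A n (\<lambda>r. Y r w))\<^sup>2) < \<epsilon>"
      by (auto dest!: eventually_happens)
    then show "\<exists>F. lip_cyl t F \<and> (\<E> w. (indicat_real (?E K) w - F (\<lambda>r. Y r w))\<^sup>2) < \<epsilon>" using cA by blast
  qed
  have "?P f"
  proof (rule N.l2_induct[OF gen ist GP, where P="?P"])
    fix A assume "A \<in> ?G"
    then consider K where "K \<in> ?K" "A = ?E K" | "A \<in> null_sets M" by blast
    then show "?P (indicator A)"
    proof cases
      case 1
      then show ?thesis using ind by simp
    next
      case 2
      have m: "indicat_real A \<in> borel_measurable ?F" using 2 Fnull by auto
      have l: "l2 (indicat_real A)" using measurable_from_subalg[OF F m] by (rule l2_bounded[where C=1]) (auto simp: indicator_def)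
      have "AE w in M. (indicat_real A w - 0)\<^sup>2 = 0" using AE_not_in[OF 2] by eventually_elim simp
      then have "(\<E> w. (indicat_real A w - 0)\<^sup>2) = 0" by (rule integral_eq_zero_AE)
      then have "?app (indicator A)" using lip_cyl.const[of t 0] by (intro allI impI exI[of _ "\<lambda>y. 0"]) auto
      then show ?thesis using m l by blast
    qed
  next
    show "?P (indicator (space ?N))"
    proof -
      have "?E {} = space ?N" using sN by auto
      then show ?thesis using ind[of "{}"] by simp
    qed
  next
    fix f g assume f: "?P f" and g: "?P g"
    have "?app (\<lambda>x. f x + g x)"
    proof (intro allI impI)
      fix \<epsilon> :: real assume e: "\<epsilon> > 0"
      then have e4: "\<epsilon> / 4 > 0" by simp
      obtain A where A: "lip_cyl t A" "(\<E> w. (f w - A (\<lambda>r. Y r w))\<^sup>2) < \<epsilon> / 4" using f e4 by blast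
      obtain B where B: "lip_cyl t B" "(\<E> w. (g w - B (\<lambda>r. Y r w))\<^sup>2) < \<epsilon> / 4" using g e4 by blast
      have "(\<E> w. ((f w - A (\<lambda>r. Y r w)) + (g w - B (\<lambda>r. Y r w)))\<^sup>2) < \<epsilon>"
        using dl[OF l2_diff[OF _ FY[OF A(1)]] l2_diff[OF _ FY[OF B(1)]], of f g] f g A(2) B(2) by simp
      then have "(\<E> w. (f w + g w - (A (\<lambda>r. Y r w) + B (\<lambda>r. Y r w)))\<^sup>2) < \<epsilon>"
        by (simp add: algebra_simps)
      then show "\<exists>F. lip_cyl t F \<and> (\<E> w. (f w + g w - F (\<lambda>r. Y r w))\<^sup>2) < \<epsilon>"
        using lip_cyl.add[OF A(1) B(1)] by blast
    qed
    then show "?P (\<lambda>x. f x + g x)" using f g by auto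
  next
    fix c f assume f: "?P f"
    have "?app (\<lambda>x. c * f x)"
    proof (intro allI impI)
      fix \<epsilon> :: real assume e: "\<epsilon> > 0"
      then have "\<epsilon> / (c\<^sup>2 + 1) > 0" by (simp add: add_nonneg_pos)
      then obtain A where A: "lip_cyl t A" "(\<E> w. (f w - A (\<lambda>r. Y r w))\<^sup>2) < \<epsilon> / (c\<^sup>2 + 1)" using f by blast
      have "(\<E> w. (c * f w - c * A (\<lambda>r. Y r w))\<^sup>2) = c\<^sup>2 * (\<E> w. (f w - A (\<lambda>r. Y r w))\<^sup>2)"
        by (simp only: right_diff_distrib[symmetric] power_mult_distrib integral_mult_right_zero)
      also have "\<dots> \<le> (c\<^sup>2 + 1) * (\<E> w. (f w - A (\<lambda>r. Y r w))\<^sup>2)"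
        by (intro mult_right_mono) auto
      also have "\<dots> < \<epsilon>" using A(2) by (simp add: pos_less_divide_eq add_nonneg_pos mult.commute)
      finally show "\<exists>F. lip_cyl t F \<and> (\<E> w. (c * f w - F (\<lambda>r. Y r w))\<^sup>2) < \<epsilon>"
        using lip_cyl.mult[OF lip_cyl.const A(1)] by blast
    qed
    then show "?P (\<lambda>x. c * f x)" using f by auto
  next
    fix f s assume s: "\<And>n::nat. ?P (s n)" and f: "f \<in> borel_measurable ?N" "integrable ?N (\<lambda>x. (f x)\<^sup>2)"
      and lim: "(\<lambda>n. \<integral>x. (f x - s n x)\<^sup>2 \<partial>?N) \<longlonglongrightarrow> 0"
    have fF: "f \<in> borel_measurable ?F" using f(1) mN by simp
    have lf: "l2 f" using measurable_from_subalg[OF F fF] integrable_from_subalg[OF F f(2)] by (simp add: l2_def)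
    have eq: "(\<integral>x. (f x - s n x)\<^sup>2 \<partial>?N) = expectation (\<lambda>x. (f x - s n x)\<^sup>2)" for n
      using s[of n] fF by (intro integral_subalgebra2[OF F]) auto
    have "?app f"
    proof (intro allI impI)
      fix \<epsilon> :: real assume e: "\<epsilon> > 0"
      then have e4: "\<epsilon> / 4 > 0" by simp
      have "\<forall>\<^sub>F n in sequentially. expectation (\<lambda>x. (f x - s n x)\<^sup>2) < \<epsilon> / 4"
        using order_tendstoD(2)[OF lim e4] unfolding eq .
      then obtain n where n: "expectation (\<lambda>x. (f x - s n x)\<^sup>2) < \<epsilon> / 4" by (auto dest!: eventually_happens)
      obtain A where A: "lip_cyl t A" "(\<E> w. (s n w - A (\<lambda>r. Y r w))\<^sup>2) < \<epsilon> / 4" using s[of n] e4 by blast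
      have "(\<E> w. ((f w - s n w) + (s n w - A (\<lambda>r. Y r w)))\<^sup>2) < \<epsilon>"
        using dl[OF l2_diff[OF lf] l2_diff[OF _ FY[OF A(1)]], of "s n" "s n"] s[of n] A(2) n by simp
      then show "\<exists>F. lip_cyl t F \<and> (\<E> w. (f w - F (\<lambda>r. Y r w))\<^sup>2) < \<epsilon>" using A(1) by auto
    qed
    then show "?P f" using fF lf by blast
  next
    show "f \<in> borel_measurable ?N" using f mN by simp
    show "integrable ?N (\<lambda>x. (f x)\<^sup>2)" using f by (intro integrable_in_subalg[OF F]) (auto simp: l2_def)
  qed
  then show ?thesis using e by blast
qed

end

section \<open>Discretisation of an observation\<close>

context finite_horizon
begin

text \<open>The squared norm in \<open>L\<^sup>2(dt \<otimes> P)\<close>.\<close>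

definition Q :: "'a process \<Rightarrow> real" where
  "Q X = (LBINT t:{0..T}. (\<E> w. (X t w)\<^sup>2))"

lemma Q_cong: "(\<And>t w. t \<in> {0..T} \<Longrightarrow> X t w = Y t w) \<Longrightarrow> Q X = Q Y"
  unfolding Q_def by (rule set_lebesgue_integral_cong) auto

lemma Q_add:
  assumes X: "l2p X" and Y: "l2p Y"
  shows "Q (\<lambda>t w. X t w + Y t w) \<le> 2 * Q X + 2 * Q Y"
proof -
  have T0: "0 \<le> (0 :: real)" "T \<le> T" by auto
  note i = l2p_sq_integrable[OF X T0] l2p_sq_integrable[OF Y T0] l2p_sq_integrable[OF l2p_add[OF X Y] T0]
  have "Q (\<lambda>t w. X t w + Y t w) \<le> (LBINT t:{0..T}. 2 * (\<E> w. (X t w)\<^sup>2) + 2 * (\<E> w. (Y t w)\<^sup>2))"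
    unfolding Q_def
  proof (rule set_integral_mono[OF i(3)])
    show "set_integrable lborel {0..T} (\<lambda>t. 2 * (\<E> w. (X t w)\<^sup>2) + 2 * (\<E> w. (Y t w)\<^sup>2))"
      using i by (intro set_integral_add) auto
    fix t assume t: "t \<in> {0..T}"
    note l = l2p_l2[OF X t] l2p_l2[OF Y t]
    have "(\<E> w. (X t w + Y t w)\<^sup>2) \<le> (\<E> w. 2 * (X t w)\<^sup>2 + 2 * (Y t w)\<^sup>2)"
      using l[THEN l2_square_integrable] l2_square_integrable[OF l2_add[OF l]]
      by (intro integral_mono) (auto intro: square_sum_le)
    then show "(\<E> w. (X t w + Y t w)\<^sup>2) \<le> 2 * (\<E> w. (X t w)\<^sup>2) + 2 * (\<E> w. (Y t w)\<^sup>2)"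
      using l[THEN l2_square_integrable] by simp
  qed
  also have "\<dots> = 2 * Q X + 2 * Q Y" unfolding Q_def using i by (subst set_integral_add) auto
  finally show ?thesis .
qed

lemma Q_nonneg: "0 \<le> Q X"
  unfolding Q_def set_lebesgue_integral_def by (intro Bochner_Integration.integral_nonneg) auto

lemma l2p_sum: "finite I \<Longrightarrow> (\<And>i. i \<in> I \<Longrightarrow> l2p (X i)) \<Longrightarrow> l2p (\<lambda>t w. \<Sum>i\<in>I. X i t w)"
proof (induction I rule: finite_induct)
  case empty
  show ?case using l2p_coeff[OF bounded_coefficient_const, of 0] by simp
next
  case (insert i I)
  then have "l2p (\<lambda>t w. X i t w + (\<Sum>i\<in>I. X i t w))" by (intro l2p_add) auto
  then show ?case using insert by simp
qed

lemma l2p_step: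
  assumes "\<And>k. k < n \<Longrightarrow> l2 (c k)"
  shows "l2p (\<lambda>t w. step n (\<lambda>k. c k w) t)"
  unfolding step_def
proof (rule l2p_sum)
  fix k assume k: "k \<in> {..<n}"
  have "\<bar>indicat_real {grid n k<..grid n (Suc k)} t\<bar> \<le> 1" for t by (auto simp: indicator_def)
  then have "bounded_coefficient T (indicat_real {grid n k<..grid n (Suc k)})"
    unfolding bounded_coefficient_def
    by (intro conjI exI[of _ 1] ballI measurable_restrict_space1) auto
  then show "l2p (\<lambda>t w. indicat_real {grid n k<..grid n (Suc k)} t * c k w)"
    using assms k by (intro l2p_coeff_mult l2p_const_process) auto
qed simp

lemma Q_step:
  assumes n: "n > 0" and c: "\<And>k. k < n \<Longrightarrow> l2 (c k)"
  shows "Q (\<lambda>t w. step n (\<lambda>k. c k w) t) = T / real n * (\<Sum>k<n. (\<E> w. (c k w)\<^sup>2))"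
proof -
  have "(\<E> w. (step n (\<lambda>k. c k w) t)\<^sup>2) = step n (\<lambda>k. (\<E> w. (c k w)\<^sup>2)) t" if t: "t \<in> {0..T}" for t
  proof -
    have "(\<E> w. (step n (\<lambda>k. c k w) t)\<^sup>2) = (\<E> w. \<Sum>k<n. indicator {grid n k<..grid n (Suc k)} t * (c k w)\<^sup>2)"
      using step_square[OF n t] by (simp add: step_def del: of_nat_Suc)
    also have "\<dots> = (\<Sum>k<n. (\<E> w. indicator {grid n k<..grid n (Suc k)} t * (c k w)\<^sup>2))"
      using c by (intro Bochner_Integration.integral_sum integrable_mult_right l2_square_integrable) auto
    finally show ?thesis by (simp only: step_def integral_mult_right_zero)
  qed
  then have "Q (\<lambda>t w. step n (\<lambda>k. c k w) t) = (LBINT t:{0..T}. step n (\<lambda>k. (\<E> w. (c k w)\<^sup>2)) t)"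
    unfolding Q_def by (intro set_lebesgue_integral_cong) auto
  also have "\<dots> = T / real n * (\<Sum>k<n. (\<E> w. (c k w)\<^sup>2))"
    unfolding integral_TM_full by (rule step_integral(1)[OF n])
  finally show ?thesis .
qed

lemma time_int_step:
  assumes n: "n > 0" and i: "i \<le> n"
  shows "time_int (\<lambda>t w. step n (\<lambda>k. c k w) t) (grid n i) w = T / real n * (\<Sum>k<i. c k w)"
proof -
  have "time_int (\<lambda>t w. step n (\<lambda>k. c k w) t) (grid n i) w = (\<integral>t. indicator {0..grid n i} t * step n (\<lambda>k. c k w) t \<partial>TM)"
    by (rule time_int_TM[OF grid_range[OF n i]])
  also have "\<dots> = (\<integral>t. step n (\<lambda>k. if k < i then c k w else 0) t \<partial>TM)"
  proof (rule Bochner_Integration.integral_cong[OF refl])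
    fix t assume "t \<in> space TM"
    then have t: "t \<in> {0..T}" by simp
    from n t show "indicator {0..grid n i} t * step n (\<lambda>k. c k w) t = step n (\<lambda>k. if k < i then c k w else 0) t"
    proof (cases rule: step_cases)
      case 1
      then show ?thesis by (simp add: step_zero)
    next
      case (2 k)
      show ?thesis
      proof (cases "k < i")
        case True
        then have "t \<le> grid n i" using 2(2) grid_mono[of "Suc k" i n] by auto
        then show ?thesis using True t by (simp add: step_value[OF 2])
      next
        case False
        then have "grid n i < t" using 2(2) grid_mono[of i k n] by auto
        then show ?thesis using False by (simp add: step_value[OF 2])
      qed
    qed
  qed
  also have "\<dots> = T / real n * (\<Sum>k<n. if k < i then c k w else 0)" by (rule step_integral(1)[OF n])
  also have "(\<Sum>k<n. if k < i then c k w else 0) = (\<Sum>k<i. c k w)"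
    using i by (intro sum.mono_neutral_cong_right) auto
  finally show ?thesis .
qed

lemma average_time_int:
  assumes n: "n > 0" and k: "k \<le> n"
  shows "average n (\<lambda>s. X s w) k = real n / T * (time_int X (grid n k) w - time_int X (grid n (k - 1)) w)"
  using grid_range[OF n k] grid_range[OF n, of "k - 1"] k by (simp add: average_def time_int_TM)

lemma l2_average:
  assumes X: "l2p X" and n: "n > 0" and k: "k \<le> n"
  shows "l2 (\<lambda>w. average n (\<lambda>s. X s w) k)"
  unfolding average_time_int[OF n k] using grid_range[OF n k] grid_range[OF n, of "k - 1"] k
  by (intro l2_cmult l2_diff l2p_time_int_bound(1)[OF X]) auto

lemma average_adapted:
  assumes H: "filtration H" and X: "l2p X" and n: "n > 0" and k: "k \<le> n"
    and ad: "\<And>s. s \<in> {0..T} \<Longrightarrow> X s \<in> borel_measurable (H s)"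
  shows "(\<lambda>w. average n (\<lambda>s. X s w) k) \<in> borel_measurable (H (grid n k))"
proof -
  have *: "time_int X r \<in> borel_measurable (H (grid n k))" if r: "r \<in> {0..grid n k}" for r
  proof (rule time_int_adapted[OF filtrationD(1,2)[OF H grid_range[OF n k]] X])
    show "r \<in> {0..T}" using r grid_range[OF n k] by auto
    fix s assume s: "s \<in> {0..r}"
    show "X s \<in> borel_measurable (H (grid n k))"
      by (rule filtration_measurable_mono[OF H _ _ _ ad[of s]]) (use s r grid_range[OF n k] in auto)
  qed
  have "grid n k \<in> {0..grid n k}" "grid n (k - 1) \<in> {0..grid n k}"
    using grid_range[OF n k] grid_mono[of "k - 1" k n] grid_mono[of 0 "k - 1" n] by auto
  from *[OF this(1)] *[OF this(2)] show ?thesis unfolding average_time_int[OF n k] by auto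
qed

lemma average_process_converges:
  assumes X: "l2p X"
  shows "(\<lambda>n. Q (\<lambda>t w. step (Suc n) (\<lambda>k. average (Suc n) (\<lambda>s. X s w) k) t - X t w)) \<longlonglongrightarrow> 0"
proof -
  let ?D = "\<lambda>n t w. step (Suc n) (\<lambda>k. average (Suc n) (\<lambda>s. X s w) k) t - X t w"
  have D: "l2p (?D n)" for n by (intro l2p_diff l2p_step X l2_average) auto
  have T0: "0 \<le> (0 :: real)" "T \<le> T" by auto
  let ?e = "\<lambda>n w. \<integral>t. (?D n t w)\<^sup>2 \<partial>TM"
  have q: "Q (?D n) = expectation (?e n)" "integrable M (?e n)" for n
    using expectation_product_LBINT(1,2)[OF D D T0, of n n] unfolding Q_def integral_TM_full by (simp_all add: power2_eq_square)
  have iX: "integrable M (\<lambda>w. \<integral>t. (X t w)\<^sup>2 \<partial>TM)"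
    using expectation_product_LBINT(2)[OF X X T0] unfolding integral_TM_full by (simp add: power2_eq_square)
  have path: "AE w in M. (\<lambda>t. X t w) \<in> borel_measurable TM \<and> integrable TM (\<lambda>t. (X t w)\<^sup>2)"
    using l2p_AE_integrable[OF X X] AE_space[of M]
    by eventually_elim (use joint_section[OF l2p_measurable[OF X]] in \<open>auto simp: power2_eq_square\<close>)
  have "(\<lambda>n. expectation (?e n)) \<longlonglongrightarrow> (\<E> w. 0)"
  proof (rule integral_dominated_convergence[where w="\<lambda>w. 4 * (\<integral>t. (X t w)\<^sup>2 \<partial>TM)"])
    show "AE w in M. (\<lambda>n. ?e n w) \<longlonglongrightarrow> 0"
      using path
    proof eventually_elim
      case (elim w)
      then show ?case using average_converges[of "\<lambda>t. X t w"] by (simp add: power2_commute[of "X _ w"])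
    qed
    show "AE w in M. norm (?e n w) \<le> 4 * (\<integral>t. (X t w)\<^sup>2 \<partial>TM)" for n
      using path
    proof eventually_elim
      case (elim w)
      let ?s = "step (Suc n) (\<lambda>k. average (Suc n) (\<lambda>s. X s w) k)"
      have ist: "integrable TM (\<lambda>t. (?s t)\<^sup>2)" "?s \<in> borel_measurable TM"
        using step_square_integral(2)[of "Suc n"] step_integral(2)[of "Suc n"] by auto
      have le: "(?D n t w)\<^sup>2 \<le> 2 * (?s t)\<^sup>2 + 2 * (X t w)\<^sup>2" for t
        using square_sum_le[of "?s t" "- X t w"] by simp
      have "?e n w \<le> (\<integral>t. 2 * (?s t)\<^sup>2 + 2 * (X t w)\<^sup>2 \<partial>TM)"
      proof (rule integral_mono)
        show b: "integrable TM (\<lambda>t. 2 * (?s t)\<^sup>2 + 2 * (X t w)\<^sup>2)" using ist elim by simp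
        show "integrable TM (\<lambda>t. (?D n t w)\<^sup>2)"
          by (rule Bochner_Integration.integrable_bound[OF b]) (use ist elim le in auto)
      qed (rule le)
      also have "\<dots> = 2 * (\<integral>t. (?s t)\<^sup>2 \<partial>TM) + 2 * (\<integral>t. (X t w)\<^sup>2 \<partial>TM)" using ist elim by simp
      also have "(\<integral>t. (?s t)\<^sup>2 \<partial>TM) \<le> (\<integral>t. (X t w)\<^sup>2 \<partial>TM)" using elim by (intro average_contraction) auto
      finally show ?case by simp
    qed
  qed (use q iX in auto)
  then show ?thesis using q by simp
qed

lemma time_int_increment:
  assumes X: "l2p X" and sr: "0 \<le> s" "s \<le> r" "r \<le> T" and C: "\<And>t. t \<in> {0..T} \<Longrightarrow> (\<E> w. (X t w)\<^sup>2) \<le> C"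
  shows "(\<E> w. (time_int X r w - time_int X s w)\<^sup>2) \<le> T * (C * (r - s))"
proof -
  let ?I = "\<lambda>u w. indicator {s..r} u * X u w"
  have I: "l2p ?I" using X by (rule l2p_indicator)
  have TT: "T \<in> {0..T}" using T_pos by auto
  have R: "r \<in> {0..T}" "s \<in> {0..T}" using sr by auto
  have AE: "AE w in M. time_int X r w - time_int X s w = time_int ?I T w"
    using LBINT_between[OF X sr]
  proof eventually_elim
    case (elim w)
    have "time_int ?I T w = (\<integral>u. indicator {s..r} u * X u w \<partial>TM)"
      unfolding time_int_TM[OF TT] by (rule Bochner_Integration.integral_cong) auto
    then show ?case using elim integral_TM[OF sr(1,3), of "\<lambda>u. X u w"] by simp
  qed
  have "(\<E> w. (time_int X r w - time_int X s w)\<^sup>2) = (\<E> w. (time_int ?I T w)\<^sup>2)"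
    by (rule expectation_square_cong_AE[OF AE l2_measurable[OF l2_diff[OF l2p_l2[OF l2p_time_int[OF X] R(1)] l2p_l2[OF l2p_time_int[OF X] R(2)]]]
          l2_measurable[OF l2p_l2[OF l2p_time_int[OF I] TT]]])
  also have "\<dots> \<le> T * (LBINT u:{0..T}. (\<E> w. (?I u w)\<^sup>2))"
    by (rule l2p_time_int_bound(2)[OF I TT])
  also have "(LBINT u:{0..T}. (\<E> w. (?I u w)\<^sup>2)) \<le> (\<integral>u. C * indicator {s..r} u \<partial>TM)"
    unfolding integral_TM_full
  proof (rule integral_mono)
    have "integrable TM (\<lambda>u. indicat_real {s..r} u * 1)" by (rule integrable_cell) simp
    then show "integrable TM (\<lambda>u. C * indicator {s..r} u)" by simp
    show "integrable TM (\<lambda>u. (\<E> w. (?I u w)\<^sup>2))"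
      using TP.integrable_fst[OF l2p_mult_integrable[OF I I]] by (simp add: power2_eq_square)
    fix u assume "u \<in> space TM"
    then show "(\<E> w. (?I u w)\<^sup>2) \<le> C * indicator {s..r} u"
      using C[of u] by (auto simp: indicator_def)
  qed
  also have "(\<integral>u. C * indicator {s..r} u \<partial>TM) = C * (r - s)"
    using integral_TM[OF sr(1,3), of "\<lambda>_. 1"] sr by (simp add: set_lebesgue_integral_def)
  finally show ?thesis using T_pos by simp
qed

text \<open>
  A Lipschitz cylinder function depends on finitely many times, so pointwise convergence in \<open>L\<^sup>2\<close>
  suffices. This is why such functions are used for the feedback.
\<close>

lemma lip_cyl_converges:
  assumes F: "lip_cyl t F" and t: "t \<le> T"
    and Y: "\<And>r. r \<in> {0..T} \<Longrightarrow> Y r \<in> borel_measurable M" and Z: "\<And>j r. r \<in> {0..T} \<Longrightarrow> Z j r \<in> borel_measurable M"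
    and d: "\<And>j r. r \<in> {0..T} \<Longrightarrow> l2 (\<lambda>w. Y r w - Z j r w)"
    and lim: "\<And>r. r \<in> {0..T} \<Longrightarrow> (\<lambda>j::nat. (\<E> w. (Y r w - Z j r w)\<^sup>2)) \<longlonglongrightarrow> 0"
  shows "(\<lambda>j. (\<E> w. (F (\<lambda>r. Y r w) - F (\<lambda>r. Z j r w))\<^sup>2)) \<longlonglongrightarrow> 0"
proof -
  obtain R L where R: "finite R" "R \<subseteq> {0..t}" "L \<ge> 0" "\<And>y y'. \<bar>F y - F y'\<bar> \<le> L * (\<Sum>r\<in>R. \<bar>y r - y' r\<bar>)"
    using lip_cyl_lipschitz[OF F] by blast
  have RT: "r \<in> {0..T}" if "r \<in> R" for r using that R t by auto
  let ?b = "\<lambda>j. L\<^sup>2 * (real (card R) * (\<Sum>r\<in>R. (\<E> w. (Y r w - Z j r w)\<^sup>2)))"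
  have le: "(\<E> w. (F (\<lambda>r. Y r w) - F (\<lambda>r. Z j r w))\<^sup>2) \<le> ?b j" for j
  proof -
    have pt: "(F y - F y')\<^sup>2 \<le> L\<^sup>2 * (real (card R) * (\<Sum>r\<in>R. (y r - y' r)\<^sup>2))" for y y'
    proof -
      have "(F y - F y')\<^sup>2 = \<bar>F y - F y'\<bar>\<^sup>2" by simp
      also have "\<dots> \<le> (L * (\<Sum>r\<in>R. \<bar>y r - y' r\<bar>))\<^sup>2" by (intro power_mono R) auto
      also have "\<dots> = L\<^sup>2 * (\<Sum>r\<in>R. \<bar>y r - y' r\<bar>)\<^sup>2" by (rule power_mult_distrib)
      also have "\<dots> \<le> L\<^sup>2 * (real (card R) * (\<Sum>r\<in>R. (y r - y' r)\<^sup>2))"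
        using sum_squared_le_sum_of_squares[of "\<lambda>r. \<bar>y r - y' r\<bar>" R] by (intro mult_left_mono) (auto simp: mult.commute)
      finally show ?thesis .
    qed
    have ib: "integrable M (\<lambda>w. L\<^sup>2 * (real (card R) * (\<Sum>r\<in>R. (Y r w - Z j r w)\<^sup>2)))"
      by (intro integrable_mult_right Bochner_Integration.integrable_sum l2_square_integrable d RT)
    have "(\<E> w. (F (\<lambda>r. Y r w) - F (\<lambda>r. Z j r w))\<^sup>2) \<le> (\<E> w. L\<^sup>2 * (real (card R) * (\<Sum>r\<in>R. (Y r w - Z j r w)\<^sup>2)))"
    proof (rule integral_mono)
      have "(\<lambda>w. F (\<lambda>r. Y r w)) \<in> borel_measurable M"
        by (rule lip_cyl_measurable[OF F]) (use Y t in auto)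
      moreover have "(\<lambda>w. F (\<lambda>r. Z j r w)) \<in> borel_measurable M"
        by (rule lip_cyl_measurable[OF F]) (use Z t in auto)
      ultimately show "integrable M (\<lambda>w. (F (\<lambda>r. Y r w) - F (\<lambda>r. Z j r w))\<^sup>2)"
        using pt by (intro Bochner_Integration.integrable_bound[OF ib]) (auto intro!: AE_I2 order_trans[OF pt] abs_ge_self)
    qed (use ib pt in auto)
    also have "\<dots> = ?b j"
      by (simp only: integral_mult_right_zero, subst Bochner_Integration.integral_sum)
         (auto intro!: l2_square_integrable d RT)
    finally show ?thesis .
  qed
  have "?b \<longlonglongrightarrow> L\<^sup>2 * (real (card R) * (\<Sum>r\<in>R. 0))"
    using RT by (intro tendsto_mult tendsto_const tendsto_sum lim)
  then have b0: "?b \<longlonglongrightarrow> 0" by simp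
  show ?thesis by (rule Lim_null_comparison[OF _ b0]) (use le in \<open>auto intro!: always_eventually\<close>)
qed

text \<open>
  The fine grid carries the Gaussian steps and the drift \<open>b\<close>; the feedback changes only on the
  coarse grid with \<open>N\<close> cells. The process \<open>Z\<close> is the discretised observation, constant on the cells
  of the fine grid. By \<open>decoupling\<close> it is almost independent of the initial information if \<open>b\<close> is
  close to the feedback.
\<close>

lemma observation_step:
  fixes N m :: nat
  assumes W: "brownian_wrt H W" and Nm: "N > 0" "m > 0" "n = N * m"
    and b: "\<And>k. k < n \<Longrightarrow> b k \<in> borel_measurable (H (grid n k))" "\<And>k. k < n \<Longrightarrow> l2 (b k)"
    and F: "\<And>k. k < N \<Longrightarrow> lip_cyl (grid N k) (F k)"
    and F0: "lip_cyl T F0" "\<And>y. \<bar>F0 y\<bar> \<le> C" "C > 0"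
    and u: "u \<in> borel_measurable (H 0)" "\<And>w. 0 \<le> u w \<and> u w \<le> 1"
    and Z: "\<And>r w. Z r w = T / real n * (\<Sum>k<nat \<lfloor>r / (T / real n)\<rfloor>. b k w)
        + (W (grid n (nat \<lfloor>r / (T / real n)\<rfloor>)) w - W 0 w)"
    and v: "v = Q (\<lambda>t w. step n (\<lambda>k. b k w) t - step N (\<lambda>k. F k (\<lambda>r. Z r w)) t)"
  shows "\<bar>(\<E> w. F0 (\<lambda>r. Z r w) * u w) - (\<E> w. F0 (\<lambda>r. Z r w)) * expectation u\<bar>
    \<le> 4 * C * (2 * sqrt v + v)"
proof -
  have n: "n > 0" using Nm by simp
  define \<delta> where "\<delta> = T / real n"
  have \<delta>: "\<delta> > 0" using n T_pos by (simp add: \<delta>_def)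
  define ix where "ix r = nat \<lfloor>r / \<delta>\<rfloor>" for r
  define D where "D k w = W (grid n (Suc k)) w - W (grid n k) w" for k w
  \<comment> \<open>the coarse feedback as a function of the discrete path; \<open>ix r\<close> is the last fine grid point up to \<open>r\<close>\<close>
  define h where "h k y = F (k div m) (\<lambda>r. y (ix r))" for k and y :: "nat \<Rightarrow> real"
  note filt = brownian_wrt_filtration[OF W]
  have gr: "grid n k \<in> {0..T}" if "k \<le> n" for k using grid_range[OF n that] .
  have glt: "grid n k < grid n (Suc k)" for k using \<delta> by (simp add: grid_Suc \<delta>_def)
  have kN: "k div m < N" if "k < n" for k using that Nm by (simp add: less_mult_imp_div_less)
  have gNk: "grid N (k div m) \<le> grid n k" if "k < n" for k
  proof -
    have "grid N (k div m) = grid n (k div m * m)" using Nm by (simp add: grid_def)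
    then show ?thesis using grid_mono[of "k div m * m" k n] by simp
  qed
  have ixle: "ix r \<le> k" if "r \<le> grid n k" for r k
  proof -
    have "r / \<delta> \<le> real k" using that \<delta> by (simp add: grid_def \<delta>_def[symmetric] pos_divide_le_eq)
    then have "\<lfloor>r / \<delta>\<rfloor> \<le> int k" by (simp add: floor_le_iff)
    then show ?thesis by (simp add: ix_def)
  qed
  have Sk: "Suc k \<le> n" "k \<le> n" if "k < n" for k using that by auto
  interpret gf: gaussian_feedback M \<delta> n "\<lambda>k. H (grid n k)" D b h
  proof unfold_locales
    show "0 < \<delta>" by (rule \<delta>)
    show "subalgebra M (H (grid n k))" if "k \<le> n" for k using filtrationD(1)[OF filt gr[OF that]] .
    show "sets (H (grid n k)) \<subseteq> sets (H (grid n (Suc k)))" if "k < n" for k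
      using filt gr[of k] gr[of "Suc k"] glt[of k] that by (auto simp: filtration_def)
    show "D k \<in> borel_measurable (H (grid n (Suc k)))" if "k < n" for k
      unfolding D_def[abs_def]
    proof (rule borel_measurable_diff)
      show "W (grid n (Suc k)) \<in> borel_measurable (H (grid n (Suc k)))"
        using brownian_wrt_adapted(1)[OF W] gr[of "Suc k"] that by auto
      show "W (grid n k) \<in> borel_measurable (H (grid n (Suc k)))"
        by (rule filtration_measurable_mono[OF filt _ _ _ brownian_wrt_adapted(1)[OF W, of "grid n k"]])
           (use gr[of k] gr[of "Suc k"] glt[of k] that in auto)
    qed
    show "indep_set (sets (H (grid n k))) {D k -` S \<inter> space M | S. S \<in> sets borel}" if "k < n" for k
      using W gr[of k] gr[of "Suc k"] glt[of k] that unfolding brownian_wrt_def D_def[abs_def] by auto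
    show "distributed M lborel (D k) (\<lambda>x. ennreal (normal_density 0 (sqrt \<delta>) x))" if "k < n" for k
    proof -
      have "grid n (Suc k) - grid n k = \<delta>" by (simp add: grid_Suc \<delta>_def)
      then show ?thesis
        using W gr[of k] gr[of "Suc k"] glt[of k] that unfolding brownian_wrt_def D_def[abs_def] by auto
    qed
    show "b k \<in> borel_measurable (H (grid n k))" if "k < n" for k using b(1)[OF that] .
    show "h k \<in> borel_measurable paths" if "k < n" for k
      unfolding h_def[abs_def]
      by (rule lip_cyl_measurable[OF F[OF kN[OF that]]]) (auto intro: measurable_component_singleton)
  qed
  have gY: "gf.Y i w = \<delta> * (\<Sum>k<i. b k w) + (W (grid n i) w - W 0 w)" for i w
  proof (induction i)
    case (Suc i)
    have "D i w = W (grid n (Suc i)) w - W (grid n i) w" by (simp add: D_def)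
    then show ?case by (simp only: gf.Y.simps Suc) (simp add: algebra_simps)
  qed simp
  have Zg: "Z r w = gf.X k w (ix r)" if "r \<le> grid n k" for r k w
  proof -
    have "Z r w = \<delta> * (\<Sum>k<ix r. b k w) + (W (grid n (ix r)) w - W 0 w)"
      unfolding Z ix_def \<delta>_def ..
    then show ?thesis using ixle[OF that] by (simp only: gf.X_def gY if_True)
  qed
  have gg: "gf.g k w = b k w - F (k div m) (\<lambda>r. Z r w)" if k: "k < n" for k w
  proof -
    have "F (k div m) (\<lambda>r. gf.X k w (ix r)) = F (k div m) (\<lambda>r. Z r w)"
      using gNk[OF k] by (intro lip_cyl_cong[OF F[OF kN[OF k]]] Zg[symmetric]) auto
    then show ?thesis by (simp add: gf.g_def h_def)
  qed
  have Zm: "Z r \<in> borel_measurable M" if "r \<in> {0..T}" for r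
  proof -
    have i: "ix r \<le> n" using that ixle[of r n] n by simp
    have "b k \<in> borel_measurable M" if "k < ix r" for k using b(2)[of k] that i by (auto simp: l2_def)
    then show ?thesis unfolding Z[abs_def] ix_def[symmetric] \<delta>_def[symmetric]
      using brownian_wrt_adapted(2)[OF W gr[OF i]] brownian_wrt_adapted(2)[OF W, of 0] T_pos
      by (intro borel_measurable_add borel_measurable_times borel_measurable_const borel_measurable_sum borel_measurable_diff) auto
  qed
  have FZ: "l2 (\<lambda>w. F k (\<lambda>r. Z r w))" if k: "k < N" for k
  proof -
    obtain B where "\<And>y. \<bar>F k y\<bar> \<le> B" using lip_cyl_bounded[OF F[OF k]] by blast
    moreover have "(\<lambda>w. F k (\<lambda>r. Z r w)) \<in> borel_measurable M"
      using Zm grid_range[OF Nm(1), of k] k by (intro lip_cyl_measurable[OF F[OF k]]) auto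
    ultimately show ?thesis by (intro l2_bounded) auto
  qed
  have lg: "l2 (gf.g k)" if k: "k < n" for k
    unfolding gg[OF k, abs_def] by (intro l2_diff b(2)[OF k] FZ[OF kN[OF k]])
  have "\<delta> * (\<Sum>j<n. (\<E> w. (gf.g j w)\<^sup>2)) = Q (\<lambda>t w. step n (\<lambda>k. gf.g k w) t)"
    using Q_step[OF n lg] by (simp add: \<delta>_def)
  also have "\<dots> = v" unfolding v
  proof (rule Q_cong)
    fix t w assume t: "t \<in> {0..T}"
    have "step n (\<lambda>k. gf.g k w) t = step n (\<lambda>k. b k w - F (k div m) (\<lambda>r. Z r w)) t"
      unfolding step_def by (intro sum.cong) (auto simp: gg)
    also have "\<dots> = step n (\<lambda>k. b k w) t - step N (\<lambda>k. F k (\<lambda>r. Z r w)) t"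
      unfolding step_linear(2) using step_refine[OF Nm(1,2) t, of "\<lambda>k. F k (\<lambda>r. Z r w)"] Nm(3) by simp
    finally show "step n (\<lambda>k. gf.g k w) t = step n (\<lambda>k. b k w) t - step N (\<lambda>k. F k (\<lambda>r. Z r w)) t" .
  qed
  finally have vv: "v = \<delta> * (\<Sum>j<n. (\<E> w. (gf.g j w)\<^sup>2))" by simp
  have G: "(\<lambda>y. F0 (\<lambda>r. y (ix r))) \<in> borel_measurable paths"
    by (rule lip_cyl_measurable[OF F0(1)]) (auto intro: measurable_component_singleton)
  have GZ: "F0 (\<lambda>r. gf.X n w (ix r)) = F0 (\<lambda>r. Z r w)" for w
    using n by (intro lip_cyl_cong[OF F0(1)] Zg[symmetric]) auto
  have u0: "u \<in> borel_measurable (H (grid n 0))" using u(1) by simp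
  show ?thesis
    using gf.decoupling[OF lg vv G F0(2,3) u0 u(2)] by (simp add: GZ)
qed

end

section \<open>Independence of an observation from the initial information\<close>

context prob_space
begin

lemma l2_inner_tendsto:
  assumes f: "l2 f" "\<And>n::nat. l2 (g n)" and h: "l2 h"
    and lim: "(\<lambda>n. (\<E> w. (f w - g n w)\<^sup>2)) \<longlonglongrightarrow> 0"
  shows "(\<lambda>n. (\<E> w. g n w * h w)) \<longlonglongrightarrow> (\<E> w. f w * h w)"
proof -
  have le: "((\<E> w. f w * h w) - (\<E> w. g n w * h w))\<^sup>2
      \<le> (\<E> w. (f w - g n w)\<^sup>2) * (\<E> w. (h w)\<^sup>2)" for n
  proof -
    have "(\<E> w. f w * h w) - (\<E> w. g n w * h w) = (\<E> w. (f w - g n w) * h w)"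
      using l2_mult_integrable[OF f(1) h] l2_mult_integrable[OF f(2) h] by (simp add: left_diff_distrib)
    then show ?thesis using l2_cauchy_schwarz[OF l2_diff[OF f] h] by simp
  qed
  have "(\<lambda>n. (\<E> w. (f w - g n w)\<^sup>2) * (\<E> w. (h w)\<^sup>2)) \<longlonglongrightarrow> 0"
    using tendsto_mult_left_zero[OF lim] by simp
  then have "(\<lambda>n. ((\<E> w. f w * h w) - (\<E> w. g n w * h w))\<^sup>2) \<longlonglongrightarrow> 0"
    by (rule Lim_null_comparison[rotated]) (use le in simp)
  then have "(\<lambda>n. (\<E> w. f w * h w) - (\<E> w. g n w * h w)) \<longlonglongrightarrow> 0"
    by (simp only: power_tendsto_0_iff zero_less_numeral)
  from tendsto_diff[OF tendsto_const this, of "(\<E> w. f w * h w)"] show ?thesis by simp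
qed

end

context finite_horizon
begin

lemma Q_diff_commute: "Q (\<lambda>t w. X t w - Y t w) = Q (\<lambda>t w. Y t w - X t w)"
  unfolding Q_def by (simp add: power2_commute)

lemma time_int_Q:
  assumes X: "l2p X" and t: "t \<in> {0..T}"
  shows "(\<E> w. (time_int X t w)\<^sup>2) \<le> T * Q X"
proof -
  have i: "integrable TM (\<lambda>s. (\<E> w. (X s w)\<^sup>2))"
    using TP.integrable_fst[OF l2p_mult_integrable[OF X X]] by (simp add: power2_eq_square)
  have "(LBINT s:{0..t}. (\<E> w. (X s w)\<^sup>2)) = (\<integral>s. indicator {0..t} s * (\<E> w. (X s w)\<^sup>2) \<partial>TM)"
    using t by (simp add: integral_TM)
  also have "\<dots> \<le> (\<integral>s. (\<E> w. (X s w)\<^sup>2) \<partial>TM)"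
    by (rule integral_mono[OF integrable_cell(1)[OF i] i]) (auto simp: indicator_def)
  finally have "T * (LBINT s:{0..t}. (\<E> w. (X s w)\<^sup>2)) \<le> T * Q X"
    unfolding Q_def integral_TM_full using T_pos by simp
  then show ?thesis using l2p_time_int_bound(2)[OF X t] by linarith
qed

text \<open>
  The averages of \<open>\<beta>\<close> over a grid are measurable with respect to the observation at the beginning
  of each cell, and are replaced by cylinder functions there.
\<close>

lemma coarse_approximation:
  assumes \<beta>: "l2p \<beta>" and Y: "\<And>r. r \<in> {0..T} \<Longrightarrow> Y r \<in> borel_measurable M"
    and ad: "\<And>t. t \<in> {0..T} \<Longrightarrow> \<beta> t \<in> borel_measurable (aug_filtration M {Y} t)" and \<eta>: "\<eta> > 0"
  obtains N F where "N > 0" "\<And>k. k < N \<Longrightarrow> lip_cyl (grid N k) (F k)" "\<And>k. k < N \<Longrightarrow> l2 (\<lambda>w. F k (\<lambda>r. Y r w))"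
    "Q (\<lambda>t w. \<beta> t w - step N (\<lambda>k. F k (\<lambda>r. Y r w)) t) \<le> \<eta>"
proof -
  have filt: "filtration (aug_filtration M {Y})" by (rule aug_filtration_filtration) (use Y in auto)
  have "\<forall>\<^sub>F n in sequentially. Q (\<lambda>t w. step (Suc n) (\<lambda>k. average (Suc n) (\<lambda>s. \<beta> s w) k) t - \<beta> t w) < \<eta> / 4"
    using order_tendstoD(2)[OF average_process_converges[OF \<beta>], of "\<eta> / 4"] \<eta> by simp
  then obtain n where n: "Q (\<lambda>t w. step (Suc n) (\<lambda>k. average (Suc n) (\<lambda>s. \<beta> s w) k) t - \<beta> t w) < \<eta> / 4"
    by (auto dest!: eventually_happens)
  define N where "N = Suc n"
  have N: "N > 0" by (simp add: N_def)
  let ?a = "\<lambda>k w. average N (\<lambda>s. \<beta> s w) k"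
  have a: "l2 (?a k)" if "k < N" for k using l2_average[OF \<beta> N, of k] that by simp
  have e: "\<eta> / (4 * T) > 0" using \<eta> T_pos by simp
  have "\<forall>k. \<exists>F. k < N \<longrightarrow> lip_cyl (grid N k) F \<and> (\<E> w. (?a k w - F (\<lambda>r. Y r w))\<^sup>2) < \<eta> / (4 * T)"
  proof
    fix k
    show "\<exists>F. k < N \<longrightarrow> lip_cyl (grid N k) F \<and> (\<E> w. (?a k w - F (\<lambda>r. Y r w))\<^sup>2) < \<eta> / (4 * T)"
    proof (cases "k < N")
      case True
      then have k: "k \<le> N" by simp
      from cylinder_dense[OF Y grid_range[OF N k] average_adapted[OF filt \<beta> N k ad] a[OF True] e]
      show ?thesis by blast
    qed simp
  qed
  then obtain F where F: "\<And>k. k < N \<Longrightarrow> lip_cyl (grid N k) (F k)"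
    "\<And>k. k < N \<Longrightarrow> (\<E> w. (?a k w - F k (\<lambda>r. Y r w))\<^sup>2) < \<eta> / (4 * T)"
    by (metis choice)
  have FY: "l2 (\<lambda>w. F k (\<lambda>r. Y r w))" if k: "k < N" for k
  proof -
    obtain B where "\<And>y. \<bar>F k y\<bar> \<le> B" using lip_cyl_bounded[OF F(1)[OF k]] by blast
    moreover have "(\<lambda>w. F k (\<lambda>r. Y r w)) \<in> borel_measurable M"
      by (rule lip_cyl_measurable[OF F(1)[OF k]]) (use Y grid_range[OF N, of k] k in auto)
    ultimately show ?thesis by (intro l2_bounded) auto
  qed
  let ?s = "\<lambda>t w. step N (\<lambda>k. ?a k w) t" and ?f = "\<lambda>t w. step N (\<lambda>k. F k (\<lambda>r. Y r w)) t"
  have s: "l2p ?s" by (rule l2p_step[OF a])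
  have f: "l2p ?f" by (rule l2p_step[OF FY])
  have "Q (\<lambda>t w. ?s t w - ?f t w) = Q (\<lambda>t w. step N (\<lambda>k. ?a k w - F k (\<lambda>r. Y r w)) t)"
    by (simp only: step_linear)
  also have "\<dots> = T / real N * (\<Sum>k<N. (\<E> w. (?a k w - F k (\<lambda>r. Y r w))\<^sup>2))"
    by (rule Q_step[OF N]) (intro l2_diff a FY)
  also have "\<dots> \<le> T / real N * (\<Sum>k<N. \<eta> / (4 * T))"
    using T_pos F(2) by (intro mult_left_mono sum_mono) (auto intro: less_imp_le)
  also have "\<dots> = \<eta> / 4" using T_pos N by simp
  finally have 2: "Q (\<lambda>t w. ?s t w - ?f t w) \<le> \<eta> / 4" .
  have 1: "Q (\<lambda>t w. \<beta> t w - ?s t w) \<le> \<eta> / 4"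
    using n by (subst Q_diff_commute) (simp add: N_def)
  have "Q (\<lambda>t w. (\<beta> t w - ?s t w) + (?s t w - ?f t w)) \<le> \<eta>"
    using Q_add[OF l2p_diff[OF \<beta> s] l2p_diff[OF s f]] 1 2 by linarith
  then have "Q (\<lambda>t w. \<beta> t w - ?f t w) \<le> \<eta>" by simp
  then show thesis using N F(1) FY by (intro that[of N F]) auto
qed

lemma discretised_observation_error:
  assumes W: "brownian_wrt H W" and W0: "AE w in M. W 0 w = 0" and \<beta>: "l2p \<beta>" and n: "n > 0"
    and b: "\<And>k. k < n \<Longrightarrow> l2 (b k)" and r: "r \<in> {0..T}"
    and C: "\<And>t. t \<in> {0..T} \<Longrightarrow> (\<E> w. (\<beta> t w)\<^sup>2) \<le> C" "C \<ge> 0" and i: "i = nat \<lfloor>r / (T / real n)\<rfloor>"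
  defines "E \<equiv> \<lambda>w. time_int \<beta> r w + W r w - (T / real n * (\<Sum>k<i. b k w) + (W (grid n i) w - W 0 w))"
  shows "l2 E" "(\<E> w. (E w)\<^sup>2) \<le> 2 * (T * (C * (T / real n)))
      + 4 * (T * Q (\<lambda>t w. step n (\<lambda>k. b k w) t - \<beta> t w)) + 4 * (T / real n)"
proof -
  let ?d = "T / real n" let ?S = "\<lambda>t w. step n (\<lambda>k. b k w) t" let ?g = "grid n i"
  have d: "?d > 0" using n T_pos by simp
  have "0 \<le> r / ?d" using r d by simp
  then have ri: "real i \<le> r / ?d" "r / ?d < real i + 1" unfolding i by (auto simp: of_nat_nat)
  have g: "?g \<le> r" "r - ?g \<le> ?d"
  proof -
    have "x * q \<le> r \<and> r - x * q \<le> q" if "x \<le> r / q" "r / q < x + 1" "0 < q" for x q :: real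
      using that by (simp add: pos_le_divide_eq pos_divide_less_eq algebra_simps)
    from this[OF ri d] show "?g \<le> r" "r - ?g \<le> ?d" by (auto simp only: grid_def)
  qed
  have "r / ?d \<le> real n" using r n T_pos d by (simp add: pos_divide_le_eq)
  then have "real i \<le> real n" using ri by linarith
  then have iN: "i \<le> n" by simp
  have gT: "?g \<in> {0..T}" using grid_range[OF n iN] .
  have S: "l2p ?S" by (rule l2p_step[OF b])
  have D: "l2p (\<lambda>t w. ?S t w - \<beta> t w)" by (intro l2p_diff S \<beta>)
  define A where "A w = time_int \<beta> r w - time_int \<beta> ?g w" for w
  define B where "B w = - time_int (\<lambda>t w. ?S t w - \<beta> t w) ?g w" for w
  define V where "V w = W r w - W ?g w" for w
  have lA: "l2 A" unfolding A_def[abs_def] by (intro l2_diff l2p_time_int_bound(1)[OF \<beta>] r gT)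
  have lB: "l2 B" unfolding B_def[abs_def] by (intro l2_minus l2p_time_int_bound(1)[OF D] gT)
  have lV: "l2 V" unfolding V_def[abs_def] by (rule brownian_increment_moments(1)[OF W]) (use g r gT in auto)
  have AE: "AE w in M. A w + (B w + V w) = E w"
    using W0 time_int_diff[OF S \<beta> gT]
    by eventually_elim (simp add: E_def A_def B_def V_def time_int_step[OF n iN])
  have Wm: "W t \<in> borel_measurable M" if "t \<in> {0..T}" for t using brownian_wrt_adapted(2)[OF W that] .
  have Em: "E \<in> borel_measurable M"
    unfolding E_def using Wm[OF r] Wm[OF gT] Wm[of 0] T_pos l2_measurable[OF l2p_time_int_bound(1)[OF \<beta> r]] l2_measurable[OF b] iN
    by (intro borel_measurable_add borel_measurable_diff borel_measurable_times borel_measurable_const borel_measurable_sum) auto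
  have lABV: "l2 (\<lambda>w. A w + (B w + V w))" by (intro l2_add lA lB lV)
  show "l2 E" by (rule l2_cong_AE[OF lABV Em AE])
  have "(\<E> w. (E w)\<^sup>2) = (\<E> w. (A w + (B w + V w))\<^sup>2)"
    by (rule expectation_square_cong_AE[symmetric, OF AE l2_measurable[OF lABV] Em])
  also have "\<dots> \<le> (\<E> w. 2 * (A w)\<^sup>2 + 4 * (B w)\<^sup>2 + 4 * (V w)\<^sup>2)"
  proof (rule integral_mono)
    show "(A w + (B w + V w))\<^sup>2 \<le> 2 * (A w)\<^sup>2 + 4 * (B w)\<^sup>2 + 4 * (V w)\<^sup>2" for w
      using square_sum_le[of "A w" "B w + V w"] square_sum_le[of "B w" "V w"] by linarith
  qed (use lA[THEN l2_square_integrable] lB[THEN l2_square_integrable] lV[THEN l2_square_integrable] l2_square_integrable[OF lABV] in auto)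
  also have "\<dots> = 2 * (\<E> w. (A w)\<^sup>2) + 4 * (\<E> w. (B w)\<^sup>2) + 4 * (\<E> w. (V w)\<^sup>2)"
    using lA lB lV by (simp add: l2_square_integrable)
  finally have le: "(\<E> w. (E w)\<^sup>2) \<le> \<dots>" .
  have 1: "(\<E> w. (A w)\<^sup>2) \<le> T * (C * ?d)"
  proof -
    have "(\<E> w. (A w)\<^sup>2) \<le> T * (C * (r - ?g))"
      unfolding A_def by (rule time_int_increment[OF \<beta> _ _ _ C(1)]) (use g r gT in auto)
    also have "\<dots> \<le> T * (C * ?d)" using g(2) T_pos C(2) by (intro mult_left_mono) auto
    finally show ?thesis .
  qed
  have 2: "(\<E> w. (B w)\<^sup>2) \<le> T * Q (\<lambda>t w. ?S t w - \<beta> t w)"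
    unfolding B_def using time_int_Q[OF D gT] by simp
  have 3: "(\<E> w. (V w)\<^sup>2) \<le> ?d"
    unfolding V_def using brownian_increment_moments(3)[OF W, of ?g r] g r gT by auto
  show "(\<E> w. (E w)\<^sup>2) \<le> 2 * (T * (C * ?d)) + 4 * (T * Q (\<lambda>t w. ?S t w - \<beta> t w)) + 4 * ?d"
    using le 1 2 3 by linarith
qed

text \<open>
  First a coarse grid and a cylinder feedback \<open>F\<close> are fixed such that \<open>F\<close> along \<open>Y\<close> is within \<open>\<eta>\<close> of the
  drift. Then the fine grid is refined: the discretised observation \<open>Z j\<close> converges to \<open>Y\<close>, and by
  the Lipschitz property so does the feedback along \<open>Z j\<close>. In the limit the defect of independence
  is bounded in terms of \<open>\<eta>\<close>, which is arbitrary.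
\<close>

lemma observation_decoupled:
  assumes W: "brownian_wrt H W" and W0: "AE w in M. W 0 w = 0" and \<beta>: "l2p \<beta>"
    and Y: "\<And>t w. Y t w = time_int \<beta> t w + W t w"
    and adY: "\<And>t. t \<in> {0..T} \<Longrightarrow> \<beta> t \<in> borel_measurable (aug_filtration M {Y} t)"
    and adH: "\<And>t. t \<in> {0..T} \<Longrightarrow> \<beta> t \<in> borel_measurable (H t)"
    and u: "u \<in> borel_measurable (H 0)" "\<And>w. 0 \<le> u w \<and> u w \<le> 1" and F0: "lip_cyl T F0"
  shows "(\<E> w. F0 (\<lambda>r. Y r w) * u w) = (\<E> w. F0 (\<lambda>r. Y r w)) * expectation u"
proof -
  note filt = brownian_wrt_filtration[OF W]
  have z: "0 \<in> {0..T}" and TT: "T \<in> {0..T}" using T_pos by auto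
  have Ym: "Y r \<in> borel_measurable M" if r: "r \<in> {0..T}" for r
  proof -
    have "(\<lambda>w. time_int \<beta> r w + W r w) \<in> borel_measurable M"
      using l2_measurable[OF l2p_time_int_bound(1)[OF \<beta> r]] brownian_wrt_adapted(2)[OF W r] by auto
    then show ?thesis by (simp add: Y[abs_def])
  qed
  obtain C where C: "C \<ge> 0" "\<And>t. t \<in> {0..T} \<Longrightarrow> (\<E> w. (\<beta> t w)\<^sup>2) \<le> C" using l2p_bound[OF \<beta>] by blast
  obtain C0 where C0: "C0 > 0" "\<And>y. \<bar>F0 y\<bar> \<le> C0" using lip_cyl_bounded[OF F0] by blast
  have uM: "u \<in> borel_measurable M" using filtrationD(4)[OF filt z u(1)] .
  have u1: "\<bar>u w\<bar> \<le> 1" for w using u(2)[of w] by auto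
  have lu: "l2 u" by (rule l2_bounded[OF uM u1])
  define X where "X = \<bar>(\<E> w. F0 (\<lambda>r. Y r w) * u w) - (\<E> w. F0 (\<lambda>r. Y r w)) * expectation u\<bar>"
  have bound: "X \<le> 4 * C0 * (2 * sqrt (4 * \<eta>) + 4 * \<eta>)" if \<eta>: "\<eta> > 0" for \<eta>
  proof -
    obtain N F where N: "N > 0" and F: "\<And>k. k < N \<Longrightarrow> lip_cyl (grid N k) (F k)"
      and FY: "\<And>k. k < N \<Longrightarrow> l2 (\<lambda>w. F k (\<lambda>r. Y r w))"
      and QF: "Q (\<lambda>t w. \<beta> t w - step N (\<lambda>k. F k (\<lambda>r. Y r w)) t) \<le> \<eta>"
      using coarse_approximation[OF \<beta> Ym adY \<eta>] by blast
    \<comment> \<open>refinements of the coarse grid, so that each fine cell lies in one coarse cell\<close>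
    define n where "n j = N * Suc j" for j
    have n: "n j > 0" for j using N by (simp add: n_def)
    define b where "b j k w = average (n j) (\<lambda>s. \<beta> s w) k" for j k w
    have bl: "l2 (b j k)" if "k < n j" for j k unfolding b_def[abs_def] using l2_average[OF \<beta> n, of k j] that by simp
    have bH: "b j k \<in> borel_measurable (H (grid (n j) k))" if "k < n j" for j k
      unfolding b_def[abs_def] using average_adapted[OF filt \<beta> n _ adH, of k j] that by simp
    define Z where "Z j r w = T / real (n j) * (\<Sum>k<nat \<lfloor>r / (T / real (n j))\<rfloor>. b j k w)
        + (W (grid (n j) (nat \<lfloor>r / (T / real (n j))\<rfloor>)) w - W 0 w)" for j r w
    define qa where "qa j = Q (\<lambda>t w. step (n j) (\<lambda>k. b j k w) t - \<beta> t w)" for j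
    have qa: "qa \<longlonglongrightarrow> 0"
    proof -
      have "strict_mono (\<lambda>j. n j - 1)"
        by (rule strict_monoI_Suc) (use N in \<open>auto simp: n_def\<close>)
      from LIMSEQ_subseq_LIMSEQ[OF average_process_converges[OF \<beta>] this]
      show ?thesis unfolding qa_def[abs_def] b_def using n by (simp add: comp_def)
    qed
    have dn: "(\<lambda>j. T / real (n j)) \<longlonglongrightarrow> 0"
    proof -
      have eq: "(T / real N) * inverse (real (Suc j)) = T / real (n j)" for j
        by (simp only: n_def of_nat_mult divide_inverse inverse_mult_distrib mult.assoc)
      have "(\<lambda>j. (T / real N) * inverse (real (Suc j))) \<longlonglongrightarrow> (T / real N) * 0"
        by (intro tendsto_intros LIMSEQ_inverse_real_of_nat)
      then show ?thesis by (simp only: eq mult_zero_right)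
    qed
    have Zerr: "l2 (\<lambda>w. Y r w - Z j r w)" "(\<E> w. (Y r w - Z j r w)\<^sup>2) \<le> 2 * (T * (C * (T / real (n j)))) + 4 * (T * qa j) + 4 * (T / real (n j))"
      if r: "r \<in> {0..T}" for j r
      using discretised_observation_error[OF W W0 \<beta> n bl r C(2,1) refl, of j] by (simp_all add: Y Z_def qa_def)
    have Zm: "Z j r \<in> borel_measurable M" if r: "r \<in> {0..T}" for j r
    proof -
      have "(\<lambda>w. Y r w - (Y r w - Z j r w)) \<in> borel_measurable M" using Ym[OF r] l2_measurable[OF Zerr(1)[OF r]] by (rule borel_measurable_diff)
      then show ?thesis by simp
    qed
    have Zlim: "(\<lambda>j. (\<E> w. (Y r w - Z j r w)\<^sup>2)) \<longlonglongrightarrow> 0" if r: "r \<in> {0..T}" for r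
    proof (rule Lim_null_comparison)
      have "(\<lambda>j. 2 * (T * (C * (T / real (n j)))) + 4 * (T * qa j) + 4 * (T / real (n j))) \<longlonglongrightarrow> 2 * (T * (C * 0)) + 4 * (T * 0) + 4 * 0"
        by (intro tendsto_add tendsto_mult tendsto_const dn qa)
      then show "(\<lambda>j. 2 * (T * (C * (T / real (n j)))) + 4 * (T * qa j) + 4 * (T / real (n j))) \<longlonglongrightarrow> 0" by simp
    qed (use Zerr(2)[OF r] in simp)
    have FZl: "l2 (\<lambda>w. G (\<lambda>r. Z j r w))" if G: "lip_cyl t G" "t \<le> T" for G t j
    proof -
      obtain B where "\<And>y. \<bar>G y\<bar> \<le> B" using lip_cyl_bounded[OF G(1)] by blast
      moreover have "(\<lambda>w. G (\<lambda>r. Z j r w)) \<in> borel_measurable M"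
        by (rule lip_cyl_measurable[OF G(1)]) (use Zm G(2) in auto)
      ultimately show ?thesis by (intro l2_bounded) auto
    qed
    have gN: "grid N k \<le> T" if "k < N" for k using grid_range[OF N, of k] that by simp
    define qc where "qc j = Q (\<lambda>t w. step N (\<lambda>k. F k (\<lambda>r. Y r w) - F k (\<lambda>r. Z j r w)) t)" for j
    have qc: "qc \<longlonglongrightarrow> 0"
    proof -
      have eq: "qc j = T / real N * (\<Sum>k<N. (\<E> w. (F k (\<lambda>r. Y r w) - F k (\<lambda>r. Z j r w))\<^sup>2))" for j
        unfolding qc_def by (rule Q_step[OF N]) (intro l2_diff FY FZl[OF F gN])
      have "(\<lambda>j. T / real N * (\<Sum>k<N. (\<E> w. (F k (\<lambda>r. Y r w) - F k (\<lambda>r. Z j r w))\<^sup>2))) \<longlonglongrightarrow> T / real N * (\<Sum>k<N. 0)"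
        using F gN by (intro tendsto_mult tendsto_const tendsto_sum lip_cyl_converges[OF _ _ Ym Zm Zerr(1) Zlim]) auto
      then show ?thesis unfolding eq[abs_def] by simp
    qed
    define v where "v j = Q (\<lambda>t w. step (n j) (\<lambda>k. b j k w) t - step N (\<lambda>k. F k (\<lambda>r. Z j r w)) t)" for j
    define p where "p j = 2 * qa j + 4 * \<eta> + 4 * qc j" for j
    have vw: "v j \<le> p j" for j
    proof -
      let ?S = "\<lambda>t w. step (n j) (\<lambda>k. b j k w) t" and ?f = "\<lambda>t w. step N (\<lambda>k. F k (\<lambda>r. Y r w)) t"
        and ?z = "\<lambda>t w. step N (\<lambda>k. F k (\<lambda>r. Z j r w)) t"
      have l: "l2p ?S" "l2p ?f" "l2p ?z"
        using bl FY FZl[OF F gN] by (auto intro!: l2p_step)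
      have "Q (\<lambda>t w. (\<beta> t w - ?f t w) + (?f t w - ?z t w)) \<le> 2 * \<eta> + 2 * qc j"
        using Q_add[OF l2p_diff[OF \<beta> l(2)] l2p_diff[OF l(2,3)]] QF by (simp add: qc_def step_linear)
      moreover have "v j = Q (\<lambda>t w. (?S t w - \<beta> t w) + ((\<beta> t w - ?f t w) + (?f t w - ?z t w)))"
        unfolding v_def by simp
      ultimately show ?thesis
        using Q_add[OF l2p_diff[OF l(1) \<beta>] l2p_add[OF l2p_diff[OF \<beta> l(2)] l2p_diff[OF l(2,3)]]]
        unfolding p_def qa_def by linarith
    qed
    have v0: "0 \<le> v j" for j unfolding v_def by (rule Q_nonneg)
    let ?X = "\<lambda>j. \<bar>(\<E> w. F0 (\<lambda>r. Z j r w) * u w) - (\<E> w. F0 (\<lambda>r. Z j r w)) * expectation u\<bar>"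
    have step: "?X j \<le> 4 * C0 * (2 * sqrt (p j) + p j)" for j
    proof -
      have "?X j \<le> 4 * C0 * (2 * sqrt (v j) + v j)"
        by (rule observation_step[OF W N zero_less_Suc n_def[of j] bH bl F F0 C0(2,1) u Z_def v_def])
      also have "\<dots> \<le> 4 * C0 * (2 * sqrt (p j) + p j)"
        using vw[of j] v0[of j] C0(1) by (intro mult_left_mono add_mono) auto
      finally show ?thesis .
    qed
    have F0l: "l2 (\<lambda>w. F0 (\<lambda>r. Y r w))"
    proof -
      have "(\<lambda>w. F0 (\<lambda>r. Y r w)) \<in> borel_measurable M" by (rule lip_cyl_measurable[OF F0]) (use Ym in auto)
      then show ?thesis using C0(2) by (intro l2_bounded) auto
    qed
    note F0lim = lip_cyl_converges[OF F0 order_refl Ym Zm Zerr(1) Zlim]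
    have i1: "(\<lambda>j. (\<E> w. F0 (\<lambda>r. Z j r w) * u w)) \<longlonglongrightarrow> (\<E> w. F0 (\<lambda>r. Y r w) * u w)"
      by (rule l2_inner_tendsto[OF F0l FZl[OF F0 order_refl] lu F0lim])
    have i2: "(\<lambda>j. (\<E> w. F0 (\<lambda>r. Z j r w))) \<longlonglongrightarrow> (\<E> w. F0 (\<lambda>r. Y r w))"
      using l2_inner_tendsto[OF F0l FZl[OF F0 order_refl] l2_const F0lim, of 1] by simp
    have l1: "?X \<longlonglongrightarrow> X" unfolding X_def by (intro tendsto_rabs tendsto_diff tendsto_mult i1 i2 tendsto_const)
    have "p \<longlonglongrightarrow> 2 * 0 + 4 * \<eta> + 4 * 0" unfolding p_def[abs_def] by (intro tendsto_add tendsto_mult tendsto_const qa qc)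
    then have "p \<longlonglongrightarrow> 4 * \<eta>" by simp
    then have rlim: "(\<lambda>j. 4 * C0 * (2 * sqrt (p j) + p j)) \<longlonglongrightarrow> 4 * C0 * (2 * sqrt (4 * \<eta>) + 4 * \<eta>)"
      by (intro tendsto_intros)
    show ?thesis by (rule LIMSEQ_le[OF l1 rlim]) (use step in blast)
  qed
  have "X \<le> 4 * C0 * (2 * sqrt (4 * 0) + 4 * 0)"
  proof (rule LIMSEQ_le_const)
    show "(\<lambda>i. 4 * C0 * (2 * sqrt (4 * inverse (real (Suc i))) + 4 * inverse (real (Suc i)))) \<longlonglongrightarrow> 4 * C0 * (2 * sqrt (4 * 0) + 4 * 0)"
      by (intro tendsto_intros LIMSEQ_inverse_real_of_nat)
    show "\<exists>N. \<forall>i\<ge>N. X \<le> 4 * C0 * (2 * sqrt (4 * inverse (real (Suc i))) + 4 * inverse (real (Suc i)))"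
      using bound by (intro exI[of _ 0] allI impI) auto
  qed
  then have "X \<le> 0" by simp
  then show ?thesis unfolding X_def by linarith
qed

end

section \<open>Controls driven by their own observation\<close>

context finite_horizon
begin

text \<open>Cylinder functions of \<open>Y\<close> are dense.\<close>

lemma observation_independent:
  assumes W: "brownian_wrt H W" and W0: "AE w in M. W 0 w = 0" and \<beta>: "l2p \<beta>"
    and Y: "\<And>t w. Y t w = time_int \<beta> t w + W t w"
    and adY: "\<And>t. t \<in> {0..T} \<Longrightarrow> \<beta> t \<in> borel_measurable (aug_filtration M {Y} t)"
    and adH: "\<And>t. t \<in> {0..T} \<Longrightarrow> \<beta> t \<in> borel_measurable (H t)"
    and u: "u \<in> borel_measurable (H 0)" "\<And>w. 0 \<le> u w \<and> u w \<le> 1"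
    and U: "U \<in> borel_measurable (aug_filtration M {Y} T)" "l2 U"
  shows "(\<E> w. U w * u w) = expectation U * expectation u"
proof -
  have z: "0 \<in> {0..T}" and TT: "T \<in> {0..T}" using T_pos by auto
  have Ym: "Y r \<in> borel_measurable M" if r: "r \<in> {0..T}" for r
  proof -
    have "(\<lambda>w. time_int \<beta> r w + W r w) \<in> borel_measurable M"
      using l2_measurable[OF l2p_time_int_bound(1)[OF \<beta> r]] brownian_wrt_adapted(2)[OF W r] by auto
    then show ?thesis by (simp add: Y[abs_def])
  qed
  have uM: "u \<in> borel_measurable M" using filtrationD(4)[OF brownian_wrt_filtration[OF W] z u(1)] .
  have u1: "\<bar>u w\<bar> \<le> 1" for w using u(2)[of w] by auto
  have lu: "l2 u" by (rule l2_bounded[OF uM u1])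
  have "\<forall>i. \<exists>F. lip_cyl T F \<and> (\<E> w. (U w - F (\<lambda>r. Y r w))\<^sup>2) < inverse (real (Suc i))"
    using cylinder_dense[OF Ym TT U] by simp
  then obtain F where F: "\<And>i. lip_cyl T (F i)" "\<And>i. (\<E> w. (U w - F i (\<lambda>r. Y r w))\<^sup>2) < inverse (real (Suc i))"
    by (metis choice)
  have Fl: "l2 (\<lambda>w. F i (\<lambda>r. Y r w))" for i
  proof -
    obtain B where "\<And>y. \<bar>F i y\<bar> \<le> B" using lip_cyl_bounded[OF F(1)] by blast
    moreover have "(\<lambda>w. F i (\<lambda>r. Y r w)) \<in> borel_measurable M" by (rule lip_cyl_measurable[OF F(1)]) (use Ym in auto)
    ultimately show ?thesis by (intro l2_bounded) auto
  qed
  have lim: "(\<lambda>i. (\<E> w. (U w - F i (\<lambda>r. Y r w))\<^sup>2)) \<longlonglongrightarrow> 0"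
    by (rule Lim_null_comparison[OF _ LIMSEQ_inverse_real_of_nat]) (use F(2) in \<open>auto intro!: always_eventually less_imp_le simp del: of_nat_Suc\<close>)
  have "(\<lambda>i. (\<E> w. F i (\<lambda>r. Y r w)) * expectation u) \<longlonglongrightarrow> (\<E> w. U w * u w)"
    using l2_inner_tendsto[OF U(2) Fl lu lim] observation_decoupled[OF W W0 \<beta> Y adY adH u F(1)] by simp
  moreover have "(\<lambda>i. (\<E> w. F i (\<lambda>r. Y r w)) * expectation u) \<longlonglongrightarrow> expectation U * expectation u"
    using l2_inner_tendsto[OF U(2) Fl l2_const lim, of 1] by (intro tendsto_mult tendsto_const) simp
  ultimately show ?thesis by (rule LIMSEQ_unique)
qed

lemma measurable_subset_sets:
  assumes "sets F \<subseteq> sets G" "space F = space G" "f \<in> measurable F N"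
  shows "f \<in> measurable G N"
  by (rule measurable_from_subalg[OF _ assms(3)]) (use assms in \<open>auto simp: subalgebra_def\<close>)

text \<open>The noise is the observation minus the integral of a drift that the observation determines.\<close>

lemma noise_adapted_to_observation:
  assumes \<beta>: "l2p \<beta>" and Wm: "\<And>t. t \<in> {0..T} \<Longrightarrow> W t \<in> borel_measurable M"
    and Y: "\<And>t w. Y t w = time_int \<beta> t w + W t w"
    and adY: "\<And>t. t \<in> {0..T} \<Longrightarrow> \<beta> t \<in> borel_measurable (aug_filtration M {Y} t)" and t: "t \<in> {0..T}"
  shows "filtration (aug_filtration M {Y})" "W t \<in> borel_measurable (aug_filtration M {Y} t)"
    "sets (aug_filtration M {W} t) \<subseteq> sets (aug_filtration M {Y} t)"
proof -
  have Ym: "Y r \<in> borel_measurable M" if r: "r \<in> {0..T}" for r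
  proof -
    have "(\<lambda>w. time_int \<beta> r w + W r w) \<in> borel_measurable M"
      using l2_measurable[OF l2p_time_int_bound(1)[OF \<beta> r]] Wm[OF r] by auto
    then show ?thesis by (simp add: Y[abs_def])
  qed
  show filt: "filtration (aug_filtration M {Y})" by (rule aug_filtration_filtration) (use Ym in auto)
  have W: "W r \<in> borel_measurable (aug_filtration M {Y} t)" if r: "r \<in> {0..t}" for r
  proof -
    have "time_int \<beta> r \<in> borel_measurable (aug_filtration M {Y} t)"
    proof (rule time_int_adapted[OF filtrationD(1,2)[OF filt t] \<beta>])
      show "r \<in> {0..T}" using r t by auto
      fix s assume s: "s \<in> {0..r}"
      show "\<beta> s \<in> borel_measurable (aug_filtration M {Y} t)"
        by (rule filtration_measurable_mono[OF filt _ _ _ adY[of s]]) (use s r t in auto)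
    qed
    moreover have "Y r \<in> borel_measurable (aug_filtration M {Y} t)"
      using r by (intro aug_filtration_measurable) auto
    ultimately have "(\<lambda>w. Y r w - time_int \<beta> r w) \<in> borel_measurable (aug_filtration M {Y} t)" by auto
    then show ?thesis by (simp add: Y)
  qed
  show "W t \<in> borel_measurable (aug_filtration M {Y} t)" using W t by auto
  show "sets (aug_filtration M {W} t) \<subseteq> sets (aug_filtration M {Y} t)"
  proof (rule aug_filtration_subset)
    show "X r \<in> borel_measurable (aug_filtration M {Y} t)" if "X \<in> {W}" "r \<in> {0..t}" for X r
      using W that by simp
  qed (rule filtrationD(3)[OF filt t], rule filtrationD(2)[OF filt t])
qed

text \<open>
  Let \<open>U\<close> be a bounded transform of the control, \<open>P\<close> its projection onto the past of \<open>W\<close> and \<open>R = U - P\<close>.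
  Both \<open>U\<close> and \<open>P\<close> depend on \<open>Y\<close>, hence are independent of \<open>V\<close>, even after multiplication by an event \<open>A\<close>
  of the past of \<open>W\<close>; so \<open>R\<close> is orthogonal to the indicators of \<open>A \<inter> B\<close> with \<open>B\<close> in \<open>\<sigma>(V)\<close>. These generate
  the \<open>\<sigma>\<close>-algebra of \<open>(W, V)\<close>, in which \<open>R\<close> is measurable, so \<open>R\<close> is orthogonal to itself.
\<close>

lemma control_adapted_to_noise:
  assumes W: "brownian_motion M T W" and V: "brownian_motion M T V" and ind: "independent_processes M T W V"
    and \<beta>: "l2p \<beta>" and Y: "\<And>t w. Y t w = time_int \<beta> t w + W t w"
    and adY: "\<And>t. t \<in> {0..T} \<Longrightarrow> \<beta> t \<in> borel_measurable (aug_filtration M {Y} t)"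
    and adF: "\<And>t. t \<in> {0..T} \<Longrightarrow> \<beta> t \<in> borel_measurable (aug_filtration M {W, V} t)"
    and t: "t \<in> {0..T}"
    and p: "p \<in> borel_measurable (aug_filtration M {Y} t)" "p \<in> borel_measurable (aug_filtration M {W, V} t)"
  shows "(p :: 'a \<Rightarrow> real) \<in> borel_measurable (aug_filtration M {W} t)"
proof -
  have z: "0 \<in> {0..T}" and TT: "T \<in> {0..T}" using T_pos by auto
  have Wm: "W t \<in> borel_measurable M" and Vm: "V t \<in> borel_measurable M" if "t \<in> {0..T}" for t
    using W V that by (auto simp: brownian_motion_def)
  have W0: "AE w in M. W 0 w = 0" using W by (simp add: brownian_motion_def)
  \<comment> \<open>the filtration in which \<open>V\<close> is known at time \<open>0\<close>\<close>
  define H where "H t = sigma (space M) (sets (aug_filtration M {W} t) \<union> sets (aug_filtration M {V} T))" for t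
  have BH: "brownian_wrt H W" unfolding H_def[abs_def] by (rule brownian_enlarged[OF W Vm ind])
  note fH = brownian_wrt_filtration[OF BH]
  have fW: "filtration (aug_filtration M {W})" by (rule aug_filtration_filtration) (use Wm in auto)
  have fV: "filtration (aug_filtration M {V})" by (rule aug_filtration_filtration) (use Vm in auto)
  have fF: "filtration (aug_filtration M {W, V})" by (rule aug_filtration_filtration) (use Wm Vm in auto)
  have full: "sets (aug_filtration M {W, V} t) \<subseteq> sets (H t)" if "t \<in> {0..T}" for t
    unfolding H_def by (rule aug_filtration_pair_subset[OF Wm Vm that])
  have adH: "\<beta> t \<in> borel_measurable (H t)" if t: "t \<in> {0..T}" for t
    by (rule measurable_subset_sets[OF full[OF t] _ adF[OF t]]) (use filtrationD(3)[OF fF t] filtrationD(3)[OF fH t] in simp)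
  have fY: "filtration (aug_filtration M {Y})" by (rule noise_adapted_to_observation(1)[OF \<beta> Wm Y adY t])
  have WYt: "sets (aug_filtration M {W} t) \<subseteq> sets (aug_filtration M {Y} t)"
    by (rule noise_adapted_to_observation(3)[OF \<beta> Wm Y adY t])
  let ?FW = "aug_filtration M {W} t" and ?FV = "aug_filtration M {V} T" and ?FY = "aug_filtration M {Y} T"
  note sW = filtrationD[OF fW t] and sV = filtrationD[OF fV TT] and sY = filtrationD[OF fY TT] and sH = filtrationD[OF fH t]
  \<comment> \<open>\<open>arctan\<close> makes the control bounded without losing information\<close>
  define U where "U w = arctan (p w)" for w
  have Ub: "\<bar>U w\<bar> \<le> 2" for w
    using arctan_bounded[of "p w"] pi_less_4 by (auto simp: U_def abs_le_iff)
  have at: "arctan \<in> borel_measurable borel" by (intro borel_measurable_continuous_onI continuous_intros)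
  have Ut: "U \<in> borel_measurable (aug_filtration M {Y} t)" unfolding U_def[abs_def] by (rule measurable_compose[OF p(1) at])
  have UY: "U \<in> borel_measurable ?FY"
    by (rule filtration_measurable_mono[OF fY _ _ _ Ut]) (use t in auto)
  have UM: "U \<in> borel_measurable M" using sY(4)[OF UY] .
  have lU: "l2 U" by (rule l2_bounded[OF UM Ub])
  define P where "P = real_cond_exp M ?FW U"
  have PF: "P \<in> borel_measurable ?FW" by (simp add: P_def)
  have lP: "l2 P" unfolding P_def by (rule l2_orthogonal_projection(1)[OF sW(1) lU])
  have WY: "f \<in> borel_measurable ?FY" if f: "f \<in> borel_measurable ?FW" for f :: "'a \<Rightarrow> real"
  proof -
    have "f \<in> borel_measurable (aug_filtration M {Y} t)"
      by (rule measurable_subset_sets[OF WYt _ f]) (use sW(3) filtrationD(3)[OF fY t] in simp)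
    then show ?thesis by (rule filtration_measurable_mono[OF fY, rotated 3]) (use t in auto)
  qed
  define R where "R w = U w - P w" for w
  have lR: "l2 R" unfolding R_def[abs_def] by (intro l2_diff lU lP)
  have RH: "R \<in> borel_measurable (H t)"
  proof -
    have "U \<in> borel_measurable (aug_filtration M {W, V} t)" unfolding U_def[abs_def] by (rule measurable_compose[OF p(2) at])
    then have "U \<in> borel_measurable (H t)"
      by (rule measurable_subset_sets[OF full[OF t], rotated]) (use filtrationD(3)[OF fF t] sH(3) in simp)
    moreover have "P \<in> borel_measurable (H t)"
    proof (rule measurable_subset_sets[OF _ _ PF])
      show "sets ?FW \<subseteq> sets (H t)" unfolding H_def by (rule subalgebra_join(2)[OF sW(1) sV(1)])
    qed (use sW(3) sH(3) in simp)
    ultimately show ?thesis unfolding R_def[abs_def] by auto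
  qed
  let ?G = "{A \<inter> B | A B. A \<in> sets ?FW \<and> B \<in> sets ?FV}"
  let ?N = "restr_to_subalg M (H t)"
  interpret N: prob_space ?N using prob_space_axioms sH(1) by (simp add: prob_space_restr_to_subalg)
  have sN: "sets ?N = sets (H t)" "space ?N = space M" using sH(1) by (auto simp: sets_restr_to_subalg space_restr_to_subalg)
  have subW: "sets ?FW \<subseteq> sets (H t)" "sets ?FV \<subseteq> sets (H t)" unfolding H_def by (rule subalgebra_join(2,3)[OF sW(1) sV(1)])+
  have GH: "?G \<subseteq> sets (H t)" using subW by auto
  have gen: "sets ?N = sigma_sets (space ?N) ?G"
  proof
    have "sets (H t) \<subseteq> sigma_sets (space M) ?G" unfolding H_def by (rule generated_by_inter[OF sW(1) sV(1)])
    then show "sets ?N \<subseteq> sigma_sets (space ?N) ?G" unfolding sN .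
    show "sigma_sets (space ?N) ?G \<subseteq> sets ?N" unfolding sN using sets.sigma_sets_subset[OF GH] sH(3) by simp
  qed
  have ist: "Int_stable ?G"
  proof (rule Int_stableI, clarify)
    fix A B A' B' assume "A \<in> sets ?FW" "B \<in> sets ?FV" "A' \<in> sets ?FW" "B' \<in> sets ?FV"
    then show "\<exists>C D. A \<inter> B \<inter> (A' \<inter> B') = C \<inter> D \<and> C \<in> sets ?FW \<and> D \<in> sets ?FV"
      by (intro exI[of _ "A \<inter> A'"] exI[of _ "B \<inter> B'"]) auto
  qed
  have GP: "?G \<subseteq> Pow (space ?N)" using GH sets.space_closed[of "H t"] sH(3) sN by auto
  have ortho: "(\<E> w. indicator (A \<inter> B) w * R w) = 0" if A: "A \<in> sets ?FW" and B: "B \<in> sets ?FV" for A B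
  proof -
    have AM: "A \<in> sets M" and BM: "B \<in> sets M" using A B sW(1) sV(1) by (auto simp: subalgebra_def)
    have iA: "indicat_real A \<in> borel_measurable ?FW" using A by simp
    have lA: "l2 (indicat_real A)" by (rule l2_bounded[where C=1]) (use AM in \<open>auto simp: indicator_def\<close>)
    have uB: "indicat_real B \<in> borel_measurable (H 0)"
    proof -
      have "sets ?FV \<subseteq> sets (H 0)" unfolding H_def by (rule subalgebra_join(3)[OF filtrationD(1)[OF fW z] sV(1)])
      then show ?thesis using B by auto
    qed
    have B01: "0 \<le> indicat_real B w \<and> indicat_real B w \<le> 1" for w by (simp add: indicator_def)
    have key: "(\<E> w. (indicator A w * f w) * indicator B w) = (\<E> w. indicator A w * f w) * expectation (indicat_real B)"
      if f: "f \<in> borel_measurable ?FY" "l2 f" for f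
    proof (rule observation_independent[OF BH W0 \<beta> Y adY adH uB B01])
      show "(\<lambda>w. indicator A w * f w) \<in> borel_measurable ?FY" using WY[OF iA] f(1) by auto
      show "l2 (\<lambda>w. indicator A w * f w)"
        by (rule l2_bounded_mult[OF f(2), where C=1]) (use AM in \<open>auto simp: indicator_def\<close>)
    qed
    have eq: "(\<E> w. indicator A w * P w) = (\<E> w. indicator A w * U w)"
      unfolding P_def by (rule l2_orthogonal_projection(2)[OF sW(1) lU lA iA])
    have iAB: "integrable M (\<lambda>w. (indicator A w * f w) * indicator B w)" if "l2 f" for f :: "'a \<Rightarrow> real"
    proof -
      have "l2 (\<lambda>w. (indicator A w * indicator B w) * f w)"
        by (rule l2_bounded_mult[OF that, where C=1]) (use AM BM in \<open>auto simp: indicator_def\<close>)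
      from l2_integrable[OF this] show ?thesis by (simp add: mult_ac)
    qed
    have "(\<E> w. indicator (A \<inter> B) w * R w)
      = (\<E> w. (indicator A w * U w) * indicator B w - (indicator A w * P w) * indicator B w)"
      by (rule Bochner_Integration.integral_cong) (auto simp: R_def indicator_def)
    also have "\<dots> = 0"
      using key[OF UY lU] key[OF WY[OF PF] lP] eq iAB[OF lU] iAB[OF lP] by simp
    finally show ?thesis .
  qed
  let ?P = "\<lambda>f. f \<in> borel_measurable (H t) \<and> l2 f \<and> (\<E> w. f w * R w) = 0"
  have mN: "measurable ?N borel = (measurable (H t) borel :: ('a \<Rightarrow> real) set)" by (rule measurable_cong_sets) (use sN in auto)
  have ind: "?P (indicator E)" if E: "E \<in> ?G" for E
  proof -
    have EH: "E \<in> sets (H t)" using E GH by blast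
    then have EM: "E \<in> sets M" using sH(1) by (auto simp: subalgebra_def)
    have "l2 (indicat_real E)" by (rule l2_bounded[where C=1]) (use EM in \<open>auto simp: indicator_def\<close>)
    moreover have "(\<E> w. indicat_real E w * R w) = 0" using E ortho by blast
    ultimately show ?thesis using EH by simp
  qed
  have "?P R"
  proof (rule N.l2_induct[OF gen ist GP, where P="?P"])
    show "?P (indicator E)" if "E \<in> ?G" for E by (rule ind[OF that])
    have "space M = space M \<inter> space M" "space M \<in> sets ?FW" "space M \<in> sets ?FV" using sW(3) sV(3) sets.top[of ?FW] sets.top[of ?FV] by auto
    then have "space ?N \<in> ?G" unfolding sN by blast
    then show "?P (indicator (space ?N))" by (rule ind)
  next
    fix f g assume f: "?P f" and g: "?P g"
    then show "?P (\<lambda>x. f x + g x)"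
      using l2_mult_integrable[OF _ lR, of f] l2_mult_integrable[OF _ lR, of g] by (auto simp: distrib_right)
  next
    fix c f assume f: "?P f"
    then show "?P (\<lambda>x. c * f x)" by (auto simp: mult.assoc)
  next
    fix f s assume s: "\<And>n::nat. ?P (s n)" and f: "f \<in> borel_measurable ?N" "integrable ?N (\<lambda>x. (f x)\<^sup>2)"
      and lim: "(\<lambda>n. \<integral>x. (f x - s n x)\<^sup>2 \<partial>?N) \<longlonglongrightarrow> 0"
    have fF: "f \<in> borel_measurable (H t)" using f(1) mN by simp
    have lf: "l2 f" using measurable_from_subalg[OF sH(1) fF] integrable_from_subalg[OF sH(1) f(2)] by (simp add: l2_def)
    have "(\<integral>x. (f x - s n x)\<^sup>2 \<partial>?N) = expectation (\<lambda>x. (f x - s n x)\<^sup>2)" for n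
      using s[of n] fF by (intro integral_subalgebra2[OF sH(1)]) auto
    then have "(\<lambda>n. (\<E> w. s n w * R w)) \<longlonglongrightarrow> (\<E> w. f w * R w)"
      using s lim by (intro l2_inner_tendsto lf lR) auto
    then have "(\<E> w. f w * R w) = 0" using s by (simp add: LIMSEQ_const_iff)
    then show "?P f" using fF lf by blast
  next
    show "R \<in> borel_measurable ?N" using RH mN by simp
    show "integrable ?N (\<lambda>x. (R x)\<^sup>2)" using RH lR by (intro integrable_in_subalg[OF sH(1)]) (auto simp: l2_def)
  qed
  then have "(\<E> w. (R w)\<^sup>2) \<le> 0" by (simp add: power2_eq_square)
  then have "AE w in M. R w = 0" by (rule l2_zero_AE[OF lR])
  then have "AE w in M. U w = P w" by (simp add: R_def)
  then have UF: "U \<in> borel_measurable ?FW" by (rule AE_eq_measurable[OF sW(1,2) PF UM])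
  have "tan \<in> borel_measurable (borel :: real measure)"
    unfolding tan_def[abs_def] by measurable
  from measurable_compose[OF UF this] show ?thesis by (simp add: U_def tan_arctan)
qed

lemma sup_square_l2p:
  assumes X: "(\<lambda>(t, w). X t w) \<in> borel_measurable (TM \<Otimes>\<^sub>M M)" and s: "sup_square_integrable M T X"
  shows "l2p X"
proof -
  define K where "K = (\<integral>\<^sup>+w. (\<Squnion>t\<in>{0..T}. ennreal ((X t w)\<^sup>2)) \<partial>M)"
  have K: "K < \<infinity>" using s by (simp add: sup_square_integrable_def K_def)
  have m: "X t \<in> borel_measurable M" if t: "t \<in> {0..T}" for t
  proof -
    have "(\<lambda>w. (\<lambda>(t, w). X t w) (t, w)) \<in> borel_measurable M"
      using X t by (intro measurable_compose[OF measurable_Pair1']) auto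
    then show ?thesis by simp
  qed
  have le: "(\<integral>\<^sup>+w. ennreal ((X t w)\<^sup>2) \<partial>M) \<le> K" if "t \<in> {0..T}" for t
    unfolding K_def using that by (intro nn_integral_mono SUP_upper)
  show ?thesis
  proof (rule l2pI[OF X])
    fix t assume t: "t \<in> {0..T}"
    have "integrable M (\<lambda>w. (X t w)\<^sup>2)"
      using m[OF t] order.strict_trans1[OF le[OF t] K] by (intro integrableI_bounded) auto
    then show "l2 (X t)" using m[OF t] by (simp add: l2_def)
    have "(\<E> w. (X t w)\<^sup>2) = enn2real (\<integral>\<^sup>+w. ennreal ((X t w)\<^sup>2) \<partial>M)"
      using m[OF t] by (intro integral_eq_nn_integral) auto
    also have "\<dots> \<le> enn2real K" using le[OF t] K by (intro enn2real_mono) auto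
    finally show "(\<E> w. (X t w)\<^sup>2) \<le> enn2real K" .
  qed
qed

lemma S2_l2p:
  assumes "S2_process M T F X"
  shows "l2p X" "\<And>t. t \<in> {0..T} \<Longrightarrow> X t \<in> borel_measurable (F t)"
  using assms sup_square_l2p[OF adapted_process_joint] by (auto simp: S2_process_def adapted_process_def)

lemma cond_exp_version_l2p:
  assumes F: "filtration F" and X: "l2p X" and h: "cond_exp_version M T F X h"
  shows "l2p h" "\<And>t. t \<in> {0..T} \<Longrightarrow> h t \<in> borel_measurable (F t)"
    "\<And>t U. t \<in> {0..T} \<Longrightarrow> l2 U \<Longrightarrow> U \<in> borel_measurable (F t) \<Longrightarrow> (\<E> w. U w * h t w) = (\<E> w. U w * X t w)"
proof -
  have ad: "adapted_process M T F h" and ver: "\<And>t. t \<in> {0..T} \<Longrightarrow> AE w in M. h t w = real_cond_exp M (F t) (X t) w"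
    using h by (auto simp: cond_exp_version_def)
  show hF: "h t \<in> borel_measurable (F t)" if "t \<in> {0..T}" for t using ad that by (auto simp: adapted_process_def)
  have hM: "h t \<in> borel_measurable M" if t: "t \<in> {0..T}" for t using filtrationD(4)[OF F t hF[OF t]] .
  obtain C where C: "\<And>t. t \<in> {0..T} \<Longrightarrow> (\<E> w. (X t w)\<^sup>2) \<le> C" using l2p_bound[OF X] by blast
  have P: "l2 (real_cond_exp M (F t) (X t))" "(\<E> w. (real_cond_exp M (F t) (X t) w)\<^sup>2) \<le> C" if t: "t \<in> {0..T}" for t
    using l2_orthogonal_projection(1,3)[OF filtrationD(1)[OF F t] l2p_l2[OF X t]] C[OF t] by auto
  have eq: "AE w in M. real_cond_exp M (F t) (X t) w = h t w" if "t \<in> {0..T}" for t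
    using ver[OF that] by eventually_elim simp
  show "l2p h"
  proof (rule l2pI[OF adapted_process_joint[OF ad]])
    fix t assume t: "t \<in> {0..T}"
    show "l2 (h t)" by (rule l2_cong_AE[OF P(1)[OF t] hM[OF t] eq[OF t]])
    show "(\<E> w. (h t w)\<^sup>2) \<le> C"
      using expectation_square_cong_AE[OF eq[OF t] l2_measurable[OF P(1)[OF t]] hM[OF t]] P(2)[OF t] by simp
  qed
  fix t U assume t: "t \<in> {0..T}" and U: "l2 U" "U \<in> borel_measurable (F t)"
  have "(\<E> w. U w * h t w) = (\<E> w. U w * real_cond_exp M (F t) (X t) w)"
  proof (rule integral_cong_AE)
    show "AE w in M. U w * h t w = U w * real_cond_exp M (F t) (X t) w" using ver[OF t] by eventually_elim simp
  qed (use hM[OF t] U l2_measurable[OF P(1)[OF t]] l2_measurable[OF U(1)] in auto)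
  also have "\<dots> = (\<E> w. U w * X t w)"
    by (rule l2_orthogonal_projection(2)[OF filtrationD(1)[OF F t] l2p_l2[OF X t] U])
  finally show "(\<E> w. U w * h t w) = (\<E> w. U w * X t w)" .
qed

end

section \<open>States, filters and innovations of the game\<close>

locale lq_setting =
  fixes G :: "'a lq_game" and Ric :: "real \<Rightarrow> real" and x0 :: "'a process"
  assumes basis: "stochastic_basis G" and A1: "assumption_A1 G" and A2: "assumption_A2 G" and A3: "assumption_A3 G"
    and riccati: "riccati_solution G Ric" and x0: "uncontrolled_state G x0" and info: "information_assumption G x0"

sublocale lq_setting \<subseteq> finite_horizon "pspace G" "hor G"
  using basis unfolding finite_horizon_def finite_horizon_axioms_def stochastic_basis_def by simp

context lq_setting
begin

abbreviation "F \<equiv> full_filtration G"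
abbreviation "O0 \<equiv> obs1_uncontrolled_filtration G x0"

text \<open>
  The follower's feedback acts on the state through \<open>gain\<close>, applied to \<open>Ric\<close> times the filter of the state
  and to \<open>\<theta>\<close>; \<open>drift\<close> is the coefficient of the closed loop.
\<close>

definition gain :: "real \<Rightarrow> real" where "gain t = (cB1 G t)\<^sup>2 * inverse (wR G t)"
definition drift :: "real \<Rightarrow> real" where "drift t = cA G t - gain t * Ric t"

lemma T_in: "hor G \<in> {0..hor G}" "0 \<in> {0..hor G}" using T_pos by auto

lemma noises: "brownian_motion (pspace G) (hor G) (BW G)" "brownian_motion (pspace G) (hor G) (BWb G)"
  "independent_processes (pspace G) (hor G) (BW G) (BWb G)"
  using basis by (auto simp: stochastic_basis_def)

lemma BW_brownian: "brownian_wrt F (BW G)" and BWb_brownian: "brownian_wrt F (BWb G)"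
  using brownian_full[OF noises] by (simp_all add: full_filtration_def[abs_def])

lemma F_filtration: "filtration F" by (rule brownian_wrt_filtration[OF BW_brownian])

lemma BW_measurable: "t \<in> {0..hor G} \<Longrightarrow> BW G t \<in> borel_measurable (pspace G)"
  by (rule brownian_wrt_adapted(2)[OF BW_brownian])

lemma coefficients:
  "bounded_coefficient (hor G) (cA G)" "bounded_coefficient (hor G) (cB1 G)" "bounded_coefficient (hor G) (cB2 G)"
  "bounded_coefficient (hor G) (c\<alpha> G)" "bounded_coefficient (hor G) (cf1 G)" "bounded_coefficient (hor G) (cf2 G)"
  "bounded_coefficient (hor G) (cg G)" "bounded_coefficient (hor G) (wLb G)" "bounded_coefficient (hor G) (wRb G)"
  "bounded_coefficient (hor G) (wl G)" "bounded_coefficient (hor G) (wlb G)" "bounded_coefficient (hor G) (wr G)"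
  "bounded_coefficient (hor G) (wrb G)" "bounded_coefficient (hor G) (\<lambda>t. inverse (wR G t))"
  using A1 A2 A3 by (auto simp: assumption_A1_def assumption_A2_def assumption_A3_def)

lemma Ric_bounded: "bounded_coefficient (hor G) Ric"
proof -
  have c: "continuous_on {0..hor G} Ric" using riccati by (simp add: riccati_solution_def)
  then have "bounded (Ric ` {0..hor G})" by (intro compact_imp_bounded compact_continuous_image) auto
  then obtain C where "\<forall>x\<in>Ric ` {0..hor G}. norm x \<le> C" by (auto simp: bounded_iff)
  then have "\<forall>t\<in>{0..hor G}. \<bar>Ric t\<bar> \<le> C" by simp
  with borel_measurable_continuous_on_restrict[OF c] show ?thesis by (auto simp: bounded_coefficient_def)
qed

lemma gain_bounded: "bounded_coefficient (hor G) gain"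
  unfolding gain_def[abs_def] power2_eq_square by (intro bounded_coefficient_mult coefficients)

lemma drift_bounded: "bounded_coefficient (hor G) drift"
proof -
  have "bounded_coefficient (hor G) (\<lambda>t. cA G t + - (gain t * Ric t))"
    by (intro bounded_coefficient_add bounded_coefficient_minus bounded_coefficient_mult coefficients gain_bounded Ric_bounded)
  then show ?thesis by (simp add: drift_def[abs_def])
qed

lemma x0_l2p: "l2p x0" and x0_adapted: "t \<in> {0..hor G} \<Longrightarrow> x0 t \<in> borel_measurable (F t)"
  using S2_l2p[of F x0] x0 by (auto simp: uncontrolled_state_def)

lemma leader_control:
  assumes "leader_admissible G v"
  shows "l2p v" "\<And>t. t \<in> {0..hor G} \<Longrightarrow> v t \<in> borel_measurable (F t)" "\<And>t. t \<in> {0..hor G} \<Longrightarrow> v t \<in> borel_measurable (obs2_filtration G v t)"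
  using assms sup_square_l2p[OF adapted_process_joint, of F v] by (auto simp: leader_admissible_def adapted_process_def)

lemma obs2_drift:
  assumes v: "leader_admissible G v"
  shows "l2p (\<lambda>s w. cf2 G s + v s w)" "\<And>t w. obs2 G v t w = time_int (\<lambda>s w. cf2 G s + v s w) t w + BW G t w"
    "\<And>t. t \<in> {0..hor G} \<Longrightarrow> (\<lambda>w. cf2 G t + v t w) \<in> borel_measurable (obs2_filtration G v t)"
    "\<And>t. t \<in> {0..hor G} \<Longrightarrow> (\<lambda>w. cf2 G t + v t w) \<in> borel_measurable (F t)"
proof -
  show "l2p (\<lambda>s w. cf2 G s + v s w)" by (intro l2p_add l2p_coeff coefficients leader_control(1)[OF v])
  show "obs2 G v t w = time_int (\<lambda>s w. cf2 G s + v s w) t w + BW G t w" for t w by (simp add: obs2_def time_int_def)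
  show "(\<lambda>w. cf2 G t + v t w) \<in> borel_measurable (obs2_filtration G v t)" if "t \<in> {0..hor G}" for t
    using leader_control(3)[OF v that] by simp
  show "(\<lambda>w. cf2 G t + v t w) \<in> borel_measurable (F t)" if "t \<in> {0..hor G}" for t
    using leader_control(2)[OF v that] by simp
qed

lemma obs2_filtration_facts:
  assumes v: "leader_admissible G v" and t: "t \<in> {0..hor G}"
  shows "filtration (obs2_filtration G v)" "BW G t \<in> borel_measurable (obs2_filtration G v t)"
    "sets (aug_filtration (pspace G) {BW G} t) \<subseteq> sets (obs2_filtration G v t)"
proof -
  note n = noise_adapted_to_observation[where W = "BW G" and Y = "obs2 G v" and \<beta> = "\<lambda>s w. cf2 G s + v s w" and t = t]
  show "filtration (obs2_filtration G v)" by (rule n(1)) (intro obs2_drift[OF v] BW_measurable t; assumption)+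
  show "BW G t \<in> borel_measurable (obs2_filtration G v t)" by (rule n(2)) (intro obs2_drift[OF v] BW_measurable t; assumption)+
  show "sets (aug_filtration (pspace G) {BW G} t) \<subseteq> sets (obs2_filtration G v t)"
    by (rule n(3)) (intro obs2_drift[OF v] BW_measurable t; assumption)+
qed

text \<open>
  Being free of the observation that the control generates, this makes different controls of the
  leader comparable.
\<close>

lemma leader_control_noise_adapted:
  assumes v: "leader_admissible G v" and t: "t \<in> {0..hor G}"
  shows "v t \<in> borel_measurable (aug_filtration (pspace G) {BW G} t)"
  by (rule control_adapted_to_noise[OF noises obs2_drift(1,2)[OF v] obs2_drift(3)[OF v] obs2_drift(4)[OF v, unfolded full_filtration_def] t
        leader_control(3)[OF v t] leader_control(2)[OF v t, unfolded full_filtration_def]])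

lemma O0_facts:
  shows "filtration O0" and "\<And>t. t \<in> {0..hor G} \<Longrightarrow> sets (O0 t) \<subseteq> sets (F t)"
    and "\<And>t. t \<in> {0..hor G} \<Longrightarrow> obs1_uncontrolled G x0 t \<in> borel_measurable (pspace G)"
proof -
  have l: "l2p (\<lambda>s w. cf1 G s * x0 s w)" by (intro l2p_coeff_mult coefficients x0_l2p)
  have eq: "obs1_uncontrolled G x0 t = (\<lambda>w. time_int (\<lambda>s w. cf1 G s * x0 s w) t w + BW G t w)" for t
    by (auto simp: obs1_uncontrolled_def time_int_def)
  have ad: "obs1_uncontrolled G x0 t \<in> borel_measurable (F t)" if t: "t \<in> {0..hor G}" for t
  proof -
    have "time_int (\<lambda>s w. cf1 G s * x0 s w) t \<in> borel_measurable (F t)"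
    proof (rule time_int_adapted[OF filtrationD(1,2)[OF F_filtration t] l t])
      fix s assume s: "s \<in> {0..t}"
      have "x0 s \<in> borel_measurable (F t)"
        by (rule filtration_measurable_mono[OF F_filtration _ _ _ x0_adapted[of s]]) (use s t in auto)
      then show "(\<lambda>w. cf1 G s * x0 s w) \<in> borel_measurable (F t)" by simp
    qed
    then show ?thesis unfolding eq using brownian_wrt_adapted(1)[OF BW_brownian t] by (rule borel_measurable_add)
  qed
  show m: "obs1_uncontrolled G x0 t \<in> borel_measurable (pspace G)" if t: "t \<in> {0..hor G}" for t
    using filtrationD(4)[OF F_filtration t ad[OF t]] .
  show "filtration O0" by (rule aug_filtration_filtration) (use m in simp)
  show "sets (O0 t) \<subseteq> sets (F t)" if t: "t \<in> {0..hor G}" for t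
  proof (rule aug_filtration_subset)
    fix X r assume "X \<in> {obs1_uncontrolled G x0}" and r: "r \<in> {0..t}"
    then have X: "X = obs1_uncontrolled G x0" by simp
    show "X r \<in> borel_measurable (F t)" unfolding X
      by (rule filtration_measurable_mono[OF F_filtration _ _ _ ad[of r]]) (use r t in auto)
  qed (rule filtrationD(3)[OF F_filtration t], rule filtrationD(2)[OF F_filtration t])
qed

text \<open>
  The difference \<open>z\<close> of the controlled and the uncontrolled state solves a linear equation without
  noise whose inhomogeneity is adapted to either observation: \<open>v1\<close> by admissibility, \<open>v2\<close> by the
  information assumption. Hence \<open>z\<close> is adapted to both, and each observation can be computed from
  the other.
\<close>

lemma controlled_state:
  assumes v2: "leader_admissible G v2" and f: "follower_admissible G x0 v2 v1 x" and t: "t \<in> {0..hor G}"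
  shows "obs1_filtration G x t = O0 t" "(\<lambda>w. x t w - x0 t w) \<in> borel_measurable (O0 t)"
    "obs1 G x t \<in> borel_measurable (pspace G)" "filtration (obs1_filtration G x)" "sets (obs2_filtration G v2 t) \<subseteq> sets (O0 t)"
proof -
  have infoD: "sets (obs2_filtration G v2 t) \<subseteq> sets (obs1_filtration G x t) \<inter> sets (O0 t)" if "t \<in> {0..hor G}" for t
    using info v2 f that unfolding information_assumption_def by blast
  show "sets (obs2_filtration G v2 t) \<subseteq> sets (O0 t)" using infoD[OF t] by blast
  have st: "state_equation G v1 v2 x" and ad0: "adapted_process (pspace G) (hor G) O0 v1"
    and ad1: "adapted_process (pspace G) (hor G) (obs1_filtration G x) v1" and sq: "sup_square_integrable (pspace G) (hor G) v1"
    using f by (auto simp: follower_admissible_def)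
  have v1: "l2p v1" by (rule sup_square_l2p[OF adapted_process_joint[OF ad0] sq])
  have xl: "l2p x" using S2_l2p(1) st by (auto simp: state_equation_def)
  note v2l = leader_control(1)[OF v2]
  define k where "k s w = cB1 G s * v1 s w + (cB2 G s * v2 s w + c\<alpha> G s)" for s w
  have kl: "l2p k" unfolding k_def[abs_def] by (intro l2p_add l2p_coeff_mult l2p_coeff coefficients v1 v2l)
  define z where "z t w = x t w - x0 t w" for t w
  have zl: "l2p z" unfolding z_def[abs_def] by (intro l2p_diff xl x0_l2p)
  obtain I J where I: "ito_integral (pspace G) (hor G) F (BW G) (\<lambda>t w. cc G t) I"
    and J: "ito_integral (pspace G) (hor G) F (BWb G) (\<lambda>t w. ccb G t) J"
    and X: "AE w in pspace G. \<forall>t\<in>{0..hor G}. x t w = x_init G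
             + (LBINT s:{0..t}. cA G s * x s w + cB1 G s * v1 s w + cB2 G s * v2 s w + c\<alpha> G s) + I t w + J t w"
    using st by (auto simp: state_equation_def)
  obtain I0 J0 where I0: "ito_integral (pspace G) (hor G) F (BW G) (\<lambda>t w. cc G t) I0"
    and J0: "ito_integral (pspace G) (hor G) F (BWb G) (\<lambda>t w. ccb G t) J0"
    and X0: "AE w in pspace G. \<forall>t\<in>{0..hor G}. x0 t w = x_init G + (LBINT s:{0..t}. cA G s * x0 s w) + I0 t w + J0 t w"
    using x0 by (auto simp: uncontrolled_state_def)
  have ode: "AE w in pspace G. z t w = time_int (\<lambda>s w. cA G s * z s w + k s w) t w" if t: "t \<in> {0..hor G}" for t
  proof -
    have l: "l2p (\<lambda>s w. cA G s * x s w + k s w)" "l2p (\<lambda>s w. cA G s * x0 s w)"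
      by (intro l2p_add l2p_coeff_mult coefficients xl kl x0_l2p)+
    have e: "(\<lambda>s w. cA G s * x s w + k s w - cA G s * x0 s w) = (\<lambda>s w. cA G s * z s w + k s w)"
      by (auto simp: z_def fun_eq_iff right_diff_distrib)
    show ?thesis
      using X X0 ito_integral_unique[OF BW_brownian I I0 t] ito_integral_unique[OF BWb_brownian J J0 t] time_int_diff[OF l t, unfolded e]
    proof eventually_elim
      case (elim w)
      have "time_int (\<lambda>s w. cA G s * x s w + k s w) t w = (LBINT s:{0..t}. cA G s * x s w + cB1 G s * v1 s w + cB2 G s * v2 s w + c\<alpha> G s)"
        unfolding time_int_def k_def by (simp add: add.assoc)
      then show ?case using elim t by (simp add: z_def time_int_def[of "\<lambda>s w. cA G s * x0 s w"])
    qed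
  qed
  have obsl: "l2p (\<lambda>s w. cf1 G s * x s w + cg G s)" by (intro l2p_add l2p_coeff_mult l2p_coeff coefficients xl)
  have obs1m: "obs1 G x t \<in> borel_measurable (pspace G)" if t: "t \<in> {0..hor G}" for t
  proof -
    have "obs1 G x t = (\<lambda>w. time_int (\<lambda>s w. cf1 G s * x s w + cg G s) t w + BW G t w)" by (auto simp: obs1_def time_int_def)
    then show ?thesis using l2_measurable[OF l2p_time_int_bound(1)[OF obsl t]] BW_measurable[OF t] by simp
  qed
  then show "obs1 G x t \<in> borel_measurable (pspace G)" using t .
  have filt1: "filtration (obs1_filtration G x)" by (rule aug_filtration_filtration) (use obs1m in simp)
  then show "filtration (obs1_filtration G x)" .
  note filt0 = O0_facts(1)
  have zad: "z t \<in> borel_measurable (H t)"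
    if H: "filtration H" and v1H: "adapted_process (pspace G) (hor G) H v1" and obs2H: "\<And>t. t \<in> {0..hor G} \<Longrightarrow> sets (obs2_filtration G v2 t) \<subseteq> sets (H t)"
      and t: "t \<in> {0..hor G}" for H t
  proof (rule linear_ode_adapted[OF H zl kl coefficients(1) _ ode t])
    fix s assume s: "s \<in> {0..hor G}"
    have "v2 s \<in> borel_measurable (H s)"
      by (rule measurable_subset_sets[OF obs2H[OF s] _ leader_control(3)[OF v2 s]])
         (use filtrationD(3)[OF obs2_filtration_facts(1)[OF v2 s] s] filtrationD(3)[OF H s] in simp)
    moreover have "v1 s \<in> borel_measurable (H s)" using v1H s by (auto simp: adapted_process_def)
    ultimately show "k s \<in> borel_measurable (H s)" unfolding k_def[abs_def] by simp
  qed
  have z0: "z t \<in> borel_measurable (O0 t)" if t: "t \<in> {0..hor G}" for t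
    by (rule zad[OF filt0 ad0 _ t]) (use infoD in blast)
  have z1: "z t \<in> borel_measurable (obs1_filtration G x t)" if t: "t \<in> {0..hor G}" for t
    by (rule zad[OF filt1 ad1 _ t]) (use infoD in blast)
  show "(\<lambda>w. x t w - x0 t w) \<in> borel_measurable (O0 t)" using z0[OF t] by (simp add: z_def[abs_def])
  define q where "q s w = cf1 G s * z s w + cg G s" for s w
  have ql: "l2p q" unfolding q_def[abs_def] by (intro l2p_add l2p_coeff_mult l2p_coeff coefficients zl)
  have qe: "AE w in pspace G. obs1 G x t w = obs1_uncontrolled G x0 t w + time_int q t w" if t: "t \<in> {0..hor G}" for t
  proof -
    have l: "l2p (\<lambda>s w. cf1 G s * x0 s w)" by (intro l2p_coeff_mult coefficients x0_l2p)
    have e: "(\<lambda>s w. cf1 G s * x s w + cg G s - cf1 G s * x0 s w) = q"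
      by (auto simp: q_def z_def fun_eq_iff right_diff_distrib)
    show ?thesis using time_int_diff[OF obsl l t, unfolded e]
      by eventually_elim (simp add: obs1_def obs1_uncontrolled_def time_int_def)
  qed
  have qad: "time_int q r \<in> borel_measurable (H t)"
    if H: "filtration H" and zH: "\<And>t. t \<in> {0..hor G} \<Longrightarrow> z t \<in> borel_measurable (H t)" and r: "r \<in> {0..t}" and t: "t \<in> {0..hor G}" for H r t
  proof (rule time_int_adapted[OF filtrationD(1,2)[OF H t] ql])
    show "r \<in> {0..hor G}" using r t by auto
    fix s assume s: "s \<in> {0..r}"
    have "z s \<in> borel_measurable (H t)"
      by (rule filtration_measurable_mono[OF H _ _ _ zH[of s]]) (use s r t in auto)
    then show "q s \<in> borel_measurable (H t)" unfolding q_def[abs_def] by simp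
  qed
  have sub1: "sets (obs1_filtration G x t) \<subseteq> sets (O0 t)"
  proof (rule aug_filtration_subset)
    fix X r assume "X \<in> {obs1 G x}" and r: "r \<in> {0..t}"
    then have X: "X = obs1 G x" by simp
    have rT: "r \<in> {0..hor G}" using r t by auto
    have "obs1_uncontrolled G x0 r \<in> borel_measurable (O0 t)" using r by (intro aug_filtration_measurable) auto
    then have m: "(\<lambda>w. obs1_uncontrolled G x0 r w + time_int q r w) \<in> borel_measurable (O0 t)"
      using qad[OF filt0 z0 r t] by simp
    show "X r \<in> borel_measurable (O0 t)" unfolding X
      by (rule AE_eq_measurable[OF filtrationD(1,2)[OF filt0 t] m obs1m[OF rT] qe[OF rT]])
  qed (rule filtrationD(3)[OF filt0 t], rule filtrationD(2)[OF filt0 t])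
  have sub2: "sets (O0 t) \<subseteq> sets (obs1_filtration G x t)"
  proof (rule aug_filtration_subset)
    fix X r assume "X \<in> {obs1_uncontrolled G x0}" and r: "r \<in> {0..t}"
    then have X: "X = obs1_uncontrolled G x0" by simp
    have rT: "r \<in> {0..hor G}" using r t by auto
    have "obs1 G x r \<in> borel_measurable (obs1_filtration G x t)" using r by (intro aug_filtration_measurable) auto
    then have m: "(\<lambda>w. obs1 G x r w - time_int q r w) \<in> borel_measurable (obs1_filtration G x t)"
      using qad[OF filt1 z1 r t] by simp
    have ae: "AE w in pspace G. obs1_uncontrolled G x0 r w = obs1 G x r w - time_int q r w"
      using qe[OF rT] by eventually_elim simp
    show "X r \<in> borel_measurable (obs1_filtration G x t)" unfolding X
      by (rule AE_eq_measurable[OF filtrationD(1,2)[OF filt1 t] m O0_facts(3)[OF rT] ae])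
  qed (rule filtrationD(3)[OF filt1 t], rule filtrationD(2)[OF filt1 t])
  show "obs1_filtration G x t = O0 t" by (rule aug_filtration_eqI) (use sub1 sub2 in blast)
qed

lemma state_filter:
  assumes v2: "leader_admissible G v2" and ls: "leader_system G Ric x0 v2 x xh \<theta> \<Gamma>"
  shows "l2p x" "\<And>t. t \<in> {0..hor G} \<Longrightarrow> x t \<in> borel_measurable (F t)"
    "l2p xh" "\<And>t. t \<in> {0..hor G} \<Longrightarrow> xh t \<in> borel_measurable (O0 t)"
    "\<And>t U. t \<in> {0..hor G} \<Longrightarrow> l2 U \<Longrightarrow> U \<in> borel_measurable (O0 t) \<Longrightarrow> expectation (\<lambda>w. U w * xh t w) = expectation (\<lambda>w. U w * x t w)"
    "\<And>t. t \<in> {0..hor G} \<Longrightarrow> obs1_filtration G x t = O0 t" "filtration (obs1_filtration G x)"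
    "\<And>t. t \<in> {0..hor G} \<Longrightarrow> (\<lambda>w. x t w - x0 t w) \<in> borel_measurable (O0 t)"
    "\<And>t. t \<in> {0..hor G} \<Longrightarrow> BW G t \<in> borel_measurable (O0 t)"
    "\<And>t. t \<in> {0..hor G} \<Longrightarrow> obs1 G x t \<in> borel_measurable (pspace G)"
    "l2p \<theta>" "\<And>t. t \<in> {0..hor G} \<Longrightarrow> \<theta> t \<in> borel_measurable (F t)"
proof -
  obtain v1 where f: "follower_admissible G x0 v2 v1 x" using ls by (auto simp: leader_system_def)
  have S: "S2_process (pspace G) (hor G) F x" and ch: "cond_exp_version (pspace G) (hor G) (obs1_filtration G x) x xh"
    and St: "S2_process (pspace G) (hor G) (obs1_filtration G x) \<theta>" using ls by (auto simp: leader_system_def)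
  note cs = controlled_state[OF v2 f]
  show xl: "l2p x" and "\<And>t. t \<in> {0..hor G} \<Longrightarrow> x t \<in> borel_measurable (F t)" using S2_l2p[OF S] by auto
  show eq: "obs1_filtration G x t = O0 t" if "t \<in> {0..hor G}" for t using cs(1)[OF that] .
  show filt: "filtration (obs1_filtration G x)" using cs(4)[OF T_in(1)] .
  note cv = cond_exp_version_l2p[OF filt xl ch]
  show "l2p xh" by (rule cv(1))
  show "xh t \<in> borel_measurable (O0 t)" if "t \<in> {0..hor G}" for t using cv(2)[OF that] eq[OF that] by simp
  show "expectation (\<lambda>w. U w * xh t w) = expectation (\<lambda>w. U w * x t w)" if "t \<in> {0..hor G}" "l2 U" "U \<in> borel_measurable (O0 t)" for t U
    using cv(3)[OF that(1,2)] that(3) eq[OF that(1)] by simp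
  show "(\<lambda>w. x t w - x0 t w) \<in> borel_measurable (O0 t)" if "t \<in> {0..hor G}" for t using cs(2)[OF that] .
  show "BW G t \<in> borel_measurable (O0 t)" if t: "t \<in> {0..hor G}" for t
    by (rule measurable_subset_sets[OF cs(5)[OF t] _ obs2_filtration_facts(2)[OF v2 t]])
       (use filtrationD(3)[OF obs2_filtration_facts(1)[OF v2 t] t] filtrationD(3)[OF O0_facts(1) t] in simp)
  show "obs1 G x t \<in> borel_measurable (pspace G)" if "t \<in> {0..hor G}" for t using cs(3)[OF that] .
  show "l2p \<theta>" by (rule S2_l2p(1)[OF St])
  show "\<theta> t \<in> borel_measurable (F t)" if t: "t \<in> {0..hor G}" for t
  proof (rule measurable_subset_sets[OF O0_facts(2)[OF t]])
    show "\<theta> t \<in> borel_measurable (O0 t)" using S2_l2p(2)[OF St t] eq[OF t] by simp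
  qed (use filtrationD(3)[OF O0_facts(1) t] filtrationD(3)[OF F_filtration t] in simp)
qed

text \<open>
  The process \<open>innovation - W\<close> is the time integral of \<open>d = f\<^sub>1 (x - xh)\<close>. It is adapted to the
  observation of the follower, as \<open>W\<close> is, while \<open>d\<close> is orthogonal to that observation. By integration
  by parts the second moment of \<open>\<integral>d\<close> is twice the integral of \<open>E[d \<integral>d]\<close>, which is zero.
\<close>

lemma innovation_is_noise:
  assumes v2: "leader_admissible G v2" and ls: "leader_system G Ric x0 v2 x xh \<theta> \<Gamma>" and t: "t \<in> {0..hor G}"
  shows "AE w in pspace G. innovation G x xh t w = BW G t w" "innovation G x xh t \<in> borel_measurable (pspace G)"
proof -
  note sf = state_filter[OF v2 ls]
  define d where "d s w = cf1 G s * (x s w - xh s w)" for s w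
  have dl: "l2p d" unfolding d_def[abs_def] by (intro l2p_coeff_mult l2p_diff coefficients sf)
  have hl: "l2p (\<lambda>s w. cf1 G s * xh s w + cg G s)" and xl: "l2p (\<lambda>s w. cf1 G s * x s w + cg G s)"
    by (intro l2p_add l2p_coeff_mult l2p_coeff coefficients sf)+
  have ie: "innovation G x xh t = (\<lambda>w. obs1 G x t w - time_int (\<lambda>s w. cf1 G s * xh s w + cg G s) t w)" for t
    by (auto simp: innovation_def time_int_def)
  show "innovation G x xh t \<in> borel_measurable (pspace G)"
    unfolding ie using sf(10)[OF t] l2_measurable[OF l2p_time_int_bound(1)[OF hl t]] by (rule borel_measurable_diff)
  have D: "AE w in pspace G. time_int d t w = innovation G x xh t w - BW G t w" if t: "t \<in> {0..hor G}" for t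
  proof -
    have e: "(\<lambda>s w. cf1 G s * x s w + cg G s - (cf1 G s * xh s w + cg G s)) = d"
      by (auto simp: d_def fun_eq_iff right_diff_distrib)
    show ?thesis using time_int_diff[OF xl hl t, unfolded e]
      by eventually_elim (simp add: ie obs1_def time_int_def)
  qed
  have Dad: "time_int d t \<in> borel_measurable (O0 t)" if t: "t \<in> {0..hor G}" for t
  proof (rule AE_eq_measurable[OF filtrationD(1,2)[OF O0_facts(1) t] _ l2_measurable[OF l2p_time_int_bound(1)[OF dl t]] D[OF t]])
    have "obs1 G x t \<in> borel_measurable (O0 t)"
      using aug_filtration_measurable[of "obs1 G x" "{obs1 G x}" t t "pspace G"] t sf(6)[OF t] by simp
    moreover have "time_int (\<lambda>s w. cf1 G s * xh s w + cg G s) t \<in> borel_measurable (O0 t)"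
    proof (rule time_int_adapted[OF filtrationD(1,2)[OF O0_facts(1) t] hl t])
      fix s assume s: "s \<in> {0..t}"
      have "xh s \<in> borel_measurable (O0 t)"
        by (rule filtration_measurable_mono[OF O0_facts(1) _ _ _ sf(4)[of s]]) (use s t in auto)
      then show "(\<lambda>w. cf1 G s * xh s w + cg G s) \<in> borel_measurable (O0 t)" by simp
    qed
    ultimately show "(\<lambda>w. innovation G x xh t w - BW G t w) \<in> borel_measurable (O0 t)"
      unfolding ie using sf(9)[OF t] by simp
  qed
  have zero: "expectation (\<lambda>w. d s w * time_int d s w) = 0" if s: "s \<in> {0..hor G}" for s
  proof -
    note lD = l2p_time_int_bound(1)[OF dl s]
    have "expectation (\<lambda>w. d s w * time_int d s w) = cf1 G s * (expectation (\<lambda>w. time_int d s w * x s w) - expectation (\<lambda>w. time_int d s w * xh s w))"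
    proof -
      have "d s w * time_int d s w = cf1 G s * (time_int d s w * x s w - time_int d s w * xh s w)" for w
        by (simp add: d_def right_diff_distrib mult_ac)
      then show ?thesis
        using l2_mult_integrable[OF lD l2p_l2[OF sf(1) s]] l2_mult_integrable[OF lD l2p_l2[OF sf(3) s]] by simp
    qed
    then show ?thesis using sf(5)[OF s lD Dad[OF s]] by simp
  qed
  have "expectation (\<lambda>w. time_int d t w * time_int d t w) = (LBINT s:{0..t}. 0) + (LBINT s:{0..t}. 0)"
    unfolding expectation_by_parts[OF dl dl t]
    by (intro arg_cong2[where f="(+)"] set_lebesgue_integral_cong) (use zero t in auto)
  then have "expectation (\<lambda>w. (time_int d t w)\<^sup>2) \<le> 0"
    by (simp add: power2_eq_square set_lebesgue_integral_def)
  from l2_zero_AE[OF l2p_time_int_bound(1)[OF dl t] this] D[OF t]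
  show "AE w in pspace G. innovation G x xh t w = BW G t w" by eventually_elim simp
qed

lemma innovation_integral_orthogonal:
  assumes v2: "leader_admissible G v2" and ls: "leader_system G Ric x0 v2 x xh \<theta> \<Gamma>"
    and N: "ito_integral (pspace G) (hor G) (obs1_filtration G x) (innovation G x xh) \<Gamma>' N"
    and r: "r \<in> {0..hor G}" and Z: "l2 Z" "Z \<in> borel_measurable (F r)"
  shows "expectation (\<lambda>w. (N (hor G) w - N r w) * Z w) = 0" "\<And>t. t \<in> {0..hor G} \<Longrightarrow> l2 (N t)"
proof -
  note sf = state_filter[OF v2 ls]
  have sub: "sets (obs1_filtration G x t) \<subseteq> sets (F t)" if "t \<in> {0..hor G}" for t
    using O0_facts(2)[OF that] sf(6)[OF that] by simp
  show "expectation (\<lambda>w. (N (hor G) w - N r w) * Z w) = 0"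
    by (rule ito_integral_orthogonal[OF N sf(7) sub BW_brownian innovation_is_noise(1)[OF v2 ls] innovation_is_noise(2)[OF v2 ls] r Z])
  have "\<forall>t\<in>{0..hor G}. l2 (N t)"
    using ito_integral_approx[OF N sf(7) BW_brownian innovation_is_noise(1)[OF v2 ls] innovation_is_noise(2)[OF v2 ls]] by blast
  then show "l2 (N t)" if "t \<in> {0..hor G}" for t using that by blast
qed

end

section \<open>Pairings of processes and backward equations\<close>

context finite_horizon
begin

definition pairing :: "'a process \<Rightarrow> 'a process \<Rightarrow> real" where
  "pairing X Y = (LBINT t:{0..T}. (\<E> w. X t w * Y t w))"

lemma pairing_sym: "pairing X Y = pairing Y X"
  by (simp add: pairing_def mult.commute)

lemma pairing_coeff: "pairing (\<lambda>t w. f t * X t w) Y = pairing X (\<lambda>t w. f t * Y t w)"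
  by (simp add: pairing_def mult_ac)

lemma pairing_cmult: "pairing (\<lambda>t w. c * X t w) Y = c * pairing X Y"
  by (simp add: pairing_def mult.assoc)

lemma pairing_add:
  assumes X: "l2p X" and X': "l2p X'" and Y: "l2p Y"
  shows "pairing (\<lambda>t w. X t w + X' t w) Y = pairing X Y + pairing X' Y"
proof -
  have "pairing (\<lambda>t w. X t w + X' t w) Y = (LBINT t:{0..T}. (\<E> w. X t w * Y t w) + (\<E> w. X' t w * Y t w))"
    unfolding pairing_def
  proof (rule set_lebesgue_integral_cong)
    show "\<forall>t. t \<in> {0..T} \<longrightarrow> (\<E> w. (X t w + X' t w) * Y t w) = (\<E> w. X t w * Y t w) + (\<E> w. X' t w * Y t w)"
      using l2_mult_integrable[OF l2p_l2[OF X] l2p_l2[OF Y]] l2_mult_integrable[OF l2p_l2[OF X'] l2p_l2[OF Y]]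
      by (auto simp: distrib_right)
  qed simp
  also have "\<dots> = pairing X Y + pairing X' Y"
    unfolding pairing_def by (rule set_integral_add(2)) (intro expectation_product_LBINT(3) X X' Y; simp)+
  finally show ?thesis .
qed

lemma pairing_diff:
  assumes X: "l2p X" and X': "l2p X'" and Y: "l2p Y"
  shows "pairing (\<lambda>t w. X t w - X' t w) Y = pairing X Y - pairing X' Y"
  using pairing_add[OF X l2p_cmult[OF X', of "-1"] Y] pairing_cmult[of "-1" X' Y] by simp

lemma pairing_cong:
  assumes X: "l2p X" and Y: "l2p Y" and Y': "l2p Y'"
    and eq: "\<And>t. t \<in> {0..T} \<Longrightarrow> AE w in M. Y t w = Y' t w"
  shows "pairing X Y = pairing X Y'"
  unfolding pairing_def
proof (rule set_lebesgue_integral_cong)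
  show "\<forall>t. t \<in> {0..T} \<longrightarrow> (\<E> w. X t w * Y t w) = (\<E> w. X t w * Y' t w)"
  proof safe
    fix t assume "t \<in> {0..T}"
    note t = this
    show "(\<E> w. X t w * Y t w) = (\<E> w. X t w * Y' t w)"
    proof (rule integral_cong_AE)
      show "AE w in M. X t w * Y t w = X t w * Y' t w" using eq[OF t] by eventually_elim simp
    qed (use l2_measurable[OF l2p_l2[OF X t]] l2_measurable[OF l2p_l2[OF Y t]] l2_measurable[OF l2p_l2[OF Y' t]] in auto)
  qed
qed simp

lemma pairing_nonneg:
  assumes "\<And>t. t \<in> {0..T} \<Longrightarrow> 0 \<le> f t"
  shows "0 \<le> pairing (\<lambda>t w. f t * X t w) X"
  unfolding pairing_def set_lebesgue_integral_def
proof (rule Bochner_Integration.integral_nonneg)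
  fix t
  have "0 \<le> f t * X t w * X t w" if "t \<in> {0..T}" for w
    using assms[OF that] by (simp add: mult.assoc)
  then show "0 \<le> indicat_real {0..T} t *\<^sub>R (\<E> w. f t * X t w * X t w)"
    by (auto simp: indicator_def intro!: Bochner_Integration.integral_nonneg)
qed

lemma pairing_square:
  assumes X: "l2p X" and H: "l2p H" and f: "bounded_coefficient T f"
  shows "pairing (\<lambda>t w. f t * (X t w + H t w)) (\<lambda>t w. X t w + H t w)
    = pairing (\<lambda>t w. f t * X t w) X + 2 * pairing (\<lambda>t w. f t * X t w) H + pairing (\<lambda>t w. f t * H t w) H"
proof -
  note l = l2p_add[OF X H] l2p_coeff_mult[OF f X] l2p_coeff_mult[OF f H] 
  have "pairing (\<lambda>t w. f t * (X t w + H t w)) (\<lambda>t w. X t w + H t w)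
    = pairing (\<lambda>t w. X t w + H t w) (\<lambda>t w. f t * X t w) + pairing (\<lambda>t w. X t w + H t w) (\<lambda>t w. f t * H t w)"
    using pairing_add[OF l(2,3,1)] by (simp add: distrib_left pairing_sym)
  also have "\<dots> = pairing X (\<lambda>t w. f t * X t w) + pairing H (\<lambda>t w. f t * X t w) + (pairing X (\<lambda>t w. f t * H t w) + pairing H (\<lambda>t w. f t * H t w))"
    using pairing_add[OF X H l(2)] pairing_add[OF X H l(3)] by simp
  finally show ?thesis
    using pairing_coeff[of f X X] pairing_coeff[of f X H] pairing_coeff[of f H H] pairing_coeff[of f H X] pairing_sym[of "\<lambda>t w. f t * H t w" X] by simp
qed

text \<open>Splits the expectation of an integrated running cost into its four pairings.\<close>

lemma expectation_sum_of_products: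
  assumes "l2p X1" "l2p Y1" "l2p X2" "l2p Y2" "l2p X3" "l2p Y3" "l2p X4" "l2p Y4"
  shows "(\<E> w. LBINT t:{0..T}. X1 t w * Y1 t w + X2 t w * Y2 t w + X3 t w * Y3 t w + X4 t w * Y4 t w)
      = pairing X1 Y1 + pairing X2 Y2 + pairing X3 Y3 + pairing X4 Y4" (is ?A)
    and "AE w in M. (LBINT t:{0..T}. X1 t w * Y1 t w + X2 t w * Y2 t w + X3 t w * Y3 t w + X4 t w * Y4 t w)
      = (LBINT t:{0..T}. X1 t w * Y1 t w) + (LBINT t:{0..T}. X2 t w * Y2 t w) + (LBINT t:{0..T}. X3 t w * Y3 t w) + (LBINT t:{0..T}. X4 t w * Y4 t w)" (is ?B)
    and "integrable M (\<lambda>w. LBINT t:{0..T}. X1 t w * Y1 t w + X2 t w * Y2 t w + X3 t w * Y3 t w + X4 t w * Y4 t w)" (is ?C)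
proof -
  let ?p = "\<lambda>t w. X1 t w * Y1 t w + X2 t w * Y2 t w + X3 t w * Y3 t w + X4 t w * Y4 t w"
  show B: ?B
    using l2p_AE_integrable[OF assms(1,2)] l2p_AE_integrable[OF assms(3,4)] l2p_AE_integrable[OF assms(5,6)] l2p_AE_integrable[OF assms(7,8)]
    by eventually_elim (simp add: integral_TM_full)
  note add = Bochner_Integration.integrable_add
  have i: "integrable (TM \<Otimes>\<^sub>M M) (\<lambda>(t, w). ?p t w)"
    using add[OF add[OF add[OF l2p_mult_integrable[OF assms(1,2)] l2p_mult_integrable[OF assms(3,4)]]
       l2p_mult_integrable[OF assms(5,6)]] l2p_mult_integrable[OF assms(7,8)]] by (simp add: split_def)
  show C: ?C unfolding integral_TM_full using TP.integrable_snd[OF i] by simp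
  have j: "integrable M (\<lambda>w. LBINT t:{0..T}. X1 t w * Y1 t w)" "integrable M (\<lambda>w. LBINT t:{0..T}. X2 t w * Y2 t w)"
    "integrable M (\<lambda>w. LBINT t:{0..T}. X3 t w * Y3 t w)" "integrable M (\<lambda>w. LBINT t:{0..T}. X4 t w * Y4 t w)"
    using expectation_product_LBINT(2)[OF assms(1,2), of 0 T] expectation_product_LBINT(2)[OF assms(3,4), of 0 T]
      expectation_product_LBINT(2)[OF assms(5,6), of 0 T] expectation_product_LBINT(2)[OF assms(7,8), of 0 T] by auto
  have "(\<E> w. LBINT t:{0..T}. ?p t w) = (\<E> w. (LBINT t:{0..T}. X1 t w * Y1 t w) + (LBINT t:{0..T}. X2 t w * Y2 t w)
      + (LBINT t:{0..T}. X3 t w * Y3 t w) + (LBINT t:{0..T}. X4 t w * Y4 t w))"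
    using C j by (intro integral_cong_AE B) auto
  also have "\<dots> = pairing X1 Y1 + pairing X2 Y2 + pairing X3 Y3 + pairing X4 Y4"
    using j expectation_product_LBINT(1)[OF assms(1,2), of 0 T] expectation_product_LBINT(1)[OF assms(3,4), of 0 T]
      expectation_product_LBINT(1)[OF assms(5,6), of 0 T] expectation_product_LBINT(1)[OF assms(7,8), of 0 T] by (simp add: pairing_def)
  finally show ?A .
qed

lemma backward_equation:
  assumes a: "l2p a" and eq: "AE w in M. \<forall>t\<in>{0..T}. X t w = \<zeta> w + (LBINT s:{t..T}. a s w) - (N T w - N t w)"
  shows "AE w in M. X T w = \<zeta> w"
    and "\<And>s Z. s \<in> {0..T} \<Longrightarrow> l2 (X T) \<Longrightarrow> l2 (X s) \<Longrightarrow> l2 Z \<Longrightarrow> l2 (N T) \<Longrightarrow> l2 (N s)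
      \<Longrightarrow> (\<E> w. (N T w - N s w) * Z w) = 0
      \<Longrightarrow> (\<E> w. (X T w - X s w + (time_int a T w - time_int a s w)) * Z w) = 0"
proof -
  have T: "T \<in> {0..T}" using T_pos by simp
  have lT: "AE w in M. (LBINT r:{T..T}. a r w) = time_int a T w - time_int a T w"
    using T by (intro LBINT_between[OF a]) auto
  show XT: "AE w in M. X T w = \<zeta> w"
    using eq lT
  proof (eventually_elim, goal_cases)
    case (1 w)
    have "X T w = \<zeta> w + (LBINT s:{T..T}. a s w) - (N T w - N T w)" using bspec[OF 1(1) T] .
    also have "(LBINT s:{T..T}. a s w) = 0" using 1(2) T by auto
    finally show ?case by simp
  qed
  fix s Z assume s: "s \<in> {0..T}" and l: "l2 (X T)" "l2 (X s)" "l2 Z" "l2 (N T)" "l2 (N s)"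
    and o: "(\<E> w. (N T w - N s w) * Z w) = 0"
  have lb: "AE w in M. (LBINT r:{s..T}. a r w) = time_int a T w - time_int a s w"
    using s by (intro LBINT_between[OF a]) auto
  have "(\<E> w. (X T w - X s w + (time_int a T w - time_int a s w)) * Z w) = (\<E> w. (N T w - N s w) * Z w)"
  proof (rule integral_cong_AE)
    show "AE w in M. (X T w - X s w + (time_int a T w - time_int a s w)) * Z w = (N T w - N s w) * Z w"
      using eq XT lb
    proof eventually_elim
      case (elim w)
      have "X s w = \<zeta> w + (LBINT r:{s..T}. a r w) - (N T w - N s w)" using bspec[OF elim(1) s] .
      then show ?case using elim by simp
    qed
  qed (use l2_measurable[OF l(1)] l2_measurable[OF l(2)] l2_measurable[OF l(3)] l2_measurable[OF l(4)] l2_measurable[OF l(5)]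
       l2_measurable[OF l2p_time_int_bound(1)[OF a T]] l2_measurable[OF l2p_time_int_bound(1)[OF a s]] in auto)
  then show "(\<E> w. (X T w - X s w + (time_int a T w - time_int a s w)) * Z w) = 0" using o by simp
qed

text \<open>
  Testing with \<open>X s\<close> and using the Cauchy-Schwarz inequality yields the estimate for Gronwall's
  lemma.
\<close>

lemma backward_linear_zero:
  assumes X: "l2p X" and A: "bounded_coefficient T A" and XT: "AE w in M. X T w = 0"
    and orth: "\<And>s. s \<in> {0..T} \<Longrightarrow> (\<E> w. (X T w - X s w + (time_int (\<lambda>s w. A s * X s w) T w - time_int (\<lambda>s w. A s * X s w) s w)) * X s w) = 0"
    and t: "t \<in> {0..T}"
  shows "AE w in M. X t w = 0"
proof -
  obtain b where b: "\<And>t. t \<in> {0..T} \<Longrightarrow> \<bar>A t\<bar> \<le> b" using A unfolding bounded_coefficient_def by blast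
  define g where "g s w = A s * X s w" for s w
  have g: "l2p g" unfolding g_def[abs_def] by (rule l2p_coeff_mult[OF A X])
  have T: "T \<in> {0..T}" using T_pos by simp
  show ?thesis
  proof (rule l2p_gronwall_backward[OF X _ _ t])
    show "0 \<le> T * b\<^sup>2" using T_pos by simp
    fix s assume s: "s \<in> {0..T}"
    note lX = l2p_l2[OF X s] and lT = l2p_l2[OF X T]
    define D where "D w = time_int g T w - time_int g s w" for w
    have lD: "l2 D" unfolding D_def[abs_def] by (intro l2_diff l2p_time_int_bound(1) g T s)
    have "(\<E> w. (X s w)\<^sup>2) = (\<E> w. D w * X s w)"
    proof -
      have "(\<E> w. (X T w - X s w + D w) * X s w) = (\<E> w. D w * X s w - (X s w)\<^sup>2)"
      proof (rule integral_cong_AE)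
        show "AE w in M. (X T w - X s w + D w) * X s w = D w * X s w - (X s w)\<^sup>2"
          using XT by eventually_elim (simp add: algebra_simps power2_eq_square)
      qed (use l2_measurable[OF lX] l2_measurable[OF lT] l2_measurable[OF lD] in auto)
      also have "\<dots> = (\<E> w. D w * X s w) - (\<E> w. (X s w)\<^sup>2)"
        using l2_mult_integrable[OF lD lX] l2_square_integrable[OF lX] by simp
      finally show ?thesis using orth[OF s] by (simp add: D_def g_def[abs_def])
    qed
    then have "((\<E> w. (X s w)\<^sup>2))\<^sup>2 \<le> (\<E> w. (D w)\<^sup>2) * (\<E> w. (X s w)\<^sup>2)"
      using l2_cauchy_schwarz[OF lD lX] by simp
    then have 1: "(\<E> w. (X s w)\<^sup>2) \<le> (\<E> w. (D w)\<^sup>2)"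
    proof -
      have "e \<le> d" if "e\<^sup>2 \<le> d * e" "0 \<le> e" "0 \<le> d" for e d :: real
        using that by (cases "e = 0") (auto simp: power2_eq_square intro: mult_right_le_imp_le)
      then show "(\<E> w. (X s w)\<^sup>2) \<le> (\<E> w. (D w)\<^sup>2)"
        if "((\<E> w. (X s w)\<^sup>2))\<^sup>2 \<le> (\<E> w. (D w)\<^sup>2) * (\<E> w. (X s w)\<^sup>2)"
        using that by simp
    qed
    define h where "h r w = indicator {s..T} r * g r w" for r w
    have h: "l2p h" unfolding h_def[abs_def] by (rule l2p_indicator[OF g])
    have "AE w in M. time_int h T w = D w"
    proof -
      have e: "time_int h T w = (LBINT r:{s..T}. g r w)" for w
        unfolding time_int_def set_lebesgue_integral_def h_def
        by (intro Bochner_Integration.integral_cong) (use s in \<open>auto simp: indicator_def\<close>)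
      show ?thesis unfolding e D_def using s by (intro LBINT_between[OF g]) auto
    qed
    then have "(\<E> w. (D w)\<^sup>2) = (\<E> w. (time_int h T w)\<^sup>2)"
      by (intro expectation_square_cong_AE l2_measurable lD l2p_time_int_bound(1)[OF h T]) auto
    also have "\<dots> \<le> T * (LBINT r:{0..T}. (\<E> w. (h r w)\<^sup>2))" by (rule l2p_time_int_bound(2)[OF h T])
    also have "(LBINT r:{0..T}. (\<E> w. (h r w)\<^sup>2)) = (LBINT r:{s..T}. (\<E> w. (g r w)\<^sup>2))"
      unfolding set_lebesgue_integral_def h_def
      by (intro Bochner_Integration.integral_cong) (use s in \<open>auto simp: indicator_def\<close>)
    also have "\<dots> \<le> b\<^sup>2 * (LBINT r:{s..T}. (\<E> w. (X r w)\<^sup>2))"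
      unfolding g_def by (rule expectation_coeff_LBINT_le[OF X b A]) (use s in auto)
    finally have "(\<E> w. (D w)\<^sup>2) \<le> T * (b\<^sup>2 * (LBINT r:{s..T}. (\<E> w. (X r w)\<^sup>2)))"
      using T_pos by simp
    then show "(\<E> w. (X s w)\<^sup>2) \<le> T * b\<^sup>2 * (LBINT r:{s..T}. (\<E> w. (X r w)\<^sup>2))"
      using 1 by (simp add: mult.assoc)
  qed
qed

lemma forward_linear_zero:
  assumes X: "l2p X" and A: "bounded_coefficient T A"
    and eq: "\<And>t. t \<in> {0..T} \<Longrightarrow> AE w in M. X t w = time_int (\<lambda>s w. A s * X s w) t w" and t: "t \<in> {0..T}"
  shows "AE w in M. X t w = 0"
proof -
  obtain b where b: "\<And>t. t \<in> {0..T} \<Longrightarrow> \<bar>A t\<bar> \<le> b" using A unfolding bounded_coefficient_def by blast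
  have g: "l2p (\<lambda>s w. A s * X s w)" by (rule l2p_coeff_mult[OF A X])
  show ?thesis
  proof (rule l2p_gronwall_forward[OF X _ _ t])
    show "0 \<le> T * b\<^sup>2" using T_pos by simp
    fix s assume s: "s \<in> {0..T}"
    have "(\<E> w. (X s w)\<^sup>2) = (\<E> w. (time_int (\<lambda>s w. A s * X s w) s w)\<^sup>2)"
      by (intro expectation_square_cong_AE eq s l2_measurable l2p_l2[OF X s] l2p_time_int_bound(1)[OF g s])
    also have "\<dots> \<le> T * (LBINT r:{0..s}. (\<E> w. (A r * X r w)\<^sup>2))" by (rule l2p_time_int_bound(2)[OF g s])
    also have "\<dots> \<le> T * (b\<^sup>2 * (LBINT r:{0..s}. (\<E> w. (X r w)\<^sup>2)))"
      by (intro mult_left_mono expectation_coeff_LBINT_le[OF X b A]) (use s T_pos in auto)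
    finally show "(\<E> w. (X s w)\<^sup>2) \<le> T * b\<^sup>2 * (LBINT r:{0..s}. (\<E> w. (X r w)\<^sup>2))" by (simp add: mult.assoc)
  qed
qed

end

section \<open>Comparison of two controls of the leader\<close>

context lq_setting
begin

text \<open>
  Both equations with the coefficients gathered into \<open>gain\<close> and \<open>drift\<close>; the stochastic integral of
  the backward equation is represented only by the orthogonality of its increments.
\<close>

lemma leader_system_data:
  assumes v: "leader_admissible G v" and ls: "leader_system G Ric x0 v x xh \<theta> \<Gamma>"
  shows "\<exists>I J. ito_integral (pspace G) (hor G) F (BW G) (\<lambda>t w. cc G t) I \<and>
        ito_integral (pspace G) (hor G) F (BWb G) (\<lambda>t w. ccb G t) J \<and>
        (AE w in pspace G. \<forall>t\<in>{0..hor G}. x t w = x_init G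
             + time_int (\<lambda>s w. cA G s * x s w - gain s * Ric s * xh s w - gain s * \<theta> s w + cB2 G s * v s w
                  + (c\<alpha> G s - cB1 G s * inverse (wR G s) * wr G s)) t w + I t w + J t w)" (is ?forward)
    and "\<exists>N. (\<forall>t\<in>{0..hor G}. l2 (N t)) \<and>
        (\<forall>s Z. s \<in> {0..hor G} \<longrightarrow> l2 Z \<longrightarrow> Z \<in> borel_measurable (F s) \<longrightarrow> expectation (\<lambda>w. (N (hor G) w - N s w) * Z w) = 0) \<and>
        (AE w in pspace G. \<forall>t\<in>{0..hor G}. \<theta> t w = wm G
             + (LBINT s:{t..hor G}. drift s * \<theta> s w + cB2 G s * Ric s * v s w
                  + (c\<alpha> G s * Ric s + wl G s - cB1 G s * Ric s * inverse (wR G s) * wr G s)) - (N (hor G) w - N t w))" (is ?backward)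
proof -
  obtain I J where I: "ito_integral (pspace G) (hor G) F (BW G) (\<lambda>t w. cc G t) I" "ito_integral (pspace G) (hor G) F (BWb G) (\<lambda>t w. ccb G t) J"
    and X: "AE w in pspace G. \<forall>t\<in>{0..hor G}.
           x t w = x_init G
             + (LBINT s:{0..t}. cA G s * x s w
                  - (cB1 G s)\<^sup>2 * Ric s * inverse (wR G s) * xh s w
                  - (cB1 G s)\<^sup>2 * inverse (wR G s) * \<theta> s w
                  - cB1 G s * inverse (wR G s) * wr G s
                  + cB2 G s * v s w + c\<alpha> G s)
             + I t w + J t w"
    using ls unfolding leader_system_def by blast
  have e: "cA G s * x s w - (cB1 G s)\<^sup>2 * Ric s * inverse (wR G s) * xh s w - (cB1 G s)\<^sup>2 * inverse (wR G s) * \<theta> s w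
                  - cB1 G s * inverse (wR G s) * wr G s + cB2 G s * v s w + c\<alpha> G s
     = cA G s * x s w - gain s * Ric s * xh s w - gain s * \<theta> s w + cB2 G s * v s w + (c\<alpha> G s - cB1 G s * inverse (wR G s) * wr G s)" for s w
    by (simp add: gain_def mult_ac)
  show ?forward
    by (rule exI[of _ I], rule exI[of _ J]) (use I X in \<open>simp only: e time_int_def simp_thms\<close>)
  obtain N where N: "ito_integral (pspace G) (hor G) (obs1_filtration G x) (innovation G x xh) \<Gamma> N"
    and Th: "AE w in pspace G. \<forall>t\<in>{0..hor G}.
           \<theta> t w = wm G
             + (LBINT s:{t..hor G}. (cA G s - (cB1 G s)\<^sup>2 * Ric s * inverse (wR G s)) * \<theta> s w
                  + cB2 G s * Ric s * v s w
                  - cB1 G s * Ric s * inverse (wR G s) * wr G s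
                  + c\<alpha> G s * Ric s + wl G s)
             - (N (hor G) w - N t w)"
    using ls unfolding leader_system_def by blast
  have e2: "(cA G s - (cB1 G s)\<^sup>2 * Ric s * inverse (wR G s)) * \<theta> s w + cB2 G s * Ric s * v s w
                  - cB1 G s * Ric s * inverse (wR G s) * wr G s + c\<alpha> G s * Ric s + wl G s
     = drift s * \<theta> s w + cB2 G s * Ric s * v s w + (c\<alpha> G s * Ric s + wl G s - cB1 G s * Ric s * inverse (wR G s) * wr G s)" for s w
    by (simp add: drift_def gain_def mult_ac)
  show ?backward
  proof (rule exI[of _ N], intro conjI ballI allI impI)
    show "l2 (N t)" if "t \<in> {0..hor G}" for t
      by (rule innovation_integral_orthogonal(2)[OF v ls N T_in(2) l2_const[of 0] _ that]) simp
    show "expectation (\<lambda>w. (N (hor G) w - N s w) * Z w) = 0" if "s \<in> {0..hor G}" "l2 Z" "Z \<in> borel_measurable (F s)" for s Z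
      by (rule innovation_integral_orthogonal(1)[OF v ls N that])
  qed (use Th in \<open>simp only: e2\<close>)
qed

text \<open>
  The first conclusion follows from the second: a variable that the observation determines is its
  own conditional expectation.
\<close>

lemma filter_difference:
  assumes v: "leader_admissible G v" "leader_system G Ric x0 v x xh \<theta> \<Gamma>"
    and v': "leader_admissible G v'" "leader_system G Ric x0 v' y yh \<theta>' \<Gamma>'" and t: "t \<in> {0..hor G}"
  shows "AE w in pspace G. yh t w - xh t w = y t w - x t w" "(\<lambda>w. y t w - x t w) \<in> borel_measurable (O0 t)"
proof -
  note sv = state_filter[OF v] and sw = state_filter[OF v']
  note l = l2p_l2[OF sv(1) t] l2p_l2[OF sw(1) t] l2p_l2[OF sv(3) t] l2p_l2[OF sw(3) t]
  have "(\<lambda>w. (y t w - x0 t w) - (x t w - x0 t w)) \<in> borel_measurable (O0 t)"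
    using sw(8)[OF t] sv(8)[OF t] by (rule borel_measurable_diff)
  then show m: "(\<lambda>w. y t w - x t w) \<in> borel_measurable (O0 t)" by simp
  \<comment> \<open>\<open>e\<close> is orthogonal to each of the two filtering errors, of which it is the difference\<close>
  define e where "e w = (yh t w - xh t w) - (y t w - x t w)" for w
  have el: "l2 e" unfolding e_def[abs_def] by (intro l2_diff l)
  have em: "e \<in> borel_measurable (O0 t)" unfolding e_def[abs_def] using sw(4)[OF t] sv(4)[OF t] m by simp
  note p = sw(5)[OF t el em] sv(5)[OF t el em]
  have "(e w)\<^sup>2 = (e w * yh t w - e w * y t w) - (e w * xh t w - e w * x t w)" for w
    by (simp add: e_def power2_eq_square algebra_simps)
  then have "expectation (\<lambda>w. (e w)\<^sup>2) = (expectation (\<lambda>w. e w * yh t w) - expectation (\<lambda>w. e w * y t w))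
      - (expectation (\<lambda>w. e w * xh t w) - expectation (\<lambda>w. e w * x t w))"
    using l2_mult_integrable[OF el l(1)] l2_mult_integrable[OF el l(2)] l2_mult_integrable[OF el l(3)] l2_mult_integrable[OF el l(4)] by simp
  then have "expectation (\<lambda>w. (e w)\<^sup>2) \<le> 0" using p by simp
  from l2_zero_AE[OF el this] show "AE w in pspace G. yh t w - xh t w = y t w - x t w"
    by eventually_elim (simp add: e_def)
qed

text \<open>
  The Ito integrals cancel, and the filter term is absorbed into \<open>drift\<close> because the difference of
  the filters is that of the states.
\<close>

lemma state_difference:
  assumes v: "leader_admissible G v" "leader_system G Ric x0 v x xh \<theta> \<Gamma>"
    and v': "leader_admissible G v'" "leader_system G Ric x0 v' y yh \<theta>' \<Gamma>'" and t: "t \<in> {0..hor G}"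
  shows "AE w in pspace G. y t w - x t w = time_int (\<lambda>s w. drift s * (y s w - x s w) - gain s * (\<theta>' s w - \<theta> s w) + cB2 G s * (v' s w - v s w)) t w"
proof -
  note sv = state_filter[OF v] and sw = state_filter[OF v']
  define b where "b x xh \<theta> v = (\<lambda>s w. cA G s * x s w - gain s * Ric s * xh s w - gain s * \<theta> s w + cB2 G s * v s w
                  + (c\<alpha> G s - cB1 G s * inverse (wR G s) * wr G s))" for x xh \<theta> v :: "real \<Rightarrow> 'a \<Rightarrow> real"
  have const: "bounded_coefficient (hor G) (\<lambda>s. c\<alpha> G s - cB1 G s * inverse (wR G s) * wr G s)"
    using bounded_coefficient_add[OF coefficients(4) bounded_coefficient_minus[OF bounded_coefficient_mult[OF bounded_coefficient_mult[OF coefficients(2,14)] coefficients(12)]]] by simp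
  have bl: "l2p (b x xh \<theta> v)" if "l2p x" "l2p xh" "l2p \<theta>" "l2p v" for x xh \<theta> v
    unfolding b_def by (intro l2p_add l2p_diff l2p_coeff_mult[OF coefficients(1)] l2p_coeff_mult[OF gain_bounded]
       l2p_coeff_mult[OF bounded_coefficient_mult[OF gain_bounded Ric_bounded]] l2p_coeff_mult[OF coefficients(3)] l2p_coeff[OF const] that)
  note bv = bl[OF sv(1,3,11) leader_control(1)[OF v(1)]] and bw = bl[OF sw(1,3,11) leader_control(1)[OF v'(1)]]
  obtain I J where I: "ito_integral (pspace G) (hor G) F (BW G) (\<lambda>t w. cc G t) I"
    and J: "ito_integral (pspace G) (hor G) F (BWb G) (\<lambda>t w. ccb G t) J"
    and X: "AE w in pspace G. \<forall>t\<in>{0..hor G}. x t w = x_init G + time_int (b x xh \<theta> v) t w + I t w + J t w"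
    using leader_system_data(1)[OF v] unfolding b_def by blast
  obtain I' J' where I': "ito_integral (pspace G) (hor G) F (BW G) (\<lambda>t w. cc G t) I'"
    and J': "ito_integral (pspace G) (hor G) F (BWb G) (\<lambda>t w. ccb G t) J'"
    and Y: "AE w in pspace G. \<forall>t\<in>{0..hor G}. y t w = x_init G + time_int (b y yh \<theta>' v') t w + I' t w + J' t w"
    using leader_system_data(1)[OF v'] unfolding b_def by blast
  let ?Z = "\<lambda>s w. drift s * (y s w - x s w) - gain s * (\<theta>' s w - \<theta> s w) + cB2 G s * (v' s w - v s w)"
  have Zl: "l2p ?Z" by (intro l2p_add l2p_diff l2p_coeff_mult drift_bounded gain_bounded coefficients(3) sv(1,11) sw(1,11) leader_control(1) v v')
  have Dl: "l2p (\<lambda>s w. b y yh \<theta>' v' s w - b x xh \<theta> v s w)" by (intro l2p_diff bv bw)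
  have "AE w in pspace G. time_int (\<lambda>s w. b y yh \<theta>' v' s w - b x xh \<theta> v s w) t w = time_int ?Z t w"
  proof (rule time_int_cong_AE[OF Dl Zl t])
    fix s assume s: "s \<in> {0..t}"
    then have sT: "s \<in> {0..hor G}" using t by auto
    show "AE w in pspace G. b y yh \<theta>' v' s w - b x xh \<theta> v s w = ?Z s w"
      using filter_difference(1)[OF v v' sT]
    proof eventually_elim
      case (elim w)
      have "b y yh \<theta>' v' s w - b x xh \<theta> v s w = cA G s * (y s w - x s w) - gain s * Ric s * (yh s w - xh s w)
          - gain s * (\<theta>' s w - \<theta> s w) + cB2 G s * (v' s w - v s w)" by (simp add: b_def algebra_simps)
      also have "\<dots> = ?Z s w" unfolding elim by (simp add: drift_def algebra_simps)
      finally show ?case .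
    qed
  qed
  then show ?thesis
    using X Y ito_integral_unique[OF BW_brownian I I' t] ito_integral_unique[OF BWb_brownian J J' t] time_int_diff[OF bw bv t]
  proof eventually_elim
    case (elim w)
    show ?case using elim(1) bspec[OF elim(2) t] bspec[OF elim(3) t] elim(4-6) by linarith
  qed
qed

text \<open>
  The stochastic integrals of the two backward equations are formed with two innovations. Both
  are versions of \<open>W\<close>, so the increments of each integral are orthogonal to the common filtration
  \<open>F\<close>.
\<close>

lemma adjoint_difference:
  assumes v: "leader_admissible G v" "leader_system G Ric x0 v x xh \<theta> \<Gamma>"
    and v': "leader_admissible G v'" "leader_system G Ric x0 v' y yh \<theta>' \<Gamma>'"
  shows "AE w in pspace G. \<theta>' (hor G) w - \<theta> (hor G) w = 0"
    and "\<And>s Z. s \<in> {0..hor G} \<Longrightarrow> l2 Z \<Longrightarrow> Z \<in> borel_measurable (F s) \<Longrightarrow>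
      expectation (\<lambda>w. ((\<theta>' (hor G) w - \<theta> (hor G) w) - (\<theta>' s w - \<theta> s w)
        + (time_int (\<lambda>s w. drift s * (\<theta>' s w - \<theta> s w) + cB2 G s * Ric s * (v' s w - v s w)) (hor G) w
          - time_int (\<lambda>s w. drift s * (\<theta>' s w - \<theta> s w) + cB2 G s * Ric s * (v' s w - v s w)) s w)) * Z w) = 0"
proof -
  note sv = state_filter[OF v] and sw = state_filter[OF v']
  define a where "a \<theta> v = (\<lambda>s w. drift s * \<theta> s w + cB2 G s * Ric s * v s w
                  + (c\<alpha> G s * Ric s + wl G s - cB1 G s * Ric s * inverse (wR G s) * wr G s))" for \<theta> v :: "real \<Rightarrow> 'a \<Rightarrow> real"
  have const: "bounded_coefficient (hor G) (\<lambda>s. c\<alpha> G s * Ric s + wl G s - cB1 G s * Ric s * inverse (wR G s) * wr G s)"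
    using bounded_coefficient_add[OF bounded_coefficient_add[OF bounded_coefficient_mult[OF coefficients(4) Ric_bounded] coefficients(10)]
       bounded_coefficient_minus[OF bounded_coefficient_mult[OF bounded_coefficient_mult[OF bounded_coefficient_mult[OF coefficients(2) Ric_bounded] coefficients(14)] coefficients(12)]]] by simp
  have BR: "bounded_coefficient (hor G) (\<lambda>s. cB2 G s * Ric s)" by (rule bounded_coefficient_mult[OF coefficients(3) Ric_bounded])
  have al: "l2p (a \<theta> v)" if "l2p \<theta>" "l2p v" for \<theta> v
    unfolding a_def by (intro l2p_add l2p_coeff_mult[OF drift_bounded] l2p_coeff_mult[OF BR] l2p_coeff[OF const] that)
  note av = al[OF sv(11) leader_control(1)[OF v(1)]] and aw = al[OF sw(11) leader_control(1)[OF v'(1)]]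
  obtain N where N: "\<And>t. t \<in> {0..hor G} \<Longrightarrow> l2 (N t)"
    "\<And>s Z. s \<in> {0..hor G} \<Longrightarrow> l2 Z \<Longrightarrow> Z \<in> borel_measurable (F s) \<Longrightarrow> expectation (\<lambda>w. (N (hor G) w - N s w) * Z w) = 0"
    and A: "AE w in pspace G. \<forall>t\<in>{0..hor G}. \<theta> t w = wm G + (LBINT s:{t..hor G}. a \<theta> v s w) - (N (hor G) w - N t w)"
    using leader_system_data(2)[OF v] unfolding a_def by blast
  obtain N' where N': "\<And>t. t \<in> {0..hor G} \<Longrightarrow> l2 (N' t)"
    "\<And>s Z. s \<in> {0..hor G} \<Longrightarrow> l2 Z \<Longrightarrow> Z \<in> borel_measurable (F s) \<Longrightarrow> expectation (\<lambda>w. (N' (hor G) w - N' s w) * Z w) = 0"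
    and A': "AE w in pspace G. \<forall>t\<in>{0..hor G}. \<theta>' t w = wm G + (LBINT s:{t..hor G}. a \<theta>' v' s w) - (N' (hor G) w - N' t w)"
    using leader_system_data(2)[OF v'] unfolding a_def by blast
  show "AE w in pspace G. \<theta>' (hor G) w - \<theta> (hor G) w = 0"
    using backward_equation(1)[OF av A] backward_equation(1)[OF aw A'] by eventually_elim simp
  fix s Z assume s: "s \<in> {0..hor G}" and Z: "l2 Z" "Z \<in> borel_measurable (F s)"
  note T = T_in(1)
  let ?g = "\<lambda>s w. drift s * (\<theta>' s w - \<theta> s w) + cB2 G s * Ric s * (v' s w - v s w)"
  have ge: "(\<lambda>s w. a \<theta>' v' s w - a \<theta> v s w) = ?g" by (auto simp: a_def fun_eq_iff algebra_simps)
  have gl: "l2p ?g" using l2p_diff[OF aw av] unfolding ge .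
  define E where "E w = \<theta> (hor G) w - \<theta> s w + (time_int (a \<theta> v) (hor G) w - time_int (a \<theta> v) s w)" for w
  define E' where "E' w = \<theta>' (hor G) w - \<theta>' s w + (time_int (a \<theta>' v') (hor G) w - time_int (a \<theta>' v') s w)" for w
  have El: "l2 E" unfolding E_def[abs_def] by (intro l2_add l2_diff l2p_l2[OF sv(11)] l2p_time_int_bound(1)[OF av] s T)
  have E'l: "l2 E'" unfolding E'_def[abs_def] by (intro l2_add l2_diff l2p_l2[OF sw(11)] l2p_time_int_bound(1)[OF aw] s T)
  have "expectation (\<lambda>w. E w * Z w) = 0" unfolding E_def
    by (rule backward_equation(2)[OF av A s l2p_l2[OF sv(11) T] l2p_l2[OF sv(11) s] Z(1) N(1)[OF T] N(1)[OF s] N(2)[OF s Z]])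
  moreover have "expectation (\<lambda>w. E' w * Z w) = 0" unfolding E'_def
    by (rule backward_equation(2)[OF aw A' s l2p_l2[OF sw(11) T] l2p_l2[OF sw(11) s] Z(1) N'(1)[OF T] N'(1)[OF s] N'(2)[OF s Z]])
  ultimately have "expectation (\<lambda>w. (E' w - E w) * Z w) = 0"
    using l2_mult_integrable[OF El Z(1)] l2_mult_integrable[OF E'l Z(1)] by (simp add: left_diff_distrib)
  moreover have "expectation (\<lambda>w. (E' w - E w) * Z w) = expectation (\<lambda>w. ((\<theta>' (hor G) w - \<theta> (hor G) w) - (\<theta>' s w - \<theta> s w)
        + (time_int ?g (hor G) w - time_int ?g s w)) * Z w)" (is "_ = expectation ?R")
  proof (rule integral_cong_AE)
    show "AE w in pspace G. (E' w - E w) * Z w = ?R w"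
      using time_int_diff[OF aw av T, unfolded ge] time_int_diff[OF aw av s, unfolded ge]
      by eventually_elim (simp add: E_def E'_def)
  qed (use l2_measurable[OF El] l2_measurable[OF E'l] l2_measurable[OF Z(1)] l2_measurable[OF l2p_time_int_bound(1)[OF gl T]] l2_measurable[OF l2p_time_int_bound(1)[OF gl s]]
      l2_measurable[OF l2p_l2[OF sv(11) T]] l2_measurable[OF l2p_l2[OF sv(11) s]] l2_measurable[OF l2p_l2[OF sw(11) T]] l2_measurable[OF l2p_l2[OF sw(11) s]] in auto)
  ultimately show "expectation ?R = 0" by simp
qed

lemma leader_cost_pairing:
  assumes x: "l2p x" and v: "l2p v"
  shows "leader_cost G v x = 1 / 2 * (pairing (\<lambda>t w. wLb G t * x t w) x + pairing (\<lambda>t w. wRb G t * v t w) v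
     + 2 * pairing (\<lambda>t w. wlb G t) x + 2 * pairing (\<lambda>t w. wrb G t) v
     + wMb G * expectation (\<lambda>w. (x (hor G) w)\<^sup>2) + 2 * wmb G * expectation (x (hor G)))"
proof -
  note s = l2p_coeff_mult[OF coefficients(8) x] x l2p_coeff_mult[OF coefficients(9) v] v
    l2p_cmult[OF l2p_coeff[OF coefficients(11)], of 2] x l2p_cmult[OF l2p_coeff[OF coefficients(13)], of 2] v
  note E = expectation_sum_of_products[OF s]
  note xT = l2p_l2[OF x T_in(1)]
  have "leader_cost G v x = 1/2 * expectation (\<lambda>w. (LBINT t:{0..hor G}. wLb G t * x t w * x t w + wRb G t * v t w * v t w
        + 2 * wlb G t * x t w + 2 * wrb G t * v t w)
     + wMb G * (x (hor G) w)\<^sup>2 + 2 * wmb G * x (hor G) w)"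
    unfolding leader_cost_def by (simp add: power2_eq_square mult.assoc)
  also have "\<dots> = 1/2 * (pairing (\<lambda>t w. wLb G t * x t w) x + pairing (\<lambda>t w. wRb G t * v t w) v
     + pairing (\<lambda>t w. 2 * wlb G t) x + pairing (\<lambda>t w. 2 * wrb G t) v
     + wMb G * expectation (\<lambda>w. (x (hor G) w)\<^sup>2) + 2 * wmb G * expectation (x (hor G)))"
    using E(1,3) l2_square_integrable[OF xT] l2_integrable[OF xT] by simp
  finally show ?thesis using pairing_cmult[of 2 "\<lambda>t w. wlb G t" x] pairing_cmult[of 2 "\<lambda>t w. wrb G t" v] by simp
qed

end

section \<open>Optimality of stationary controls\<close>

context lq_setting
begin

text \<open>
  The three martingale parts of the adjoint equation are used only through the orthogonality of
  their increments.
\<close>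

lemma adjoint_lambda_facts:
  assumes v: "leader_admissible G v" "leader_system G Ric x0 v x xh \<theta> \<Gamma>"
    and adj: "adjoint_lambda_equation G Ric x xh lam \<eta>1 \<eta>2 \<eta>3"
  obtains lamh where "l2p lam" "\<And>t. t \<in> {0..hor G} \<Longrightarrow> lam t \<in> borel_measurable (F t)" "l2p lamh"
    "\<And>t U. t \<in> {0..hor G} \<Longrightarrow> l2 U \<Longrightarrow> U \<in> borel_measurable (O0 t) \<Longrightarrow> expectation (\<lambda>w. U w * lamh t w) = expectation (\<lambda>w. U w * lam t w)"
    "AE w in pspace G. lam (hor G) w = wMb G * x (hor G) w + wmb G"
    "l2p (\<lambda>s w. wLb G s * x s w + wlb G s + cA G s * lam s w - gain s * Ric s * lamh s w)"
    "\<And>s Z. s \<in> {0..hor G} \<Longrightarrow> l2 Z \<Longrightarrow> Z \<in> borel_measurable (F s) \<Longrightarrow>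
      expectation (\<lambda>w. (lam (hor G) w - lam s w
        + (time_int (\<lambda>s w. wLb G s * x s w + wlb G s + cA G s * lam s w - gain s * Ric s * lamh s w) (hor G) w
          - time_int (\<lambda>s w. wLb G s * x s w + wlb G s + cA G s * lam s w - gain s * Ric s * lamh s w) s w)) * Z w) = 0"
proof -
  note sv = state_filter[OF v] and T = T_in(1)
  obtain lamh N1 N2 N3 where S: "S2_process (pspace G) (hor G) F lam"
    and ch: "cond_exp_version (pspace G) (hor G) (obs1_filtration G x) lam lamh"
    and N1: "ito_integral (pspace G) (hor G) F (BW G) \<eta>1 N1"
    and N2: "ito_integral (pspace G) (hor G) F (BWb G) \<eta>2 N2"
    and N3: "ito_integral (pspace G) (hor G) (obs1_filtration G x) (innovation G x xh) \<eta>3 N3"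
    and eq: "AE w in pspace G. \<forall>t\<in>{0..hor G}.
           lam t w = wMb G * x (hor G) w + wmb G
             + (LBINT s:{t..hor G}. wLb G s * x s w + wlb G s + cA G s * lam s w
                  - (cB1 G s)\<^sup>2 * Ric s * inverse (wR G s) * lamh s w)
             - (N1 (hor G) w - N1 t w) - (N2 (hor G) w - N2 t w) - (N3 (hor G) w - N3 t w)"
    using adj unfolding adjoint_lambda_equation_def by blast
  define g where "g = (\<lambda>s w. wLb G s * x s w + wlb G s + cA G s * lam s w - gain s * Ric s * lamh s w)"
  define N where "N t w = N1 t w + N2 t w + N3 t w" for t w
  note lam = S2_l2p[OF S]
  note cv = cond_exp_version_l2p[OF sv(7) lam(1) ch]
  have gl: "l2p g" unfolding g_def
    by (intro l2p_add l2p_diff l2p_coeff_mult[OF coefficients(8)] l2p_coeff[OF coefficients(11)] l2p_coeff_mult[OF coefficients(1)]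
         l2p_coeff_mult[OF bounded_coefficient_mult[OF gain_bounded Ric_bounded]] sv(1) lam(1) cv(1))
  have e: "wLb G s * x s w + wlb G s + cA G s * lam s w - (cB1 G s)\<^sup>2 * Ric s * inverse (wR G s) * lamh s w = g s w" for s w
    by (simp add: g_def gain_def mult_ac)
  have eqN: "AE w in pspace G. \<forall>t\<in>{0..hor G}. lam t w = (wMb G * x (hor G) w + wmb G) + (LBINT s:{t..hor G}. g s w) - (N (hor G) w - N t w)"
    using eq unfolding e by eventually_elim (simp add: N_def)
  have lN12: "\<forall>t\<in>{0..hor G}. l2 (N1 t)" "\<forall>t\<in>{0..hor G}. l2 (N2 t)"
    using ito_integral_approx[OF N1 F_filtration BW_brownian _ brownian_wrt_adapted(2)[OF BW_brownian]]
      ito_integral_approx[OF N2 F_filtration BWb_brownian _ brownian_wrt_adapted(2)[OF BWb_brownian]] by auto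
  have lN3: "l2 (N3 t)" if "t \<in> {0..hor G}" for t
    by (rule innovation_integral_orthogonal(2)[OF v N3 T_in(2) l2_const[of 0] _ that]) simp
  have lN: "l2 (N t)" if "t \<in> {0..hor G}" for t unfolding N_def[abs_def] by (intro l2_add lN3) (use lN12 that in auto)
  have oN: "expectation (\<lambda>w. (N (hor G) w - N s w) * Z w) = 0" if s: "s \<in> {0..hor G}" and Z: "l2 Z" "Z \<in> borel_measurable (F s)" for s Z
  proof -
    have o1: "expectation (\<lambda>w. (N1 (hor G) w - N1 s w) * Z w) = 0"
      by (rule ito_integral_orthogonal[OF N1 F_filtration _ BW_brownian _ brownian_wrt_adapted(2)[OF BW_brownian] s Z]) auto
    have o2: "expectation (\<lambda>w. (N2 (hor G) w - N2 s w) * Z w) = 0"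
      by (rule ito_integral_orthogonal[OF N2 F_filtration _ BWb_brownian _ brownian_wrt_adapted(2)[OF BWb_brownian] s Z]) auto
    have o3: "expectation (\<lambda>w. (N3 (hor G) w - N3 s w) * Z w) = 0"
      by (rule innovation_integral_orthogonal(1)[OF v N3 s Z])
    have i: "integrable (pspace G) (\<lambda>w. (N1 (hor G) w - N1 s w) * Z w)" "integrable (pspace G) (\<lambda>w. (N2 (hor G) w - N2 s w) * Z w)"
      "integrable (pspace G) (\<lambda>w. (N3 (hor G) w - N3 s w) * Z w)"
      by (rule l2_mult_integrable[OF l2_diff Z(1)], use lN12 s T lN3 in blast, use lN12 s T lN3 in blast)+
    have "expectation (\<lambda>w. (N (hor G) w - N s w) * Z w) = expectation (\<lambda>w. (N1 (hor G) w - N1 s w) * Z w + (N2 (hor G) w - N2 s w) * Z w + (N3 (hor G) w - N3 s w) * Z w)"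
      by (rule Bochner_Integration.integral_cong) (auto simp: N_def algebra_simps)
    also have "\<dots> = 0"
      using Bochner_Integration.integral_add[OF Bochner_Integration.integrable_add[OF i(1,2)] i(3)] Bochner_Integration.integral_add[OF i(1,2)] o1 o2 o3 by simp
    finally show ?thesis .
  qed
  show thesis
  proof (rule that[of lamh, folded g_def])
    show "expectation (\<lambda>w. U w * lamh t w) = expectation (\<lambda>w. U w * lam t w)" if "t \<in> {0..hor G}" "l2 U" "U \<in> borel_measurable (O0 t)" for t U
      using cv(3)[OF that(1,2)] that(3) sv(6)[OF that(1)] by simp
    show "expectation (\<lambda>w. (lam (hor G) w - lam s w + (time_int g (hor G) w - time_int g s w)) * Z w) = 0"
      if "s \<in> {0..hor G}" "l2 Z" "Z \<in> borel_measurable (F s)" for s Z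
      by (rule backward_equation(2)[OF gl eqN that(1) l2p_l2[OF lam(1) T] l2p_l2[OF lam(1) that(1)] that(2) lN[OF T] lN[OF that(1)] oN[OF that]])
    show "AE w in pspace G. lam (hor G) w = wMb G * x (hor G) w + wmb G" by (rule backward_equation(1)[OF gl eqN])
  qed (use lam cv(1) gl in auto)
qed

text \<open>
  Duality of \<open>lam\<close> with \<open>\<xi>\<close> leaves the cross term \<open>gain \<phi> lam\<close>, duality of \<open>\<phi>\<close> with \<open>K\<close> leaves the same
  term, and it cancels in the difference: the equation of \<open>K\<close> is made for this cancellation, and
  its initial value \<open>0\<close> matches \<open>\<phi>(T) = 0\<close>.
\<close>

lemma first_order_identity:
  assumes v: "leader_admissible G v" "leader_system G Ric x0 v x xh \<theta> \<Gamma>"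
    and v': "leader_admissible G v'" "leader_system G Ric x0 v' y yh \<theta>' \<Gamma>'"
    and adj: "adjoint_lambda_equation G Ric x xh lam \<eta>1 \<eta>2 \<eta>3" and adjK: "adjoint_K_equation G Ric lam K"
  shows "expectation (\<lambda>w. (wMb G * x (hor G) w + wmb G) * (y (hor G) w - x (hor G) w))
      + pairing (\<lambda>t w. wLb G t * x t w + wlb G t) (\<lambda>t w. y t w - x t w)
    = pairing (\<lambda>t w. cB2 G t * (v' t w - v t w)) lam + pairing (\<lambda>t w. cB2 G t * Ric t * (v' t w - v t w)) K"
proof -
  note sv = state_filter[OF v] and sw = state_filter[OF v'] and T = T_in(1)
  obtain lamh where lam: "l2p lam" "\<And>t. t \<in> {0..hor G} \<Longrightarrow> lam t \<in> borel_measurable (F t)" and lamh: "l2p lamh"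
    "\<And>t U. t \<in> {0..hor G} \<Longrightarrow> l2 U \<Longrightarrow> U \<in> borel_measurable (O0 t) \<Longrightarrow> expectation (\<lambda>w. U w * lamh t w) = expectation (\<lambda>w. U w * lam t w)"
    and lamT: "AE w in pspace G. lam (hor G) w = wMb G * x (hor G) w + wmb G"
    and gl: "l2p (\<lambda>s w. wLb G s * x s w + wlb G s + cA G s * lam s w - gain s * Ric s * lamh s w)"
    and orth: "\<And>s Z. s \<in> {0..hor G} \<Longrightarrow> l2 Z \<Longrightarrow> Z \<in> borel_measurable (F s) \<Longrightarrow>
      expectation (\<lambda>w. (lam (hor G) w - lam s w
        + (time_int (\<lambda>s w. wLb G s * x s w + wlb G s + cA G s * lam s w - gain s * Ric s * lamh s w) (hor G) w
          - time_int (\<lambda>s w. wLb G s * x s w + wlb G s + cA G s * lam s w - gain s * Ric s * lamh s w) s w)) * Z w) = 0"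
    by (rule adjoint_lambda_facts[OF v adj]) (rule that; assumption)
  define \<xi> where "\<xi> t w = y t w - x t w" for t w
  define \<phi> where "\<phi> t w = \<theta>' t w - \<theta> t w" for t w
  define u where "u t w = v' t w - v t w" for t w
  define q where "q t w = wLb G t * x t w + wlb G t" for t w
  define g where "g = (\<lambda>s w. q s w + cA G s * lam s w - gain s * Ric s * lamh s w)"
  define h where "h = (\<lambda>s w. drift s * \<phi> s w + cB2 G s * Ric s * u s w)"
  define Z1 where "Z1 = (\<lambda>s w. drift s * \<xi> s w - gain s * \<phi> s w + cB2 G s * u s w)"
  define Z2 where "Z2 = (\<lambda>s w. drift s * K s w - gain s * lam s w)"
  have SK: "S2_process (pspace G) (hor G) F K"
    and K: "AE w in pspace G. \<forall>t\<in>{0..hor G}. K t w = (LBINT s:{0..t}. - (cB1 G s)\<^sup>2 * inverse (wR G s) * lam s w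
                   + (cA G s - (cB1 G s)\<^sup>2 * Ric s * inverse (wR G s)) * K s w)"
    using adjK unfolding adjoint_K_equation_def by blast+
  note Kl = S2_l2p[OF SK]
  have l: "l2p \<xi>" "l2p \<phi>" "l2p u" unfolding \<xi>_def[abs_def] \<phi>_def[abs_def] u_def[abs_def]
    by (intro l2p_diff sv(1,11) sw(1,11) leader_control(1) v(1) v'(1))+
  have ad: "\<xi> t \<in> borel_measurable (F t)" "\<phi> t \<in> borel_measurable (F t)" "u t \<in> borel_measurable (F t)" if t: "t \<in> {0..hor G}" for t
    unfolding \<xi>_def[abs_def] \<phi>_def[abs_def] u_def[abs_def]
    using sv(2,12)[OF t] sw(2,12)[OF t] leader_control(2)[OF v(1) t] leader_control(2)[OF v'(1) t] by simp_all
  have BR: "bounded_coefficient (hor G) (\<lambda>s. cB2 G s * Ric s)" and GR: "bounded_coefficient (hor G) (\<lambda>s. gain s * Ric s)"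
    by (intro bounded_coefficient_mult coefficients gain_bounded Ric_bounded)+
  have ql: "l2p q" unfolding q_def[abs_def] by (intro l2p_add l2p_coeff_mult l2p_coeff coefficients sv)
  have dx: "l2p (\<lambda>s w. drift s * \<xi> s w)" and gp: "l2p (\<lambda>s w. gain s * \<phi> s w)" and bu: "l2p (\<lambda>s w. cB2 G s * u s w)"
    and dp: "l2p (\<lambda>s w. drift s * \<phi> s w)" and bru: "l2p (\<lambda>s w. cB2 G s * Ric s * u s w)"
    and dK: "l2p (\<lambda>s w. drift s * K s w)" and gla: "l2p (\<lambda>s w. gain s * lam s w)"
    and Al: "l2p (\<lambda>s w. cA G s * lam s w)" and Gh: "l2p (\<lambda>s w. gain s * Ric s * lamh s w)" and Gl: "l2p (\<lambda>s w. gain s * Ric s * lam s w)"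
    by (intro l2p_coeff_mult[OF drift_bounded] l2p_coeff_mult[OF gain_bounded] l2p_coeff_mult[OF BR] l2p_coeff_mult[OF GR]
        l2p_coeff_mult[OF coefficients(1)] l2p_coeff_mult[OF coefficients(3)] l Kl(1) lam(1) lamh(1))+
  have zl: "l2p Z1" "l2p Z2" "l2p h" "l2p g" unfolding Z1_def Z2_def h_def g_def by (intro l2p_add l2p_diff dx gp bu dp bru dK gla ql Al Gh)+
  have zad: "Z1 t \<in> borel_measurable (F t)" "Z2 t \<in> borel_measurable (F t)" if t: "t \<in> {0..hor G}" for t
    unfolding Z1_def Z2_def using ad[OF t] lam(2)[OF t] Kl(2)[OF t] by simp_all
  have \<xi>Z: "AE w in pspace G. \<xi> t w = time_int Z1 t w" if t: "t \<in> {0..hor G}" for t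
    using state_difference[OF v v' t] by (simp add: \<xi>_def Z1_def \<phi>_def u_def)
  have KZ: "AE w in pspace G. K t w = time_int Z2 t w" if t: "t \<in> {0..hor G}" for t
  proof -
    have e: "- (cB1 G s)\<^sup>2 * inverse (wR G s) * lam s w + (cA G s - (cB1 G s)\<^sup>2 * Ric s * inverse (wR G s)) * K s w = Z2 s w" for s w
      by (simp add: Z2_def drift_def gain_def algebra_simps)
    show ?thesis using K unfolding e by eventually_elim (use t in \<open>simp add: time_int_def\<close>)
  qed
  have lT: "l2 (lam (hor G))" "l2 (\<xi> (hor G))" "l2 (\<phi> (hor G))" "l2 (x (hor G))" by (intro l2p_l2[OF _ T] lam(1) l sv(1))+
  have tZ: "l2p (time_int Z1)" "l2p (time_int Z2)" by (intro l2p_time_int zl)+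
  have \<xi>Z': "AE w in pspace G. time_int Z1 t w = \<xi> t w" if "t \<in> {0..hor G}" for t
    using \<xi>Z[OF that] by eventually_elim simp
  have KZ': "AE w in pspace G. time_int Z2 t w = K t w" if "t \<in> {0..hor G}" for t
    using KZ[OF that] by eventually_elim simp
  have d1: "expectation (\<lambda>w. lam (hor G) w * time_int Z1 (hor G) w) = pairing lam Z1 - pairing g (time_int Z1)"
    unfolding pairing_def
  proof (rule duality[OF lam(1) zl(4) zl(1) T])
    fix s assume s: "s \<in> {0..hor G}"
    show "expectation (\<lambda>w. (lam (hor G) w - lam s w + (time_int g (hor G) w - time_int g s w)) * Z1 s w) = 0"
      using orth[OF s l2p_l2[OF zl(1) s] zad(1)[OF s]] by (simp add: g_def q_def)
  qed
  have d2: "expectation (\<lambda>w. \<phi> (hor G) w * time_int Z2 (hor G) w) = pairing \<phi> Z2 - pairing h (time_int Z2)"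
    unfolding pairing_def
  proof (rule duality[OF l(2) zl(3) zl(2) T])
    fix s assume s: "s \<in> {0..hor G}"
    show "expectation (\<lambda>w. (\<phi> (hor G) w - \<phi> s w + (time_int h (hor G) w - time_int h s w)) * Z2 s w) = 0"
      using adjoint_difference(2)[OF v v' s l2p_l2[OF zl(2) s] zad(2)[OF s]] by (simp add: h_def \<phi>_def u_def)
  qed
  have "expectation (\<lambda>w. \<phi> (hor G) w * time_int Z2 (hor G) w) = expectation (\<lambda>w. 0)"
  proof (rule integral_cong_AE)
    show "AE w in pspace G. \<phi> (hor G) w * time_int Z2 (hor G) w = 0"
      using adjoint_difference(1)[OF v v'] by eventually_elim (simp add: \<phi>_def)
  qed (use l2_measurable[OF lT(3)] l2_measurable[OF l2p_l2[OF tZ(2) T]] in auto)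
  \<comment> \<open>the left-hand side of the second duality vanishes because \<open>\<phi>(T) = 0\<close>\<close>
  then have d2': "pairing \<phi> Z2 = pairing h K"
    using d2 pairing_cong[OF zl(3) tZ(2) Kl(1) KZ'] by simp
  have "expectation (\<lambda>w. lam (hor G) w * time_int Z1 (hor G) w) = expectation (\<lambda>w. (wMb G * x (hor G) w + wmb G) * \<xi> (hor G) w)"
  proof (rule integral_cong_AE)
    show "AE w in pspace G. lam (hor G) w * time_int Z1 (hor G) w = (wMb G * x (hor G) w + wmb G) * \<xi> (hor G) w"
      using lamT \<xi>Z[OF T] by eventually_elim simp
  qed (use l2_measurable[OF lT(1)] l2_measurable[OF lT(2)] l2_measurable[OF lT(4)] l2_measurable[OF l2p_l2[OF tZ(1) T]] in auto)
  then have d1': "expectation (\<lambda>w. (wMb G * x (hor G) w + wmb G) * \<xi> (hor G) w) = pairing lam Z1 - pairing g \<xi>"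
    using d1 pairing_cong[OF zl(4) tZ(1) l(1) \<xi>Z'] by simp
  \<comment> \<open>\<open>\<xi>\<close> is determined by the observation, so it does not see the difference of \<open>lamh\<close> and \<open>lam\<close>\<close>
  have lamhat: "pairing (\<lambda>s w. gain s * Ric s * lamh s w) \<xi> = pairing (\<lambda>s w. gain s * Ric s * lam s w) \<xi>"
    unfolding pairing_def
  proof (rule set_lebesgue_integral_cong)
    show "\<forall>t. t \<in> {0..hor G} \<longrightarrow> expectation (\<lambda>w. gain t * Ric t * lamh t w * \<xi> t w) = expectation (\<lambda>w. gain t * Ric t * lam t w * \<xi> t w)"
    proof safe
      fix t assume t: "t \<in> {0..hor G}"
      have "\<xi> t \<in> borel_measurable (O0 t)" using filter_difference(2)[OF v v' t] by (simp add: \<xi>_def[abs_def])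
      note pr = lamh(2)[OF t l2p_l2[OF l(1) t] this]
      have e: "gain t * Ric t * z * \<xi> t w = (gain t * Ric t) * (\<xi> t w * z)" for z w by (simp only: mult_ac)
      show "expectation (\<lambda>w. gain t * Ric t * lamh t w * \<xi> t w) = expectation (\<lambda>w. gain t * Ric t * lam t w * \<xi> t w)"
        unfolding e by (simp only: integral_mult_right_zero pr)
    qed
  qed simp
  have g: "pairing g \<xi> = pairing q \<xi> + pairing (\<lambda>s w. drift s * lam s w) \<xi>"
  proof -
    have "pairing g \<xi> = pairing q \<xi> + pairing (\<lambda>s w. cA G s * lam s w) \<xi> - pairing (\<lambda>s w. gain s * Ric s * lam s w) \<xi>"
      unfolding g_def using pairing_diff[OF l2p_add[OF ql Al] Gh l(1)] pairing_add[OF ql Al l(1)] lamhat by simp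
    also have "(\<lambda>s w. drift s * lam s w) = (\<lambda>s w. cA G s * lam s w - gain s * Ric s * lam s w)"
      by (auto simp: drift_def left_diff_distrib)
    ultimately show ?thesis using pairing_diff[OF Al Gl l(1)] by simp
  qed
  have "pairing lam Z1 = pairing (\<lambda>s w. drift s * \<xi> s w) lam - pairing (\<lambda>s w. gain s * \<phi> s w) lam + pairing (\<lambda>s w. cB2 G s * u s w) lam"
    unfolding Z1_def pairing_sym[of lam] using pairing_add[OF l2p_diff[OF dx gp] bu lam(1)] pairing_diff[OF dx gp lam(1)] by simp
  moreover have "pairing \<phi> Z2 = pairing (\<lambda>s w. drift s * K s w) \<phi> - pairing (\<lambda>s w. gain s * lam s w) \<phi>"
    unfolding Z2_def pairing_sym[of \<phi>] by (rule pairing_diff[OF dK gla l(2)])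
  moreover have "pairing h K = pairing (\<lambda>s w. drift s * \<phi> s w) K + pairing (\<lambda>s w. cB2 G s * Ric s * u s w) K"
    unfolding h_def by (rule pairing_add[OF dp bru Kl(1)])
  moreover have "pairing (\<lambda>s w. drift s * \<xi> s w) lam = pairing (\<lambda>s w. drift s * lam s w) \<xi>"
    "pairing (\<lambda>s w. gain s * \<phi> s w) lam = pairing (\<lambda>s w. gain s * lam s w) \<phi>"
    "pairing (\<lambda>s w. drift s * K s w) \<phi> = pairing (\<lambda>s w. drift s * \<phi> s w) K"
    by (simp_all add: pairing_def mult_ac)
  ultimately have "expectation (\<lambda>w. (wMb G * x (hor G) w + wmb G) * \<xi> (hor G) w) + pairing q \<xi>
      = pairing (\<lambda>t w. cB2 G t * u t w) lam + pairing (\<lambda>t w. cB2 G t * Ric t * u t w) K"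
    using d1' d2' g by simp
  then show ?thesis by (simp add: \<xi>_def[abs_def] u_def q_def[abs_def])
qed

text \<open>
  The competitor is adapted to \<open>W\<close> and thus to the observation generated by \<open>v\<close>, so \<open>lam\<close> and \<open>K\<close> may be
  replaced by their conditional expectations.
\<close>

lemma stationarity_pairing:
  assumes v: "leader_admissible G v" and v': "leader_admissible G v'" and lam: "l2p lam" and K: "l2p K"
    and opt: "AE t in lborel. t \<in> {0..hor G} \<longrightarrow> (AE w in pspace G.
           wRb G t * v t w + wrb G t
             + cB2 G t * real_cond_exp (pspace G) (obs2_filtration G v t) (lam t) w
             + cB2 G t * Ric t * real_cond_exp (pspace G) (obs2_filtration G v t) (K t) w = 0)"
  shows "pairing (\<lambda>t w. wRb G t * v t w + wrb G t) (\<lambda>t w. v' t w - v t w)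
    + pairing (\<lambda>t w. cB2 G t * (v' t w - v t w)) lam + pairing (\<lambda>t w. cB2 G t * Ric t * (v' t w - v t w)) K = 0"
proof -
  note lv = leader_control[OF v] and lw = leader_control[OF v']
  have BR: "bounded_coefficient (hor G) (\<lambda>s. cB2 G s * Ric s)" by (rule bounded_coefficient_mult[OF coefficients(3) Ric_bounded])
  define u where "u t w = v' t w - v t w" for t w
  define S where "S = (\<lambda>t w. wRb G t * v t w + wrb G t + cB2 G t * lam t w + cB2 G t * Ric t * K t w)"
  have ul: "l2p u" unfolding u_def[abs_def] by (intro l2p_diff lv lw)
  have rl: "l2p (\<lambda>t w. wRb G t * v t w + wrb G t)" and bl: "l2p (\<lambda>t w. cB2 G t * lam t w)" and bk: "l2p (\<lambda>t w. cB2 G t * Ric t * K t w)"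
    by (intro l2p_add l2p_coeff_mult[OF coefficients(9)] l2p_coeff_mult[OF coefficients(3)] l2p_coeff_mult[OF BR] l2p_coeff[OF coefficients(13)] lv lam K)+
  have split: "pairing S u = pairing (\<lambda>t w. wRb G t * v t w + wrb G t) u + pairing (\<lambda>t w. cB2 G t * lam t w) u + pairing (\<lambda>t w. cB2 G t * Ric t * K t w) u"
    unfolding S_def using pairing_add[OF l2p_add[OF rl bl] bk ul] pairing_add[OF rl bl ul] by simp
  have zero: "AE t in lborel. t \<in> {0..hor G} \<longrightarrow> expectation (\<lambda>w. S t w * u t w) = 0"
    using opt
  proof eventually_elim
    case (elim t)
    show ?case
    proof
      assume t: "t \<in> {0..hor G}"
      let ?O = "obs2_filtration G v t"
      note f = obs2_filtration_facts[OF v t]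
      have sub: "subalgebra (pspace G) ?O" by (rule filtrationD(1)[OF f(1) t])
      have fW: "filtration (aug_filtration (pspace G) {BW G})" by (rule aug_filtration_filtration) (use BW_measurable in simp)
      have "v' t \<in> borel_measurable ?O"
        by (rule measurable_subset_sets[OF f(3) _ leader_control_noise_adapted[OF v' t]])
           (use filtrationD(3)[OF f(1) t] filtrationD(3)[OF fW t] in simp)
      then have um: "u t \<in> borel_measurable ?O" unfolding u_def[abs_def] using lv(3)[OF t] by simp
      note u2 = l2p_l2[OF ul t] and r2 = l2p_l2[OF rl t] and la2 = l2p_l2[OF lam t] and K2 = l2p_l2[OF K t]
      let ?cl = "real_cond_exp (pspace G) ?O (lam t)" and ?cK = "real_cond_exp (pspace G) ?O (K t)"
      have cl: "l2 ?cl" and cK: "l2 ?cK" by (rule l2_orthogonal_projection(1)[OF sub la2], rule l2_orthogonal_projection(1)[OF sub K2])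
      note i = l2_mult_integrable[OF u2 r2] l2_mult_integrable[OF u2 la2] l2_mult_integrable[OF u2 K2] l2_mult_integrable[OF u2 cl] l2_mult_integrable[OF u2 cK]
      have "expectation (\<lambda>w. S t w * u t w) = expectation (\<lambda>w. u t w * (wRb G t * v t w + wrb G t) + cB2 G t * (u t w * lam t w) + cB2 G t * Ric t * (u t w * K t w))"
        by (rule Bochner_Integration.integral_cong) (auto simp: S_def algebra_simps)
      also have "\<dots> = expectation (\<lambda>w. u t w * (wRb G t * v t w + wrb G t)) + cB2 G t * expectation (\<lambda>w. u t w * lam t w) + cB2 G t * Ric t * expectation (\<lambda>w. u t w * K t w)"
        using i by (simp del: Bochner_Integration.integral_add add: Bochner_Integration.integral_add)
      also have "\<dots> = expectation (\<lambda>w. u t w * (wRb G t * v t w + wrb G t)) + cB2 G t * expectation (\<lambda>w. u t w * ?cl w) + cB2 G t * Ric t * expectation (\<lambda>w. u t w * ?cK w)"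
        using l2_orthogonal_projection(2)[OF sub la2 u2 um] l2_orthogonal_projection(2)[OF sub K2 u2 um] by simp
      also have "\<dots> = expectation (\<lambda>w. u t w * (wRb G t * v t w + wrb G t) + cB2 G t * (u t w * ?cl w) + cB2 G t * Ric t * (u t w * ?cK w))"
        using i by simp
      also have "\<dots> = expectation (\<lambda>w. 0)"
      proof (rule integral_cong_AE)
        show "AE w in pspace G. u t w * (wRb G t * v t w + wrb G t) + cB2 G t * (u t w * ?cl w) + cB2 G t * Ric t * (u t w * ?cK w) = 0"
          using mp[OF elim t]
        proof eventually_elim
          case (elim w)
          have "u t w * (wRb G t * v t w + wrb G t) + cB2 G t * (u t w * ?cl w) + cB2 G t * Ric t * (u t w * ?cK w)
            = u t w * (wRb G t * v t w + wrb G t + cB2 G t * ?cl w + cB2 G t * Ric t * ?cK w)" by (simp add: algebra_simps)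
          then show ?case using elim by simp
        qed
      qed (use l2_measurable[OF u2] l2_measurable[OF r2] l2_measurable[OF cl] l2_measurable[OF cK] in auto)
      finally show "expectation (\<lambda>w. S t w * u t w) = 0" by simp
    qed
  qed
  have "pairing S u = (LBINT t:{0..hor G}. 0)"
    unfolding pairing_def set_lebesgue_integral_def
  proof (rule integral_cong_AE)
    have "set_integrable lborel {0..hor G} (\<lambda>t. expectation (\<lambda>w. S t w * u t w))"
      unfolding S_def by (rule expectation_product_LBINT(3)[OF l2p_add[OF l2p_add[OF rl bl] bk] ul]) auto
    then show "(\<lambda>t. indicat_real {0..hor G} t *\<^sub>R expectation (\<lambda>w. S t w * u t w)) \<in> borel_measurable lborel"
      unfolding set_integrable_def by (rule borel_measurable_integrable)
    show "AE t in lborel. indicat_real {0..hor G} t *\<^sub>R expectation (\<lambda>w. S t w * u t w) = indicat_real {0..hor G} t *\<^sub>R 0"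
      using zero by eventually_elim (auto simp: indicator_def)
  qed simp
  then have "pairing S u = 0" by (simp add: set_lebesgue_integral_def)
  moreover have "pairing (\<lambda>t w. cB2 G t * lam t w) u = pairing (\<lambda>t w. cB2 G t * u t w) lam"
    "pairing (\<lambda>t w. cB2 G t * Ric t * K t w) u = pairing (\<lambda>t w. cB2 G t * Ric t * u t w) K"
    by (simp_all add: pairing_def mult_ac)
  ultimately show ?thesis using split by (simp add: u_def[abs_def])
qed

lemma leader_cost_difference:
  assumes x: "l2p x" and v: "l2p v" and y: "l2p y" and v': "l2p v'"
  shows "leader_cost G v' y - leader_cost G v x =
      1 / 2 * (pairing (\<lambda>t w. wLb G t * (y t w - x t w)) (\<lambda>t w. y t w - x t w)
        + pairing (\<lambda>t w. wRb G t * (v' t w - v t w)) (\<lambda>t w. v' t w - v t w)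
        + wMb G * expectation (\<lambda>w. (y (hor G) w - x (hor G) w)\<^sup>2))
      + (expectation (\<lambda>w. (wMb G * x (hor G) w + wmb G) * (y (hor G) w - x (hor G) w))
        + pairing (\<lambda>t w. wLb G t * x t w + wlb G t) (\<lambda>t w. y t w - x t w)
        + pairing (\<lambda>t w. wRb G t * v t w + wrb G t) (\<lambda>t w. v' t w - v t w))"
proof -
  note T = T_in(1)
  define \<xi> where "\<xi> t w = y t w - x t w" for t w
  define u where "u t w = v' t w - v t w" for t w
  have l: "l2p \<xi>" "l2p u" unfolding \<xi>_def[abs_def] u_def[abs_def] by (intro l2p_diff x v y v')+
  have yx: "y = (\<lambda>t w. x t w + \<xi> t w)" and wv: "v' = (\<lambda>t w. v t w + u t w)" by (auto simp: \<xi>_def u_def)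
  note lL = l2p_coeff_mult[OF coefficients(8) x] and lR = l2p_coeff_mult[OF coefficients(9) v]
    and ll = l2p_coeff[OF coefficients(11)] and lr = l2p_coeff[OF coefficients(13)]
  have a: "pairing (\<lambda>t w. wlb G t) y = pairing (\<lambda>t w. wlb G t) x + pairing (\<lambda>t w. wlb G t) \<xi>"
    using pairing_add[OF x l(1) ll] unfolding yx by (simp add: pairing_sym[of "\<lambda>t w. wlb G t"])
  have b: "pairing (\<lambda>t w. wrb G t) v' = pairing (\<lambda>t w. wrb G t) v + pairing (\<lambda>t w. wrb G t) u"
    using pairing_add[OF v l(2) lr] unfolding wv by (simp add: pairing_sym[of "\<lambda>t w. wrb G t"])
  have c: "pairing (\<lambda>t w. wLb G t * y t w) y = pairing (\<lambda>t w. wLb G t * x t w) x + 2 * pairing (\<lambda>t w. wLb G t * x t w) \<xi> + pairing (\<lambda>t w. wLb G t * \<xi> t w) \<xi>"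
    unfolding yx by (rule pairing_square[OF x l(1) coefficients(8)])
  have d: "pairing (\<lambda>t w. wRb G t * v' t w) v' = pairing (\<lambda>t w. wRb G t * v t w) v + 2 * pairing (\<lambda>t w. wRb G t * v t w) u + pairing (\<lambda>t w. wRb G t * u t w) u"
    unfolding wv by (rule pairing_square[OF v l(2) coefficients(9)])
  have e: "pairing (\<lambda>t w. wLb G t * x t w + wlb G t) \<xi> = pairing (\<lambda>t w. wLb G t * x t w) \<xi> + pairing (\<lambda>t w. wlb G t) \<xi>"
    by (rule pairing_add[OF lL ll l(1)])
  have f: "pairing (\<lambda>t w. wRb G t * v t w + wrb G t) u = pairing (\<lambda>t w. wRb G t * v t w) u + pairing (\<lambda>t w. wrb G t) u"
    by (rule pairing_add[OF lR lr l(2)])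
  note X = l2p_l2[OF x T] and H = l2p_l2[OF l(1) T]
  note i = l2_square_integrable[OF X] l2_square_integrable[OF H] l2_mult_integrable[OF X H] l2_integrable[OF X] l2_integrable[OF H]
  have "expectation (\<lambda>w. (y (hor G) w)\<^sup>2) = expectation (\<lambda>w. (x (hor G) w)\<^sup>2 + 2 * (x (hor G) w * \<xi> (hor G) w) + (\<xi> (hor G) w)\<^sup>2)"
    unfolding yx by (simp add: power2_sum algebra_simps)
  also have "\<dots> = expectation (\<lambda>w. (x (hor G) w)\<^sup>2) + 2 * expectation (\<lambda>w. x (hor G) w * \<xi> (hor G) w) + expectation (\<lambda>w. (\<xi> (hor G) w)\<^sup>2)"
    using i by simp
  finally have g: "expectation (\<lambda>w. (y (hor G) w)\<^sup>2) = expectation (\<lambda>w. (x (hor G) w)\<^sup>2) + 2 * expectation (\<lambda>w. x (hor G) w * \<xi> (hor G) w) + expectation (\<lambda>w. (\<xi> (hor G) w)\<^sup>2)" .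
  have h: "expectation (y (hor G)) = expectation (x (hor G)) + expectation (\<xi> (hor G))" unfolding yx using i by simp
  have k: "expectation (\<lambda>w. (wMb G * x (hor G) w + wmb G) * \<xi> (hor G) w) = wMb G * expectation (\<lambda>w. x (hor G) w * \<xi> (hor G) w) + wmb G * expectation (\<xi> (hor G))"
    using i by (simp add: distrib_right mult.assoc)
  have "leader_cost G v' y - leader_cost G v x = 1 / 2 * (pairing (\<lambda>t w. wLb G t * \<xi> t w) \<xi> + pairing (\<lambda>t w. wRb G t * u t w) u
        + wMb G * expectation (\<lambda>w. (\<xi> (hor G) w)\<^sup>2))
      + (expectation (\<lambda>w. (wMb G * x (hor G) w + wmb G) * \<xi> (hor G) w)
        + pairing (\<lambda>t w. wLb G t * x t w + wlb G t) \<xi> + pairing (\<lambda>t w. wRb G t * v t w + wrb G t) u)"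
    unfolding leader_cost_pairing[OF y v'] leader_cost_pairing[OF x v] a b c d e f g h k by (simp add: algebra_simps)
  then show ?thesis by (simp add: \<xi>_def[abs_def] u_def[abs_def])
qed

text \<open>
  For equal controls the equation of \<open>\<theta>' - \<theta>\<close> is homogeneous with terminal value \<open>0\<close>, and then so is
  that of \<open>y - x\<close>.
\<close>

lemma leader_state_unique:
  assumes v: "leader_admissible G v" "leader_system G Ric x0 v x xh \<theta> \<Gamma>"
    and v': "leader_system G Ric x0 v y yh \<theta>' \<Gamma>'" and t: "t \<in> {0..hor G}"
  shows "AE w in pspace G. y t w - x t w = 0"
proof -
  note sv = state_filter[OF v] and sw = state_filter[OF v(1) v']
  have lp: "l2p (\<lambda>s w. \<theta>' s w - \<theta> s w)" and lx: "l2p (\<lambda>s w. y s w - x s w)" by (intro l2p_diff sv sw)+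
  have phi: "AE w in pspace G. \<theta>' t w - \<theta> t w = 0" if t: "t \<in> {0..hor G}" for t
  proof (rule backward_linear_zero[OF lp drift_bounded adjoint_difference(1)[OF v v(1) v'] _ t])
    fix s assume s: "s \<in> {0..hor G}"
    have m: "(\<lambda>w. \<theta>' s w - \<theta> s w) \<in> borel_measurable (F s)" using sv(12)[OF s] sw(12)[OF s] by simp
    show "expectation (\<lambda>w. (\<theta>' (hor G) w - \<theta> (hor G) w - (\<theta>' s w - \<theta> s w)
       + (time_int (\<lambda>s w. drift s * (\<theta>' s w - \<theta> s w)) (hor G) w - time_int (\<lambda>s w. drift s * (\<theta>' s w - \<theta> s w)) s w)) * (\<theta>' s w - \<theta> s w)) = 0"
      using adjoint_difference(2)[OF v v(1) v' s l2p_l2[OF lp s] m] by simp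
  qed
  show ?thesis
  proof (rule forward_linear_zero[OF lx drift_bounded _ t])
    fix t assume t: "t \<in> {0..hor G}"
    have "AE w in pspace G. time_int (\<lambda>s w. drift s * (y s w - x s w) - gain s * (\<theta>' s w - \<theta> s w) + cB2 G s * (v s w - v s w)) t w
        = time_int (\<lambda>s w. drift s * (y s w - x s w)) t w"
    proof (rule time_int_cong_AE[OF _ l2p_coeff_mult[OF drift_bounded lx] t])
      show "l2p (\<lambda>s w. drift s * (y s w - x s w) - gain s * (\<theta>' s w - \<theta> s w) + cB2 G s * (v s w - v s w))"
        using l2p_diff[OF l2p_coeff_mult[OF drift_bounded lx] l2p_coeff_mult[OF gain_bounded lp]] by simp
      fix s assume "s \<in> {0..t}"
      then have s: "s \<in> {0..hor G}" using t by auto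
      show "AE w in pspace G. drift s * (y s w - x s w) - gain s * (\<theta>' s w - \<theta> s w) + cB2 G s * (v s w - v s w) = drift s * (y s w - x s w)"
        using phi[OF s] by eventually_elim simp
    qed
    with state_difference[OF v v(1) v' t]
    show "AE w in pspace G. y t w - x t w = time_int (\<lambda>s w. drift s * (y s w - x s w)) t w" by eventually_elim simp
  qed
qed

lemma leader_cost_unique:
  assumes v: "leader_admissible G v" "leader_system G Ric x0 v x xh \<theta> \<Gamma>" and v': "leader_system G Ric x0 v y yh \<theta>' \<Gamma>'"
  shows "leader_cost G v y = leader_cost G v x"
proof -
  note sv = state_filter(1)[OF v] and sw = state_filter(1)[OF v(1) v'] and vl = leader_control(1)[OF v(1)] and T = T_in(1)
  have lx: "l2p (\<lambda>s w. y s w - x s w)" by (intro l2p_diff sv sw)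
  have z: "l2p (\<lambda>s w. 0::real)" using l2p_const_process[OF l2_const[of 0]] by simp
  have p: "pairing X (\<lambda>s w. y s w - x s w) = 0" if X: "l2p X" for X
    using pairing_cong[OF X lx z] leader_state_unique[OF v v'] by (simp add: pairing_def set_lebesgue_integral_def)
  have q: "pairing X (\<lambda>s w. v s w - v s w) = 0" for X by (simp add: pairing_def set_lebesgue_integral_def)
  note lT = l2_measurable[OF l2p_l2[OF sv T]] l2_measurable[OF l2p_l2[OF sw T]]
  have "expectation (\<lambda>w. (y (hor G) w - x (hor G) w)\<^sup>2) = expectation (\<lambda>w. 0)"
  proof (rule integral_cong_AE)
    show "AE w in pspace G. (y (hor G) w - x (hor G) w)\<^sup>2 = 0" using leader_state_unique[OF v v' T] by eventually_elim simp
  qed (use lT in auto)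
  moreover have "expectation (\<lambda>w. (wMb G * x (hor G) w + wmb G) * (y (hor G) w - x (hor G) w)) = expectation (\<lambda>w. 0)"
  proof (rule integral_cong_AE)
    show "AE w in pspace G. (wMb G * x (hor G) w + wmb G) * (y (hor G) w - x (hor G) w) = 0"
      using leader_state_unique[OF v v' T] by eventually_elim simp
  qed (use lT in auto)
  moreover have "l2p (\<lambda>t w. wLb G t * (y t w - x t w))" by (rule l2p_coeff_mult[OF coefficients(8) lx])
  moreover have "l2p (\<lambda>t w. wLb G t * x t w + wlb G t)" by (intro l2p_add l2p_coeff_mult l2p_coeff coefficients sv)
  ultimately show ?thesis using leader_cost_difference[OF sv vl sw vl] p q by simp
qed

text \<open>
  The adjoint processes belong to one state \<open>x\<close> of \<open>v\<close>, whereas optimality concerns every state \<open>x'\<close> of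
  \<open>v\<close>; both have the same cost.
\<close>

lemma stationary_control_optimal:
  assumes v: "leader_admissible G v" "leader_system G Ric x0 v x xh \<theta> \<Gamma>"
    and adj: "adjoint_lambda_equation G Ric x xh lam \<eta>1 \<eta>2 \<eta>3" and adjK: "adjoint_K_equation G Ric lam K"
    and opt: "AE t in lborel. t \<in> {0..hor G} \<longrightarrow> (AE w in pspace G.
           wRb G t * v t w + wrb G t
             + cB2 G t * real_cond_exp (pspace G) (obs2_filtration G v t) (lam t) w
             + cB2 G t * Ric t * real_cond_exp (pspace G) (obs2_filtration G v t) (K t) w = 0)"
  shows "leader_optimal G Ric x0 v"
  unfolding leader_optimal_def
proof (intro conjI allI impI v(1), elim conjE)
  fix x' xh' \<theta>' \<Gamma>' v' y yh \<theta>'' \<Gamma>''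
  assume vs: "leader_system G Ric x0 v x' xh' \<theta>' \<Gamma>'" and v': "leader_admissible G v'" "leader_system G Ric x0 v' y yh \<theta>'' \<Gamma>''"
  have "l2p lam" "l2p K" using adj adjK S2_l2p(1) by (auto simp: adjoint_lambda_equation_def adjoint_K_equation_def)
  note s = stationarity_pairing[OF v(1) v'(1) this opt]
  have nn: "\<And>t. t \<in> {0..hor G} \<Longrightarrow> 0 \<le> wLb G t" "\<And>t. t \<in> {0..hor G} \<Longrightarrow> 0 \<le> wRb G t" "0 \<le> wMb G"
    using A2 by (auto simp: assumption_A2_def)
  have "0 \<le> leader_cost G v' y - leader_cost G v x"
    unfolding leader_cost_difference[OF state_filter(1)[OF v] leader_control(1)[OF v(1)] state_filter(1)[OF v'] leader_control(1)[OF v'(1)]]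
    using first_order_identity[OF v v' adj adjK] s pairing_nonneg[OF nn(1), where X = "\<lambda>t w. y t w - x t w"] pairing_nonneg[OF nn(2), where X = "\<lambda>t w. v' t w - v t w"]
      mult_nonneg_nonneg[OF nn(3), of "expectation (\<lambda>w. (y (hor G) w - x (hor G) w)\<^sup>2)"] by simp
  then show "leader_cost G v x' \<le> leader_cost G v' y" using leader_cost_unique[OF v vs] by simp
qed

end

theorem theorem3p5:
  fixes G :: "'a lq_game"
    and Ric :: "real \<Rightarrow> real"
    and x0 v2 x xh \<theta> \<Gamma> lam \<eta>1 \<eta>2 \<eta>3 K :: "real \<Rightarrow> 'a \<Rightarrow> real"
  assumes "stochastic_basis G"
    and "assumption_A1 G" and "assumption_A2 G" and "assumption_A3 G"
    and "riccati_solution G Ric"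
    and "uncontrolled_state G x0"
    and "information_assumption G x0"
    and "leader_admissible G v2"
    and "leader_system G Ric x0 v2 x xh \<theta> \<Gamma>"
    and "adjoint_lambda_equation G Ric x xh lam \<eta>1 \<eta>2 \<eta>3"
    and "adjoint_K_equation G Ric lam K"
    and "AE t in lborel. t \<in> {0..hor G} \<longrightarrow> (AE \<omega> in pspace G.
           wRb G t * v2 t \<omega> + wrb G t
             + cB2 G t * real_cond_exp (pspace G) (obs2_filtration G v2 t) (lam t) \<omega>
             + cB2 G t * Ric t * real_cond_exp (pspace G) (obs2_filtration G v2 t) (K t) \<omega> = 0)"
  shows "leader_optimal G Ric x0 v2"
proof -
  interpret lq_setting G Ric x0 by unfold_locales (fact assms)+
  show ?thesis by (rule stationary_control_optimal[OF assms(8-12)])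
qed

end
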